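(* Let $L>0$ be smooth and $P$-periodic on $\mathbb R$. For every $c_*\in\mathbb R$ and all sufficiently large $n$, there are $P$-periodic reconstructions with first warp $\ell_1=L$, smoothly parametrized by $(\delta,c)$ near $(\delta_n,c_* )$, where $\delta_n\downarrow0$ and $\varepsilon=\delta^{2(k_2+1)}$. The phase-increment map $(\delta,c)\mapsto(\Delta_1,\Delta_2)$ has rank two, so rational returns are dense. On the slice $c=0$, its first component $\Delta_1$ has nonzero $\delta$-derivative, and rational returns are dense there as well. When $M_1$ and $M_2$ are closed, the returning members give harmonic maps from closed source manifolds on finite $P$-covers.
   Context: Setting. For $i=1,2$, $(M_i,g_i)$ is a Riemannian manifold of dimension $k_i>0$, and $f_i:(M_i,g_i)\to\mathbb S^{2n_i+1}\subset\mathbb C^{n_i+1}$ (unit round sphere) is an eigenmap: $\Delta f_i=-d_if_i$ with $d_i=|df_i|^2>0$ constant. Reconstruction. Given $c\in\mathbb R$, $\varepsilon>0$, $\sigma\in\{-1,1\}$ and a smooth $a:\mathbb R\to(0,1)$ with $R:=1-a^2-(a')^2>0$ (an admissible magnitude), set $Q=1+(c^2-1)a^2$, $b=\sqrt{1-a^2}$, $F=\sqrt{\varepsilon Q/(a^2R)}$, $T=\frac1{a^2Q}-\frac{a+a''}{aR}$; let $(\ell_1,\ell_2)$ be the unique pair of positive functions (the source warps) with $\ell_1^{k_1}\ell_2^{k_2}=F$ and $d_2/\ell_2^2-d_1/\ell_1^2=T$; and choose phases with $s_1'=\sigma\sqrt\varepsilon/(Fa^2)$, $s_2'=\sigma c\sqrt\varepsilon/(Fb^2)$.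 Then $G=(ae^{is_1}f_1,be^{is_2}f_2)$ is harmonic from $(\mathbb R\times M_1\times M_2,\ dt^2+\ell_1^2g_1+\ell_2^2g_2)$ to $\mathbb S^{2n_1+2n_2+3}$, and its profile $(ae^{is_1},be^{is_2})\subset\mathbb S^3$ has unit speed. Periodicity and return. The reconstruction is called $P$-periodic if $a$ is $P$-periodic; the warps and phase velocities are then $P$-periodic as well. Its phase increments are $\Delta_i=\int_0^Ps_i'\,dt$. A rational return means $(\Delta_1,\Delta_2)\in2\pi\mathbb Q^2$; equivalently, the profile is $mP$-periodic for some integer $m\ge1$, and then the product descends to $(\mathbb R/mP\mathbb Z)\times M_1\times M_2$ (a finite $P$-cover). Density of rational returns refers to the parameters $(\delta,c)$ of the family (respectively $\delta$ on the slice). The sequence. With $k=k_2$, $y_0=d_2^{-k/(2k+2)}L^{-k_1/(k+1)}$, $q=(2+2/k)y_0^{-2}$ and $S=\int_0^P\sqrt q\,dt$, the sequence is $\delta_n=S/\bigl(2\pi(n+\tfrac12)\bigr)$. *)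

theory Defs
  imports "HOL-Analysis.Analysis"
begin

section \<open>Smooth functions on open sets\<close>

text \<open>Meant for open \<open>S\<close> only: \<open>frechet_derivative f (at x)\<close> is the full derivative.\<close>

fun cont_differentiable_on ::
  "nat \<Rightarrow> 'a::euclidean_space set \<Rightarrow> ('a \<Rightarrow> 'b::real_normed_vector) \<Rightarrow> bool" where
  "cont_differentiable_on 0 S f \<longleftrightarrow> continuous_on S f"
| "cont_differentiable_on (Suc n) S f \<longleftrightarrow>
     (\<forall>x\<in>S. f differentiable (at x)) \<and>
     (\<forall>v. cont_differentiable_on n S (\<lambda>x. frechet_derivative f (at x) v))"

definition smooth_on ::
  "'a::euclidean_space set \<Rightarrow> ('a \<Rightarrow> 'b::real_normed_vector) \<Rightarrow> bool" where
  "smooth_on S f \<longleftrightarrow> (\<forall>n. cont_differentiable_on n S f)"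

section \<open>Riemannian manifolds\<close>

text \<open>
  A manifold is given by an indexed atlas of local parametrizations
  \<open>chart_par N i\<close>, each defined on an open subset \<open>chart_dom N i\<close> of the
  Euclidean space \<open>'e\<close> (so the dimension is \<open>DIM('e)\<close>, which is positive), as in
  do Carmo's textbook.  A Riemannian metric is the family of its coordinate expressions:
  \<open>chart_metric N i x\<close> is the inner product that the metric induces on \<open>'e\<close> at the
  coordinate point \<open>x\<close>.
\<close>

record ('m, 'i, 'e) riemannian =
  manifold_top :: "'m topology"
  charts :: "'i set"
  chart_dom :: "'i \<Rightarrow> 'e set"
  chart_par :: "'i \<Rightarrow> 'e \<Rightarrow> 'm"
  chart_metric :: "'i \<Rightarrow> 'e \<Rightarrow> 'e \<Rightarrow> 'e \<Rightarrow> real"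

definition chart_range :: "('m, 'i, 'e) riemannian \<Rightarrow> 'i \<Rightarrow> 'm set" where
  "chart_range N i = chart_par N i ` chart_dom N i"

definition overlap :: "('m, 'i, 'e) riemannian \<Rightarrow> 'i \<Rightarrow> 'i \<Rightarrow> 'e set" where
  "overlap N i j = {x \<in> chart_dom N i. chart_par N i x \<in> chart_range N j}"

definition transition :: "('m, 'i, 'e) riemannian \<Rightarrow> 'i \<Rightarrow> 'i \<Rightarrow> 'e \<Rightarrow> 'e" where
  "transition N i j x = the_inv_into (chart_dom N j) (chart_par N j) (chart_par N i x)"

definition smooth_manifold :: "('m, 'i, 'e::euclidean_space) riemannian \<Rightarrow> bool" where
  "smooth_manifold N \<longleftrightarrow>
     Hausdorff_space (manifold_top N) \<and> second_countable (manifold_top N) \<and>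
     (\<Union>i\<in>charts N. chart_range N i) = topspace (manifold_top N) \<and>
     (\<forall>i\<in>charts N.
        open (chart_dom N i) \<and>
        openin (manifold_top N) (chart_range N i) \<and>
        homeomorphic_map (top_of_set (chart_dom N i))
          (subtopology (manifold_top N) (chart_range N i)) (chart_par N i)) \<and>
     (\<forall>i\<in>charts N. \<forall>j\<in>charts N. smooth_on (overlap N i j) (transition N i j))"

definition riemannian_metric :: "('m, 'i, 'e::euclidean_space) riemannian \<Rightarrow> bool" where
  "riemannian_metric N \<longleftrightarrow>
     (\<forall>i\<in>charts N.
        (\<forall>u v. smooth_on (chart_dom N i) (\<lambda>x. chart_metric N i x u v)) \<and>
        (\<forall>x\<in>chart_dom N i.
           bilinear (chart_metric N i x) \<and>
           (\<forall>u v. chart_metric N i x u v = chart_metric N i x v u) \<and>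
           (\<forall>u. u \<noteq> 0 \<longrightarrow> chart_metric N i x u u > 0))) \<and>
     (\<forall>i\<in>charts N. \<forall>j\<in>charts N. \<forall>x\<in>overlap N i j. \<forall>u v.
        chart_metric N i x u v =
        chart_metric N j (transition N i j x)
          (frechet_derivative (transition N i j) (at x) u)
          (frechet_derivative (transition N i j) (at x) v))"

definition riemannian_manifold :: "('m, 'i, 'e::euclidean_space) riemannian \<Rightarrow> bool" where
  "riemannian_manifold N \<longleftrightarrow> smooth_manifold N \<and> riemannian_metric N"

definition closed_manifold :: "('m, 'i, 'e::euclidean_space) riemannian \<Rightarrow> bool" where
  "closed_manifold N \<longleftrightarrow> smooth_manifold N \<and> compact_space (manifold_top N)"

section \<open>Laplacian and energy density\<close>

text \<open>
  In the coordinate expressions below \<open>g x\<close> is the inner product at the coordinate point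
  \<open>x\<close> and \<open>h\<close> a function of the coordinates.
\<close>

definition gradient ::
  "('e \<Rightarrow> 'e \<Rightarrow> 'e \<Rightarrow> real) \<Rightarrow> ('e::euclidean_space \<Rightarrow> real) \<Rightarrow> 'e \<Rightarrow> 'e" where
  "gradient g h x = (THE w. \<forall>v. g x w v = frechet_derivative h (at x) v)"

text \<open>Levi-Civita connection: the covariant derivative of \<open>X\<close> in direction \<open>u\<close> is
  \<open>D\<^sub>u X + christoffel g x u (X x)\<close>, by the Koszul formula.\<close>

definition christoffel ::
  "('e \<Rightarrow> 'e \<Rightarrow> 'e \<Rightarrow> real) \<Rightarrow> 'e::euclidean_space \<Rightarrow> 'e \<Rightarrow> 'e \<Rightarrow> 'e" where
  "christoffel g x u v = (THE w. \<forall>z. g x w z =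
     (frechet_derivative (\<lambda>y. g y v z) (at x) u
      + frechet_derivative (\<lambda>y. g y u z) (at x) v
      - frechet_derivative (\<lambda>y. g y u v) (at x) z) / 2)"

definition covariant_derivative ::
  "('e \<Rightarrow> 'e \<Rightarrow> 'e \<Rightarrow> real) \<Rightarrow> ('e::euclidean_space \<Rightarrow> 'e) \<Rightarrow> 'e \<Rightarrow> 'e \<Rightarrow> 'e" where
  "covariant_derivative g X x u =
     frechet_derivative X (at x) u + christoffel g x u (X x)"

text \<open>The trace of an endomorphism of \<open>'e\<close> does not depend on the basis, so the standard
  basis serves for every \<open>g x\<close>.\<close>

definition divergence ::
  "('e \<Rightarrow> 'e \<Rightarrow> 'e \<Rightarrow> real) \<Rightarrow> ('e::euclidean_space \<Rightarrow> 'e) \<Rightarrow> 'e \<Rightarrow> real" where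
  "divergence g X x = (\<Sum>b\<in>Basis. covariant_derivative g X x b \<bullet> b)"

definition laplacian ::
  "('e \<Rightarrow> 'e \<Rightarrow> 'e \<Rightarrow> real) \<Rightarrow> ('e::euclidean_space \<Rightarrow> 'v::euclidean_space) \<Rightarrow> 'e \<Rightarrow> 'v" where
  "laplacian g h x = (\<Sum>b\<in>Basis. divergence g (gradient g (\<lambda>y. h y \<bullet> b)) x *\<^sub>R b)"

definition norm_differential_sq ::
  "('e \<Rightarrow> 'e \<Rightarrow> 'e \<Rightarrow> real) \<Rightarrow> ('e::euclidean_space \<Rightarrow> 'v::euclidean_space) \<Rightarrow> 'e \<Rightarrow> real" where
  "norm_differential_sq g h x =
     (\<Sum>b\<in>Basis. g x (gradient g (\<lambda>y. h y \<bullet> b) x) (gradient g (\<lambda>y. h y \<bullet> b) x))"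

section \<open>Eigenmaps and harmonic maps into unit spheres\<close>

definition smooth_map ::
  "('m, 'i, 'e::euclidean_space) riemannian \<Rightarrow> ('m \<Rightarrow> 'v::euclidean_space) \<Rightarrow> bool" where
  "smooth_map N f \<longleftrightarrow> (\<forall>i\<in>charts N. smooth_on (chart_dom N i) (f \<circ> chart_par N i))"

definition smooth_sphere_map ::
  "('m, 'i, 'e::euclidean_space) riemannian \<Rightarrow> ('m \<Rightarrow> 'v::euclidean_space) \<Rightarrow> bool" where
  "smooth_sphere_map N f \<longleftrightarrow>
     smooth_map N f \<and> (\<forall>p\<in>topspace (manifold_top N). f p \<in> sphere 0 1)"

definition eigenmap ::
  "('m, 'i, 'e::euclidean_space) riemannian \<Rightarrow> ('m \<Rightarrow> 'v::euclidean_space) \<Rightarrow> real \<Rightarrow> bool" where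
  "eigenmap N f d \<longleftrightarrow> d > 0 \<and> smooth_sphere_map N f \<and>
     (\<forall>i\<in>charts N. \<forall>x\<in>chart_dom N i.
        laplacian (chart_metric N i) (f \<circ> chart_par N i) x = - d *\<^sub>R f (chart_par N i x) \<and>
        norm_differential_sq (chart_metric N i) (f \<circ> chart_par N i) x = d)"

text \<open>
  The Levi-Civita connection of the sphere is the orthogonal projection of the ambient
  derivative to the tangent space, the orthogonal complement of the position vector.  Hence
  the tension field of a sphere-valued map is the tangential part of its ambient Laplacian.
\<close>

definition tension ::
  "('e \<Rightarrow> 'e \<Rightarrow> 'e \<Rightarrow> real) \<Rightarrow> ('e::euclidean_space \<Rightarrow> 'v::euclidean_space) \<Rightarrow> 'e \<Rightarrow> 'v" where
  "tension g h x = laplacian g h x - (laplacian g h x \<bullet> h x) *\<^sub>R h x"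

definition harmonic_sphere_map ::
  "('m, 'i, 'e::euclidean_space) riemannian \<Rightarrow> ('m \<Rightarrow> 'v::euclidean_space) \<Rightarrow> bool" where
  "harmonic_sphere_map N f \<longleftrightarrow> riemannian_manifold N \<and> smooth_sphere_map N f \<and>
     (\<forall>i\<in>charts N. \<forall>x\<in>chart_dom N i.
        tension (chart_metric N i) (f \<circ> chart_par N i) x = 0)"

section \<open>The line, the circles and doubly warped products\<close>

definition line :: "(real, unit, real) riemannian" where
  "line = \<lparr>manifold_top = euclidean, charts = UNIV, chart_dom = (\<lambda>_. UNIV),
           chart_par = (\<lambda>_ t. t), chart_metric = (\<lambda>_ _ u v. u * v)\<rparr>"

definition coset :: "real \<Rightarrow> real \<Rightarrow> real set" where
  "coset \<tau> t = range (\<lambda>j::int. t + of_int j * \<tau>)"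

definition circle_top :: "real \<Rightarrow> real set topology" where
  "circle_top \<tau> = topology (\<lambda>U. U \<subseteq> range (coset \<tau>) \<and> open (coset \<tau> -` U))"

lemma openin_circle_top:
  "openin (circle_top \<tau>) U \<longleftrightarrow> U \<subseteq> range (coset \<tau>) \<and> open (coset \<tau> -` U)"
proof -
  have "istopology (\<lambda>U. U \<subseteq> range (coset \<tau>) \<and> open (coset \<tau> -` U))"
    unfolding istopology_def by (auto simp: vimage_Union)
  then show ?thesis by (simp add: circle_top_def)
qed

text \<open>The quotient of the line by the translations by multiples of \<open>\<tau> > 0\<close>, with the metric
  induced by \<open>dt\<^sup>2\<close>; the chart at \<open>r\<close> is the projection of an interval of length \<open>\<tau>\<close>.\<close>

definition circle :: "real \<Rightarrow> (real set, real, real) riemannian" where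
  "circle \<tau> = \<lparr>manifold_top = circle_top \<tau>, charts = UNIV,
               chart_dom = (\<lambda>r. {r<..<r + \<tau>}),
               chart_par = (\<lambda>_. coset \<tau>), chart_metric = (\<lambda>_ _ u v. u * v)\<rparr>"

definition warped_product ::
  "('b, 'i0, real) riemannian \<Rightarrow>
   ('b \<Rightarrow> real) \<Rightarrow> ('m1, 'i1, 'e1::euclidean_space) riemannian \<Rightarrow>
   ('b \<Rightarrow> real) \<Rightarrow> ('m2, 'i2, 'e2::euclidean_space) riemannian \<Rightarrow>
   ('b \<times> 'm1 \<times> 'm2, 'i0 \<times> 'i1 \<times> 'i2, real \<times> 'e1 \<times> 'e2) riemannian" where
  "warped_product B l1 N1 l2 N2 =
     \<lparr>manifold_top =
        prod_topology (manifold_top B) (prod_topology (manifold_top N1) (manifold_top N2)),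
      charts = charts B \<times> charts N1 \<times> charts N2,
      chart_dom = (\<lambda>(i, j, k). chart_dom B i \<times> chart_dom N1 j \<times> chart_dom N2 k),
      chart_par = (\<lambda>(i, j, k) (t, x, y).
        (chart_par B i t, chart_par N1 j x, chart_par N2 k y)),
      chart_metric = (\<lambda>(i, j, k) (t, x, y) (u0, u1, u2) (v0, v1, v2).
        chart_metric B i t u0 v0
        + (l1 (chart_par B i t))\<^sup>2 * chart_metric N1 j x u1 v1
        + (l2 (chart_par B i t))\<^sup>2 * chart_metric N2 k y u2 v2)\<rparr>"

section \<open>Reconstructions\<close>

definition periodic :: "real \<Rightarrow> (real \<Rightarrow> 'a) \<Rightarrow> bool" where
  "periodic P f \<longleftrightarrow> (\<forall>t. f (t + P) = f t)"

definition mag_R :: "(real \<Rightarrow> real) \<Rightarrow> real \<Rightarrow> real" where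
  "mag_R a t = 1 - (a t)\<^sup>2 - (deriv a t)\<^sup>2"

definition mag_Q :: "real \<Rightarrow> (real \<Rightarrow> real) \<Rightarrow> real \<Rightarrow> real" where
  "mag_Q c a t = 1 + (c\<^sup>2 - 1) * (a t)\<^sup>2"

definition mag_b :: "(real \<Rightarrow> real) \<Rightarrow> real \<Rightarrow> real" where
  "mag_b a t = sqrt (1 - (a t)\<^sup>2)"

definition mag_F :: "real \<Rightarrow> real \<Rightarrow> (real \<Rightarrow> real) \<Rightarrow> real \<Rightarrow> real" where
  "mag_F c \<epsilon> a t = sqrt (\<epsilon> * mag_Q c a t / ((a t)\<^sup>2 * mag_R a t))"

definition mag_T :: "real \<Rightarrow> (real \<Rightarrow> real) \<Rightarrow> real \<Rightarrow> real" where
  "mag_T c a t =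
     1 / ((a t)\<^sup>2 * mag_Q c a t) - (a t + deriv (deriv a) t) / (a t * mag_R a t)"

definition admissible_magnitude :: "(real \<Rightarrow> real) \<Rightarrow> bool" where
  "admissible_magnitude a \<longleftrightarrow>
     smooth_on UNIV a \<and> (\<forall>t. 0 < a t \<and> a t < 1) \<and> (\<forall>t. mag_R a t > 0)"

definition source_warps ::
  "nat \<Rightarrow> real \<Rightarrow> nat \<Rightarrow> real \<Rightarrow> real \<Rightarrow> real \<Rightarrow> (real \<Rightarrow> real) \<Rightarrow>
   (real \<Rightarrow> real) \<Rightarrow> (real \<Rightarrow> real) \<Rightarrow> bool" where
  "source_warps k1 d1 k2 d2 c \<epsilon> a l1 l2 \<longleftrightarrow>
     (\<forall>t. l1 t > 0 \<and> l2 t > 0 \<and>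
          l1 t ^ k1 * l2 t ^ k2 = mag_F c \<epsilon> a t \<and>
          d2 / (l2 t)\<^sup>2 - d1 / (l1 t)\<^sup>2 = mag_T c a t)"

definition phases ::
  "real \<Rightarrow> real \<Rightarrow> real \<Rightarrow> (real \<Rightarrow> real) \<Rightarrow> (real \<Rightarrow> real) \<Rightarrow> (real \<Rightarrow> real) \<Rightarrow> bool" where
  "phases c \<epsilon> \<sigma> a s1 s2 \<longleftrightarrow>
     (\<forall>t. (s1 has_real_derivative \<sigma> * sqrt \<epsilon> / (mag_F c \<epsilon> a t * (a t)\<^sup>2)) (at t) \<and>
          (s2 has_real_derivative \<sigma> * c * sqrt \<epsilon> / (mag_F c \<epsilon> a t * (mag_b a t)\<^sup>2)) (at t))"

definition reconstruction ::
  "nat \<Rightarrow> real \<Rightarrow> nat \<Rightarrow> real \<Rightarrow> real \<Rightarrow> real \<Rightarrow> real \<Rightarrow> (real \<Rightarrow> real) \<Rightarrow>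
   (real \<Rightarrow> real) \<Rightarrow> (real \<Rightarrow> real) \<Rightarrow> (real \<Rightarrow> real) \<Rightarrow> (real \<Rightarrow> real) \<Rightarrow> bool" where
  "reconstruction k1 d1 k2 d2 c \<epsilon> \<sigma> a l1 l2 s1 s2 \<longleftrightarrow>
     \<epsilon> > 0 \<and> \<sigma> \<in> {-1, 1} \<and> admissible_magnitude a \<and>
     source_warps k1 d1 k2 d2 c \<epsilon> a l1 l2 \<and> phases c \<epsilon> \<sigma> a s1 s2"

definition periodic_reconstruction ::
  "real \<Rightarrow> nat \<Rightarrow> real \<Rightarrow> nat \<Rightarrow> real \<Rightarrow> real \<Rightarrow> real \<Rightarrow> real \<Rightarrow> (real \<Rightarrow> real) \<Rightarrow>
   (real \<Rightarrow> real) \<Rightarrow> (real \<Rightarrow> real) \<Rightarrow> (real \<Rightarrow> real) \<Rightarrow> (real \<Rightarrow> real) \<Rightarrow> bool" where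
  "periodic_reconstruction P k1 d1 k2 d2 c \<epsilon> \<sigma> a l1 l2 s1 s2 \<longleftrightarrow>
     reconstruction k1 d1 k2 d2 c \<epsilon> \<sigma> a l1 l2 s1 s2 \<and> periodic P a"

definition reconstructed_map ::
  "(real \<Rightarrow> real) \<Rightarrow> (real \<Rightarrow> real) \<Rightarrow> (real \<Rightarrow> real) \<Rightarrow>
   ('m1 \<Rightarrow> complex ^ 'n1) \<Rightarrow> ('m2 \<Rightarrow> complex ^ 'n2) \<Rightarrow>
   real \<times> 'm1 \<times> 'm2 \<Rightarrow> (complex ^ 'n1) \<times> (complex ^ 'n2)" where
  "reconstructed_map a s1 s2 f1 f2 = (\<lambda>(t, p, q).
     ((complex_of_real (a t) * exp (\<i> * complex_of_real (s1 t))) *s f1 p,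
      (complex_of_real (mag_b a t) * exp (\<i> * complex_of_real (s2 t))) *s f2 q))"

section \<open>Phase increments and rational returns\<close>

definition phase_increment :: "real \<Rightarrow> (real \<Rightarrow> real) \<Rightarrow> real" where
  "phase_increment P s = integral {0..P} (deriv s)"

definition rational_return :: "real \<Rightarrow> (real \<Rightarrow> real) \<Rightarrow> (real \<Rightarrow> real) \<Rightarrow> bool" where
  "rational_return P s1 s2 \<longleftrightarrow>
     phase_increment P s1 \<in> (\<lambda>r. 2 * pi * r) ` \<rat> \<and>
     phase_increment P s2 \<in> (\<lambda>r. 2 * pi * r) ` \<rat>"

definition rank_two_at :: "(real \<times> real \<Rightarrow> real \<times> real) \<Rightarrow> real \<times> real \<Rightarrow> bool" where
  "rank_two_at \<Phi> p \<longleftrightarrow> (\<exists>D. (\<Phi> has_derivative D) (at p) \<and> dim (range D) = 2)"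

section \<open>The sequence of parameters\<close>

definition y0 :: "nat \<Rightarrow> nat \<Rightarrow> real \<Rightarrow> (real \<Rightarrow> real) \<Rightarrow> real \<Rightarrow> real" where
  "y0 k1 k2 d2 L t =
     d2 powr (- (real k2 / (2 * real k2 + 2))) * L t powr (- (real k1 / (real k2 + 1)))"

definition q0 :: "nat \<Rightarrow> nat \<Rightarrow> real \<Rightarrow> (real \<Rightarrow> real) \<Rightarrow> real \<Rightarrow> real" where
  "q0 k1 k2 d2 L t = (2 + 2 / real k2) / (y0 k1 k2 d2 L t)\<^sup>2"

definition delta_seq ::
  "real \<Rightarrow> nat \<Rightarrow> nat \<Rightarrow> real \<Rightarrow> (real \<Rightarrow> real) \<Rightarrow> nat \<Rightarrow> real" where
  "delta_seq P k1 k2 d2 L n =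
     integral {0..P} (\<lambda>t. sqrt (q0 k1 k2 d2 L t)) / (2 * pi * (real n + 1 / 2))"

end

theory Submission
  imports Defs
begin

text \<open>
  With the first warp prescribed, a reconstruction is a second-order equation for the second
  warp.  For \<open>\<epsilon> = \<delta>\<^bsup>2(k\<^sub>2 + 1)\<^esup>\<close> and \<open>\<mu> = \<delta>\<^sup>2\<close> it is singularly perturbed, with an
  explicit slow manifold; in a suitable complex coordinate around it the equation becomes a fast oscillator
  \<open>w' = - \<i> (\<omega> / \<delta>) w + \<delta> g(\<delta>, c, t, w)\<close> with \<open>\<omega> = sqrt q\<close> and \<open>g\<close> smooth
  up to \<open>\<delta> = 0\<close>.  As long as \<open>\<bar>cis (S / \<delta>) - 1\<bar> > 1\<close>, a periodic solution of the linear
  part is bounded by its forcing, so a contraction yields a unique small periodic solution; it is smooth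
  in \<open>(\<delta>, c)\<close>, because its difference quotients obey the same estimate.  At \<open>\<delta>\<^sub>n\<close> the
  value of \<open>cis (S / \<delta>)\<close> is \<open>-1\<close>, the point farthest from resonance.

  The phase increments are \<open>\<sigma> (I\<^sub>1 / \<delta> + O(\<delta>))\<close> and \<open>\<sigma> c (I\<^sub>2 \<delta> + O(\<delta>\<^sup>3))\<close> with
  positive \<open>I\<^sub>1\<close> and \<open>I\<^sub>2\<close>, and the derivatives of the remainders are controlled as well.
  Hence the Jacobian is close to \<open>- I\<^sub>1 I\<^sub>2 / \<delta>\<close>, and the open mapping
  theorem makes rational returns dense, also on the slice \<open>c = 0\<close>, where the second increment vanishes.

  For harmonicity, the Laplacian of a doubly warped product acts on each of the two spirals
  \<open>a e\<^bsup>\<i>s\<^sub>1\<^esup>\<close> and \<open>b e\<^bsup>\<i>s\<^sub>2\<^esup>\<close> as an ordinary differential operator, of which both are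
  eigenfunctions for the same factor; so the Laplacian of the map is normal to the sphere.
\<close>

section \<open>Calculus of \<open>C\<^sup>n\<close> functions\<close>

text \<open>Why the expansion goes as far as it does: \<open>estimate\<close> bounds a periodic
  solution by \<open>P\<close> times its forcing and gains no power of \<delta> from the fast
  rotation. A forcing of order one would leave neither a small solution nor a contraction, so
  everything of lower order than \<delta> is absorbed into the coordinates; this is the purpose of
  \<open>z1\<close>, \<open>x2\<close>, \<open>z3\<close> and of the rescaling by \<open>r\<close>
  and \<open>\<rho>\<close>. The scale \<epsilon> = \<delta>^(2(k+1)) lets the magnitude and the
  second warp be of order \<delta> while the first warp stays fixed: F = L^k1 l2^k has order
  \<delta>^k, and \<epsilon> = F^2 a^2 R / Q. The leading value of a/\<delta> is y0. Resonances
  accumulate at \<delta> = 0, so the family lives in windows between them, and in \<delta> it is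
  bounded rather than expanded. Its \<delta>-derivative is only known to be of order 1/\<delta>.
  This is harmless: the correction enters the first increment with a factor \<delta>, and its
  derivative, of order one, is beaten by I1/\<delta>^2.\<close>

lemma Ck_continuous: "cont_differentiable_on n S f \<Longrightarrow> continuous_on S f"
  by (cases n) (auto intro!: continuous_at_imp_continuous_on differentiable_imp_continuous_within)

lemma Ck_mono_Suc: "cont_differentiable_on (Suc n) S f \<Longrightarrow> cont_differentiable_on n S f"
proof (induction n arbitrary: f)
  case 0
  then show ?case using Ck_continuous by (metis cont_differentiable_on.simps(1))
next
  case (Suc n)
  then show ?case by (metis cont_differentiable_on.simps(2))
qed

lemma Ck_subset: "cont_differentiable_on n S f \<Longrightarrow> T \<subseteq> S \<Longrightarrow> cont_differentiable_on n T f"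
proof (induction n arbitrary: f)
  case 0
  then show ?case by (auto intro: continuous_on_subset)
next
  case (Suc n)
  then show ?case by (auto simp: subset_iff)
qed

lemma Ck_derivative:
  assumes "cont_differentiable_on (Suc n) S f" "x \<in> S"
  shows "(f has_derivative frechet_derivative f (at x)) (at x)"
  using assms frechet_derivative_works by auto

lemma Ck_cong:
  "open S \<Longrightarrow> (\<And>x. x \<in> S \<Longrightarrow> f x = g x) \<Longrightarrow> cont_differentiable_on n S f
    \<Longrightarrow> cont_differentiable_on n S g"
proof (induction n arbitrary: f g)
  case 0
  then show ?case by (auto cong: continuous_on_cong)
next
  case (Suc n)
  have D: "(g has_derivative frechet_derivative f (at x)) (at x)" if "x \<in> S" for x
    using has_derivative_transform_within_open[OF Ck_derivative[OF Suc.prems(3) that] \<open>open S\<close> that]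
      Suc.prems(2) by auto
  then have eq: "frechet_derivative g (at x) = frechet_derivative f (at x)" if "x \<in> S" for x
    using frechet_derivative_at that by metis
  have "cont_differentiable_on n S (\<lambda>x. frechet_derivative g (at x) v)" for v
    by (rule Suc.IH[of "\<lambda>x. frechet_derivative f (at x) v"]) (use Suc.prems eq in auto)
  then show ?case using D by (auto simp: differentiable_def)
qed

text \<open>Derivatives on an open set are unique, so any formula \<open>D\<close> may replace
  \<open>frechet_derivative\<close>; most closure rules below are inductions through this
  one.\<close>

lemma Ck_SucI:
  assumes "open S" "\<And>x. x \<in> S \<Longrightarrow> (f has_derivative D x) (at x)"
    "\<And>v. cont_differentiable_on n S (\<lambda>x. D x v)"
  shows "cont_differentiable_on (Suc n) S f"
proof -
  have eq: "frechet_derivative f (at x) = D x" if "x \<in> S" for x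
    using frechet_derivative_at assms(2) that by metis
  have "cont_differentiable_on n S (\<lambda>x. frechet_derivative f (at x) v)" for v
    by (rule Ck_cong[OF assms(1) _ assms(3)[of v]]) (simp add: eq)
  then show ?thesis using assms(2) by (auto simp: differentiable_def)
qed

lemma Ck_local:
  "(\<And>x. x \<in> S \<Longrightarrow> \<exists>V. open V \<and> x \<in> V \<and> cont_differentiable_on n V f)
    \<Longrightarrow> cont_differentiable_on n S f"
proof (induction n arbitrary: f)
  case 0
  have "isCont f x" if "x \<in> S" for x
    using 0[OF that] by (auto simp: continuous_on_eq_continuous_at)
  then show ?case by (simp add: continuous_at_imp_continuous_on)
next
  case (Suc n)
  have "f differentiable (at x)" if "x \<in> S" for x
    using Suc.prems[OF that] by auto
  moreover have "cont_differentiable_on n S (\<lambda>x. frechet_derivative f (at x) v)" for v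
    by (rule Suc.IH) (use Suc.prems in force)
  ultimately show ?case by auto
qed

lemma Ck_const: "cont_differentiable_on n S (\<lambda>_. c)"
  by (induction n arbitrary: c) auto

lemma Ck_bounded_linear:
  assumes "bounded_linear f" "open S"
  shows "cont_differentiable_on n S f"
proof (cases n)
  case 0
  then show ?thesis using assms by (simp add: linear_continuous_on)
next
  case (Suc m)
  show ?thesis unfolding Suc
    by (rule Ck_SucI[OF assms(2), of f "\<lambda>_. f"])
      (auto intro: bounded_linear_imp_has_derivative assms Ck_const)
qed

lemma Ck_linear_compose:
  "bounded_linear h \<Longrightarrow> open S \<Longrightarrow> cont_differentiable_on n S f
    \<Longrightarrow> cont_differentiable_on n S (\<lambda>x. h (f x))"
proof (induction n arbitrary: f)
  case 0
  then show ?case by (auto intro: continuous_on_compose2[OF linear_continuous_on])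
next
  case (Suc n)
  show ?case
    by (rule Ck_SucI[OF \<open>open S\<close>, of _ "\<lambda>x v. h (frechet_derivative f (at x) v)"])
      (use Suc in \<open>auto intro!: bounded_linear.has_derivative[OF \<open>bounded_linear h\<close>] Ck_derivative[of n]\<close>)
qed

lemma Ck_add:
  "open S \<Longrightarrow> cont_differentiable_on n S f \<Longrightarrow> cont_differentiable_on n S g
    \<Longrightarrow> cont_differentiable_on n S (\<lambda>x. f x + g x)"
proof (induction n arbitrary: f g)
  case 0
  then show ?case by (auto intro: continuous_on_add)
next
  case (Suc n)
  show ?case
    by (rule Ck_SucI[OF \<open>open S\<close>,
          of _ "\<lambda>x v. frechet_derivative f (at x) v + frechet_derivative g (at x) v"])
      (use Suc in \<open>auto intro!: has_derivative_add Ck_derivative[of n]\<close>)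
qed

lemma Ck_Pair:
  "open S \<Longrightarrow> cont_differentiable_on n S f \<Longrightarrow> cont_differentiable_on n S g
    \<Longrightarrow> cont_differentiable_on n S (\<lambda>x. (f x, g x))"
proof (induction n arbitrary: f g)
  case 0
  then show ?case by (auto intro: continuous_on_Pair)
next
  case (Suc n)
  show ?case
    by (rule Ck_SucI[OF \<open>open S\<close>,
          of _ "\<lambda>x v. (frechet_derivative f (at x) v, frechet_derivative g (at x) v)"])
      (use Suc in \<open>auto intro!: has_derivative_Pair Ck_derivative[of n]\<close>)
qed

lemma Ck_sum:
  assumes "open S" "\<And>i. i \<in> I \<Longrightarrow> cont_differentiable_on n S (f i)"
  shows "cont_differentiable_on n S (\<lambda>x. \<Sum>i\<in>I. f i x)"
proof (cases "finite I")
  case True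
  then show ?thesis using assms
    by (induction I rule: finite_induct) (auto intro: Ck_const Ck_add)
qed (simp add: Ck_const)

lemma Ck_bilinear:
  "bounded_bilinear h \<Longrightarrow> open S \<Longrightarrow> cont_differentiable_on n S f
    \<Longrightarrow> cont_differentiable_on n S g \<Longrightarrow> cont_differentiable_on n S (\<lambda>x. h (f x) (g x))"
proof (induction n arbitrary: f g)
  case 0
  then show ?case by (auto intro: bounded_bilinear.continuous_on)
next
  case (Suc n)
  have "cont_differentiable_on n S (\<lambda>x. h (f x) (frechet_derivative g (at x) v)
      + h (frechet_derivative f (at x) v) (g x))" for v
    using Suc.prems
    by (intro Ck_add Suc.IH) (auto intro: Ck_mono_Suc simp del: cont_differentiable_on.simps
      , auto)
  then show ?case
    by (intro Ck_SucI[OF \<open>open S\<close>, of _ "\<lambda>x v. h (f x) (frechet_derivative g (at x) v)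
          + h (frechet_derivative f (at x) v) (g x)"])
      (use Suc.prems in \<open>auto intro!: bounded_bilinear.FDERIV Ck_derivative[of n]\<close>)
qed

text \<open>In f'(g x)(g' x v) the direction moves with x, while the induction hypothesis speaks of
  fixed directions; expanding g' x v in the basis separates the two.\<close>

lemma Ck_compose:
  fixes g :: "'a::euclidean_space \<Rightarrow> 'b::euclidean_space"
  shows "open S \<Longrightarrow> open T \<Longrightarrow> cont_differentiable_on n T f \<Longrightarrow> cont_differentiable_on n S g
    \<Longrightarrow> g ` S \<subseteq> T \<Longrightarrow> cont_differentiable_on n S (\<lambda>x. f (g x))"
proof (induction n arbitrary: f)
  case 0
  then show ?case by (auto intro: continuous_on_compose2)
next
  case (Suc n)
  let ?D = "\<lambda>x v. \<Sum>b\<in>Basis. (frechet_derivative g (at x) v \<bullet> b) *\<^sub>R frechet_derivative f (at (g x)) b"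
  have "cont_differentiable_on n S (\<lambda>x. ?D x v)" for v
    using Suc.prems
    by (intro Ck_sum Ck_bilinear[OF bounded_bilinear_scaleR]
        Ck_linear_compose[OF bounded_linear_inner_left]
        Suc.IH[of "\<lambda>y. frechet_derivative f (at y) b" for b])
      (auto intro: Ck_mono_Suc simp del: cont_differentiable_on.simps, auto)
  moreover have "((\<lambda>x. f (g x)) has_derivative ?D x) (at x)" if "x \<in> S" for x
  proof -
    have g: "(g has_derivative frechet_derivative g (at x)) (at x)"
      by (rule Ck_derivative[OF Suc.prems(4) that])
    have f: "(f has_derivative frechet_derivative f (at (g x))) (at (g x))"
      using Suc.prems(5) that by (intro Ck_derivative[OF Suc.prems(3)]) auto
    interpret f: linear "frechet_derivative f (at (g x))"
      using f has_derivative_linear by blast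
    have "frechet_derivative f (at (g x)) w =
        (\<Sum>b\<in>Basis. (w \<bullet> b) *\<^sub>R frechet_derivative f (at (g x)) b)" for w
      by (subst euclidean_representation[of w, symmetric])
        (simp add: f.sum f.scale del: euclidean_representation)
    then show ?thesis
      using has_derivative_compose[OF g f] by (metis (no_types, lifting) ext)
  qed
  ultimately show ?case by (rule Ck_SucI[OF \<open>open S\<close>, rotated])
qed

text \<open>The increment is walked along the coordinate directions one at a time; on each leg the
  mean value inequality compares f with its partial derivative at x, which continuity makes nearly
  constant.\<close>

lemma has_derivative_partials:
  fixes f :: "'a::euclidean_space \<Rightarrow> 'b::real_normed_vector"
  assumes "open S" "x \<in> S"
    and der: "\<And>y b. y \<in> S \<Longrightarrow> b \<in> Basis \<Longrightarrow>
      ((\<lambda>s. f (y + s *\<^sub>R b)) has_vector_derivative g b y) (at 0)"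
    and cont: "\<And>b. b \<in> Basis \<Longrightarrow> continuous_on S (g b)"
  shows "(f has_derivative (\<lambda>v. \<Sum>b\<in>Basis. (v \<bullet> b) *\<^sub>R g b x)) (at x)"
proof -
  have bl: "bounded_linear (\<lambda>v. \<Sum>b\<in>Basis. (v \<bullet> b) *\<^sub>R g b x)"
    by (intro bounded_linear_sum bounded_linear_scaleR_const bounded_linear_inner_left)
  have "\<exists>d>0. \<forall>h. norm h < d \<longrightarrow>
      norm (f (x + h) - f x - (\<Sum>b\<in>Basis. (h \<bullet> b) *\<^sub>R g b x)) \<le> e * norm h" if "e > 0" for e
  proof -
    \<comment> \<open>One share of the error for each of the \<open>DIM('a)\<close> legs.\<close>
    define \<epsilon> where "\<epsilon> = e / DIM('a)"
    have "\<epsilon> > 0" using that by (simp add: \<epsilon>_def)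
    obtain r where r: "r > 0" "ball x r \<subseteq> S" using assms(1,2) openE by blast
    have "\<exists>d>0. \<forall>y. dist y x < d \<longrightarrow> norm (g b y - g b x) \<le> \<epsilon>" if "b \<in> Basis" for b
    proof -
      have "isCont (g b) x" using cont[OF that] assms(1,2) continuous_on_eq_continuous_at by blast
      then show ?thesis using \<open>\<epsilon> > 0\<close> unfolding continuous_at_eps_delta
        by (metis dist_norm less_imp_le)
    qed
    then obtain D where D: "\<And>b. b \<in> Basis \<Longrightarrow> D b > 0"
      "\<And>b y. b \<in> Basis \<Longrightarrow> dist y x < D b \<Longrightarrow> norm (g b y - g b x) \<le> \<epsilon>"
      by metis
    define d where "d = min r (Min (D ` (Basis :: 'a set)))"
    have d: "d > 0" "d \<le> r" "\<And>b. b \<in> Basis \<Longrightarrow> d \<le> D b"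
      using r D by (auto simp: d_def min.coboundedI2)
    have seg: "norm (f (y + t *\<^sub>R b) - f y - t *\<^sub>R g b x) \<le> \<epsilon> * \<bar>t\<bar>"
      if b: "b \<in> Basis" and y: "\<And>s. s \<in> closed_segment 0 t \<Longrightarrow> dist (y + s *\<^sub>R b) x < d" for y t b
    proof -
      let ?\<phi> = "\<lambda>s. f (y + s *\<^sub>R b) - s *\<^sub>R g b x"
      have "(?\<phi> has_derivative (\<lambda>h. h *\<^sub>R (g b (y + s *\<^sub>R b) - g b x))) (at s within closed_segment 0 t)"
        if "s \<in> closed_segment 0 t" for s
      proof -
        have "y + s *\<^sub>R b \<in> S" using y[OF that] d(2) r(2) by (auto simp: dist_commute)
        from der[OF this b]
        have "((\<lambda>u. f (y + s *\<^sub>R b + (u - s) *\<^sub>R b)) has_vector_derivative g b (y + s *\<^sub>R b)) (at s)"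
          using vector_diff_chain_at[of "\<lambda>u. u - s" 1 s "\<lambda>u. f (y + s *\<^sub>R b + u *\<^sub>R b)"]
            has_vector_derivative_diff[OF has_vector_derivative_id has_vector_derivative_const, of s "at s"]
          by (simp add: o_def)
        then have "((\<lambda>u. f (y + u *\<^sub>R b)) has_vector_derivative g b (y + s *\<^sub>R b)) (at s)"
          by (simp add: algebra_simps)
        then have "(?\<phi> has_vector_derivative (g b (y + s *\<^sub>R b) - g b x)) (at s)"
          by (auto intro!: derivative_eq_intros)
        then show ?thesis unfolding has_vector_derivative_def
          by (rule has_derivative_at_withinI)
      qed
      moreover have "onorm (\<lambda>h. h *\<^sub>R (g b (y + s *\<^sub>R b) - g b x)) \<le> \<epsilon>"
        if "s \<in> closed_segment 0 t" for s
        using D(2)[OF b, of "y + s *\<^sub>R b"] y[OF that] d(3)[OF b] \<open>\<epsilon> > 0\<close>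
        by (intro onorm_le) (auto simp: mult.commute[of \<epsilon>] mult_left_mono)
      ultimately have "norm (?\<phi> t - ?\<phi> 0) \<le> \<epsilon> * norm (t - 0)"
        by (intro differentiable_bound[of "closed_segment 0 t"]) auto
      then show ?thesis by (simp add: algebra_simps)
    qed
    \<comment> \<open>Induction on the set \<open>B\<close> of coordinates already moved. The points
      on the way have coordinates dominated by those of \<open>h\<close>, so they stay in the ball
      where the partial derivatives are controlled.\<close>
    have *: "norm (f (x + (\<Sum>b\<in>B. (h \<bullet> b) *\<^sub>R b)) - f x - (\<Sum>b\<in>B. (h \<bullet> b) *\<^sub>R g b x))
        \<le> card B * (\<epsilon> * norm h)" if "B \<subseteq> Basis" "norm h < d" for B h
    proof -
      have "finite B" using that finite_subset finite_Basis by blast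
      then show ?thesis using \<open>B \<subseteq> Basis\<close>
      proof (induction B rule: finite_induct)
        case (insert b B)
        let ?y = "x + (\<Sum>b\<in>B. (h \<bullet> b) *\<^sub>R b)"
        have b: "b \<in> Basis" using insert by auto
        have near: "dist (?y + s *\<^sub>R b) x < d" if "s \<in> closed_segment 0 (h \<bullet> b)" for s
        proof -
          have s: "\<bar>s\<bar> \<le> \<bar>h \<bullet> b\<bar>" using that by (auto simp: closed_segment_eq_real_ivl split: if_splits)
          have "norm ((\<Sum>b\<in>B. (h \<bullet> b) *\<^sub>R b) + s *\<^sub>R b) \<le> norm h"
          proof (rule norm_le_componentwise)
            fix i :: 'a assume i: "i \<in> Basis"
            have "((\<Sum>b\<in>B. (h \<bullet> b) *\<^sub>R b) + s *\<^sub>R b) \<bullet> i =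
                (if i \<in> B then h \<bullet> i else if i = b then s else 0)"
            proof -
              have "(\<Sum>b\<in>B. (h \<bullet> b) *\<^sub>R b) \<bullet> i = (\<Sum>b\<in>B. if b = i then h \<bullet> i else 0)"
                unfolding inner_sum_left by (rule sum.cong) (use insert i in \<open>auto simp: inner_Basis\<close>)
              then show ?thesis using insert i b by (auto simp: inner_Basis inner_add_left)
            qed
            then show "\<bar>((\<Sum>b\<in>B. (h \<bullet> b) *\<^sub>R b) + s *\<^sub>R b) \<bullet> i\<bar> \<le> \<bar>h \<bullet> i\<bar>" using s by auto
          qed
          then have "norm ((\<Sum>b\<in>B. (h \<bullet> b) *\<^sub>R b) + s *\<^sub>R b) < d"
            using \<open>norm h < d\<close> by linarith
          then show ?thesis by (simp add: dist_norm)
        qed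
        have "norm (f (?y + (h \<bullet> b) *\<^sub>R b) - f ?y - (h \<bullet> b) *\<^sub>R g b x) \<le> \<epsilon> * \<bar>h \<bullet> b\<bar>"
          using seg[OF b near] .
        also have "\<dots> \<le> \<epsilon> * norm h" using \<open>\<epsilon> > 0\<close> Basis_le_norm[OF b] by (simp add: mult_left_mono)
        finally have 1: "norm (f (?y + (h \<bullet> b) *\<^sub>R b) - f ?y - (h \<bullet> b) *\<^sub>R g b x) \<le> \<epsilon> * norm h" .
        have 2: "norm (f ?y - f x - (\<Sum>b\<in>B. (h \<bullet> b) *\<^sub>R g b x)) \<le> card B * (\<epsilon> * norm h)"
          using insert by auto
        have "f (x + (\<Sum>b\<in>insert b B. (h \<bullet> b) *\<^sub>R b)) - f x - (\<Sum>b\<in>insert b B. (h \<bullet> b) *\<^sub>R g b x)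
          = (f (?y + (h \<bullet> b) *\<^sub>R b) - f ?y - (h \<bullet> b) *\<^sub>R g b x)
            + (f ?y - f x - (\<Sum>b\<in>B. (h \<bullet> b) *\<^sub>R g b x))"
          using insert by (simp add: algebra_simps)
        then show ?case
          using norm_triangle_mono[OF 1 2] insert by (simp add: algebra_simps)
      qed simp
    qed
    have "norm (f (x + h) - f x - (\<Sum>b\<in>Basis. (h \<bullet> b) *\<^sub>R g b x)) \<le> e * norm h"
      if "norm h < d" for h
      using *[OF order_refl that] by (simp add: \<epsilon>_def euclidean_representation)
    then show ?thesis using d(1) by blast
  qed
  note small = this
  have "\<exists>d>0. \<forall>y. norm (y - x) < d \<longrightarrow>
      norm (f y - f x - (\<Sum>b\<in>Basis. ((y - x) \<bullet> b) *\<^sub>R g b x)) \<le> e * norm (y - x)" if e: "e > 0" for e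
  proof -
    obtain d where d: "d > 0"
      "\<And>h. norm h < d \<Longrightarrow> norm (f (x + h) - f x - (\<Sum>b\<in>Basis. (h \<bullet> b) *\<^sub>R g b x)) \<le> e * norm h"
      using small[OF e] by blast
    show ?thesis
    proof (intro exI[of _ d] conjI allI impI d(1))
      fix y assume "norm (y - x) < d"
      then show "norm (f y - f x - (\<Sum>b\<in>Basis. ((y - x) \<bullet> b) *\<^sub>R g b x)) \<le> e * norm (y - x)"
        using d(2)[of "y - x"] by simp
    qed
  qed
  with bl show ?thesis by (simp add: has_derivative_at_alt)
qed

text \<open>Suited to functions that can only be differentiated one direction at a time: integrals
  with parameters and, later, periodic solutions.\<close>

lemma Ck_SucI_partials:
  fixes f :: "'a::euclidean_space \<Rightarrow> 'b::real_normed_vector"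
  assumes "open S"
    and der: "\<And>y b. y \<in> S \<Longrightarrow> b \<in> Basis \<Longrightarrow>
      ((\<lambda>s. f (y + s *\<^sub>R b)) has_vector_derivative g b y) (at 0)"
    and g: "\<And>b. b \<in> Basis \<Longrightarrow> cont_differentiable_on n S (g b)"
  shows "cont_differentiable_on (Suc n) S f"
proof (rule Ck_SucI[OF \<open>open S\<close>, of _ "\<lambda>x v. \<Sum>b\<in>Basis. (v \<bullet> b) *\<^sub>R g b x"])
  show "(f has_derivative (\<lambda>v. \<Sum>b\<in>Basis. (v \<bullet> b) *\<^sub>R g b x)) (at x)" if "x \<in> S" for x
    by (rule has_derivative_partials[OF \<open>open S\<close> that der Ck_continuous[OF g]]) auto
  show "cont_differentiable_on n S (\<lambda>x. \<Sum>b\<in>Basis. (v \<bullet> b) *\<^sub>R g b x)" for v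
    by (intro Ck_sum Ck_bilinear[OF bounded_bilinear_scaleR] Ck_const g \<open>open S\<close>)
qed


section \<open>Elementary functions\<close>

lemma real_nonzero_open: "open {x::real. x \<noteq> 0}"
  by (simp add: open_Collect_neq)

lemma Ck_inverse: "cont_differentiable_on n {x::real. x \<noteq> 0} inverse"
proof (induction n)
  case 0
  then show ?case by (auto intro: continuous_on_inverse)
next
  case (Suc n)
  show ?case
  proof (rule Ck_SucI[OF real_nonzero_open, of _ "\<lambda>x v. - (inverse x * inverse x) * v"])
    show "(inverse has_derivative (*) (- (inverse x * inverse x))) (at x)" if "x \<in> {x. x \<noteq> 0}" for x :: real
      using DERIV_inverse[of x UNIV] that
      by (simp add: has_field_derivative_def power2_eq_square)
    show "cont_differentiable_on n {x::real. x \<noteq> 0} (\<lambda>x. - (inverse x * inverse x) * v)" for v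
      by (intro Ck_bilinear[OF bounded_bilinear_mult] Ck_const real_nonzero_open Suc
          Ck_linear_compose[OF bounded_linear_minus[OF bounded_linear_ident]])
  qed
qed

lemma Ck_real_SucI:
  fixes f f' :: "real \<Rightarrow> real"
  assumes "open S" "\<And>x. x \<in> S \<Longrightarrow> (f has_real_derivative f' x) (at x)"
    "cont_differentiable_on n S f'"
  shows "cont_differentiable_on (Suc n) S f"
  using assms
  by (intro Ck_SucI[where D = "\<lambda>x v. f' x * v"])
    (auto simp: has_field_derivative_def intro!: Ck_bilinear[OF bounded_bilinear_mult] Ck_const)

lemma Ck_ln: "cont_differentiable_on n {0<..} (ln :: real \<Rightarrow> real)"
proof (cases n)
  case 0
  then show ?thesis by (auto intro!: continuous_intros)
next
  case (Suc m)
  show ?thesis unfolding Suc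
    by (rule Ck_real_SucI[of _ _ inverse])
      (auto intro!: DERIV_ln Ck_subset[OF Ck_inverse])
qed

lemma Ck_exp: "cont_differentiable_on n UNIV (exp :: real \<Rightarrow> real)"
proof (induction n)
  case 0
  then show ?case by (auto intro!: continuous_intros)
next
  case (Suc n)
  then show ?case by (intro Ck_real_SucI[of _ _ exp]) auto
qed

lemma Ck_sin_cos: "cont_differentiable_on n UNIV (sin :: real \<Rightarrow> real) \<and>
    cont_differentiable_on n UNIV (cos :: real \<Rightarrow> real)"
proof (induction n)
  case 0
  then show ?case by (auto intro!: continuous_intros)
next
  case (Suc n)
  then have "cont_differentiable_on n UNIV (\<lambda>x::real. - sin x)"
    by (intro Ck_linear_compose[OF bounded_linear_minus[OF bounded_linear_ident]]) auto
  then show ?case using Suc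
    by (intro conjI Ck_real_SucI[of _ sin cos] Ck_real_SucI[of _ cos "\<lambda>x. - sin x"]) auto
qed

subsection \<open>Smooth functions\<close>

named_theorems smooth_intros

lemma smooth_onD: "smooth_on S f \<Longrightarrow> cont_differentiable_on n S f"
  by (simp add: smooth_on_def)

lemma smooth_on_continuous: "smooth_on S f \<Longrightarrow> continuous_on S f"
  using Ck_continuous smooth_onD by blast

lemma smooth_on_subset: "smooth_on S f \<Longrightarrow> T \<subseteq> S \<Longrightarrow> smooth_on T f"
  by (auto simp: smooth_on_def intro: Ck_subset)

lemma smooth_on_cong:
  "open S \<Longrightarrow> (\<And>x. x \<in> S \<Longrightarrow> f x = g x) \<Longrightarrow> smooth_on S f \<Longrightarrow> smooth_on S g"
  by (auto simp: smooth_on_def intro: Ck_cong)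

lemma smooth_on_local:
  "(\<And>x. x \<in> S \<Longrightarrow> \<exists>V. open V \<and> x \<in> V \<and> smooth_on V f) \<Longrightarrow> smooth_on S f"
  unfolding smooth_on_def by (rule allI, rule Ck_local) metis

lemma smooth_on_frechet:
  "smooth_on S f \<Longrightarrow> smooth_on S (\<lambda>x. frechet_derivative f (at x) v)"
  unfolding smooth_on_def by (metis cont_differentiable_on.simps(2))

lemma smooth_on_has_derivative:
  "smooth_on S f \<Longrightarrow> x \<in> S \<Longrightarrow> (f has_derivative frechet_derivative f (at x)) (at x)"
  using Ck_derivative smooth_onD by blast

lemma smooth_on_differentiable: "smooth_on S f \<Longrightarrow> x \<in> S \<Longrightarrow> f differentiable (at x)"
  using smooth_on_has_derivative differentiable_def by blast

lemma smooth_on_const [smooth_intros]: "smooth_on S (\<lambda>_. c)"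
  by (simp add: smooth_on_def Ck_const)

lemma smooth_on_linear:
  "bounded_linear f \<Longrightarrow> open S \<Longrightarrow> smooth_on S f"
  by (simp add: smooth_on_def Ck_bounded_linear)

lemma smooth_on_id [smooth_intros]: "open S \<Longrightarrow> smooth_on S (\<lambda>x. x)"
  by (simp add: smooth_on_linear)

lemma smooth_on_linear_compose:
  "bounded_linear h \<Longrightarrow> open S \<Longrightarrow> smooth_on S f \<Longrightarrow> smooth_on S (\<lambda>x. h (f x))"
  by (simp add: smooth_on_def Ck_linear_compose)

lemmas smooth_on_fst [smooth_intros] = smooth_on_linear_compose[OF bounded_linear_fst]
lemmas smooth_on_snd [smooth_intros] = smooth_on_linear_compose[OF bounded_linear_snd]
lemmas smooth_on_Re [smooth_intros] = smooth_on_linear_compose[OF bounded_linear_Re]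
lemmas smooth_on_Im [smooth_intros] = smooth_on_linear_compose[OF bounded_linear_Im]
lemmas smooth_on_of_real [smooth_intros] =
  smooth_on_linear_compose[OF bounded_linear_of_real]
lemmas smooth_on_minus [smooth_intros] =
  smooth_on_linear_compose[OF bounded_linear_minus[OF bounded_linear_ident]]

lemma smooth_on_add [smooth_intros]:
  "open S \<Longrightarrow> smooth_on S f \<Longrightarrow> smooth_on S g \<Longrightarrow> smooth_on S (\<lambda>x. f x + g x)"
  by (simp add: smooth_on_def Ck_add)

lemma smooth_on_diff [smooth_intros]:
  assumes "open S" "smooth_on S f" "smooth_on S g"
  shows "smooth_on S (\<lambda>x. f x - g x)"
  using smooth_on_add[OF assms(1,2) smooth_on_minus[OF assms(1,3)]] by simp

lemma smooth_on_Pair [smooth_intros]: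
  "open S \<Longrightarrow> smooth_on S f \<Longrightarrow> smooth_on S g \<Longrightarrow> smooth_on S (\<lambda>x. (f x, g x))"
  by (simp add: smooth_on_def Ck_Pair)

lemma smooth_on_sum [smooth_intros]:
  "open S \<Longrightarrow> (\<And>i. i \<in> I \<Longrightarrow> smooth_on S (f i)) \<Longrightarrow> smooth_on S (\<lambda>x. \<Sum>i\<in>I. f i x)"
  by (simp add: smooth_on_def Ck_sum)

lemma smooth_on_bilinear:
  "bounded_bilinear h \<Longrightarrow> open S \<Longrightarrow> smooth_on S f \<Longrightarrow> smooth_on S g
    \<Longrightarrow> smooth_on S (\<lambda>x. h (f x) (g x))"
  by (simp add: smooth_on_def Ck_bilinear)

lemmas smooth_on_mult [smooth_intros] = smooth_on_bilinear[OF bounded_bilinear_mult]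
lemmas smooth_on_scaleR [smooth_intros] = smooth_on_bilinear[OF bounded_bilinear_scaleR]
lemmas smooth_on_inner [smooth_intros] = smooth_on_bilinear[OF bounded_bilinear_inner]

lemma smooth_on_power [smooth_intros]:
  fixes f :: "'a::euclidean_space \<Rightarrow> 'b::real_normed_algebra_1"
  shows "open S \<Longrightarrow> smooth_on S f \<Longrightarrow> smooth_on S (\<lambda>x. f x ^ n)"
  by (induction n) (auto intro: smooth_intros)

lemma smooth_on_compose:
  fixes g :: "'a::euclidean_space \<Rightarrow> 'b::euclidean_space"
  shows "open S \<Longrightarrow> open T \<Longrightarrow> smooth_on T f \<Longrightarrow> smooth_on S g \<Longrightarrow> g ` S \<subseteq> T
    \<Longrightarrow> smooth_on S (\<lambda>x. f (g x))"
  by (simp add: smooth_on_def Ck_compose)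

lemma smooth_on_compose_UNIV:
  fixes g :: "'a::euclidean_space \<Rightarrow> 'b::euclidean_space"
  shows "smooth_on UNIV f \<Longrightarrow> open S \<Longrightarrow> smooth_on S g \<Longrightarrow> smooth_on S (\<lambda>x. f (g x))"
  by (rule smooth_on_compose[of S UNIV]) auto

lemma smooth_on_inverse [smooth_intros]:
  fixes f :: "'a::euclidean_space \<Rightarrow> real"
  assumes "open S" "smooth_on S f" "\<And>x. x \<in> S \<Longrightarrow> f x \<noteq> 0"
  shows "smooth_on S (\<lambda>x. inverse (f x))"
  by (rule smooth_on_compose[OF _ real_nonzero_open])
    (use assms Ck_inverse in \<open>auto simp: smooth_on_def\<close>)

lemma smooth_on_divide [smooth_intros]:
  fixes f g :: "'a::euclidean_space \<Rightarrow> real"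
  assumes "open S" "smooth_on S f" "smooth_on S g" "\<And>x. x \<in> S \<Longrightarrow> g x \<noteq> 0"
  shows "smooth_on S (\<lambda>x. f x / g x)"
  using assms by (auto simp: divide_inverse intro!: smooth_intros)

lemma smooth_on_ln [smooth_intros]:
  fixes f :: "'a::euclidean_space \<Rightarrow> real"
  assumes "open S" "smooth_on S f" "\<And>x. x \<in> S \<Longrightarrow> f x > 0"
  shows "smooth_on S (\<lambda>x. ln (f x))"
  by (rule smooth_on_compose[OF _ open_greaterThan[of 0]])
    (use assms Ck_ln in \<open>auto simp: smooth_on_def\<close>)

lemma smooth_on_exp [smooth_intros]:
  fixes f :: "'a::euclidean_space \<Rightarrow> real"
  shows "open S \<Longrightarrow> smooth_on S f \<Longrightarrow> smooth_on S (\<lambda>x. exp (f x))"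
  by (rule smooth_on_compose_UNIV) (auto simp: smooth_on_def Ck_exp)

lemma smooth_on_sin [smooth_intros]:
  fixes f :: "'a::euclidean_space \<Rightarrow> real"
  shows "open S \<Longrightarrow> smooth_on S f \<Longrightarrow> smooth_on S (\<lambda>x. sin (f x))"
  by (rule smooth_on_compose_UNIV) (auto simp: smooth_on_def Ck_sin_cos)

lemma smooth_on_cos [smooth_intros]:
  fixes f :: "'a::euclidean_space \<Rightarrow> real"
  shows "open S \<Longrightarrow> smooth_on S f \<Longrightarrow> smooth_on S (\<lambda>x. cos (f x))"
  by (rule smooth_on_compose_UNIV) (auto simp: smooth_on_def Ck_sin_cos)

lemma smooth_on_powr [smooth_intros]:
  fixes f :: "'a::euclidean_space \<Rightarrow> real"
  assumes "open S" "smooth_on S f" "\<And>x. x \<in> S \<Longrightarrow> f x > 0"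
  shows "smooth_on S (\<lambda>x. f x powr a)"
  by (rule smooth_on_cong[OF assms(1), of "\<lambda>x. exp (a * ln (f x))"])
    (use assms in \<open>auto simp: powr_def dest!: less_imp_neq[symmetric] intro!: smooth_intros\<close>)

lemma smooth_on_sqrt [smooth_intros]:
  fixes f :: "'a::euclidean_space \<Rightarrow> real"
  assumes "open S" "smooth_on S f" "\<And>x. x \<in> S \<Longrightarrow> f x > 0"
  shows "smooth_on S (\<lambda>x. sqrt (f x))"
  by (rule smooth_on_cong[OF assms(1), of "\<lambda>x. f x powr (1/2)"])
    (use assms in \<open>auto simp: powr_half_sqrt less_imp_le intro!: smooth_intros\<close>)

lemma smooth_on_UNIV_deriv:
  fixes f :: "real \<Rightarrow> real"
  assumes "smooth_on UNIV f"
  shows "(f has_real_derivative deriv f t) (at t)" "smooth_on UNIV (deriv f)"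
proof -
  have D: "(f has_derivative frechet_derivative f (at t)) (at t)" for t
    by (rule smooth_on_has_derivative[OF assms]) simp
  have D': "(f has_real_derivative frechet_derivative f (at t) 1) (at t)" for t
    using D[of t] linear_cmul[OF has_derivative_linear[OF D[of t]], of _ 1]
    unfolding has_field_derivative_def
    by (metis (no_types, lifting) ext mult.commute mult.right_neutral real_scaleR_def)
  then show "(f has_real_derivative deriv f t) (at t)"
    using DERIV_imp_deriv by metis
  have "deriv f = (\<lambda>t. frechet_derivative f (at t) 1)"
    using DERIV_imp_deriv[OF D'] by auto
  then show "smooth_on UNIV (deriv f)"
    using smooth_on_frechet[OF assms, of 1] by simp
qed

subsection \<open>Integrals depending on a parameter\<close>

text \<open>Differentiation under the integral along a line in parameter space. The explicit
  derivative is recorded because the derivatives of the phase integrals are estimated through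
  it.\<close>

lemma parametric_integral_derivative:
  fixes v :: "'a::euclidean_space \<times> real \<Rightarrow> 'b::euclidean_space"
  assumes "open S" "S \<times> {a..b} \<subseteq> T" and v: "cont_differentiable_on (Suc n) T v" and y: "y \<in> S"
  shows "((\<lambda>s. integral {a..b} (\<lambda>t. v (y + s *\<^sub>R c, t))) has_vector_derivative
    integral {a..b} (\<lambda>t. frechet_derivative v (at (y, t)) (c, 0))) (at 0)"
proof -
  have cont: "continuous_on T (\<lambda>z. frechet_derivative v (at z) w)" for w
    using v Ck_continuous[of n T "\<lambda>z. frechet_derivative v (at z) w"] by (cases w) simp
  have "open ((\<lambda>s::real. y + s *\<^sub>R c) -` S)"
    by (rule open_vimage[OF \<open>open S\<close>]) (intro continuous_intros)
  then obtain r where r: "r > 0" "ball 0 r \<subseteq> (\<lambda>s::real. y + s *\<^sub>R c) -` S"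
    by (rule openE[of _ 0]) (use y in auto)
  then have in_S: "y + s *\<^sub>R c \<in> S" if "s \<in> ball 0 r" for s using that by auto
  have in_T: "(y + s *\<^sub>R c, t) \<in> T" if "s \<in> ball 0 r" "t \<in> cbox a b" for s t
    using in_S[OF that(1)] that assms(2) by auto
  have "((\<lambda>s. integral (cbox a b) (\<lambda>t. v (y + s *\<^sub>R c, t))) has_vector_derivative
      integral (cbox a b) (\<lambda>t. frechet_derivative v (at (y + 0 *\<^sub>R c, t)) (c, 0))) (at 0 within ball 0 r)"
  proof (rule leibniz_rule_vector_derivative[where
        fx = "\<lambda>s t. frechet_derivative v (at (y + s *\<^sub>R c, t)) (c, 0)"])
    fix s :: real and t assume st: "s \<in> ball 0 r" "t \<in> cbox a b"
    let ?z = "(y + s *\<^sub>R c, t)"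
    have "(v has_derivative frechet_derivative v (at ?z)) (at ?z)"
      using v in_T[OF st] by (rule Ck_derivative)
    moreover have "((\<lambda>s. (y + s *\<^sub>R c, t)) has_derivative (\<lambda>h. (h *\<^sub>R c, 0))) (at s)"
      by (auto intro!: derivative_eq_intros)
    ultimately have "((\<lambda>s. v (y + s *\<^sub>R c, t)) has_derivative
        (\<lambda>h. frechet_derivative v (at ?z) (h *\<^sub>R c, 0))) (at s)"
      by (rule has_derivative_compose[rotated])
    moreover have "frechet_derivative v (at ?z) (h *\<^sub>R c, 0) =
        h *\<^sub>R frechet_derivative v (at ?z) (c, 0)" for h
      using linear_cmul[OF linear_frechet_derivative, of v "at ?z" h "(c, 0)"]
        v in_T[OF st] by simp
    ultimately show "((\<lambda>s. v (y + s *\<^sub>R c, t)) has_vector_derivative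
        frechet_derivative v (at ?z) (c, 0)) (at s within ball 0 r)"
      unfolding has_vector_derivative_def by (simp add: has_derivative_at_withinI)
  next
    fix s :: real assume "s \<in> ball 0 r"
    then show "(\<lambda>t. v (y + s *\<^sub>R c, t)) integrable_on cbox a b"
      by (intro integrable_continuous continuous_on_compose2[OF Ck_continuous[OF v]])
        (auto intro!: continuous_intros in_T)
  next
    show "continuous_on (ball 0 r \<times> cbox a b)
        (\<lambda>(s, t). frechet_derivative v (at (y + s *\<^sub>R c, t)) (c, 0))"
      unfolding split_beta
      by (rule continuous_on_compose2[OF cont]) (auto intro!: continuous_intros in_T)
  qed (use r in auto)
  then show ?thesis
    using r by (simp add: at_within_open[of 0 "ball 0 r"])
qed

lemma Ck_parametric_integral:
  fixes v :: "'a::euclidean_space \<times> real \<Rightarrow> 'b::euclidean_space"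
  assumes "open S"
  shows "open T \<Longrightarrow> S \<times> {a..b} \<subseteq> T \<Longrightarrow> cont_differentiable_on n T v
    \<Longrightarrow> cont_differentiable_on n S (\<lambda>x. integral {a..b} (\<lambda>t. v (x, t)))"
proof (induction n arbitrary: v)
  case 0
  then have "continuous_on (S \<times> cbox a b) (\<lambda>(x, t). v (x, t))"
    by (auto simp: continuous_on_subset)
  from integral_continuous_on_param[OF this] show ?case by simp
next
  case (Suc n)
  let ?g = "\<lambda>c y. integral {a..b} (\<lambda>t. frechet_derivative v (at (y, t)) (c, 0))"
  show ?case
  proof (rule Ck_SucI_partials[OF \<open>open S\<close>, of _ ?g])
    show "cont_differentiable_on n S (?g c)" for c
      by (rule Suc.IH[of "\<lambda>z. frechet_derivative v (at z) (c, 0)"]) (use Suc.prems in auto)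
  qed (rule parametric_integral_derivative[OF \<open>open S\<close> Suc.prems(2,3)])
qed

lemma smooth_on_parametric_integral:
  fixes v :: "'a::euclidean_space \<times> real \<Rightarrow> 'b::euclidean_space"
  assumes "open S" "open T" "S \<times> {a..b} \<subseteq> T" "smooth_on T v"
  shows "smooth_on S (\<lambda>x. integral {a..b} (\<lambda>t. v (x, t)))"
  using assms by (auto simp: smooth_on_def intro: Ck_parametric_integral)

section \<open>Lines, translations and division by a parameter\<close>

lemma has_vector_derivative_line:
  assumes "(f has_derivative D) (at (x + s *\<^sub>R v))"
  shows "((\<lambda>s. f (x + s *\<^sub>R v)) has_vector_derivative D v) (at s)"
proof -
  have "((\<lambda>s. x + s *\<^sub>R v) has_derivative (\<lambda>h. h *\<^sub>R v)) (at s)"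
    by (auto intro!: derivative_eq_intros)
  from has_derivative_compose[OF this assms]
  show ?thesis
    unfolding has_vector_derivative_def
    using linear_cmul[OF has_derivative_linear[OF assms]] by simp
qed

lemma frechet_derivative_shift:
  assumes "open S" "x \<in> S" "\<And>y. y \<in> S \<Longrightarrow> f (y + s) = f y" "f differentiable (at (x + s))"
  shows "frechet_derivative f (at (x + s)) = frechet_derivative f (at x)"
proof -
  have "((\<lambda>y. y + s) has_derivative (\<lambda>y. y)) (at x)"
    by (auto intro!: derivative_eq_intros)
  moreover have "(f has_derivative frechet_derivative f (at (x + s))) (at (x + s))"
    using assms(4) frechet_derivative_works by blast
  ultimately have "((\<lambda>y. f (y + s)) has_derivative frechet_derivative f (at (x + s))) (at x)"
    using has_derivative_compose by fastforce
  then have "(f has_derivative frechet_derivative f (at (x + s))) (at x)"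
    by (rule has_derivative_transform_within_open[OF _ assms(1,2)]) (simp add: assms(3))
  then show ?thesis using frechet_derivative_at by blast
qed

text \<open>\<open>H\<close> is the derivative of F in \<mu> averaged over the segment from 0 to
  \<mu>, so it is smooth across \<mu> = 0. The segment must lie in \<open>D\<close>, hence
  \<open>star\<close>. The last clause passes translation symmetries from F to \<open>H\<close>; it
  carries periodicity in t through the expansion.\<close>

lemma hadamard:
  fixes F :: "real \<times> 'q::euclidean_space \<Rightarrow> 'b::euclidean_space"
  assumes "open D" "smooth_on D F"
    and star: "\<And>\<mu> q \<theta>. (\<mu>, q) \<in> D \<Longrightarrow> 0 \<le> \<theta> \<Longrightarrow> \<theta> \<le> 1 \<Longrightarrow> (\<theta> * \<mu>, q) \<in> D"
  shows "\<exists>H. smooth_on D H \<and>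
    (\<forall>\<mu> q. (\<mu>, q) \<in> D \<longrightarrow> F (\<mu>, q) = F (0, q) + \<mu> *\<^sub>R H (\<mu>, q)) \<and>
    (\<forall>q. (0, q) \<in> D \<longrightarrow> H (0, q) = frechet_derivative F (at (0, q)) (1, 0)) \<and>
    (\<forall>s. (\<forall>\<mu> q. (\<mu>, q) \<in> D \<longrightarrow> (\<mu>, q + s) \<in> D \<and> F (\<mu>, q + s) = F (\<mu>, q)) \<longrightarrow>
      (\<forall>\<mu> q. (\<mu>, q) \<in> D \<longrightarrow> H (\<mu>, q + s) = H (\<mu>, q)))"
proof -
  define v where "v = (\<lambda>z. frechet_derivative F (at (snd z * fst (fst z), snd (fst z))) (1, 0))"
  define T where "T = (\<lambda>z. (snd z * fst (fst z), snd (fst z))) -` D"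
  let ?H = "\<lambda>x. integral {0..1} (\<lambda>\<theta>. v (x, \<theta>))"
  have T: "open T" unfolding T_def
    by (rule open_vimage[OF \<open>open D\<close>]) (intro continuous_intros)
  have "smooth_on T v" unfolding v_def
    by (rule smooth_on_compose[OF T \<open>open D\<close> smooth_on_frechet[OF assms(2)]])
      (auto simp: T_def intro!: smooth_intros T[unfolded T_def])
  moreover have "D \<times> {0..1} \<subseteq> T" using star by (auto simp: T_def)
  ultimately have H1: "smooth_on D ?H"
    using smooth_on_parametric_integral[OF \<open>open D\<close> T] by blast
  have H2: "F (\<mu>, q) = F (0, q) + \<mu> *\<^sub>R ?H (\<mu>, q)" if "(\<mu>, q) \<in> D" for \<mu> q
  proof -
    have "((\<lambda>\<theta>. \<mu> *\<^sub>R v ((\<mu>, q), \<theta>)) has_integral F (1 * \<mu>, q) - F (0 * \<mu>, q)) {0..1}"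
    proof (rule fundamental_theorem_of_calculus)
      fix \<theta> :: real assume \<theta>: "\<theta> \<in> {0..1}"
      then have in_D: "(\<theta> * \<mu>, q) \<in> D" using star[OF that] by auto
      have "((\<lambda>s. F ((0, q) + s *\<^sub>R (\<mu>, 0))) has_vector_derivative
          frechet_derivative F (at (\<theta> * \<mu>, q)) (\<mu>, 0)) (at \<theta>)"
        by (rule has_vector_derivative_line) (simp add: smooth_on_has_derivative[OF assms(2) in_D])
      moreover have "frechet_derivative F (at (\<theta> * \<mu>, q)) (\<mu>, 0) = \<mu> *\<^sub>R v ((\<mu>, q), \<theta>)"
        using linear_cmul[OF linear_frechet_derivative[OF smooth_on_differentiable[OF assms(2) in_D]],
            of \<mu> "(1, 0)"] by (simp add: v_def)
      ultimately show "((\<lambda>\<theta>. F (\<theta> * \<mu>, q)) has_vector_derivative \<mu> *\<^sub>R v ((\<mu>, q), \<theta>))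
          (at \<theta> within {0..1})"
        by (simp add: has_vector_derivative_at_within)
    qed simp
    from integral_unique[OF this] show ?thesis by simp
  qed
  have H3: "?H (0, q) = frechet_derivative F (at (0, q)) (1, 0)" for q
    by (simp add: v_def)
  have H4: "?H (\<mu>, q + s) = ?H (\<mu>, q)"
    if inv: "\<And>\<mu> q. (\<mu>, q) \<in> D \<Longrightarrow> (\<mu>, q + s) \<in> D \<and> F (\<mu>, q + s) = F (\<mu>, q)"
      and D: "(\<mu>, q) \<in> D" for s \<mu> q
  proof (rule integral_cong)
    fix \<theta> :: real assume "\<theta> \<in> {0..1}"
    then have "(\<theta> * \<mu>, q) \<in> D" using star[OF D] by auto
    moreover from this inv have "(\<theta> * \<mu>, q) + (0, s) \<in> D" by simp
    ultimately have "frechet_derivative F (at ((\<theta> * \<mu>, q) + (0, s))) = frechet_derivative F (at (\<theta> * \<mu>, q))"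
      using inv smooth_on_differentiable[OF assms(2)]
      by (intro frechet_derivative_shift[OF assms(1)]) auto
    then show "v ((\<mu>, q + s), \<theta>) = v ((\<mu>, q), \<theta>)" by (simp add: v_def)
  qed
  show ?thesis
    by (intro exI[of _ ?H] conjI allI impI H1 H2 H3 H4) auto
qed

text \<open>The case split is forced by \<open>integral {0..t} f\<close> being zero for negative
  t.\<close>

definition primitive :: "(real \<Rightarrow> 'b::banach) \<Rightarrow> real \<Rightarrow> 'b" where
  "primitive f t = (if 0 \<le> t then integral {0..t} f else - integral {t..0} f)"

lemma primitive_eq_integral: "0 \<le> t \<Longrightarrow> primitive f t = integral {0..t} f"
  by (simp add: primitive_def)

lemma primitive_0 [simp]: "primitive f 0 = 0"
  by (simp add: primitive_def)

lemma primitive_derivative: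
  fixes f :: "real \<Rightarrow> 'b::banach"
  assumes "continuous_on UNIV f"
  shows "(primitive f has_vector_derivative f t) (at t)"
proof -
  define N where "N = \<bar>t\<bar> + 1"
  have N: "- N < t" "t < N" unfolding N_def by linarith+
  have cont: "continuous_on A f" for A using assms continuous_on_subset by blast
  have int: "f integrable_on {a..b}" for a b by (rule integrable_continuous_real[OF cont])
  have eq: "primitive f s = integral {-N..s} f - integral {-N..0} f" if "s \<in> {-N<..<N}" for s
  proof (cases "0 \<le> s")
    case True
    then have "integral {-N..0} f + integral {0..s} f = integral {-N..s} f"
      by (intro Henstock_Kurzweil_Integration.integral_combine int) (auto simp: N_def)
    then show ?thesis using True by (simp add: primitive_def algebra_simps)
  next
    case False
    then have "integral {-N..s} f + integral {s..0} f = integral {-N..0} f"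
      using that by (intro Henstock_Kurzweil_Integration.integral_combine int) auto
    then show ?thesis using False by (simp add: primitive_def algebra_simps)
  qed
  have "((\<lambda>s. integral {-N..s} f) has_vector_derivative f t) (at t within {-N..N})"
    by (rule integral_has_vector_derivative[OF cont]) (auto simp: N_def)
  then have "((\<lambda>s. integral {-N..s} f) has_vector_derivative f t) (at t)"
    using at_within_interior[of t "{-N..N}"] N by simp
  then have "((\<lambda>s. integral {-N..s} f - integral {-N..0} f) has_vector_derivative f t) (at t)"
    by (auto intro!: derivative_eq_intros)
  then show ?thesis
    by (rule has_vector_derivative_transform_within_open[of _ _ _ "{-N<..<N}"])
      (use N eq in auto)
qed

text \<open>The substitution s = \<theta> t gives a fixed interval of integration, so that
  smoothness jointly in t and the parameter follows from the rule for parametric integrals.\<close>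

lemma primitive_eq_scaled:
  fixes f :: "real \<Rightarrow> 'b::banach"
  assumes "continuous_on UNIV f"
  shows "primitive f t = integral {0..1} (\<lambda>\<theta>. t *\<^sub>R f (\<theta> * t))"
proof -
  have "((\<lambda>\<theta>. t *\<^sub>R f (\<theta> * t)) has_integral primitive f (1 * t) - primitive f (0 * t)) {0..1}"
  proof (rule fundamental_theorem_of_calculus)
    fix \<theta> :: real
    have "((\<lambda>\<theta>. \<theta> * t) has_vector_derivative t) (at \<theta>)"
      by (auto intro!: derivative_eq_intros)
    from vector_diff_chain_at[OF this primitive_derivative[OF assms]]
    show "((\<lambda>\<theta>. primitive f (\<theta> * t)) has_vector_derivative t *\<^sub>R f (\<theta> * t)) (at \<theta> within {0..1})"
      by (simp add: o_def has_vector_derivative_at_within)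
  qed simp
  from integral_unique[OF this] show ?thesis by simp
qed

lemma smooth_on_primitive:
  fixes v :: "'a::euclidean_space \<Rightarrow> real \<Rightarrow> 'b::euclidean_space"
  assumes "open U" "smooth_on (U \<times> UNIV) (\<lambda>(x, t). v x t)"
  shows "smooth_on (U \<times> UNIV) (\<lambda>(x, t). primitive (v x) t)"
proof -
  have oU: "open (U \<times> (UNIV :: real set))" using assms by (simp add: open_Times)
  let ?w = "\<lambda>z :: ('a \<times> real) \<times> real. snd (fst z) *\<^sub>R v (fst (fst z)) (snd z * snd (fst z))"
  have oT: "open ((U \<times> (UNIV :: real set)) \<times> (UNIV :: real set))"
    using oU by (simp add: open_Times)
  have "smooth_on ((U \<times> (UNIV :: real set)) \<times> (UNIV :: real set))
      (\<lambda>z. (\<lambda>(x, t). v x t) (fst (fst z), snd z * snd (fst z)))"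
    by (rule smooth_on_compose[OF oT oU assms(2)]) (auto intro!: smooth_intros oT)
  then have "smooth_on ((U \<times> (UNIV :: real set)) \<times> (UNIV :: real set)) ?w"
    by (auto intro!: smooth_intros oT)
  then have "smooth_on (U \<times> UNIV) (\<lambda>x. integral {0..1} (\<lambda>\<theta>. ?w (x, \<theta>)))"
    by (rule smooth_on_parametric_integral[OF oU oT, rotated]) auto
  moreover have "integral {0..1} (\<lambda>\<theta>. ?w (z, \<theta>)) = (\<lambda>(x, t). primitive (v x) t) z"
    if "z \<in> U \<times> UNIV" for z
  proof -
    have "continuous_on UNIV (v (fst z))"
      using continuous_on_compose2[OF smooth_on_continuous[OF assms(2)], of UNIV "\<lambda>t. (fst z, t)"] that
      by (force intro: continuous_on_Pair continuous_on_const continuous_on_id)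
    from primitive_eq_scaled[OF this] show ?thesis by (simp add: split_beta)
  qed
  ultimately show ?thesis by (rule smooth_on_cong[OF oU, rotated -1]) 
qed

section \<open>Periodic solutions of differential equations\<close>

lemma periodic_of_int:
  assumes "periodic P f"
  shows "f (t + of_int j * P) = f t"
proof -
  have nat: "f (t + of_nat n * P) = f t" for n t
  proof (induction n)
    case (Suc n)
    have "f (t + of_nat (Suc n) * P) = f (t + of_nat n * P + P)"
      by (simp add: algebra_simps)
    then show ?case using assms Suc by (simp add: periodic_def)
  qed simp
  show ?thesis
  proof (cases j)
    case (nonneg n)
    then show ?thesis using nat[of t n] by simp
  next
    case (neg n)
    have "t + of_int j * P + of_nat (Suc n) * P = t" unfolding neg by (simp add: algebra_simps)
    then show ?thesis using nat[of "t + of_int j * P" "Suc n"] by metis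
  qed
qed

lemma period_reduce:
  fixes P :: real
  assumes "P > 0"
  obtains s j where "s \<in> {0..P}" "t = s + of_int j * P"
proof
  let ?j = "\<lfloor>t / P\<rfloor>"
  have "of_int ?j \<le> t / P" "t / P < of_int ?j + 1" by linarith+
  then have "of_int ?j * P \<le> t" "t < (of_int ?j + 1) * P"
    using pos_le_divide_eq[OF assms] pos_divide_less_eq[OF assms] by blast+
  then show "t - of_int ?j * P \<in> {0..P}" by (simp add: algebra_simps)
  show "t = t - of_int ?j * P + of_int ?j * P" by simp
qed

lemma periodic_bounded:
  fixes f :: "real \<Rightarrow> 'b::real_normed_vector"
  assumes "P > 0" "periodic P f" "continuous_on UNIV f"
  obtains s where "\<And>t. norm (f t) \<le> norm (f s)"
proof -
  have "\<exists>s\<in>{0..P}. \<forall>t\<in>{0..P}. norm (f t) \<le> norm (f s)"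
    using assms by (intro continuous_attains_sup continuous_on_norm) (auto intro: continuous_on_subset)
  then obtain s where s: "\<forall>t\<in>{0..P}. norm (f t) \<le> norm (f s)" by blast
  have "norm (f t) \<le> norm (f s)" for t
    by (rule period_reduce[OF assms(1), of t]) (use s periodic_of_int[OF assms(2)] in auto)
  then show ?thesis using that by blast
qed

lemma has_vd_continuous:
  assumes "\<And>t. (f has_vector_derivative f' t) (at t)"
  shows "continuous_on UNIV f"
  using assms by (auto intro!: continuous_at_imp_continuous_on has_vector_derivative_continuous)

lemma constant_if_vd_zero:
  fixes f :: "real \<Rightarrow> 'b::real_normed_vector"
  assumes "\<And>t. (f has_vector_derivative 0) (at t)"
  shows "f t = f s"
proof -
  obtain c where "\<And>x. x \<in> UNIV \<Longrightarrow> f x = c"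
    by (rule has_vector_derivative_zero_constant[of UNIV f]) (use assms in auto)
  then show ?thesis by simp
qed

lemma has_vd_periodic:
  assumes "(f has_vector_derivative f') (at t)" "periodic P f"
  shows "(f has_vector_derivative f') (at (t + P))"
proof -
  have "((\<lambda>s. s - P) has_vector_derivative 1) (at (t + P))"
    using has_vector_derivative_diff[OF has_vector_derivative_id has_vector_derivative_const] by fastforce
  moreover have "f \<circ> (\<lambda>s. s - P) = f"
  proof
    show "(f \<circ> (\<lambda>s. s - P)) s = f s" for s
      using assms(2)[unfolded periodic_def, rule_format, of "s - P"] by simp
  qed
  ultimately show ?thesis
    using vector_diff_chain_at[of "\<lambda>s. s - P" 1 "t + P" f f'] assms(1)
    by (simp only: add_diff_cancel_right' scaleR_one)
qed

lemma shift_derivative: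
  assumes "(f has_vector_derivative f') (at (t + P))"
  shows "((\<lambda>s. f (s + P)) has_vector_derivative f') (at t)"
proof -
  have "((\<lambda>s. s + P) has_vector_derivative 1) (at t)"
    using has_vector_derivative_add[OF has_vector_derivative_id has_vector_derivative_const] by fastforce
  from vector_diff_chain_at[OF this assms] show ?thesis by (simp add: o_def)
qed

lemma periodic_integral_shift:
  fixes \<Theta> \<omega> :: "real \<Rightarrow> real"
  assumes "\<And>t. (\<Theta> has_real_derivative \<omega> t) (at t)" "periodic P \<omega>"
  shows "\<Theta> (t + P) = \<Theta> t + (\<Theta> P - \<Theta> 0)"
proof -
  have \<Theta>: "(\<Theta> has_vector_derivative \<omega> t) (at t)" for t
    using assms(1) by (simp add: has_real_derivative_iff_has_vector_derivative)
  have "((\<lambda>s. \<Theta> (s + P) - \<Theta> s) has_vector_derivative \<omega> (s + P) - \<omega> s) (at s)" for s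
    by (intro has_vector_derivative_diff shift_derivative \<Theta>)
  then have "((\<lambda>s. \<Theta> (s + P) - \<Theta> s) has_vector_derivative 0) (at s)" for s
    using assms(2) by (simp add: periodic_def)
  from constant_if_vd_zero[OF this, of t 0] show ?thesis by simp
qed

subsection \<open>The rotating linear equation\<close>

text \<open>\<open>cis (l * \<Theta>)\<close> is the integrating factor of \<open>u' = - \<i> l \<omega> u + f\<close>, and the
  non-resonance condition \<open>\<bar>cis (l S) - 1\<bar> \<ge> 1\<close> bounds a periodic solution by its jump over one
  period.\<close>

lemma cis_primitive_derivative:
  assumes "(\<Theta> has_real_derivative \<omega>) (at t)"
  shows "((\<lambda>t. cis (l * \<Theta> t)) has_vector_derivative \<i> * of_real (l * \<omega>) * cis (l * \<Theta> t)) (at t)"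
  unfolding has_vector_derivative_complex_iff
  using assms by (auto intro!: derivative_eq_intros)

locale rotation =
  fixes P l S :: real and \<omega> \<Theta> :: "real \<Rightarrow> real"
  assumes P: "P > 0"
    and \<Theta>: "\<And>t. (\<Theta> has_real_derivative \<omega> t) (at t)"
    and \<omega>_periodic: "periodic P \<omega>"
    and S: "S = \<Theta> P - \<Theta> 0"
    and nonres: "norm (cis (l * S) - 1) \<ge> 1"
begin

lemma \<Theta>_shift: "\<Theta> (t + P) = \<Theta> t + S"
  using periodic_integral_shift[OF \<Theta> \<omega>_periodic] by (simp add: S)

lemma cis_shift: "cis (l * \<Theta> (t + P)) = cis (l * S) * cis (l * \<Theta> t)"
  by (simp only: \<Theta>_shift distrib_left cis_mult add.commute[of "l * S"])

lemma estimate: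
  assumes "periodic P u"
    and u: "\<And>t. (u has_vector_derivative u' t) (at t)"
    and f: "\<And>t. norm (u' t + \<i> * of_real (l * \<omega> t) * u t) \<le> M"
  shows "norm (u t) \<le> P * M"
proof -
  define y where "y t = cis (l * \<Theta> t) * u t" for t
  have y': "(y has_vector_derivative cis (l * \<Theta> s) * (u' s + \<i> * of_real (l * \<omega> s) * u s)) (at s)" for s
    unfolding y_def using has_vector_derivative_mult[OF cis_primitive_derivative[OF \<Theta>] u]
    by (simp add: algebra_simps)
  have "norm (y (t + P) - y t) \<le> M * norm (t + P - t)"
  proof (rule differentiable_bound[of UNIV])
    show "(y has_derivative (\<lambda>h. h *\<^sub>R (cis (l * \<Theta> s) * (u' s + \<i> * of_real (l * \<omega> s) * u s)))) (at s within UNIV)" for s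
      using y'[of s] by (simp add: has_vector_derivative_def)
    show "onorm (\<lambda>h. h *\<^sub>R (cis (l * \<Theta> s) * (u' s + \<i> * of_real (l * \<omega> s) * u s))) \<le> M" for s
    proof (rule onorm_le)
      fix h :: real
      have "norm (h *\<^sub>R (cis (l * \<Theta> s) * (u' s + \<i> * of_real (l * \<omega> s) * u s))) =
          \<bar>h\<bar> * norm (u' s + \<i> * of_real (l * \<omega> s) * u s)"
        by (simp add: norm_mult)
      also have "\<dots> \<le> \<bar>h\<bar> * M" by (intro mult_left_mono f) auto
      finally show "norm (h *\<^sub>R (cis (l * \<Theta> s) * (u' s + \<i> * of_real (l * \<omega> s) * u s))) \<le> M * norm h"
        by (simp add: mult.commute)
    qed
  qed auto
  moreover have "y (t + P) - y t = (cis (l * S) - 1) * y t"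
    using assms(1)[unfolded periodic_def, rule_format, of t] unfolding y_def cis_shift
    by (simp only: left_diff_distrib mult_1 mult.assoc)
  moreover have "norm (y t) = norm (u t)" by (simp add: y_def norm_mult)
  ultimately have "norm (cis (l * S) - 1) * norm (u t) \<le> P * M"
    using P by (simp add: norm_mult mult.commute)
  moreover have "1 * norm (u t) \<le> norm (cis (l * S) - 1) * norm (u t)"
    by (intro mult_right_mono nonres) auto
  ultimately show ?thesis by simp
qed

text \<open>Variation of constants: \<open>cis (l * \<Theta> t) * u t\<close> must be a primitive of
  \<open>h\<close>, and only its constant is free to make \<open>u\<close> periodic.\<close>

lemma solvable:
  assumes f: "continuous_on UNIV f" "periodic P f"
  obtains u where "periodic P u"
    "\<And>t. (u has_vector_derivative - \<i> * of_real (l * \<omega> t) * u t + f t) (at t)"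
proof -
  let ?e = "cis (l * S)"
  have \<Theta>_cont: "continuous_on UNIV \<Theta>"
    using \<Theta> by (meson DERIV_continuous continuous_at_imp_continuous_on)
  define h where "h t = cis (l * \<Theta> t) * f t" for t
  have h: "continuous_on UNIV h" unfolding h_def cis_conv_exp
    by (intro continuous_intros f \<Theta>_cont)
  define I where "I = primitive h"
  have I': "(I has_vector_derivative h t) (at t)" for t
    unfolding I_def by (rule primitive_derivative[OF h])
  have h_shift: "h (t + P) = ?e * h t" for t
    using f(2) by (simp add: h_def cis_shift periodic_def)
  have "((\<lambda>s. I (s + P) - ?e * I s) has_vector_derivative 0) (at s)" for s
  proof -
    have "((\<lambda>s. I (s + P)) has_vector_derivative ?e * h s) (at s)"
      using shift_derivative[OF I', where t = s and P = P] by (simp add: h_shift)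
    moreover have "((\<lambda>s. ?e * I s) has_vector_derivative ?e * h s) (at s)"
      using I' by (auto intro!: derivative_eq_intros)
    ultimately show ?thesis using has_vector_derivative_diff by fastforce
  qed
  from constant_if_vd_zero[OF this, of _ 0] have I_shift: "I (t + P) = I P + ?e * I t" for t
    by (simp add: I_def algebra_simps) (metis add_diff_cancel_left' diff_add_cancel add.commute)
  \<comment> \<open>The constant for which \<open>k + I t\<close> is multiplied by \<open>?e\<close>
    over one period; \<open>I\<close> itself is so only up to the summand \<open>I P\<close>.
    Non-resonance keeps the denominator away from zero.\<close>
  define k where "k = I P / (?e - 1)"
  have "?e - 1 \<noteq> 0" using nonres by auto
  then have k: "k + I P = ?e * k" by (simp add: k_def field_simps)
  define u where "u t = cis (- l * \<Theta> t) * (k + I t)" for t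
  show ?thesis
  proof
    have "u (t + P) = u t" for t
    proof -
      have "u (t + P) = cis (- l * \<Theta> t) * cis (- l * S) * (?e * (k + I t))"
        unfolding u_def I_shift \<Theta>_shift
        by (simp only: distrib_left cis_mult add.assoc[symmetric] k)
      also have "\<dots> = (cis (- l * S) * ?e) * u t" by (simp add: u_def)
      also have "cis (- l * S) * ?e = 1" by (simp add: cis_mult)
      finally show ?thesis by simp
    qed
    then show "periodic P u" by (simp add: periodic_def)
    show "(u has_vector_derivative - \<i> * of_real (l * \<omega> t) * u t + f t) (at t)" for t
    proof -
      have "((\<lambda>t. k + I t) has_vector_derivative h t) (at t)"
        using I' by (auto intro!: derivative_eq_intros)
      from has_vector_derivative_mult[OF cis_primitive_derivative[OF \<Theta>, of "-l"] this]
      have "(u has_vector_derivative cis (- l * \<Theta> t) * h t +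
          \<i> * of_real (- l * \<omega> t) * cis (- l * \<Theta> t) * (k + I t)) (at t)"
        unfolding u_def by simp
      moreover have "cis (- l * \<Theta> t) * h t = f t"
        by (simp add: h_def cis_mult mult.assoc[symmetric])
      ultimately show ?thesis by (simp add: u_def algebra_simps)
    qed
  qed
qed

text \<open>Contraction on the P-periodic functions with values in the unit ball: freeze the
  nonlinearity at \<open>v\<close> and solve the linear equation. By \<open>estimate\<close> the
  image is bounded by P M, and the Lipschitz constant of the map is P \<kappa>.\<close>

lemma nonlinear_solvable:
  fixes g :: "real \<Rightarrow> complex \<Rightarrow> complex"
  assumes cont: "continuous_on (UNIV \<times> cball 0 1) (\<lambda>(t, w). g t w)"
    and per: "\<And>t w. norm w \<le> 1 \<Longrightarrow> g (t + P) w = g t w"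
    and bound: "\<And>t w. norm w \<le> 1 \<Longrightarrow> norm (g t w) \<le> M" "P * M \<le> 1"
    and lip: "\<And>t w z. norm w \<le> 1 \<Longrightarrow> norm z \<le> 1 \<Longrightarrow> norm (g t w - g t z) \<le> \<kappa> * norm (w - z)"
      "0 \<le> \<kappa>" "P * \<kappa> < 1"
  obtains u where "periodic P u" "\<And>t. norm (u t) \<le> P * M"
    "\<And>t. (u has_vector_derivative - \<i> * of_real (l * \<omega> t) * u t + g t (u t)) (at t)"
proof -
  define X where "X = {v :: real \<Rightarrow>\<^sub>C complex. (\<forall>t. norm (v t) \<le> 1) \<and> periodic P v}"
  have gv: "continuous_on UNIV (\<lambda>t. g t (v t))" if "v \<in> X" for v
  proof -
    have "continuous_on UNIV (\<lambda>t. (t, v t))"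
      by (intro continuous_on_Pair continuous_on_id continuous_on_apply_bcontfun)
    moreover have "(\<lambda>t. (t, v t)) ` UNIV \<subseteq> UNIV \<times> cball 0 1"
      using that by (auto simp: X_def)
    ultimately show ?thesis using continuous_on_compose2[OF cont] by fastforce
  qed
  have "\<exists>u. periodic P u \<and> (\<forall>t. (u has_vector_derivative
      - \<i> * of_real (l * \<omega> t) * u t + g t (v t)) (at t))" if "v \<in> X" for v
  proof -
    have "periodic P (\<lambda>t. g t (v t))" using that per by (simp add: X_def periodic_def)
    from solvable[OF gv[OF that] this] show ?thesis by blast
  qed
  then obtain T0 where T0: "\<And>v. v \<in> X \<Longrightarrow> periodic P (T0 v)"
    "\<And>v t. v \<in> X \<Longrightarrow> (T0 v has_vector_derivative
      - \<i> * of_real (l * \<omega> t) * T0 v t + g t (v t)) (at t)"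
    by metis
  have T0_bound: "norm (T0 v t) \<le> P * M" if "v \<in> X" for v t
    using that bound(1) by (intro estimate[OF T0(1)[OF that] T0(2)[OF that]]) (auto simp: X_def)
  define T where "T v = Bcontfun (T0 v)" for v
  have T: "apply_bcontfun (T v) = T0 v" if "v \<in> X" for v
    unfolding T_def
    by (intro Bcontfun_inverse bcontfun_normI[OF has_vd_continuous[OF T0(2)[OF that]] T0_bound[OF that]])
  have eval_lim: "(\<lambda>n. (w n :: real \<Rightarrow>\<^sub>C complex) t) \<longlonglongrightarrow> v t" if "w \<longlonglongrightarrow> v" for w v t
  proof (rule tendstoI)
    fix e :: real assume "e > 0"
    then have "\<forall>\<^sub>F n in sequentially. dist (w n) v < e" using that tendstoD by blast
    then show "\<forall>\<^sub>F n in sequentially. dist (w n t) (v t) < e"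
      by eventually_elim (use dist_bounded le_less_trans in blast)
  qed
  have "closed X"
    unfolding closed_sequential_limits
  proof (intro allI impI, elim conjE)
    fix w v assume w: "\<forall>n. w n \<in> X" "w \<longlonglongrightarrow> v"
    have "norm (v t) \<le> 1" for t
      using w(1) by (intro LIMSEQ_le_const2[OF tendsto_norm[OF eval_lim[OF w(2)]]]) (auto simp: X_def)
    moreover have "v (t + P) = v t" for t
    proof (rule LIMSEQ_unique[OF eval_lim[OF w(2)]])
      show "(\<lambda>n. w n (t + P)) \<longlonglongrightarrow> v t"
        using eval_lim[OF w(2), of t] w(1) by (simp add: X_def periodic_def)
    qed
    ultimately show "v \<in> X" by (simp add: X_def periodic_def)
  qed
  have "\<exists>!v\<in>X. T v = v"
  proof (rule Banach_fix)
    show "complete X" using \<open>closed X\<close> complete_eq_closed by blast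
    have "0 \<in> X" by (simp add: X_def periodic_def)
    then show "X \<noteq> {}" by blast
    show "T ` X \<subseteq> X"
      using T T0(1) T0_bound bound(2) order_trans by (fastforce simp: X_def)
    show "0 \<le> P * \<kappa>" "P * \<kappa> < 1" using P lip by auto
    show "dist (T v) (T w) \<le> P * \<kappa> * dist v w" if "v \<in> X" "w \<in> X" for v w
    proof (rule dist_bound)
      fix t
      have "norm (T0 v t - T0 w t) \<le> P * (\<kappa> * dist v w)"
      proof (rule estimate)
        show "periodic P (\<lambda>t. T0 v t - T0 w t)"
          using T0(1) that by (simp add: periodic_def)
        show "((\<lambda>t. T0 v t - T0 w t) has_vector_derivative
            (- \<i> * of_real (l * \<omega> t) * T0 v t + g t (v t)) -
            (- \<i> * of_real (l * \<omega> t) * T0 w t + g t (w t))) (at t)" for t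
          by (intro has_vector_derivative_diff T0 that)
        fix t
        have "norm (g t (v t) - g t (w t)) \<le> \<kappa> * norm (v t - w t)"
          using that by (intro lip) (auto simp: X_def)
        also have "\<dots> \<le> \<kappa> * dist v w"
          using dist_bounded[of v t w] lip(2) by (intro mult_left_mono) (auto simp: dist_norm)
        finally show "norm ((- \<i> * of_real (l * \<omega> t) * T0 v t + g t (v t)) -
            (- \<i> * of_real (l * \<omega> t) * T0 w t + g t (w t)) +
            \<i> * of_real (l * \<omega> t) * (T0 v t - T0 w t)) \<le> \<kappa> * dist v w"
          by (simp add: algebra_simps)
      qed
      then show "dist (T v t) (T w t) \<le> P * \<kappa> * dist v w"
        using T that by (simp add: dist_norm mult.assoc)
    qed
  qed
  then obtain v where v: "v \<in> X" "T v = v" by blast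
  then have "T0 v = apply_bcontfun v" using T by metis
  then show ?thesis
    using that[of "T0 v"] T0(1)[OF v(1)] T0_bound[OF v(1)] T0(2)[OF v(1)] by metis
qed

end

subsection \<open>Smooth dependence on parameters\<close>

lemma Ck_Suc_1: "cont_differentiable_on (Suc n) S f \<Longrightarrow> cont_differentiable_on 1 S f"
proof (induction n)
  case (Suc n)
  then show ?case using Ck_mono_Suc by blast
qed simp

text \<open>Uniform continuity near a compact set in a form where \<open>z + y\<close> may leave
  \<open>C\<close>: one radius keeps all translates inside \<open>D\<close> and controls the change
  of \<open>h\<close>.\<close>

lemma continuous_uniform_on_compact:
  fixes h :: "'a::euclidean_space \<Rightarrow> 'b::metric_space"
  assumes "open D" "continuous_on D h" "compact C" "C \<subseteq> D" "\<epsilon> > 0"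
  obtains d where "d > 0" "\<And>z y. z \<in> C \<Longrightarrow> norm y < d \<Longrightarrow> z + y \<in> D \<and> dist (h (z + y)) (h z) \<le> \<epsilon>"
proof -
  obtain e where e: "e > 0" "(\<Union>z\<in>C. ball z e) \<subseteq> D"
    using compact_subset_open_imp_ball_epsilon_subset[OF assms(3,1,4)] by blast
  have inD: "z + y \<in> D" if "z \<in> C" "y \<in> ball 0 e" for z y
    using e(2) that by (force simp: dist_norm)
  have "continuous_on (ball 0 e \<times> C) (\<lambda>x. h (snd x + fst x))"
    by (rule continuous_on_compose2[OF assms(2)]) (auto intro!: continuous_intros inD)
  note cont = this
  have "(0 :: 'a) \<in> ball 0 e" using e(1) by simp
  have "\<exists>X. 0 \<in> X \<and> open X \<and> (\<forall>y\<in>X \<inter> ball 0 e. \<forall>z\<in>C.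
      dist (h (snd (y, z) + fst (y, z))) (h (snd (0, z) + fst (0, z))) \<le> \<epsilon>)"
    by (rule continuous_on_prod_compactE[OF cont assms(3) \<open>0 \<in> ball 0 e\<close> assms(5)])
      (intro exI conjI, assumption, assumption, simp)
  then obtain X where X: "0 \<in> X" "open X"
    "\<forall>y\<in>X \<inter> ball 0 e. \<forall>z\<in>C. dist (h (snd (y, z) + fst (y, z))) (h (snd (0, z) + fst (0, z))) \<le> \<epsilon>"
    by metis
  then obtain d where d: "d > 0" "ball 0 d \<subseteq> X \<inter> ball 0 e"
    using e(1) by (metis IntI centre_in_ball open_Int open_ball openE)
  show ?thesis
  proof (rule that[OF d(1)])
    fix z y :: 'a assume "z \<in> C" "norm y < d"
    then have "y \<in> X \<inter> ball 0 e" using d(2) by auto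
    then show "z + y \<in> D \<and> dist (h (z + y)) (h z) \<le> \<epsilon>"
      using X(3) inD \<open>z \<in> C\<close> by auto
  qed
qed

text \<open>The remainder is governed by the variation of the derivative along the segment, and near
  a compact set that variation is uniformly small, basis vector by basis vector.\<close>

lemma uniformly_differentiable:
  fixes f :: "'a::euclidean_space \<Rightarrow> 'b::real_normed_vector"
  assumes "open D" "cont_differentiable_on 1 D f" "compact C" "C \<subseteq> D" "\<epsilon> > 0"
  obtains d where "d > 0"
    "\<And>z y. z \<in> C \<Longrightarrow> norm y < d \<Longrightarrow>
      norm (f (z + y) - f z - frechet_derivative f (at z) y) \<le> \<epsilon> * norm y"
proof -
  define D' where "D' z v = frechet_derivative f (at z) v" for z v
  have der: "(f has_derivative D' z) (at z)" if "z \<in> D" for z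
    using assms(2) that frechet_derivative_works unfolding D'_def by auto
  define \<eta> where "\<eta> = \<epsilon> / DIM('a)"
  have \<eta>: "\<eta> > 0" using assms(5) by (simp add: \<eta>_def)
  have cont: "continuous_on D (\<lambda>z. D' z b)" for b
    using assms(2) unfolding D'_def by simp
  have "\<exists>d>0. \<forall>z y. z \<in> C \<longrightarrow> norm y < d \<longrightarrow> z + y \<in> D \<and> dist (D' (z + y) b) (D' z b) \<le> \<eta>" for b
    by (rule continuous_uniform_on_compact[OF assms(1) cont assms(3,4) \<eta>, of b]) blast
  then obtain d0 where d0: "\<And>b. d0 b > 0"
    "\<And>b z y. z \<in> C \<Longrightarrow> norm y < d0 b \<Longrightarrow> z + y \<in> D \<and> dist (D' (z + y) b) (D' z b) \<le> \<eta>"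
    by metis
  define d where "d = Min (d0 ` (Basis :: 'a set))"
  have d: "d > 0" "\<And>b. b \<in> Basis \<Longrightarrow> d \<le> d0 b"
    using d0(1) by (auto simp: d_def)
  show ?thesis
  proof (rule that[OF d(1)])
    fix z y :: 'a assume z: "z \<in> C" and y: "norm y < d"
    have near1: "z + v \<in> D \<and> norm (D' (z + v) b - D' z b) \<le> \<eta>"
      if "norm v < d" "b \<in> Basis" for v b
      using d0(2)[OF z, of v b] d(2)[OF that(2)] that(1) by (simp add: dist_norm)
    have near: "norm v < d \<Longrightarrow> z + v \<in> D"
      "norm v < d \<Longrightarrow> b \<in> Basis \<Longrightarrow> norm (D' (z + v) b - D' z b) \<le> \<eta>" for v b
      using near1[of v] SOME_Basis by blast+
    have lin: "linear (D' (z + v))" if "norm v < d" for v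
      using der[OF near(1)[OF that]] by (rule has_derivative_linear)
    have on: "onorm (\<lambda>w. D' (z + v) w - D' z w) \<le> \<epsilon>" if v: "norm v < d" for v
    proof (rule onorm_le)
      fix w :: 'a
      have expand: "D' (z + v') w = (\<Sum>b\<in>Basis. (w \<bullet> b) *\<^sub>R D' (z + v') b)" if "norm v' < d" for v'
        by (subst euclidean_representation[of w, symmetric])
          (simp add: linear_sum[OF lin[OF that]] linear_cmul[OF lin[OF that]] del: euclidean_representation)
      have "D' (z + v) w - D' z w = (\<Sum>b\<in>Basis. (w \<bullet> b) *\<^sub>R (D' (z + v) b - D' z b))"
        using expand[OF v] expand[of 0] d(1) by (simp add: sum_subtractf scaleR_diff_right)
      also have "norm \<dots> \<le> (\<Sum>b\<in>(Basis :: 'a set). norm w * \<eta>)"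
      proof (rule sum_norm_le)
        fix b :: 'a assume b: "b \<in> Basis"
        show "norm ((w \<bullet> b) *\<^sub>R (D' (z + v) b - D' z b)) \<le> norm w * \<eta>"
          unfolding norm_scaleR using near(2)[OF v b] Basis_le_norm[OF b, of w] \<eta>
          by (intro mult_mono) auto
      qed
      finally show "norm (D' (z + v) w - D' z w) \<le> \<epsilon> * norm w"
        by (simp add: \<eta>_def mult.commute)
    qed
    have "norm (f (z + y) - f z - D' z (z + y - z)) \<le> norm (z + y - z) * \<epsilon>"
    proof (rule differentiable_bound_linearization[of z "z + y" "(\<lambda>v. z + v) ` ball 0 d" f D' z \<epsilon>])
      show "z + t *\<^sub>R (z + y - z) \<in> (\<lambda>v. z + v) ` ball 0 d" if "t \<in> {0..1}" for t
      proof -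
        have "norm (t *\<^sub>R y) \<le> norm y" using that by (simp add: mult_left_le_one_le)
        then show ?thesis using y by (auto simp: dist_norm)
      qed
      show "(f has_derivative D' x) (at x within (\<lambda>v. z + v) ` ball 0 d)"
        if "x \<in> (\<lambda>v. z + v) ` ball 0 d" for x
      proof -
        from that obtain v where "x = z + v" "v \<in> ball 0 d" by (rule imageE)
        then have "x = z + v" "norm v < d" by simp_all
        then show ?thesis by (simp add: has_derivative_at_withinI[OF der[OF near(1)]])
      qed
      show "onorm (D' x - D' z) \<le> \<epsilon>" if "x \<in> (\<lambda>v. z + v) ` ball 0 d" for x
        using that on[of "x - z"] by (auto simp: dist_norm norm_minus_commute fun_diff_def)
      show "z \<in> (\<lambda>v. z + v) ` ball 0 d" using d(1) by (auto intro!: image_eqI[of _ _ 0])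
    qed
    then show "norm (f (z + y) - f z - frechet_derivative f (at z) y) \<le> \<epsilon> * norm y"
      by (simp add: D'_def mult.commute)
  qed
qed

text \<open>Made for solutions of equations with parameters: the derivatives in p come from
  linearisation, the one in t from the equation itself.\<close>

lemma Ck_SucI_partials_prod:
  fixes F :: "'p::euclidean_space \<times> real \<Rightarrow> 'b::real_normed_vector"
  assumes "open U"
    and "\<And>p t e. p \<in> U \<Longrightarrow> e \<in> Basis \<Longrightarrow>
      ((\<lambda>s. F (p + s *\<^sub>R e, t)) has_vector_derivative g e (p, t)) (at 0)"
    and "\<And>p t. p \<in> U \<Longrightarrow> ((\<lambda>s. F (p, s)) has_vector_derivative h (p, t)) (at t)"
    and "\<And>e. e \<in> Basis \<Longrightarrow> cont_differentiable_on n (U \<times> UNIV) (g e)"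
    and "cont_differentiable_on n (U \<times> UNIV) h"
  shows "cont_differentiable_on (Suc n) (U \<times> UNIV) F"
proof (rule Ck_SucI_partials[of _ _ "\<lambda>b. if snd b = 0 then g (fst b) else h"])
  show "open (U \<times> (UNIV :: real set))" using assms(1) by (simp add: open_Times)
next
  fix y b :: "'p \<times> real" assume y: "y \<in> U \<times> UNIV" and b: "b \<in> Basis"
  obtain p t where pt: "y = (p, t)" "p \<in> U" using y by auto
  from b consider e where "b = (e, 0)" "e \<in> Basis" | "b = (0, 1)"
    by (auto simp: Basis_prod_def)
  then show "((\<lambda>s. F (y + s *\<^sub>R b)) has_vector_derivative
      (if snd b = 0 then g (fst b) else h) y) (at 0)"
  proof cases
    case 1
    then show ?thesis using assms(2)[OF pt(2)] pt by simp
  next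
    case 2
    have "((\<lambda>s. t + s) has_vector_derivative 1) (at 0)"
      using has_vector_derivative_add[OF has_vector_derivative_const has_vector_derivative_id] by fastforce
    from vector_diff_chain_at[OF this, of "\<lambda>s. F (p, s)" "h (p, t)"]
    show ?thesis using assms(3)[OF pt(2), of t] 2 pt by (simp add: o_def)
  qed
next
  show "cont_differentiable_on n (U \<times> UNIV) (if snd b = 0 then g (fst b) else h)" if "b \<in> Basis" for b
    using that assms(4,5) by (auto simp: Basis_prod_def)
qed

text \<open>\<open>stable\<close> is the analytic input: two periodic functions whose defects in the
  equation differ by at most \<open>M\<close> are at distance at most \<open>K * M\<close>, with
  \<open>K\<close> uniform in p. Continuous dependence on p rests on it; differentiability will rest
  on its linearised form.\<close>

locale periodic_family =
  fixes P K :: real and U :: "'p::euclidean_space set" and B :: "complex set"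
    and f :: "('p \<times> real) \<times> complex \<Rightarrow> complex" and u :: "'p \<Rightarrow> real \<Rightarrow> complex"
  assumes P: "P > 0" and U: "open U" and B: "open B" and K: "K \<ge> 0"
    and u_periodic: "\<And>p. p \<in> U \<Longrightarrow> periodic P (u p)"
    and u_in: "\<And>p t. p \<in> U \<Longrightarrow> u p t \<in> B"
    and f_periodic: "\<And>p t w. p \<in> U \<Longrightarrow> w \<in> B \<Longrightarrow> f ((p, t + P), w) = f ((p, t), w)"
    and u_ode: "\<And>p t. p \<in> U \<Longrightarrow> (u p has_vector_derivative f ((p, t), u p t)) (at t)"
    and stable: "\<And>p v1 v1' v2 v2' M t. p \<in> U \<Longrightarrow> periodic P v1 \<Longrightarrow> periodic P v2 \<Longrightarrow>
      (\<And>t. v1 t \<in> B) \<Longrightarrow> (\<And>t. v2 t \<in> B) \<Longrightarrow>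
      (\<And>t. (v1 has_vector_derivative v1' t) (at t)) \<Longrightarrow>
      (\<And>t. (v2 has_vector_derivative v2' t) (at t)) \<Longrightarrow>
      (\<And>t. norm ((v1' t - f ((p, t), v1 t)) - (v2' t - f ((p, t), v2 t))) \<le> M) \<Longrightarrow>
      norm (v1 t - v2 t) \<le> K * M"
begin

abbreviation "D \<equiv> (U \<times> (UNIV :: real set)) \<times> B"

lemma open_D: "open D" and open_UR: "open (U \<times> (UNIV :: real set))"
  using U B by (auto simp: open_Times)

lemma u_cont_t: "p \<in> U \<Longrightarrow> continuous_on A (u p)"
  using has_vd_continuous[OF u_ode] continuous_on_subset by blast

text \<open>\<open>u p\<close> solves the equation at p' up to a defect that is small uniformly over
  one period, by compactness; \<open>stable\<close> converts the defect into a distance.\<close>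

lemma u_uniform:
  assumes f: "continuous_on D f" and p: "p \<in> U" and "\<epsilon> > 0"
  obtains X where "open X" "p \<in> X" "X \<subseteq> U" "\<And>p' t. p' \<in> X \<Longrightarrow> norm (u p' t - u p t) \<le> \<epsilon>"
proof -
  \<comment> \<open>Divided by \<open>K + 1\<close> because \<open>K\<close> may be zero.\<close>
  define \<eta> where "\<eta> = \<epsilon> / (K + 1)"
  have \<eta>: "\<eta> > 0" "K * \<eta> \<le> \<epsilon>" using assms(3) K by (auto simp: \<eta>_def field_simps)
  have "continuous_on (U \<times> {0..P}) (\<lambda>z. f (z, u p (snd z)))"
    by (rule continuous_on_compose2[OF f])
      (auto intro!: continuous_intros continuous_on_compose2[OF u_cont_t[OF p, of UNIV]] u_in p)
  from continuous_on_prod_compactE[OF this compact_Icc p \<eta>(1)]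
  obtain X0 where X0: "p \<in> X0" "open X0"
    "\<forall>p'\<in>X0 \<inter> U. \<forall>t\<in>{0..P}. dist (f ((p', t), u p (snd (p', t)))) (f ((p, t), u p (snd (p, t)))) \<le> \<eta>"
    by blast
  show ?thesis
  proof (rule that[of "X0 \<inter> U"])
    fix p' t assume p': "p' \<in> X0 \<inter> U"
    have near: "norm (f ((p', t), u p t) - f ((p, t), u p t)) \<le> \<eta>" for t
    proof -
      obtain s j where s: "s \<in> {0..P}" "t = s + of_int j * P" by (rule period_reduce[OF P])
      have "periodic P (\<lambda>t. f ((p', t), u p t) - f ((p, t), u p t))"
        using p p' u_periodic[OF p] f_periodic u_in[OF p] by (simp add: periodic_def)
      from periodic_of_int[OF this, of s j] show ?thesis
        using X0(3) p' s by (auto simp: dist_norm)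
    qed
    have "norm (u p' t - u p t) \<le> K * \<eta>"
    proof (rule stable)
      show "norm ((f ((p', t), u p' t) - f ((p', t), u p' t)) -
          (f ((p, t), u p t) - f ((p', t), u p t))) \<le> \<eta>" for t
        using near[of t] by simp
    qed (use p p' u_periodic u_in u_ode in auto)
    then show "norm (u p' t - u p t) \<le> \<epsilon>" using \<eta> by linarith
  qed (use X0 U p in auto)
qed

lemma u_continuous:
  assumes f: "continuous_on D f"
  shows "continuous_on (U \<times> UNIV) (\<lambda>(p, t). u p t)"
proof (rule continuous_at_imp_continuous_on, clarify)
  fix p and t :: real assume p: "p \<in> U"
  show "isCont (\<lambda>(p, t). u p t) (p, t)"
    unfolding continuous_at_eps_delta
  proof (intro allI impI)
    fix e :: real assume e: "e > 0"
    then obtain X where X: "open X" "p \<in> X" "X \<subseteq> U" "\<And>p' t. p' \<in> X \<Longrightarrow> norm (u p' t - u p t) \<le> e / 3"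
      using u_uniform[OF f p, of "e/3"] by auto
    have "isCont (u p) t" using u_cont_t[OF p, of UNIV] by (simp add: continuous_on_eq_continuous_at)
    then obtain d where d: "d > 0" "\<And>s. dist s t < d \<Longrightarrow> dist (u p s) (u p t) < e / 3"
      using e unfolding continuous_at_eps_delta by (metis divide_pos_pos zero_less_numeral)
    obtain r where r: "r > 0" "ball p r \<subseteq> X" using X openE by blast
    have "dist (u (fst z) (snd z)) (u p t) < e" if z: "dist z (p, t) < min r d" for z
    proof -
      have "dist (fst z) p < r" "dist (snd z) t < d"
        using z dist_fst_le[of z "(p,t)"] dist_snd_le[of z "(p,t)"] by auto
      then have "norm (u (fst z) (snd z) - u p (snd z)) \<le> e / 3"
        using X(4)[of "fst z" "snd z"] r(2) by (auto simp: dist_commute)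
      moreover have "dist (u p (snd z)) (u p t) < e / 3" by (rule d(2)) fact
      ultimately
      show ?thesis
        using dist_triangle[of "u (fst z) (snd z)" "u p t" "u p (snd z)"] e by (simp add: dist_norm)
    qed
    then show "\<exists>d>0. \<forall>x'. dist x' (p, t) < d \<longrightarrow>
        dist (case x' of (p, t) \<Rightarrow> u p t) (case (p, t) of (p, t) \<Rightarrow> u p t) < e"
      using r d by (intro exI[of _ "min r d"]) (auto simp: split_beta)
  qed
qed

text \<open>The difference quotients \<open>v h\<close> satisfy the linearised equation with an
  error controlled by \<open>remainder\<close>. The linear estimate \<open>lin\<close> first bounds
  them, then makes them Cauchy as h tends to 0, uniformly in t; the limit solves the linearised
  equation.\<close>

lemma directional_derivative:
  assumes f1: "cont_differentiable_on 1 D f" and p: "p \<in> U"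
    and lin: "\<And>v v' M t. periodic P v \<Longrightarrow> (\<And>t. (v has_vector_derivative v' t) (at t)) \<Longrightarrow>
      (\<And>t. norm (v' t - frechet_derivative f (at ((p, t), u p t)) ((0, 0), v t)) \<le> M) \<Longrightarrow>
      norm (v t) \<le> K * M"
  obtains g where "periodic P g"
    "\<And>t. ((\<lambda>s. u (p + s *\<^sub>R e) t) has_vector_derivative g t) (at 0)"
    "\<And>t. (g has_vector_derivative frechet_derivative f (at ((p, t), u p t)) ((e, 0), g t)) (at t)"
proof -
  define z where "z t = ((p, t), u p t)" for t
  define A where "A t = frechet_derivative f (at (z t))" for t
  have fc: "continuous_on D f" using Ck_continuous[OF f1] .
  have zD: "z t \<in> D" for t using p u_in by (simp add: z_def)
  have z_cont: "continuous_on S z" for S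
    unfolding z_def by (intro continuous_on_Pair continuous_on_const continuous_on_id u_cont_t p)
  have der: "(f has_derivative A t) (at (z t))" for t
    unfolding A_def frechet_derivative_works[symmetric]
    by (rule bspec[OF conjunct1[OF f1[unfolded One_nat_def cont_differentiable_on.simps(2)]] zD])
  interpret A: linear "A t" for t using der by (rule has_derivative_linear)
  have A_periodic: "A (t + P) = A t" for t
  proof -
    have eq: "z (t + P) = z t + ((0, P), 0)"
      using u_periodic[OF p] by (simp add: z_def periodic_def)
    have "f differentiable (at (z t + ((0, P), 0)))"
      using der[of "t + P"] unfolding eq by (rule differentiableI)
    from frechet_derivative_shift[OF open_D zD _ this] show ?thesis
      unfolding A_def eq by (force simp: f_periodic)
  qed
  have A_bound: "\<exists>F\<ge>0. \<forall>t. norm (A t y) \<le> F" for y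
  proof -
    have "continuous_on D (\<lambda>z. frechet_derivative f (at z) y)" using f1 by (cases y) auto
    then have "continuous_on UNIV (\<lambda>t. A t y)"
      unfolding A_def by (rule continuous_on_compose2[OF _ z_cont]) (use zD in blast)
    moreover have "periodic P (\<lambda>t. A t y)" by (simp add: periodic_def A_periodic)
    ultimately obtain s where "\<And>t. norm (A t y) \<le> norm (A s y)"
      using periodic_bounded[OF P] by blast
    then show ?thesis using norm_ge_zero by blast
  qed
  obtain F where F: "F \<ge> 0" "\<And>t. norm (A t ((e, 0), 0)) \<le> F" using A_bound by metis
  \<comment> \<open>\<open>A t\<close> is only real-linear in the complex variable, so the
    directions 1 and \<i> are bounded separately.\<close>
  obtain F1 where F1: "F1 \<ge> 0" "\<And>t. norm (A t ((0, 0), 1)) \<le> F1" using A_bound by metis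
  obtain F2 where F2: "F2 \<ge> 0" "\<And>t. norm (A t ((0, 0), \<i>)) \<le> F2" using A_bound by metis
  have A_w: "norm (A t ((0, 0), y)) \<le> (F1 + F2) * norm y" for t y
  proof -
    have "((0, 0), y) = Re y *\<^sub>R ((0, 0), 1) + Im y *\<^sub>R ((0 :: 'p, 0 :: real), \<i>)"
      by (simp add: complex_eq_iff)
    then have "A t ((0, 0), y) = Re y *\<^sub>R A t ((0, 0), 1) + Im y *\<^sub>R A t ((0, 0), \<i>)"
      by (metis A.add A.scale)
    also have "norm \<dots> \<le> norm y * F1 + norm y * F2"
      using F1 F2 abs_Re_le_cmod[of y] abs_Im_le_cmod[of y]
      by (intro order_trans[OF norm_triangle_ineq] add_mono) (auto intro!: mult_mono)
    finally show ?thesis by (simp add: algebra_simps)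
  qed
  have A_split: "A t ((e, 0), y) = A t ((e, 0), 0) + A t ((0, 0), y)" for t y
    using A.add[of t "((e, 0), 0)" "((0, 0), y)"] by simp
  define w where "w h t = u (p + h *\<^sub>R e) t - u p t" for h t
  \<comment> \<open>Uniform differentiability along the compact image of one period under
    \<open>z\<close>; \<open>u_uniform\<close> brings the increment below the radius
    \<open>d1\<close>, and periodicity extends the bound to all t.\<close>
  have remainder: "\<exists>d>0. \<forall>h. \<bar>h\<bar> < d \<longrightarrow> p + h *\<^sub>R e \<in> U \<and>
      (\<forall>t. norm (f ((p + h *\<^sub>R e, t), u (p + h *\<^sub>R e) t) - f (z t) - A t ((h *\<^sub>R e, 0), w h t))
        \<le> \<epsilon> * (\<bar>h\<bar> * norm e + norm (w h t)))" if \<epsilon>: "\<epsilon> > 0" for \<epsilon>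
  proof -
    obtain d1 where d1: "d1 > 0" "\<And>x y. x \<in> z ` {0..P} \<Longrightarrow> norm y < d1 \<Longrightarrow>
        norm (f (x + y) - f x - frechet_derivative f (at x) y) \<le> \<epsilon> * norm y"
      using uniformly_differentiable[OF open_D f1 compact_continuous_image[OF z_cont compact_Icc] _ \<epsilon>, of 0 P]
        zD by blast
    obtain X where X: "open X" "p \<in> X" "X \<subseteq> U" "\<And>p' t. p' \<in> X \<Longrightarrow> norm (u p' t - u p t) \<le> d1 / 2"
      using u_uniform[OF fc p, of "d1/2"] d1(1) by auto
    obtain r where r: "r > 0" "ball p r \<subseteq> X" using X openE by blast
    define d where "d = min r (d1 / 2) / (norm e + 1)"
    have ne: "norm e + 1 > 0" using norm_ge_zero[of e] by linarith
    have d: "d > 0" using r d1 ne by (simp add: d_def)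
    show ?thesis
    proof (intro exI[of _ d] conjI allI impI d)
      fix h :: real assume "\<bar>h\<bar> < d"
      then have "\<bar>h\<bar> * (norm e + 1) < min r (d1 / 2)"
        using ne by (simp add: d_def pos_less_divide_eq)
      then have h: "\<bar>h\<bar> * norm e < r" "\<bar>h\<bar> * norm e < d1 / 2"
      proof -
        have "\<bar>h\<bar> * norm e \<le> \<bar>h\<bar> * (norm e + 1)" by (intro mult_left_mono) auto
        then show "\<bar>h\<bar> * norm e < r" "\<bar>h\<bar> * norm e < d1 / 2"
          using \<open>\<bar>h\<bar> * (norm e + 1) < min r (d1 / 2)\<close> by linarith+
      qed
      then have hX: "p + h *\<^sub>R e \<in> X" using r(2) by (auto simp: dist_norm)
      then show hU: "p + h *\<^sub>R e \<in> U" using X by auto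
      define \<rho> where "\<rho> t = f ((p + h *\<^sub>R e, t), u (p + h *\<^sub>R e) t) - f (z t) - A t ((h *\<^sub>R e, 0), w h t)" for t
      have w_periodic: "w h (t + P) = w h t" for t
        using u_periodic[OF p] u_periodic[OF hU] by (simp add: w_def periodic_def)
      have \<rho>_periodic: "periodic P \<rho>"
        using u_periodic[OF p] u_periodic[OF hU] f_periodic[OF p] f_periodic[OF hU] u_in[OF p] u_in[OF hU]
        by (simp add: periodic_def \<rho>_def A_periodic z_def w_periodic)
      have "norm (\<rho> s) \<le> \<epsilon> * (\<bar>h\<bar> * norm e + norm (w h s))" if s: "s \<in> {0..P}" for s
      proof -
        let ?y = "((h *\<^sub>R e, 0), w h s) :: ('p \<times> real) \<times> complex"
        have ny: "norm ?y \<le> \<bar>h\<bar> * norm e + norm (w h s)"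
          using norm_Pair_le[of "(h *\<^sub>R e, 0 :: real)" "w h s"] norm_Pair_le[of "h *\<^sub>R e" "0 :: real"] by simp
        also have "\<dots> < d1" using X(4)[OF hX, of s] h by (simp add: w_def)
        finally have "norm (f (z s + ?y) - f (z s) - A s ?y) \<le> \<epsilon> * norm ?y"
          using d1(2) s unfolding A_def by blast
        also have "z s + ?y = ((p + h *\<^sub>R e, s), u (p + h *\<^sub>R e) s)"
          by (simp add: z_def w_def)
        finally show ?thesis
          unfolding \<rho>_def using mult_left_mono[OF ny less_imp_le[OF \<epsilon>]] by (rule order_trans)
      qed
      moreover have "\<exists>s\<in>{0..P}. \<rho> t = \<rho> s \<and> w h t = w h s" for t
        by (rule period_reduce[OF P, of t])
          (use periodic_of_int[OF \<rho>_periodic] periodic_of_int[of P "w h"] w_periodic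
            in \<open>auto simp: periodic_def\<close>)
      ultimately show "norm (f ((p + h *\<^sub>R e, t), u (p + h *\<^sub>R e) t) - f (z t) - A t ((h *\<^sub>R e, 0), w h t))
          \<le> \<epsilon> * (\<bar>h\<bar> * norm e + norm (w h t))" for t
        unfolding \<rho>_def[symmetric] by metis
    qed
  qed
  define v where "v h t = w h t /\<^sub>R h" for h t
  define v' where "v' h t = (f ((p + h *\<^sub>R e, t), u (p + h *\<^sub>R e) t) - f (z t)) /\<^sub>R h" for h t
  have v_der: "(v h has_vector_derivative v' h t) (at t)" if "p + h *\<^sub>R e \<in> U" for h t
    unfolding v_def v'_def w_def z_def
    by (intro has_vector_derivative_diff bounded_linear.has_vector_derivative[OF bounded_linear_scaleR_right] u_ode p that)
  have v_periodic: "periodic P (v h)" if "p + h *\<^sub>R e \<in> U" for h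
    using u_periodic[OF p] u_periodic[OF that] by (simp add: periodic_def v_def w_def)
  have quot: "\<exists>d>0. \<forall>h. h \<noteq> 0 \<longrightarrow> \<bar>h\<bar> < d \<longrightarrow> p + h *\<^sub>R e \<in> U \<and>
      (\<forall>t. norm (v' h t - A t ((e, 0), v h t)) \<le> \<epsilon> * (norm e + norm (v h t)))" if \<epsilon>: "\<epsilon> > 0" for \<epsilon>
  proof -
    obtain d where d: "d > 0" "\<And>h. \<bar>h\<bar> < d \<Longrightarrow> p + h *\<^sub>R e \<in> U"
      "\<And>h t. \<bar>h\<bar> < d \<Longrightarrow> norm (f ((p + h *\<^sub>R e, t), u (p + h *\<^sub>R e) t) - f (z t) - A t ((h *\<^sub>R e, 0), w h t))
        \<le> \<epsilon> * (\<bar>h\<bar> * norm e + norm (w h t))"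
      using remainder[OF \<epsilon>] by blast
    have "norm (v' h t - A t ((e, 0), v h t)) \<le> \<epsilon> * (norm e + norm (v h t))" if h: "h \<noteq> 0" "\<bar>h\<bar> < d" for h t
    proof -
      have "((e, 0 :: real), v h t) = ((h *\<^sub>R e, 0), w h t) /\<^sub>R h" using h by (simp add: v_def)
      then have "A t ((e, 0), v h t) = A t ((h *\<^sub>R e, 0), w h t) /\<^sub>R h"
        by (simp only: A.scale)
      then have "v' h t - A t ((e, 0), v h t) =
          (f ((p + h *\<^sub>R e, t), u (p + h *\<^sub>R e) t) - f (z t) - A t ((h *\<^sub>R e, 0), w h t)) /\<^sub>R h"
        by (simp only: v'_def scaleR_diff_right)
      also have "norm \<dots> \<le> \<epsilon> * (\<bar>h\<bar> * norm e + norm (w h t)) / \<bar>h\<bar>"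
        using d(3)[OF h(2), of t] h(1) by (simp add: divide_simps)
      also have "\<dots> = \<epsilon> * (norm e + norm (v h t))"
        using h(1) by (simp add: v_def field_simps)
      finally show ?thesis .
    qed
    then show ?thesis using d by blast
  qed
  \<comment> \<open>The outcome of an absorption: with K \<epsilon> \<le> 1/2 the maximum of
    \<open>v h\<close> is at most K F plus half of norm e and half of itself.\<close>
  define m where "m = 2 * K * F + norm e"
  have m: "m \<ge> 0" using K F by (simp add: m_def)
  have bound: "\<exists>d>0. \<forall>h. h \<noteq> 0 \<longrightarrow> \<bar>h\<bar> < d \<longrightarrow> (\<forall>t. norm (v h t) \<le> m)"
  proof -
    define \<epsilon> where "\<epsilon> = 1 / (2 * (K + 1))"
    have \<epsilon>: "\<epsilon> > 0" "K * \<epsilon> \<le> 1 / 2" using K by (auto simp: \<epsilon>_def field_simps)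
    obtain d where d: "d > 0" "\<And>h. h \<noteq> 0 \<Longrightarrow> \<bar>h\<bar> < d \<Longrightarrow> p + h *\<^sub>R e \<in> U"
      "\<And>h t. h \<noteq> 0 \<Longrightarrow> \<bar>h\<bar> < d \<Longrightarrow> norm (v' h t - A t ((e, 0), v h t)) \<le> \<epsilon> * (norm e + norm (v h t))"
      using quot[OF \<epsilon>(1)] by blast
    have "norm (v h t) \<le> m" if h: "h \<noteq> 0" "\<bar>h\<bar> < d" for h t
    proof -
      note hU = d(2)[OF h]
      \<comment> \<open>Absorption requires a finite supremum; it is attained because
        \<open>v h\<close> is periodic and continuous.\<close>
      obtain s where s: "\<And>t. norm (v h t) \<le> norm (v h s)"
        using periodic_bounded[OF P v_periodic[OF hU] has_vd_continuous[OF v_der[OF hU]]] by blast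
      have "norm (v h s) \<le> K * (F + \<epsilon> * (norm e + norm (v h s)))"
      proof (rule lin[OF v_periodic[OF hU] v_der[OF hU]])
        fix t
        have "v' h t - A t ((0, 0), v h t) = (v' h t - A t ((e, 0), v h t)) + A t ((e, 0), 0)"
          by (simp add: A_split[of t "v h t"])
        also have "norm \<dots> \<le> \<epsilon> * (norm e + norm (v h t)) + F"
          using d(3)[OF h, of t] F(2)[of t] by (intro order_trans[OF norm_triangle_ineq] add_mono)
        also have "\<dots> \<le> \<epsilon> * (norm e + norm (v h s)) + F"
          using s[of t] \<epsilon>(1) by simp
        finally show "norm (v' h t - frechet_derivative f (at ((p, t), u p t)) ((0, 0), v h t))
            \<le> F + \<epsilon> * (norm e + norm (v h s))" by (simp add: A_def z_def)
      qed
      also have "\<dots> = K * F + (K * \<epsilon>) * (norm e + norm (v h s))" by (simp add: algebra_simps)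
      also have "\<dots> \<le> K * F + (1 / 2) * (norm e + norm (v h s))"
        using \<epsilon>(2) by (intro add_left_mono mult_right_mono) auto
      finally have "norm (v h s) \<le> m" by (simp add: m_def field_simps)
      then show ?thesis using s[of t] by linarith
    qed
    then show ?thesis using d(1) by blast
  qed
  \<comment> \<open>The difference of two quotients satisfies the homogeneous linearised equation up
    to the two errors, because the inhomogeneity from direction \<open>e\<close> is common to both
    and cancels.\<close>
  have cauchy: "\<exists>d>0. \<forall>h h'. h \<noteq> 0 \<longrightarrow> \<bar>h\<bar> < d \<longrightarrow> h' \<noteq> 0 \<longrightarrow> \<bar>h'\<bar> < d \<longrightarrow>
      p + h *\<^sub>R e \<in> U \<and>
      (\<forall>t. norm (v h t - v h' t) \<le> \<eta> \<and> norm (v' h t - A t ((e, 0), v h t)) \<le> \<eta>)" if \<eta>: "\<eta> > 0" for \<eta>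
  proof -
    define X where "X = 2 * (K + 1) * (norm e + m + 1)"
    define \<epsilon> where "\<epsilon> = \<eta> / X"
    have pos: "X > 0" using K m by (simp add: X_def add_nonneg_pos)
    have \<epsilon>: "\<epsilon> > 0" using \<eta> pos by (simp add: \<epsilon>_def)
    have eq: "\<epsilon> * X = \<eta>" using pos by (simp add: \<epsilon>_def)
    have small: "K * (2 * \<epsilon> * (norm e + m)) \<le> \<eta>" "\<epsilon> * (norm e + m) \<le> \<eta>"
    proof -
      have "0 \<le> \<epsilon> * K" "0 \<le> \<epsilon> * (norm e + m)" "0 \<le> \<epsilon> * K * (norm e + m)" using \<epsilon> K m by auto
      moreover have "\<eta> = 2 * (\<epsilon> * K * (norm e + m)) + 2 * (\<epsilon> * K) + 2 * (\<epsilon> * (norm e + m)) + 2 * \<epsilon>"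
        unfolding eq[symmetric] X_def by (simp add: algebra_simps)
      ultimately show "K * (2 * \<epsilon> * (norm e + m)) \<le> \<eta>" "\<epsilon> * (norm e + m) \<le> \<eta>"
        using \<epsilon> by (auto simp: algebra_simps)
    qed
    obtain d1 where d1: "d1 > 0" "\<And>h t. h \<noteq> 0 \<Longrightarrow> \<bar>h\<bar> < d1 \<Longrightarrow> norm (v h t) \<le> m"
      using bound by blast
    obtain d2 where d2: "d2 > 0" "\<And>h. h \<noteq> 0 \<Longrightarrow> \<bar>h\<bar> < d2 \<Longrightarrow> p + h *\<^sub>R e \<in> U"
      "\<And>h t. h \<noteq> 0 \<Longrightarrow> \<bar>h\<bar> < d2 \<Longrightarrow> norm (v' h t - A t ((e, 0), v h t)) \<le> \<epsilon> * (norm e + norm (v h t))"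
      using quot[OF \<epsilon>] by blast
    have rem: "norm (v' h t - A t ((e, 0), v h t)) \<le> \<epsilon> * (norm e + m)"
      if "h \<noteq> 0" "\<bar>h\<bar> < min d1 d2" for h t
    proof -
      have "norm (v' h t - A t ((e, 0), v h t)) \<le> \<epsilon> * (norm e + norm (v h t))"
        by (rule d2(3)) (use that in auto)
      also have "\<dots> \<le> \<epsilon> * (norm e + m)" using d1(2)[of h t] that \<epsilon> by simp
      finally show ?thesis .
    qed
    have C1: "norm (v h t - v h' t) \<le> \<eta>"
      if h: "h \<noteq> 0" "\<bar>h\<bar> < min d1 d2" and h': "h' \<noteq> 0" "\<bar>h'\<bar> < min d1 d2" for h h' t
    proof -
      have hU: "p + h *\<^sub>R e \<in> U" "p + h' *\<^sub>R e \<in> U" using d2(2) h h' by auto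
      have "norm (v h t - v h' t) \<le> K * (2 * \<epsilon> * (norm e + m))"
      proof (rule lin)
        show "periodic P (\<lambda>t. v h t - v h' t)"
          using v_periodic[OF hU(1)] v_periodic[OF hU(2)] by (simp add: periodic_def)
        show "((\<lambda>t. v h t - v h' t) has_vector_derivative v' h t - v' h' t) (at t)" for t
          by (intro has_vector_derivative_diff v_der hU)
        fix t
        have "A t ((0, 0), v h t - v h' t) = A t ((e, 0), v h t) - A t ((e, 0), v h' t)"
          using A.diff[of t "((e, 0), v h t)" "((e, 0), v h' t)"] by (simp add: zero_prod_def)
        then have "v' h t - v' h' t - A t ((0, 0), v h t - v h' t) =
            (v' h t - A t ((e, 0), v h t)) - (v' h' t - A t ((e, 0), v h' t))" by simp
        also have "norm \<dots> \<le> \<epsilon> * (norm e + m) + \<epsilon> * (norm e + m)"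
          by (intro order_trans[OF norm_triangle_ineq4] add_mono rem h h')
        finally show "norm (v' h t - v' h' t - frechet_derivative f (at ((p, t), u p t)) ((0, 0), v h t - v h' t))
            \<le> 2 * \<epsilon> * (norm e + m)" by (simp add: A_def z_def)
      qed
      then show ?thesis using small(1) by linarith
    qed
    have C2: "norm (v' h t - A t ((e, 0), v h t)) \<le> \<eta>" if "h \<noteq> 0" "\<bar>h\<bar> < min d1 d2" for h t
      using rem[OF that, of t] small(2) by linarith
    show ?thesis
    proof (intro exI[of _ "min d1 d2"] conjI allI impI)
      show "min d1 d2 > 0" using d1(1) d2(1) by simp
      show "p + h *\<^sub>R e \<in> U" if "h \<noteq> 0" "\<bar>h\<bar> < min d1 d2" for h
        by (rule d2(2)) (use that in auto)
    qed (rule C1 C2; assumption)+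
  qed
  define H where "H n = 1 / real (Suc n)" for n
  have H: "H n \<noteq> 0" "\<bar>H n\<bar> = H n" for n by (auto simp: H_def)
  have H_small: "\<exists>N. \<forall>n\<ge>N. H n < d" if d: "d > 0" for d
  proof -
    obtain N where "inverse (real (Suc N)) < d" using reals_Archimedean[OF d] by blast
    moreover have "H n \<le> inverse (real (Suc N))" if "n \<ge> N" for n
      using that by (simp add: H_def inverse_eq_divide frac_le)
    ultimately show ?thesis by (meson le_less_trans)
  qed
  have "convergent (\<lambda>n. v (H n) t)" for t
    unfolding Cauchy_convergent_iff[symmetric]
  proof (rule CauchyI)
    fix \<eta> :: real assume "\<eta> > 0"
    obtain d where d: "d > 0" "\<And>h h'. h \<noteq> 0 \<Longrightarrow> \<bar>h\<bar> < d \<Longrightarrow> h' \<noteq> 0 \<Longrightarrow> \<bar>h'\<bar> < d \<Longrightarrow>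
        norm (v h t - v h' t) \<le> \<eta> / 2"
      using cauchy[OF half_gt_zero[OF \<open>\<eta> > 0\<close>]] by blast
    obtain N where "\<And>n. n \<ge> N \<Longrightarrow> H n < d" using H_small[OF d(1)] by blast
    then have close: "norm (v (H i) t - v (H j) t) \<le> \<eta> / 2" if "i \<ge> N" "j \<ge> N" for i j
      using that by (intro d(2)) (auto simp: H)
    then show "\<exists>M. \<forall>m\<ge>M. \<forall>n\<ge>M. norm (v (H m) t - v (H n) t) < \<eta>"
    proof (intro exI[of _ N] allI impI)
      show "norm (v (H i) t - v (H j) t) < \<eta>" if "N \<le> i" "N \<le> j" for i j
        using close[OF that] \<open>\<eta> > 0\<close> by linarith
    qed
  qed
  then obtain g where g: "\<And>t. (\<lambda>n. v (H n) t) \<longlonglongrightarrow> g t"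
    unfolding convergent_def by metis
  have limit: "\<exists>d>0. \<forall>h. h \<noteq> 0 \<longrightarrow> \<bar>h\<bar> < d \<longrightarrow> p + h *\<^sub>R e \<in> U \<and>
      (\<forall>t. norm (v h t - g t) \<le> \<eta> \<and> norm (v' h t - A t ((e, 0), v h t)) \<le> \<eta>)" if \<eta>: "\<eta> > 0" for \<eta>
  proof -
    obtain d where d: "d > 0" "\<And>h h' t. h \<noteq> 0 \<Longrightarrow> \<bar>h\<bar> < d \<Longrightarrow> h' \<noteq> 0 \<Longrightarrow> \<bar>h'\<bar> < d \<Longrightarrow>
       p + h *\<^sub>R e \<in> U \<and> norm (v h t - v h' t) \<le> \<eta> \<and> norm (v' h t - A t ((e, 0), v h t)) \<le> \<eta>"
      using cauchy[OF \<eta>] by blast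
    obtain N where N: "\<And>n. n \<ge> N \<Longrightarrow> H n < d" using H_small[OF d(1)] by blast
    have "norm (v h t - g t) \<le> \<eta>" if "h \<noteq> 0" "\<bar>h\<bar> < d" for h t
    proof (rule LIMSEQ_le_const2)
      show "(\<lambda>n. norm (v h t - v (H n) t)) \<longlonglongrightarrow> norm (v h t - g t)"
        by (intro tendsto_norm tendsto_diff tendsto_const g)
      show "\<exists>N. \<forall>n\<ge>N. norm (v h t - v (H n) t) \<le> \<eta>"
        using d(2)[OF that] N H by metis
    qed
    then show ?thesis using d by blast
  qed
  have g_periodic: "periodic P g"
    unfolding periodic_def
  proof
    fix t
    obtain d where d: "d > 0" "\<And>h. h \<noteq> 0 \<Longrightarrow> \<bar>h\<bar> < d \<Longrightarrow> p + h *\<^sub>R e \<in> U"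
      using limit[of 1] by auto
    obtain N where "\<And>n. n \<ge> N \<Longrightarrow> H n < d" using H_small[OF d(1)] by blast
    then have "\<forall>\<^sub>F n in sequentially. v (H n) (t + P) = v (H n) t"
      unfolding eventually_sequentially
      using v_periodic[unfolded periodic_def] d(2) H by (intro exI[of _ N]) simp
    from iffD1[OF tendsto_cong[OF this] g[of "t + P"]]
    show "g (t + P) = g t" using g[of t] by (rule LIMSEQ_unique)
  qed
  have partial: "((\<lambda>s. u (p + s *\<^sub>R e) t) has_vector_derivative g t) (at 0)" for t
    unfolding has_vector_derivative_def has_derivative_at_alt
  proof (intro conjI allI impI bounded_linear_scaleR_left)
    fix \<eta> :: real assume "\<eta> > 0"
    then obtain d where d: "d > 0" "\<And>h. h \<noteq> 0 \<Longrightarrow> \<bar>h\<bar> < d \<Longrightarrow> norm (v h t - g t) \<le> \<eta>"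
      using limit by blast
    have "norm (u (p + y *\<^sub>R e) t - u p t - y *\<^sub>R g t) \<le> \<eta> * \<bar>y\<bar>" if "\<bar>y\<bar> < d" for y
    proof (cases "y = 0")
      case False
      then have "u (p + y *\<^sub>R e) t - u p t - y *\<^sub>R g t = y *\<^sub>R (v y t - g t)"
        by (simp add: v_def w_def scaleR_diff_right)
      then show ?thesis using d(2)[OF False that] by (simp add: mult.commute[of \<eta>] mult_left_mono)
    qed simp
    then show "\<exists>d>0. \<forall>y. norm (y - 0) < d \<longrightarrow>
        norm (u (p + y *\<^sub>R e) t - u (p + 0 *\<^sub>R e) t - (y - 0) *\<^sub>R g t) \<le> \<eta> * norm (y - 0)"
      using d(1) by auto
  qed
  \<comment> \<open>The time derivatives converge uniformly in t along \<open>H n\<close>, so the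
    limit may be differentiated termwise.\<close>
  have g_ode: "(g has_vector_derivative A t ((e, 0), g t)) (at t)" for t
  proof -
    obtain d0 where d0: "d0 > 0" "\<And>h. h \<noteq> 0 \<Longrightarrow> \<bar>h\<bar> < d0 \<Longrightarrow> p + h *\<^sub>R e \<in> U"
      using limit[of 1] by auto
    obtain N where N: "\<And>n. n \<ge> N \<Longrightarrow> H n < d0" using H_small[OF d0(1)] by blast
    have "\<exists>g2. \<forall>t\<in>UNIV. (\<lambda>n. v (H (n + N)) t) \<longlonglongrightarrow> g2 t \<and>
        (g2 has_derivative (\<lambda>h. h *\<^sub>R A t ((e, 0), g t))) (at t within UNIV)"
    proof (rule has_derivative_sequence)
      fix n and t :: real
      have "(v (H (n + N)) has_vector_derivative v' (H (n + N)) t) (at t)"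
        by (rule v_der, rule d0) (use N[of "n + N"] H in auto)
      then show "(v (H (n + N)) has_derivative (\<lambda>h. h *\<^sub>R v' (H (n + N)) t)) (at t within UNIV)"
        by (simp add: has_vector_derivative_def)
    next
      fix \<eta>' :: real assume "\<eta>' > 0"
      define \<eta> where "\<eta> = \<eta>' / (1 + F1 + F2)"
      have pos: "1 + F1 + F2 > 0" using F1 F2 by linarith
      have "\<eta> * (1 + F1 + F2) = \<eta>'" using pos by (simp add: \<eta>_def)
      then have "\<eta> + (F1 + F2) * \<eta> = \<eta>'" by (simp add: algebra_simps)
      moreover have "\<eta> > 0" using \<open>\<eta>' > 0\<close> pos by (simp add: \<eta>_def)
      ultimately have \<eta>: "\<eta> > 0" "\<eta> + (F1 + F2) * \<eta> = \<eta>'" by blast+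
      obtain d where d: "d > 0" "\<And>h t. h \<noteq> 0 \<Longrightarrow> \<bar>h\<bar> < d \<Longrightarrow>
          norm (v h t - g t) \<le> \<eta> \<and> norm (v' h t - A t ((e, 0), v h t)) \<le> \<eta>"
        using limit[OF \<eta>(1)] by blast
      obtain N' where N': "\<And>n. n \<ge> N' \<Longrightarrow> H n < d" using H_small[OF d(1)] by blast
      have close: "norm (v' h t - A t ((e, 0), g t)) \<le> \<eta>'" if "h \<noteq> 0" "\<bar>h\<bar> < d" for h t
      proof -
        have "A t ((0, 0), v h t - g t) = A t ((e, 0), v h t) - A t ((e, 0), g t)"
          using A.diff[of t "((e, 0), v h t)" "((e, 0), g t)"] by (simp add: zero_prod_def)
        then have "v' h t - A t ((e, 0), g t) = (v' h t - A t ((e, 0), v h t)) + A t ((0, 0), v h t - g t)"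
          by simp
        also have "norm \<dots> \<le> \<eta> + (F1 + F2) * \<eta>"
          using d(2)[OF that, of t] F1 F2
          by (intro order_trans[OF norm_triangle_ineq] add_mono order_trans[OF A_w] mult_left_mono) auto
        finally show ?thesis using \<eta>(2) by simp
      qed
      show "\<forall>\<^sub>F n in sequentially. \<forall>t\<in>UNIV. \<forall>h.
          norm (h *\<^sub>R v' (H (n + N)) t - h *\<^sub>R A t ((e, 0), g t)) \<le> \<eta>' * norm h"
        unfolding eventually_sequentially
      proof (intro exI[of _ N'] allI impI ballI)
        fix n t and h :: real assume "N' \<le> n"
        then have "norm (v' (H (n + N)) t - A t ((e, 0), g t)) \<le> \<eta>'"
          using N'[of "n + N"] H by (intro close) auto
        then have "\<bar>h\<bar> * norm (v' (H (n + N)) t - A t ((e, 0), g t)) \<le> \<bar>h\<bar> * \<eta>'"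
          by (intro mult_left_mono) auto
        then show "norm (h *\<^sub>R v' (H (n + N)) t - h *\<^sub>R A t ((e, 0), g t)) \<le> \<eta>' * norm h"
          by (simp add: scaleR_diff_right[symmetric] mult.commute)
      qed
    next
      show "(\<lambda>n. v (H (n + N)) t) \<longlonglongrightarrow> g t" for t by (rule LIMSEQ_ignore_initial_segment[OF g])
    qed auto
    then obtain g2 where g2: "\<And>t. (\<lambda>n. v (H (n + N)) t) \<longlonglongrightarrow> g2 t"
      "\<And>t. (g2 has_derivative (\<lambda>h. h *\<^sub>R A t ((e, 0), g t))) (at t)" by auto
    have "g2 = g"
      using LIMSEQ_unique[OF g2(1) LIMSEQ_ignore_initial_segment[OF g]] by blast
    then show ?thesis using g2(2) by (simp add: has_vector_derivative_def)
  qed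
  show ?thesis
    using that[OF g_periodic partial] g_ode unfolding A_def z_def by blast
qed

end

text \<open>The derivative of \<open>u\<close> in p solves a linear equation with the same
  coefficients and a new inhomogeneity, one order less smooth. Linear equations with given
  coefficients are thus closed under differentiation, and the induction runs over \<open>u\<close>
  and \<open>b\<close> while \<open>\<alpha>1\<close> and \<open>\<alpha>2\<close> stay fixed. Two
  coefficients occur because the equation is real-linear in a complex unknown.\<close>

lemma linear_periodic_Ck:
  fixes U :: "'p::euclidean_space set" and \<alpha>1 \<alpha>2 :: "'p \<times> real \<Rightarrow> complex"
  assumes P: "P > 0" and U: "open U" and K: "K \<ge> 0"
    and est: "\<And>p v v' M t. p \<in> U \<Longrightarrow> periodic P v \<Longrightarrow> (\<And>t. (v has_vector_derivative v' t) (at t)) \<Longrightarrow>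
      (\<And>t. norm (v' t - (Re (v t) *\<^sub>R \<alpha>1 (p, t) + Im (v t) *\<^sub>R \<alpha>2 (p, t))) \<le> M) \<Longrightarrow> norm (v t) \<le> K * M"
    and \<alpha>_periodic: "\<And>p t. p \<in> U \<Longrightarrow> \<alpha>1 (p, t + P) = \<alpha>1 (p, t)" "\<And>p t. p \<in> U \<Longrightarrow> \<alpha>2 (p, t + P) = \<alpha>2 (p, t)"
  shows "cont_differentiable_on n (U \<times> UNIV) \<alpha>1 \<Longrightarrow> cont_differentiable_on n (U \<times> UNIV) \<alpha>2 \<Longrightarrow>
    cont_differentiable_on n (U \<times> UNIV) b \<Longrightarrow>
    (\<And>p t. p \<in> U \<Longrightarrow> b (p, t + P) = b (p, t)) \<Longrightarrow> (\<And>p. p \<in> U \<Longrightarrow> periodic P (u p)) \<Longrightarrow>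
    (\<And>p t. p \<in> U \<Longrightarrow> (u p has_vector_derivative
      Re (u p t) *\<^sub>R \<alpha>1 (p, t) + Im (u p t) *\<^sub>R \<alpha>2 (p, t) + b (p, t)) (at t)) \<Longrightarrow>
    cont_differentiable_on n (U \<times> UNIV) (\<lambda>(p, t). u p t)"
proof (induction n arbitrary: u b)
  define F where "F b z = Re (snd z) *\<^sub>R \<alpha>1 (fst z) + Im (snd z) *\<^sub>R \<alpha>2 (fst z) + b (fst z)"
    for b and z :: "('p \<times> real) \<times> complex"
  have oUR: "open (U \<times> (UNIV :: real set))" using U by (simp add: open_Times)
  have oD: "open ((U \<times> (UNIV :: real set)) \<times> (UNIV :: complex set))" using oUR by (simp add: open_Times)
  have fst_image: "fst ` ((U \<times> (UNIV :: real set)) \<times> (UNIV :: complex set)) \<subseteq> U \<times> UNIV" by auto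
  have F_Ck: "cont_differentiable_on n ((U \<times> UNIV) \<times> UNIV) (F b)"
    if "cont_differentiable_on n (U \<times> UNIV) \<alpha>1" "cont_differentiable_on n (U \<times> UNIV) \<alpha>2"
      "cont_differentiable_on n (U \<times> UNIV) b" for n b
  proof -
    have comp: "cont_differentiable_on n ((U \<times> UNIV) \<times> UNIV) (\<lambda>z :: ('p \<times> real) \<times> complex. h (fst z))"
      if "cont_differentiable_on n (U \<times> UNIV) h" for h :: "'p \<times> real \<Rightarrow> complex"
      by (rule Ck_compose[OF oD oUR that Ck_bounded_linear[OF bounded_linear_fst oD] fst_image])
    note snd = Ck_bounded_linear[OF bounded_linear_snd oD]
    show ?thesis
      unfolding F_def[abs_def]
      by (intro Ck_add Ck_bilinear[OF bounded_bilinear_scaleR] oD comp[OF that(1)] comp[OF that(2)]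
          comp[OF that(3)] Ck_linear_compose[OF bounded_linear_Re oD snd]
          Ck_linear_compose[OF bounded_linear_Im oD snd])
  qed
  have family: "periodic_family P K U UNIV (F b) u"
    if b: "\<And>p t. p \<in> U \<Longrightarrow> b (p, t + P) = b (p, t)" and u: "\<And>p. p \<in> U \<Longrightarrow> periodic P (u p)"
      "\<And>p t. p \<in> U \<Longrightarrow> (u p has_vector_derivative
        Re (u p t) *\<^sub>R \<alpha>1 (p, t) + Im (u p t) *\<^sub>R \<alpha>2 (p, t) + b (p, t)) (at t)" for b u
  proof
    fix p v1 v1' v2 v2' M and t :: real
    assume p: "p \<in> U" and per: "periodic P v1" "periodic P v2"
      and v: "\<And>t. (v1 has_vector_derivative v1' t) (at t)" "\<And>t. (v2 has_vector_derivative v2' t) (at t)"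
      and le: "\<And>t. norm ((v1' t - F b ((p, t), v1 t)) - (v2' t - F b ((p, t), v2 t))) \<le> M"
    show "norm (v1 t - v2 t) \<le> K * M"
    proof (rule est[OF p])
      show "periodic P (\<lambda>t. v1 t - v2 t)" using per by (simp add: periodic_def)
      show "((\<lambda>t. v1 t - v2 t) has_vector_derivative v1' t - v2' t) (at t)" for t
        by (intro has_vector_derivative_diff v)
      show "norm (v1' t - v2' t - (Re (v1 t - v2 t) *\<^sub>R \<alpha>1 (p, t) + Im (v1 t - v2 t) *\<^sub>R \<alpha>2 (p, t))) \<le> M" for t
        using le[of t] by (simp add: F_def algebra_simps)
    qed
  qed (use P U K b u \<alpha>_periodic in \<open>auto simp: F_def\<close>)
  {
    case 0
    interpret periodic_family P K U UNIV "F b" u by (rule family) (use 0 in auto)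
    show ?case
      using u_continuous[OF Ck_continuous[OF F_Ck[OF 0(1-3)]]] by simp
  next
    case (Suc n)
    interpret periodic_family P K U UNIV "F b" u by (rule family) (use Suc.prems in auto)
    have low: "cont_differentiable_on n (U \<times> UNIV) \<alpha>1" "cont_differentiable_on n (U \<times> UNIV) \<alpha>2"
      "cont_differentiable_on n (U \<times> UNIV) b"
      by (rule Ck_mono_Suc, fact)+
    have u_n: "cont_differentiable_on n (U \<times> UNIV) (\<lambda>(p, t). u p t)"
      by (rule Suc.IH[OF low]) (use Suc.prems in auto)
    \<comment> \<open>The derivatives of coefficients and inhomogeneity in direction
      \<open>e\<close>, evaluated along \<open>u\<close>; that it is C^n uses the induction
      hypothesis for \<open>u\<close> itself.\<close>
    define b' where "b' e z = Re (u (fst z) (snd z)) *\<^sub>R frechet_derivative \<alpha>1 (at z) (e, 0)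
        + Im (u (fst z) (snd z)) *\<^sub>R frechet_derivative \<alpha>2 (at z) (e, 0)
        + frechet_derivative b (at z) (e, 0)" for e z
    have b'_n: "cont_differentiable_on n (U \<times> UNIV) (b' e)" for e
    proof -
      have un: "cont_differentiable_on n (U \<times> UNIV) (\<lambda>z. u (fst z) (snd z))"
        using u_n by (simp add: case_prod_beta')
      have "cont_differentiable_on n (U \<times> UNIV) (\<lambda>z. frechet_derivative h (at z) (e, 0))"
        if "cont_differentiable_on (Suc n) (U \<times> UNIV) h" for h :: "'p \<times> real \<Rightarrow> complex"
        using that[unfolded cont_differentiable_on.simps(2)] by blast
      note dn = this[OF Suc.prems(1)] this[OF Suc.prems(2)] this[OF Suc.prems(3)]
      show ?thesis unfolding b'_def
        by (intro Ck_add Ck_bilinear[OF bounded_bilinear_scaleR] oUR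
            Ck_linear_compose[OF bounded_linear_Re] Ck_linear_compose[OF bounded_linear_Im] un dn)
    qed
    have shift: "frechet_derivative h (at (p, t + P)) = frechet_derivative h (at (p, t))"
      if "cont_differentiable_on (Suc n) (U \<times> UNIV) h" "\<And>p t. p \<in> U \<Longrightarrow> h (p, t + P) = h (p, t)" "p \<in> U"
      for h :: "'p \<times> real \<Rightarrow> complex" and p t
      using frechet_derivative_shift[OF oUR, of "(p, t)" h "(0, P)"] that by auto
    have der_F: "frechet_derivative (F b) (at ((p, t), w)) ((e, 0), y) =
        Re y *\<^sub>R \<alpha>1 (p, t) + Im y *\<^sub>R \<alpha>2 (p, t) +
        (Re w *\<^sub>R frechet_derivative \<alpha>1 (at (p, t)) (e, 0) + Im w *\<^sub>R frechet_derivative \<alpha>2 (at (p, t)) (e, 0)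
          + frechet_derivative b (at (p, t)) (e, 0))" if p: "p \<in> U" for p t w e y
    proof -
      have d: "(h has_derivative frechet_derivative h (at (p, t))) (at (p, t))"
        if "cont_differentiable_on (Suc n) (U \<times> UNIV) h" for h :: "'p \<times> real \<Rightarrow> complex"
        by (rule Ck_derivative[OF that]) (use p in auto)
      have fst: "(fst has_derivative fst) (at ((p, t), w))"
        by (rule bounded_linear_imp_has_derivative[OF bounded_linear_fst])
      have snd: "(snd has_derivative snd) (at ((p, t), w))"
        by (rule bounded_linear_imp_has_derivative[OF bounded_linear_snd])
      have h: "((\<lambda>z. h (fst z)) has_derivative (\<lambda>x. frechet_derivative h (at (p, t)) (fst x))) (at ((p, t), w))"
        if "cont_differentiable_on (Suc n) (U \<times> UNIV) h" for h :: "'p \<times> real \<Rightarrow> complex"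
        using has_derivative_compose[OF fst, of h] d[OF that] by simp
      have "(F b has_derivative (\<lambda>x.
          (Re w *\<^sub>R frechet_derivative \<alpha>1 (at (p, t)) (fst x) + Re (snd x) *\<^sub>R \<alpha>1 (p, t)) +
          (Im w *\<^sub>R frechet_derivative \<alpha>2 (at (p, t)) (fst x) + Im (snd x) *\<^sub>R \<alpha>2 (p, t)) +
          frechet_derivative b (at (p, t)) (fst x))) (at ((p, t), w))"
        unfolding F_def
        using has_derivative_scaleR[OF bounded_linear.has_derivative[OF bounded_linear_Re snd] h[OF Suc.prems(1)]]
          has_derivative_scaleR[OF bounded_linear.has_derivative[OF bounded_linear_Im snd] h[OF Suc.prems(2)]]
        by (intro has_derivative_add h Suc.prems) simp_all
      from frechet_derivative_at[OF this, symmetric] show ?thesis by simp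
    qed
    have ex: "\<exists>g. periodic P g \<and> (\<forall>t. ((\<lambda>s. u (p + s *\<^sub>R e) t) has_vector_derivative g t) (at 0)) \<and>
        (\<forall>t. (g has_vector_derivative Re (g t) *\<^sub>R \<alpha>1 (p, t) + Im (g t) *\<^sub>R \<alpha>2 (p, t) + b' e (p, t)) (at t))"
      if p: "p \<in> U" for p e
    proof -
      obtain g where g: "periodic P g" "\<And>t. ((\<lambda>s. u (p + s *\<^sub>R e) t) has_vector_derivative g t) (at 0)"
        "\<And>t. (g has_vector_derivative frechet_derivative (F b) (at ((p, t), u p t)) ((e, 0), g t)) (at t)"
      proof (rule directional_derivative[OF Ck_Suc_1[OF F_Ck[OF Suc.prems(1-3)]] p])
        fix v v' M and t :: real
        assume v: "periodic P v" "\<And>t. (v has_vector_derivative v' t) (at t)"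
          and le: "\<And>t. norm (v' t - frechet_derivative (F b) (at ((p, t), u p t)) ((0, 0), v t)) \<le> M"
        have "frechet_derivative (F b) (at ((p, t), u p t)) ((0, 0), v t) =
            Re (v t) *\<^sub>R \<alpha>1 (p, t) + Im (v t) *\<^sub>R \<alpha>2 (p, t)" for t
        proof -
          have "frechet_derivative h (at (p, t)) (0, 0) = 0"
            if "cont_differentiable_on (Suc n) (U \<times> UNIV) h" for h :: "'p \<times> real \<Rightarrow> complex"
            using linear_0[OF has_derivative_linear[OF Ck_derivative[OF that]]] p by (simp add: zero_prod_def)
          then show ?thesis using der_F[OF p, of t "u p t" 0 "v t"] Suc.prems(1-3) by simp
        qed
        then show "norm (v t) \<le> K * M"
          using le by (intro est[OF p v]) auto
      qed blast
      then show ?thesis using der_F[OF p] by (auto simp: b'_def)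
    qed
    define G where "G e p = (SOME g. periodic P g \<and>
        (\<forall>t. ((\<lambda>s. u (p + s *\<^sub>R e) t) has_vector_derivative g t) (at 0)) \<and>
        (\<forall>t. (g has_vector_derivative Re (g t) *\<^sub>R \<alpha>1 (p, t) + Im (g t) *\<^sub>R \<alpha>2 (p, t) + b' e (p, t)) (at t)))"
      for e p
    have G: "periodic P (G e p) \<and> (\<forall>t. ((\<lambda>s. u (p + s *\<^sub>R e) t) has_vector_derivative G e p t) (at 0)) \<and>
        (\<forall>t. (G e p has_vector_derivative Re (G e p t) *\<^sub>R \<alpha>1 (p, t) + Im (G e p t) *\<^sub>R \<alpha>2 (p, t) + b' e (p, t)) (at t))"
      if p: "p \<in> U" for p e
      unfolding G_def by (rule someI_ex[OF ex[OF p]])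
    have "b' e (p, t + P) = b' e (p, t)" if "p \<in> U" for p e t
      using shift[OF Suc.prems(1) \<alpha>_periodic(1)] shift[OF Suc.prems(2) \<alpha>_periodic(2)]
        shift[OF Suc.prems(3,4)] u_periodic[OF that] that
      by (simp add: b'_def periodic_def)
    then have G_n: "cont_differentiable_on n (U \<times> UNIV) (\<lambda>(p, t). G e p t)" for e
      by (intro Suc.IH[OF low(1,2) b'_n[of e]]) (use G in blast)+
    show ?case
    proof (rule Ck_SucI_partials_prod[OF U, of _ "\<lambda>e (p, t). G e p t" "\<lambda>z. F b (z, u (fst z) (snd z))"])
      show "cont_differentiable_on n (U \<times> UNIV) (\<lambda>z. F b (z, u (fst z) (snd z)))"
        by (rule Ck_compose[OF oUR oD F_Ck[OF low]])
          (use u_n in \<open>auto intro!: Ck_Pair Ck_bounded_linear[OF bounded_linear_ident] oUR simp: case_prod_beta'\<close>)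
      show "((\<lambda>s. (\<lambda>(p, t). u p t) (p + s *\<^sub>R e, t)) has_vector_derivative (\<lambda>(p, t). G e p t) (p, t)) (at 0)"
        if "p \<in> U" for p e t using G[OF that] by simp
      show "((\<lambda>s. (\<lambda>(p, t). u p t) (p, s)) has_vector_derivative F b ((p, t), u (fst (p, t)) (snd (p, t)))) (at t)"
        if "p \<in> U" for p t using u_ode[OF that] by simp
    qed (rule G_n)
  }
qed

context periodic_family
begin

text \<open>Bootstrap: if \<open>u\<close> is C^n, the coefficients of the linearised equation along
  \<open>u\<close> are C^n, so by the linear case the derivatives \<open>G\<close> are C^n, and
  \<open>u\<close> is C^(n+1).\<close>

lemma u_smooth:
  assumes f: "smooth_on D f"
    and lin: "\<And>p v v' M t. p \<in> U \<Longrightarrow> periodic P v \<Longrightarrow> (\<And>t. (v has_vector_derivative v' t) (at t)) \<Longrightarrow>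
      (\<And>t. norm (v' t - frechet_derivative f (at ((p, t), u p t)) ((0, 0), v t)) \<le> M) \<Longrightarrow>
      norm (v t) \<le> K * M"
  shows "smooth_on (U \<times> UNIV) (\<lambda>(p, t). u p t)"
proof -
  define z where "z = (\<lambda>x :: 'p \<times> real. (x, u (fst x) (snd x)))"
  have zD: "z ` (U \<times> UNIV) \<subseteq> D" using u_in by (auto simp: z_def)
  define \<alpha> where "\<alpha> w x = frechet_derivative f (at (z x)) ((0, 0), w)" for w x
  define b where "b e x = frechet_derivative f (at (z x)) ((e, 0), 0)" for e x
  have fD: "(f has_derivative frechet_derivative f (at y)) (at y)" if "y \<in> D" for y
    by (rule smooth_on_has_derivative[OF f that])
  have split: "frechet_derivative f (at (z (p, t))) ((e, 0), w) =
      Re w *\<^sub>R \<alpha> 1 (p, t) + Im w *\<^sub>R \<alpha> \<i> (p, t) + b e (p, t)" if p: "p \<in> U" for p t e w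
  proof -
    have "z (p, t) \<in> D" using zD p by auto
    then interpret linear "frechet_derivative f (at (z (p, t)))"
      by (rule has_derivative_linear[OF fD])
    have "((e, 0), w) = Re w *\<^sub>R ((0, 0), 1) + Im w *\<^sub>R ((0, 0), \<i>) + ((e, 0 :: real), 0 :: complex)"
      by (simp add: complex_eq_iff)
    then have "frechet_derivative f (at (z (p, t))) ((e, 0), w) = frechet_derivative f (at (z (p, t)))
        (Re w *\<^sub>R ((0, 0), 1) + Im w *\<^sub>R ((0, 0), \<i>) + ((e, 0 :: real), 0 :: complex))"
      by (rule arg_cong)
    then show ?thesis unfolding \<alpha>_def b_def by (simp only: add scale)
  qed
  have shift: "frechet_derivative f (at (z (p, t + P))) = frechet_derivative f (at (z (p, t)))"
    if p: "p \<in> U" for p t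
  proof -
    have eq: "z (p, t + P) = z (p, t) + ((0, P), 0)"
      using u_periodic[OF p] by (simp add: z_def periodic_def)
    have "f differentiable (at (z (p, t + P)))"
      by (rule smooth_on_differentiable[OF f]) (use zD p in auto)
    moreover have "z (p, t) \<in> D" using zD p by blast
    ultimately show ?thesis
      using frechet_derivative_shift[OF open_D, of "z (p, t)" f "((0, P), 0)"] eq
      by (force simp: f_periodic)
  qed
  have ex: "\<exists>g. periodic P g \<and> (\<forall>t. ((\<lambda>s. u (p + s *\<^sub>R e) t) has_vector_derivative g t) (at 0)) \<and>
      (\<forall>t. (g has_vector_derivative Re (g t) *\<^sub>R \<alpha> 1 (p, t) + Im (g t) *\<^sub>R \<alpha> \<i> (p, t) + b e (p, t)) (at t))"
    if p: "p \<in> U" for p e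
  proof -
    obtain g where g: "periodic P g" "\<And>t. ((\<lambda>s. u (p + s *\<^sub>R e) t) has_vector_derivative g t) (at 0)"
      "\<And>t. (g has_vector_derivative frechet_derivative f (at ((p, t), u p t)) ((e, 0), g t)) (at t)"
      by (rule directional_derivative[OF smooth_onD[OF f, of 1] p, of e]) (use lin[OF p] in blast)+
    have "frechet_derivative f (at ((p, t), u p t)) ((e, 0), g t) =
        Re (g t) *\<^sub>R \<alpha> 1 (p, t) + Im (g t) *\<^sub>R \<alpha> \<i> (p, t) + b e (p, t)" for t
      using split[OF p, of t e "g t"] by (simp add: z_def)
    then show ?thesis using g by auto
  qed
  define G where "G e p = (SOME g. periodic P g \<and>
      (\<forall>t. ((\<lambda>s. u (p + s *\<^sub>R e) t) has_vector_derivative g t) (at 0)) \<and>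
      (\<forall>t. (g has_vector_derivative Re (g t) *\<^sub>R \<alpha> 1 (p, t) + Im (g t) *\<^sub>R \<alpha> \<i> (p, t) + b e (p, t)) (at t)))"
    for e p
  have G: "periodic P (G e p) \<and> (\<forall>t. ((\<lambda>s. u (p + s *\<^sub>R e) t) has_vector_derivative G e p t) (at 0)) \<and>
      (\<forall>t. (G e p has_vector_derivative Re (G e p t) *\<^sub>R \<alpha> 1 (p, t) + Im (G e p t) *\<^sub>R \<alpha> \<i> (p, t) + b e (p, t)) (at t))"
    if p: "p \<in> U" for p e
    unfolding G_def by (rule someI_ex[OF ex[OF p]])
  have est: "norm (v t) \<le> K * M" if p: "p \<in> U" and v: "periodic P v" "\<And>t. (v has_vector_derivative v' t) (at t)"
    and le: "\<And>t. norm (v' t - (Re (v t) *\<^sub>R \<alpha> 1 (p, t) + Im (v t) *\<^sub>R \<alpha> \<i> (p, t))) \<le> M" for p v v' M t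
  proof (rule lin[OF p v])
    fix t
    have "z (p, t) \<in> D" using zD p by auto
    then have "b 0 (p, t) = 0"
      using linear_0[OF has_derivative_linear[OF fD]] by (simp add: b_def zero_prod_def)
    then show "norm (v' t - frechet_derivative f (at ((p, t), u p t)) ((0, 0), v t)) \<le> M"
      using split[OF p, of t 0 "v t"] le[of t] by (simp add: z_def)
  qed
  have "cont_differentiable_on n (U \<times> UNIV) (\<lambda>(p, t). u p t)" for n
  proof (induction n)
    case 0
    show ?case using u_continuous[OF smooth_on_continuous[OF f]] by simp
  next
    case (Suc n)
    then have u_n: "cont_differentiable_on n (U \<times> UNIV) (\<lambda>x. u (fst x) (snd x))"
      by (simp add: case_prod_beta')
    have z_n: "cont_differentiable_on n (U \<times> UNIV) z"
      unfolding z_def by (intro Ck_Pair Ck_bounded_linear[OF bounded_linear_ident] open_UR u_n)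
    have df: "cont_differentiable_on n (U \<times> UNIV) (\<lambda>x. frechet_derivative f (at (z x)) y)" for y
      by (rule Ck_compose[OF open_UR open_D smooth_onD[OF smooth_on_frechet[OF f]] z_n zD])
    have "cont_differentiable_on n (U \<times> UNIV) (\<lambda>(p, t). G e p t)" for e
    proof (rule linear_periodic_Ck[of P U K "\<alpha> 1" "\<alpha> \<i>" n "b e", OF P U K])
      show "norm (v t) \<le> K * M" if "p \<in> U" "periodic P v" "\<And>t. (v has_vector_derivative v' t) (at t)"
        "\<And>t. norm (v' t - (Re (v t) *\<^sub>R \<alpha> 1 (p, t) + Im (v t) *\<^sub>R \<alpha> \<i> (p, t))) \<le> M" for p v v' M t
        using that by (rule est)
      show "cont_differentiable_on n (U \<times> UNIV) (\<alpha> 1)" "cont_differentiable_on n (U \<times> UNIV) (\<alpha> \<i>)"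
        "cont_differentiable_on n (U \<times> UNIV) (b e)"
        unfolding \<alpha>_def b_def by (rule df)+
    next
      show "\<alpha> 1 (p, t + P) = \<alpha> 1 (p, t)" "\<alpha> \<i> (p, t + P) = \<alpha> \<i> (p, t)" "b e (p, t + P) = b e (p, t)"
        if "p \<in> U" for p t by (simp_all add: \<alpha>_def b_def shift[OF that])
    qed (use G in blast)+
    moreover have "cont_differentiable_on n (U \<times> UNIV) (\<lambda>x. f (z x))"
      by (rule Ck_compose[OF open_UR open_D smooth_onD[OF f] z_n zD])
    ultimately show ?case
    proof (intro Ck_SucI_partials_prod[OF U, of _ "\<lambda>e (p, t). G e p t" "\<lambda>x. f (z x)"])
      show "((\<lambda>s. (\<lambda>(p, t). u p t) (p + s *\<^sub>R e, t)) has_vector_derivative (\<lambda>(p, t). G e p t) (p, t)) (at 0)"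
        if "p \<in> U" for p e t using G[OF that] by simp
      show "((\<lambda>s. (\<lambda>(p, t). u p t) (p, s)) has_vector_derivative f (z (p, t))) (at t)"
        if "p \<in> U" for p t using u_ode[OF that] by (simp add: z_def)
    qed
  qed
  then show ?thesis by (simp add: smooth_on_def)
qed

end

subsection \<open>A family of fast oscillators\<close>

lemma continuous_bounded_on_compact:
  fixes f :: "'a::metric_space \<Rightarrow> 'b::real_normed_vector"
  assumes "continuous_on S f" "compact C" "C \<subseteq> S"
  obtains M where "M > 0" "\<And>x. x \<in> C \<Longrightarrow> norm (f x) \<le> M"
proof -
  have "bounded (f ` C)"
    by (intro compact_imp_bounded compact_continuous_image continuous_on_subset[OF assms(1,3)] assms(2))
  then show ?thesis using that by (auto simp: bounded_pos)
qed

text \<open>The abstract form of the problem near the slow manifold. The box contains \<delta> = 0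
  and negative \<delta>, where \<open>g\<close> is considered but not the equation; this gives
  bounds on \<open>g\<close> that are uniform up to \<delta> = 0.\<close>

locale oscillator =
  fixes P S c0 \<delta>1 :: real and \<omega> :: "real \<Rightarrow> real"
    and g :: "((real \<times> real) \<times> real) \<times> complex \<Rightarrow> complex"
  assumes P: "P > 0" and \<delta>1: "\<delta>1 > 0"
    and \<omega>_smooth: "smooth_on UNIV \<omega>" and \<omega>_periodic: "periodic P \<omega>"
    and S: "S = integral {0..P} \<omega>"
    and g_smooth: "smooth_on ((({-\<delta>1<..<\<delta>1} \<times> {c0-1<..<c0+1}) \<times> UNIV) \<times> ball 0 2) g"
    and g_periodic: "\<And>p t w. g ((p, t + P), w) = g ((p, t), w)"
begin

definition "Box = (({-\<delta>1<..<\<delta>1} \<times> {c0-1<..<c0+1}) \<times> (UNIV :: real set)) \<times> ball (0 :: complex) 2"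

definition "near = (({-\<delta>1/2..\<delta>1/2} \<times> {c0-1/2..c0+1/2}) \<times> (UNIV :: real set)) \<times> cball (0 :: complex) 1"

text \<open>The strict inequality makes the parameter set open, while \<open>rotation\<close> asks
  for the weak one. The upper limit for \<delta> is left free because it is lowered again for the
  Jacobian.\<close>

definition dom :: "real \<Rightarrow> (real \<times> real) set" where
  "dom \<delta>2 = {(\<delta>, c). 0 < \<delta> \<and> \<delta> < \<delta>2 \<and> c0 - 1/2 < c \<and> c < c0 + 1/2 \<and> norm (cis (S / \<delta>) - 1) > 1}"

lemma open_Box: "open Box"
  unfolding Box_def by (intro open_Times open_greaterThanLessThan open_UNIV open_ball)

lemma near_Box: "near \<subseteq> Box"
  using \<delta>1 by (auto simp: near_def Box_def)

lemma g_smooth': "smooth_on Box g"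
  using g_smooth by (simp add: Box_def)

lemma g_derivative: "z \<in> Box \<Longrightarrow> (g has_derivative frechet_derivative g (at z)) (at z)"
  using smooth_on_has_derivative[OF g_smooth'] .

lemma open_dom: "open (dom \<delta>2)"
proof -
  have "continuous_on ({0<..} \<times> UNIV) (\<lambda>p :: real \<times> real. norm (cis (S / fst p) - 1))"
    unfolding cis_conv_exp by (intro continuous_intros) auto
  then have "open ({0<..} \<times> UNIV \<inter> (\<lambda>p :: real \<times> real. norm (cis (S / fst p) - 1)) -` {1<..})"
    by (rule continuous_open_preimage) (auto intro: open_Times)
  moreover have "open ({..<\<delta>2} \<times> {c0 - 1/2<..<c0 + 1/2})"
    by (intro open_Times) auto
  moreover have "dom \<delta>2 = ({0<..} \<times> UNIV \<inter> (\<lambda>p :: real \<times> real. norm (cis (S / fst p) - 1)) -` {1<..})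
      \<inter> ({..<\<delta>2} \<times> {c0 - 1/2<..<c0 + 1/2})"
    by (auto simp: dom_def)
  ultimately show ?thesis by (metis open_Int)
qed

text \<open>\<open>near\<close> is unbounded in t; periodicity reduces it to the compact set with t
  in one period. The derivative in the complex variable is bounded through the directions 1 and
  \<i>.\<close>

lemma near_bound:
  obtains M where "M > 0" "\<And>z. z \<in> near \<Longrightarrow> norm (g z) \<le> M"
    "\<And>z. z \<in> near \<Longrightarrow> norm (frechet_derivative g (at z) (((1, 0), 0), 0)) \<le> M"
    "\<And>z. z \<in> near \<Longrightarrow> norm (frechet_derivative g (at z) (((0, 1), 0), 0)) \<le> M"
    "\<And>z y. z \<in> near \<Longrightarrow> norm (frechet_derivative g (at z) (0, y)) \<le> M * norm y"
proof -
  define C where "C = (({-\<delta>1/2..\<delta>1/2} \<times> {c0-1/2..c0+1/2}) \<times> {0..P}) \<times> cball (0 :: complex) 1"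
  have C: "compact C" "C \<subseteq> Box"
    using near_Box by (auto simp: C_def near_def intro!: compact_Times)
  have D_bound: "\<exists>M>0. \<forall>z\<in>near. norm (frechet_derivative g (at z) v) \<le> M" for v
  proof -
    obtain M where M: "M > 0" "\<And>z. z \<in> C \<Longrightarrow> norm (frechet_derivative g (at z) v) \<le> M"
      by (rule continuous_bounded_on_compact[OF smooth_on_continuous[OF smooth_on_frechet[OF g_smooth', of v]] C]) blast
    have "norm (frechet_derivative g (at z) v) \<le> M" if z: "z \<in> near" for z
    proof -
      obtain p t w where ptw: "z = ((p, t), w)" by (metis prod.exhaust)
      obtain s j where s: "s \<in> {0..P}" "t = s + of_int j * P" by (rule period_reduce[OF P])
      have eq: "z = ((p, s), w) + ((0, of_int j * P), 0)" using ptw s by simp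
      have sB: "((p, s), w) \<in> Box" using z ptw near_Box by (auto simp: Box_def)
      have "g (y + ((0, of_int j * P), 0)) = g y" for y
      proof -
        obtain p' t' w' where "y = ((p', t'), w')" by (metis prod.exhaust)
        moreover have "periodic P (\<lambda>t. g ((p', t), w'))" by (simp add: periodic_def g_periodic)
        ultimately show ?thesis using periodic_of_int[of P "\<lambda>t. g ((p', t), w')" t' j] by simp
      qed
      moreover have "g differentiable (at z)"
        using smooth_on_differentiable[OF g_smooth'] z near_Box by blast
      ultimately have "frechet_derivative g (at z) = frechet_derivative g (at ((p, s), w))"
        unfolding eq using frechet_derivative_shift[OF open_Box sB] by blast
      then show ?thesis using M(2)[of "((p, s), w)"] z s ptw by (auto simp: C_def near_def)
    qed
    then show ?thesis using M(1) by blast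
  qed
  obtain M0 where M0: "M0 > 0" "\<And>z. z \<in> C \<Longrightarrow> norm (g z) \<le> M0"
    by (rule continuous_bounded_on_compact[OF smooth_on_continuous[OF g_smooth'] C]) blast
  have g_le: "norm (g z) \<le> M0" if z: "z \<in> near" for z
  proof -
    obtain p t w where ptw: "z = ((p, t), w)" by (metis prod.exhaust)
    obtain s j where s: "s \<in> {0..P}" "t = s + of_int j * P" by (rule period_reduce[OF P])
    have "periodic P (\<lambda>t. g ((p, t), w))" by (simp add: periodic_def g_periodic)
    then have "g z = g ((p, s), w)" using periodic_of_int[of P "\<lambda>t. g ((p, t), w)" s j] s ptw by simp
    then show ?thesis using M0(2)[of "((p, s), w)"] z s ptw by (auto simp: C_def near_def)
  qed
  obtain M1 where M1: "M1 > 0" "\<And>z. z \<in> near \<Longrightarrow> norm (frechet_derivative g (at z) (((1, 0), 0), 0)) \<le> M1"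
    using D_bound by blast
  obtain M2 where M2: "M2 > 0" "\<And>z. z \<in> near \<Longrightarrow> norm (frechet_derivative g (at z) (((0, 1), 0), 0)) \<le> M2"
    using D_bound by blast
  obtain M3 where M3: "M3 > 0" "\<And>z. z \<in> near \<Longrightarrow> norm (frechet_derivative g (at z) (0, 1)) \<le> M3"
    using D_bound by blast
  obtain M4 where M4: "M4 > 0" "\<And>z. z \<in> near \<Longrightarrow> norm (frechet_derivative g (at z) (0, \<i>)) \<le> M4"
    using D_bound by blast
  define M where "M = M0 + M1 + M2 + M3 + M4"
  show ?thesis
  proof (rule that[of M])
    show "norm (frechet_derivative g (at z) (0, y)) \<le> M * norm y" if z: "z \<in> near" for z y
    proof -
      have "z \<in> Box" using z near_Box by blast
      then interpret linear "frechet_derivative g (at z)"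
        by (rule has_derivative_linear[OF g_derivative])
      have "(0, y) = Re y *\<^sub>R (0 :: (real \<times> real) \<times> real, 1) + Im y *\<^sub>R (0, \<i>)"
        by (simp add: complex_eq_iff)
      then have "frechet_derivative g (at z) (0, y) =
          frechet_derivative g (at z) (Re y *\<^sub>R (0, 1) + Im y *\<^sub>R (0, \<i>))" by (rule arg_cong)
      also have "\<dots> = Re y *\<^sub>R frechet_derivative g (at z) (0, 1) + Im y *\<^sub>R frechet_derivative g (at z) (0, \<i>)"
        by (simp only: add scale)
      also have "norm \<dots> \<le> norm y * M3 + norm y * M4"
        unfolding norm_scaleR using M3(1) M4(1) M3(2)[OF z] M4(2)[OF z] abs_Re_le_cmod[of y] abs_Im_le_cmod[of y]
        by (intro order_trans[OF norm_triangle_ineq] add_mono) (auto intro!: mult_mono)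
      also have "\<dots> \<le> M * norm y"
        using M0 M1 M2 by (simp add: M_def algebra_simps)
      finally show ?thesis .
    qed
    show "M > 0" using M0 M1 M2 M3 M4 by (simp add: M_def)
    show "norm (g z) \<le> M" if "z \<in> near" for z
      using g_le[OF that] M0 M1 M2 M3 M4 by (simp add: M_def)
    show "norm (frechet_derivative g (at z) (((1, 0), 0), 0)) \<le> M" if "z \<in> near" for z
      using M1(2)[OF that] M0 M1 M2 M3 M4 by (simp add: M_def)
    show "norm (frechet_derivative g (at z) (((0, 1), 0), 0)) \<le> M" if "z \<in> near" for z
      using M2(2)[OF that] M0 M1 M2 M3 M4 by (simp add: M_def)
  qed
qed

text \<open>Written with projections so that the smoothness rules apply to all variables jointly;
  \<open>rhs_eq\<close> is the readable form.\<close>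

definition rhs :: "((real \<times> real) \<times> real) \<times> complex \<Rightarrow> complex" where
  "rhs z = - (\<omega> (snd (fst z)) / fst (fst (fst z))) *\<^sub>R (\<i> * snd z) + fst (fst (fst z)) *\<^sub>R g z"

lemma rhs_eq: "rhs (((\<delta>, c), t), w) =
    - \<i> * of_real (1 / \<delta> * \<omega> t) * w + \<delta> *\<^sub>R g (((\<delta>, c), t), w)"
  by (simp add: rhs_def scaleR_conv_of_real)

lemma rhs_derivative:
  assumes "(((\<delta>, c), t), w) \<in> Box" "\<delta> \<noteq> 0"
  shows "frechet_derivative rhs (at (((\<delta>, c), t), w)) (((a, b), 0), y) =
    - (\<omega> t / \<delta>) *\<^sub>R (\<i> * y) + (a * \<omega> t / \<delta>\<^sup>2) *\<^sub>R (\<i> * w) + a *\<^sub>R g (((\<delta>, c), t), w)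
    + \<delta> *\<^sub>R frechet_derivative g (at (((\<delta>, c), t), w)) (((a, b), 0), y)"
proof -
  let ?z = "(((\<delta>, c), t), w)"
  have \<omega>': "(\<omega> has_derivative (\<lambda>h. h * deriv \<omega> t)) (at t)"
    using smooth_on_UNIV_deriv(1)[OF \<omega>_smooth, of t]
    by (simp add: has_field_derivative_def mult.commute[of _ "deriv \<omega> t"])
  have T: "((\<lambda>z :: ((real \<times> real) \<times> real) \<times> complex. snd (fst z)) has_derivative (\<lambda>h. snd (fst h))) (at ?z)"
    by (auto intro!: derivative_eq_intros)
  have \<omega>z: "((\<lambda>z :: ((real \<times> real) \<times> real) \<times> complex. \<omega> (snd (fst z))) has_derivative
      (\<lambda>h. snd (fst h) * deriv \<omega> t)) (at ?z)"
    using has_derivative_compose[OF T, of \<omega>] \<omega>' by simp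
  have "(rhs has_derivative (\<lambda>h.
      - (\<omega> t / \<delta>) *\<^sub>R (\<i> * snd h)
      - ((snd (fst h) * deriv \<omega> t * \<delta> - \<omega> t * fst (fst (fst h))) / \<delta>\<^sup>2) *\<^sub>R (\<i> * w)
      + (\<delta> *\<^sub>R frechet_derivative g (at ?z) h + fst (fst (fst h)) *\<^sub>R g ?z))) (at ?z)"
    unfolding rhs_def[abs_def]
    using assms(2)
    by (auto intro!: derivative_eq_intros \<omega>z g_derivative assms
        simp: power2_eq_square field_simps scaleR_left_diff_distrib)
  from frechet_derivative_at[OF this, symmetric] show ?thesis
    by (simp add: algebra_simps)
qed

lemma dom_rotation:
  assumes "(\<delta>, c) \<in> dom \<delta>2"
  shows "rotation P (1 / \<delta>) S \<omega> (primitive \<omega>)"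
proof
  show "(primitive \<omega> has_real_derivative \<omega> t) (at t)" for t
    unfolding has_real_derivative_iff_has_vector_derivative
    by (rule primitive_derivative[OF smooth_on_continuous[OF \<omega>_smooth]])
  show "S = primitive \<omega> P - primitive \<omega> 0"
    using P by (simp add: S primitive_eq_integral)
  show "1 \<le> norm (cis (1 / \<delta> * S) - 1)" using assms by (simp add: dom_def)
qed (fact P \<omega>_periodic)+

lemma g_lipschitz:
  assumes "\<And>z y. z \<in> near \<Longrightarrow> norm (frechet_derivative g (at z) (0, y)) \<le> M * norm y"
    "\<bar>\<delta>\<bar> \<le> \<delta>1/2" "c0 - 1/2 \<le> c" "c \<le> c0 + 1/2" "norm w \<le> 1" "norm z \<le> 1"
  shows "norm (g (((\<delta>, c), t), w) - g (((\<delta>, c), t), z)) \<le> M * norm (w - z)"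
proof (rule differentiable_bound[of "cball 0 1" "\<lambda>w. g (((\<delta>, c), t), w)"
      "\<lambda>w y. frechet_derivative g (at (((\<delta>, c), t), w)) (0, y)"])
  fix x :: complex assume x: "x \<in> cball 0 1"
  then have n: "(((\<delta>, c), t), x) \<in> near" using assms(2,3,4) by (auto simp: near_def abs_le_iff)
  then have B: "(((\<delta>, c), t), x) \<in> Box" using near_Box by blast
  have "((\<lambda>w. (((\<delta>, c), t), w)) has_derivative (\<lambda>y. (0, y))) (at x)"
    by (auto intro!: derivative_eq_intros simp: zero_prod_def)
  from has_derivative_compose[OF this g_derivative[OF B]]
  show "((\<lambda>w. g (((\<delta>, c), t), w)) has_derivative
      (\<lambda>y. frechet_derivative g (at (((\<delta>, c), t), x)) (0, y))) (at x within cball 0 1)"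
    by (rule has_derivative_at_withinI)
  show "onorm (\<lambda>y. frechet_derivative g (at (((\<delta>, c), t), x)) (0, y)) \<le> M"
    by (rule onorm_le[OF assms(1)[OF n]])
qed (use assms in auto)

text \<open>Orders in \<delta>: the forcing \<delta> g makes \<open>u\<close> of order \<delta>. A
  derivative in c falls on \<open>g\<close> alone and keeps this order. A derivative in \<delta>
  falls also on \<omega>/\<delta> and produces (\<omega>/\<delta>^2) u, which is of order
  1/\<delta>.\<close>

theorem oscillator_family:
  obtains \<delta>2 M u where "0 < \<delta>2" "\<delta>2 \<le> \<delta>1/2" "\<delta>2 \<le> 1" "M > 0"
    "\<And>p. p \<in> dom \<delta>2 \<Longrightarrow> periodic P (u p)"
    "\<And>\<delta> c t. (\<delta>, c) \<in> dom \<delta>2 \<Longrightarrow> norm (u (\<delta>, c) t) \<le> M * \<delta>"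
    "\<And>p t. p \<in> dom \<delta>2 \<Longrightarrow> norm (u p t) < 1"
    "\<And>p t. p \<in> dom \<delta>2 \<Longrightarrow> (u p has_vector_derivative rhs ((p, t), u p t)) (at t)"
    "smooth_on (dom \<delta>2 \<times> UNIV) (\<lambda>(p, t). u p t)"
    "\<And>\<delta> c t. (\<delta>, c) \<in> dom \<delta>2 \<Longrightarrow>
      norm (frechet_derivative (\<lambda>(p, t). u p t) (at ((\<delta>, c), t)) ((1, 0), 0)) \<le> M / \<delta>"
    "\<And>\<delta> c t. (\<delta>, c) \<in> dom \<delta>2 \<Longrightarrow>
      norm (frechet_derivative (\<lambda>(p, t). u p t) (at ((\<delta>, c), t)) ((0, 1), 0)) \<le> M * \<delta>"
proof -
  obtain M0 where M0: "M0 > 0" "\<And>z. z \<in> near \<Longrightarrow> norm (g z) \<le> M0"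
    "\<And>z. z \<in> near \<Longrightarrow> norm (frechet_derivative g (at z) (((1, 0), 0), 0)) \<le> M0"
    "\<And>z. z \<in> near \<Longrightarrow> norm (frechet_derivative g (at z) (((0, 1), 0), 0)) \<le> M0"
    "\<And>z y. z \<in> near \<Longrightarrow> norm (frechet_derivative g (at z) (0, y)) \<le> M0 * norm y"
    by (rule near_bound) blast
  obtain W where W: "\<And>t. norm (\<omega> t) \<le> W"
    using periodic_bounded[OF P \<omega>_periodic smooth_on_continuous[OF \<omega>_smooth]] by metis
  have W0: "W \<ge> 0" using W[of 0] norm_ge_zero[of "\<omega> 0"] by linarith
  \<comment> \<open>Makes P \<delta> M0 at most 1/2. This serves as the contraction constant and
    also absorbs the nonlinear term in the a priori estimates.\<close>
  define \<delta>2 where "\<delta>2 = min (\<delta>1/2) (1 / (2 * (P * M0 + 1)))"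
  have PM: "P * M0 > 0" using P M0(1) by simp
  then have \<delta>2: "0 < \<delta>2" "\<delta>2 \<le> \<delta>1/2" "\<delta>2 \<le> 1 / (2 * (P * M0 + 1))" using \<delta>1 by (auto simp: \<delta>2_def)
  have half: "1 / (2 * (P * M0 + 1)) \<le> 1" using PM by simp
  define V where "V = dom \<delta>2"
  have V: "0 < \<delta>" "\<delta> \<le> \<delta>1/2" "\<delta> \<le> 1" "P * (\<delta> * M0) \<le> 1/2" "c0 - 1/2 < c" "c < c0 + 1/2" if "(\<delta>, c) \<in> V" for \<delta> c
  proof -
    show "0 < \<delta>" "\<delta> \<le> \<delta>1/2" "c0 - 1/2 < c" "c < c0 + 1/2" using that \<delta>2 by (auto simp: V_def dom_def)
    have le: "\<delta> \<le> 1 / (2 * (P * M0 + 1))" using that \<delta>2 by (auto simp: V_def dom_def)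
    then show "\<delta> \<le> 1" using half by linarith
    have "\<delta> * (2 * (P * M0 + 1)) \<le> 1"
      using le PM by (simp add: pos_le_divide_eq)
    then show "P * (\<delta> * M0) \<le> 1/2" using \<open>0 < \<delta>\<close> by (simp add: algebra_simps)
  qed
  have in_near: "(((\<delta>, c), t), w) \<in> near" if "(\<delta>, c) \<in> V" "norm w \<le> 1" for \<delta> c t w
    using V[OF that(1)] that(2) by (auto simp: near_def)
  have in_Box: "(((\<delta>, c), t), w) \<in> Box" if "(\<delta>, c) \<in> V" "norm w \<le> 1" for \<delta> c t w
    using in_near[OF that] near_Box by blast
  have lip: "norm (g (((\<delta>, c), t), w) - g (((\<delta>, c), t), z)) \<le> M0 * norm (w - z)"
    if "(\<delta>, c) \<in> V" "norm w \<le> 1" "norm z \<le> 1" for \<delta> c t w z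
    using V[OF that(1)] that by (intro g_lipschitz M0(5)) auto
  have "\<exists>v. periodic P v \<and> (\<forall>t. norm (v t) \<le> P * (fst p * M0)) \<and>
      (\<forall>t. (v has_vector_derivative rhs ((p, t), v t)) (at t))" if pV: "p \<in> V" for p
  proof -
    obtain \<delta> c where p: "p = (\<delta>, c)" "(\<delta>, c) \<in> V" using pV by (cases p) auto
    note V' = V[OF p(2)]
    interpret rotation P "1 / \<delta>" S \<omega> "primitive \<omega>"
      using p(2) unfolding V_def by (rule dom_rotation)
    have slice: "(\<lambda>(t, w). (((\<delta>, c), t), w)) ` (UNIV \<times> cball 0 1) \<subseteq> Box"
      using in_Box[OF p(2)] by auto
    obtain v where "periodic P v" "\<And>t. norm (v t) \<le> P * (\<delta> * M0)"
      "\<And>t. (v has_vector_derivative - \<i> * of_real (1 / \<delta> * \<omega> t) * v t + \<delta> *\<^sub>R g (((\<delta>, c), t), v t)) (at t)"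
    proof (rule nonlinear_solvable[of "\<lambda>t w. \<delta> *\<^sub>R g (((\<delta>, c), t), w)" "\<delta> * M0" "\<delta> * M0"])
      show "continuous_on (UNIV \<times> cball 0 1) (\<lambda>(t, w). \<delta> *\<^sub>R g (((\<delta>, c), t), w))"
        unfolding split_beta
        by (intro continuous_intros continuous_on_compose2[OF smooth_on_continuous[OF g_smooth']])
          (use slice in \<open>auto simp: split_beta\<close>)
      show "norm (\<delta> *\<^sub>R g (((\<delta>, c), t), w)) \<le> \<delta> * M0" if "norm w \<le> 1" for t w
        using M0(2)[OF in_near[OF p(2) that, of t]] V' by simp
      show "norm (\<delta> *\<^sub>R g (((\<delta>, c), t), w) - \<delta> *\<^sub>R g (((\<delta>, c), t), z)) \<le> \<delta> * M0 * norm (w - z)"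
        if "norm w \<le> 1" "norm z \<le> 1" for t w z
        using lip[OF p(2) that, of t] V'
        by (simp add: scaleR_diff_right[symmetric] mult.assoc mult_left_mono)
    qed (use V' M0(1) g_periodic in auto)
    then show ?thesis unfolding p(1) rhs_eq by auto
  qed
  then obtain u where u: "\<And>p. p \<in> V \<Longrightarrow> periodic P (u p)"
    "\<And>p t. p \<in> V \<Longrightarrow> norm (u p t) \<le> P * (fst p * M0)"
    "\<And>p t. p \<in> V \<Longrightarrow> (u p has_vector_derivative rhs ((p, t), u p t)) (at t)"
    by metis
  have u_lt: "norm (u p t) < 1" if "p \<in> V" for p t
    using u(2)[OF that, of t] V(4)[of "fst p" "snd p"] that by simp
  \<comment> \<open>A term of size \<delta> M0 times the unknown is moved to the left-hand side; the
    price is the factor 2.\<close>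
  have absorb: "norm (v t) \<le> 2 * P * M"
    if p: "(\<delta>, c) \<in> V" and v: "periodic P v" "\<And>t. (v has_vector_derivative v' t) (at t)"
      and le: "\<And>t. norm (v' t + \<i> * of_real (1 / \<delta> * \<omega> t) * v t) \<le> M + \<delta> * (M0 * norm (v t))"
    for \<delta> c v v' M t
  proof -
    note V' = V[OF p]
    interpret rotation P "1 / \<delta>" S \<omega> "primitive \<omega>"
      using p unfolding V_def by (rule dom_rotation)
    obtain s where s: "\<And>t. norm (v t) \<le> norm (v s)"
      using periodic_bounded[OF P v(1) has_vd_continuous[OF v(2)]] by blast
    have "norm (v s) \<le> P * (M + \<delta> * (M0 * norm (v s)))"
    proof (rule estimate[OF v])
      fix t
      have "\<delta> * (M0 * norm (v t)) \<le> \<delta> * (M0 * norm (v s))"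
        using s[of t] V'(1) M0(1) by simp
      then show "norm (v' t + \<i> * of_real (1 / \<delta> * \<omega> t) * v t) \<le> M + \<delta> * (M0 * norm (v s))"
        using le[of t] by linarith
    qed
    also have "\<dots> = P * M + P * (\<delta> * M0) * norm (v s)" by (simp add: algebra_simps)
    also have "\<dots> \<le> P * M + 1/2 * norm (v s)"
      using V'(4) by (intro add_left_mono mult_right_mono) auto
    finally have "norm (v s) \<le> 2 * (P * M)" by linarith
    then show ?thesis using s[of t] by simp
  qed
  have Dgz: "norm (frechet_derivative g (at (((\<delta>, c), t), u (\<delta>, c) t)) (0, y)) \<le> M0 * norm y"
    if "(\<delta>, c) \<in> V" for \<delta> c t y
    by (rule M0(5)[OF in_near[OF that]]) (use u_lt[OF that] less_imp_le in blast)
  have oVR: "open (V \<times> (UNIV :: real set))" unfolding V_def by (intro open_Times open_dom open_UNIV)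
  interpret fam: periodic_family P "2 * P" V "ball 0 1" rhs u
  proof
    show "P > 0" "open V" "open (ball (0 :: complex) 1)" "2 * P \<ge> 0"
      using P open_dom by (auto simp: V_def)
    show "u p t \<in> ball 0 1" if "p \<in> V" for p t using u_lt[OF that] by simp
    show "rhs ((p, t + P), w) = rhs ((p, t), w)" for p t w
      using \<omega>_periodic by (simp add: rhs_def g_periodic periodic_def)
    fix p v1 v1' v2 v2' M and t :: real
    assume p: "p \<in> V" and per: "periodic P v1" "periodic P v2"
      and ball: "\<And>t. v1 t \<in> ball 0 1" "\<And>t. v2 t \<in> ball 0 1"
      and v: "\<And>t. (v1 has_vector_derivative v1' t) (at t)" "\<And>t. (v2 has_vector_derivative v2' t) (at t)"
      and le: "\<And>t. norm ((v1' t - rhs ((p, t), v1 t)) - (v2' t - rhs ((p, t), v2 t))) \<le> M"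
    obtain \<delta> c where pdc: "p = (\<delta>, c)" "(\<delta>, c) \<in> V" using p by (cases p) auto
    show "norm (v1 t - v2 t) \<le> 2 * P * M"
    proof (rule absorb[OF pdc(2)])
      show "periodic P (\<lambda>t. v1 t - v2 t)" using per by (simp add: periodic_def)
      show "((\<lambda>t. v1 t - v2 t) has_vector_derivative v1' t - v2' t) (at t)" for t
        by (intro has_vector_derivative_diff v)
      fix t
      have "v1' t - v2' t + \<i> * of_real (1 / \<delta> * \<omega> t) * (v1 t - v2 t) =
          ((v1' t - rhs ((p, t), v1 t)) - (v2' t - rhs ((p, t), v2 t)))
          + \<delta> *\<^sub>R (g (((\<delta>, c), t), v1 t) - g (((\<delta>, c), t), v2 t))"
        unfolding pdc(1) rhs_eq by (simp add: algebra_simps diff_divide_distrib)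
      also have "norm \<dots> \<le> M + \<delta> * (M0 * norm (v1 t - v2 t))"
        using lip[OF pdc(2), of "v1 t" "v2 t" t] ball[of t] le[of t] V(1)[OF pdc(2)]
        by (intro order_trans[OF norm_triangle_ineq] add_mono) auto
      finally show "norm (v1' t - v2' t + \<i> * of_real (1 / \<delta> * \<omega> t) * (v1 t - v2 t))
          \<le> M + \<delta> * (M0 * norm (v1 t - v2 t))" .
    qed
  qed (use u in auto)
  have VB: "(V \<times> UNIV) \<times> ball 0 1 \<subseteq> Box"
    using in_Box by fastforce
  have rhs_smooth: "smooth_on ((V \<times> UNIV) \<times> ball 0 1) rhs"
    unfolding rhs_def[abs_def]
    by (intro smooth_intros fam.open_D smooth_on_subset[OF g_smooth' VB]
        smooth_on_compose_UNIV[OF \<omega>_smooth]) (auto dest: V(1))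
  \<comment> \<open>Stated for every direction \<open>e\<close>: by linearity the two derivatives of
    \<open>rhs\<close> combine to the one in the direction of \<open>v t\<close> alone. With e = 0
    this is the estimate that \<open>directional_derivative\<close> asks for; with \<open>e\<close>
    a parameter direction it bounds the parameter derivative by its inhomogeneity.\<close>
  have lin: "norm (v t) \<le> 2 * P * M" if p: "p \<in> V" and v: "periodic P v" "\<And>t. (v has_vector_derivative v' t) (at t)"
    and le: "\<And>t. norm (v' t - frechet_derivative rhs (at ((p, t), u p t)) ((e, 0), v t)
        + frechet_derivative rhs (at ((p, t), u p t)) ((e, 0), 0)) \<le> M" for p e v v' M t
  proof -
    obtain \<delta> c where pdc: "p = (\<delta>, c)" "(\<delta>, c) \<in> V" using p by (cases p) auto
    obtain a b where e: "e = (a, b)" by (cases e)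
    show ?thesis
    proof (rule absorb[OF pdc(2) v])
      fix t
      let ?z = "(((\<delta>, c), t), u (\<delta>, c) t)"
      have z: "?z \<in> Box" "\<delta> \<noteq> 0"
        using in_Box[OF pdc(2)] u_lt[OF pdc(2), of t] V(1)[OF pdc(2)] less_imp_le by auto
      interpret linear "frechet_derivative g (at ?z)"
        by (rule has_derivative_linear[OF g_derivative[OF z(1)]])
      have "frechet_derivative g (at ?z) (((a, b), 0), v t) =
          frechet_derivative g (at ?z) (((a, b), 0), 0) + frechet_derivative g (at ?z) (0, v t)"
        using add[of "(((a, b), 0), 0)" "(0, v t)"] by simp
      then have "v' t + \<i> * of_real (1 / \<delta> * \<omega> t) * v t =
          (v' t - frechet_derivative rhs (at ?z) (((a, b), 0), v t) + frechet_derivative rhs (at ?z) (((a, b), 0), 0))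
          + \<delta> *\<^sub>R frechet_derivative g (at ?z) (0, v t)"
        unfolding rhs_derivative[OF z] by (simp add: scaleR_conv_of_real algebra_simps)
      also have "norm \<dots> \<le> M + \<delta> * (M0 * norm (v t))"
        using le[of t] Dgz[OF pdc(2), of t "v t"] V(1)[OF pdc(2)]
        by (intro norm_triangle_mono[of "_ - _ + _"]) (auto simp: pdc e)
      finally show "norm (v' t + \<i> * of_real (1 / \<delta> * \<omega> t) * v t) \<le> M + \<delta> * (M0 * norm (v t))" .
    qed
  qed
  have rhs_lin: "linear (frechet_derivative rhs (at ((p, t), u p t)))" if "p \<in> V" for p t
    by (rule has_derivative_linear[OF smooth_on_has_derivative[OF rhs_smooth]])
      (use that u_lt in auto)
  have lin0: "norm (v t) \<le> 2 * P * M" if p: "p \<in> V" and v: "periodic P v" "\<And>t. (v has_vector_derivative v' t) (at t)"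
    and le: "\<And>t. norm (v' t - frechet_derivative rhs (at ((p, t), u p t)) ((0, 0), v t)) \<le> M" for p v v' M t
  proof (rule lin[OF p v, of 0])
    show "norm (v' t - frechet_derivative rhs (at ((p, t), u p t)) ((0, 0), v t)
        + frechet_derivative rhs (at ((p, t), u p t)) ((0, 0), 0)) \<le> M" for t
      using le[of t] linear_0[OF rhs_lin[OF p, of t]] by (simp add: zero_prod_def)
  qed
  have u_smooth: "smooth_on (V \<times> UNIV) (\<lambda>(p, t). u p t)"
    by (rule fam.u_smooth[OF rhs_smooth]) (use lin0 in blast)
  \<comment> \<open>The parameter derivative is the periodic solution \<open>h\<close> of the
    linearised equation, so the expression estimated in \<open>lin\<close> reduces to the derivative
    of \<open>rhs\<close> in the direction of the parameters.\<close>
  have D_bound: "norm (frechet_derivative (\<lambda>(p, t). u p t) (at (p, t)) (e, 0)) \<le> 2 * P * N"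
    if p: "p \<in> V" and N: "\<And>t. norm (frechet_derivative rhs (at ((p, t), u p t)) ((e, 0), 0)) \<le> N" for p t e N
  proof -
    obtain h where h: "periodic P h" "\<And>t. ((\<lambda>s. u (p + s *\<^sub>R e) t) has_vector_derivative h t) (at 0)"
      "\<And>t. (h has_vector_derivative frechet_derivative rhs (at ((p, t), u p t)) ((e, 0), h t)) (at t)"
      by (rule fam.directional_derivative[OF smooth_onD[OF rhs_smooth, of 1] p, of e]) (use lin0[OF p] in blast)+
    have "((\<lambda>(p, t). u p t) has_derivative frechet_derivative (\<lambda>(p, t). u p t) (at (p, t))) (at ((p, t) + 0 *\<^sub>R (e, 0)))"
      using smooth_on_has_derivative[OF u_smooth, of "(p, t)"] p by simp
    from has_vector_derivative_line[OF this]
    have "frechet_derivative (\<lambda>(p, t). u p t) (at (p, t)) (e, 0) = h t"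
      using h(2)[of t] vector_derivative_unique_at by fastforce
    moreover have "norm (h t) \<le> 2 * P * N"
      by (rule lin[OF p h(1,3), of e]) (use N in simp)
    ultimately show ?thesis by simp
  qed
  define M where "M = P * M0 + 2 * P * (W * P * M0 + 2 * M0) + 2 * P * M0"
  have M: "M > 0" "P * M0 \<le> M" "2 * P * (W * P * M0 + 2 * M0) \<le> M" "2 * P * M0 \<le> M"
    using P M0(1) W0 by (auto simp: M_def add_pos_nonneg add_nonneg_nonneg)
  show ?thesis
  proof (rule that[of \<delta>2 M u])
    show "\<delta>2 \<le> 1" using \<delta>2 half by linarith
    show "norm (u (\<delta>, c) t) \<le> M * \<delta>" if "(\<delta>, c) \<in> dom \<delta>2" for \<delta> c t
    proof -
      have "norm (u (\<delta>, c) t) \<le> (P * M0) * \<delta>" using u(2)[of "(\<delta>, c)" t] that by (simp add: V_def algebra_simps)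
      also have "\<dots> \<le> M * \<delta>" using M V[of \<delta> c] that by (intro mult_right_mono) (auto simp: V_def)
      finally show ?thesis .
    qed
    show "norm (frechet_derivative (\<lambda>(p, t). u p t) (at ((\<delta>, c), t)) ((1, 0), 0)) \<le> M / \<delta>"
      if "(\<delta>, c) \<in> dom \<delta>2" for \<delta> c t
    proof -
      have p: "(\<delta>, c) \<in> V" using that by (simp add: V_def)
      note V' = V[OF p]
      have "norm (frechet_derivative (\<lambda>(p, t). u p t) (at ((\<delta>, c), t)) ((1, 0), 0))
          \<le> 2 * P * ((W * P * M0 + 2 * M0) / \<delta>)"
      proof (rule D_bound[OF p])
        fix t
        let ?z = "(((\<delta>, c), t), u (\<delta>, c) t)"
        have z: "?z \<in> Box" "\<delta> \<noteq> 0" "?z \<in> near"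
          using in_Box[OF p] in_near[OF p] u_lt[OF p, of t] V'(1) less_imp_le by auto
        have "norm (frechet_derivative rhs (at ?z) (((1, 0), 0), 0)) \<le>
            \<bar>\<omega> t\<bar> / \<delta>\<^sup>2 * norm (u (\<delta>, c) t) + M0 + \<delta> * M0"
        proof -
          have "frechet_derivative rhs (at ?z) (((1, 0), 0), 0) = (\<omega> t / \<delta>\<^sup>2) *\<^sub>R (\<i> * u (\<delta>, c) t)
              + g ?z + \<delta> *\<^sub>R frechet_derivative g (at ?z) (((1, 0), 0), 0)"
            unfolding rhs_derivative[OF z(1,2)] by simp
          then show ?thesis
            using M0(2,3)[OF z(3)] V'(1) by (auto intro!: norm_triangle_mono simp: norm_mult)
        qed
        \<comment> \<open>The smallness of \<open>u\<close> cancels one of the two powers of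
          1/\<delta>.\<close>
        also have "\<bar>\<omega> t\<bar> / \<delta>\<^sup>2 * norm (u (\<delta>, c) t) \<le> W / \<delta>\<^sup>2 * (P * (\<delta> * M0))"
          using W[of t] u(2)[OF p, of t] W0 by (intro mult_mono divide_right_mono) auto
        also have "\<dots> = W * P * M0 / \<delta>" using V'(1) by (simp add: power2_eq_square)
        also have "W * P * M0 / \<delta> + M0 + \<delta> * M0 \<le> W * P * M0 / \<delta> + M0 / \<delta> + M0 / \<delta>"
        proof -
          have "M0 \<le> M0 / \<delta>" using V'(1,3) M0(1) by (simp add: pos_le_divide_eq)
          moreover have "\<delta> * M0 \<le> M0" using V'(1,3) M0(1) by simp
          ultimately show ?thesis by linarith
        qed
        also have "\<dots> = (W * P * M0 + 2 * M0) / \<delta>" by (simp add: add_divide_distrib)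
        finally show "norm (frechet_derivative rhs (at ?z) (((1, 0), 0), 0)) \<le> (W * P * M0 + 2 * M0) / \<delta>"
          by simp
      qed
      also have "\<dots> \<le> M / \<delta>" using M(3) V'(1) by (simp add: divide_right_mono)
      finally show ?thesis .
    qed
    show "norm (frechet_derivative (\<lambda>(p, t). u p t) (at ((\<delta>, c), t)) ((0, 1), 0)) \<le> M * \<delta>"
      if "(\<delta>, c) \<in> dom \<delta>2" for \<delta> c t
    proof -
      have p: "(\<delta>, c) \<in> V" using that by (simp add: V_def)
      note V' = V[OF p]
      have "norm (frechet_derivative (\<lambda>(p, t). u p t) (at ((\<delta>, c), t)) ((0, 1), 0)) \<le> 2 * P * (\<delta> * M0)"
      proof (rule D_bound[OF p])
        fix t
        let ?z = "(((\<delta>, c), t), u (\<delta>, c) t)"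
        have z: "?z \<in> Box" "\<delta> \<noteq> 0" "?z \<in> near"
          using in_Box[OF p] in_near[OF p] u_lt[OF p, of t] V'(1) less_imp_le by auto
        show "norm (frechet_derivative rhs (at ?z) (((0, 1), 0), 0)) \<le> \<delta> * M0"
          unfolding rhs_derivative[OF z(1,2)] using M0(4)[OF z(3)] V'(1) by simp
      qed
      also have "\<dots> = (2 * P * M0) * \<delta>" by simp
      also have "\<dots> \<le> M * \<delta>" using M(4) V'(1) by (intro mult_right_mono) auto
      finally show ?thesis .
    qed
  qed (use \<delta>2 M u u_lt u_smooth in \<open>auto simp: V_def\<close>)
qed

end

section \<open>The slow manifold\<close>

lemma periodic_deriv:
  fixes f :: "real \<Rightarrow> real"
  assumes "periodic P f" "smooth_on UNIV f"
  shows "periodic P (deriv f)"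
  unfolding periodic_def
proof
  fix t
  have "(f has_vector_derivative deriv f t) (at (t + P))"
    by (rule has_vd_periodic[OF _ assms(1)])
      (use smooth_on_UNIV_deriv(1)[OF assms(2)] in \<open>simp add: has_real_derivative_iff_has_vector_derivative\<close>)
  then show "deriv f (t + P) = deriv f t"
    by (simp add: DERIV_imp_deriv has_real_derivative_iff_has_vector_derivative)
qed

locale slow_manifold =
  fixes k1 k :: nat and d1 d2 P :: real and L :: "real \<Rightarrow> real"
  assumes k: "k > 0" and d2: "d2 > 0" and P: "P > 0"
    and L_smooth: "smooth_on UNIV L" and L_pos: "\<And>t. L t > 0" and L_periodic: "periodic P L"
begin

text \<open>With x = (l2/\<delta>)^2 L^(2 k1 / k), the product of the warps is \<delta>^k x^(k/2),
  and d2 / l2^2 = m / (\<delta>^2 x). All dependence on \<open>L\<close> then sits in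
  \<open>m\<close> and \<open>e\<close>.\<close>

definition m where "m t = d2 * L t powr (2 * real k1 / real k)"
definition e where "e t = d1 / (L t)\<^sup>2"
text \<open>The zero of 1 - m / x^(k+1), which is what the z equation leaves at \<delta> =
  0.\<close>

definition x0 where "x0 t = m t powr (1 / (real k + 1))"
text \<open>Linearised around \<open>x0\<close>, the deviations of x and z drive each other with
  coefficients - \<open>\<alpha>\<close> and \<open>\<beta>\<close>; \<open>\<beta>\<close> is the
  slope of 1 - m / x^(k+1) at \<open>x0\<close>.\<close>

definition \<alpha> where "\<alpha> t = 2 * m t / real k"
definition \<beta> where "\<beta> t = (real k + 1) * m t / x0 t ^ (k + 2)"
definition \<omega> where "\<omega> t = sqrt (\<alpha> t * \<beta> t)"
text \<open>Scaling the two deviations by r and 1/r turns both coefficients into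
  \<open>\<omega>\<close>. As \<open>r\<close> depends on t, its derivative then appears in the
  equations; \<open>\<rho>\<close> serves to remove it.\<close>

definition r where "r t = (\<alpha> t / \<beta> t) powr (1/4)"
definition \<rho> where "\<rho> t = deriv r t / \<alpha> t"

text \<open>\<open>z\<^sub>1\<close>, \<open>x\<^sub>2\<close> and \<open>z\<^sub>3\<close> are the coefficients of the slow manifold
  \<open>x = x\<^sub>0 + \<delta>\<^sup>2 x\<^sub>2 + \<dots>\<close>, \<open>z = \<delta> z\<^sub>1 + \<delta>\<^sup>3 z\<^sub>3 + \<dots>\<close>; the last two are affine in \<open>c\<^sup>2\<close>.\<close>

definition z1 where "z1 t = - deriv x0 t / \<alpha> t"
definition x2a where "x2a t = (deriv z1 t - e t / x0 t ^ k) / \<beta> t"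
definition x2b where "x2b t = 2 / (x0 t ^ k * \<beta> t)"
definition x2 where "x2 c t = x2a t + c\<^sup>2 * x2b t"
definition z3a where "z3a t = (2 / real k * z1 t * e t * x0 t - deriv x2a t) / \<alpha> t"
definition z3b where "z3b t = - deriv x2b t / \<alpha> t"
definition z3 where "z3 c t = z3a t + c\<^sup>2 * z3b t"

lemma m_pos: "m t > 0" using d2 L_pos[of t] by (simp add: m_def)
lemma x0_pos: "x0 t > 0" using m_pos[of t] by (simp add: x0_def)
lemma \<alpha>_pos: "\<alpha> t > 0" using m_pos[of t] k by (simp add: \<alpha>_def)
lemma \<beta>_pos: "\<beta> t > 0" using m_pos[of t] x0_pos[of t] by (simp add: \<beta>_def add_nonneg_pos)
lemma \<omega>_pos: "\<omega> t > 0" using \<alpha>_pos[of t] \<beta>_pos[of t] by (simp add: \<omega>_def)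
lemma r_pos: "r t > 0" using \<alpha>_pos[of t] \<beta>_pos[of t] by (simp add: r_def)

lemma x0_power: "x0 t ^ (k + 1) = m t"
proof -
  have "x0 t ^ (k + 1) = x0 t powr real (k + 1)" by (rule powr_realpow[OF x0_pos, symmetric])
  also have "\<dots> = m t powr (1 / (real k + 1) * (real k + 1))" by (simp add: x0_def powr_powr add.commute)
  also have "1 / (real k + 1) * (real k + 1) = 1" by simp
  finally show ?thesis using m_pos[of t] by simp
qed

lemma r_square: "(r t)\<^sup>2 = sqrt (\<alpha> t / \<beta> t)"
proof -
  have "(r t)\<^sup>2 = r t powr 2" using r_pos[of t] by simp
  also have "\<dots> = (\<alpha> t / \<beta> t) powr (1/2)" by (simp add: r_def powr_powr)
  finally show ?thesis using \<alpha>_pos[of t] \<beta>_pos[of t] by (simp add: powr_half_sqrt)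
qed

lemma r_\<alpha>: "(r t)\<^sup>2 * \<omega> t = \<alpha> t"
  using \<alpha>_pos[of t] \<beta>_pos[of t] unfolding r_square \<omega>_def
  by (simp add: real_sqrt_divide real_sqrt_mult)

lemma r_\<beta>: "\<beta> t * (r t)\<^sup>2 = \<omega> t"
proof -
  have "\<beta> t = sqrt (\<beta> t) * sqrt (\<beta> t)" using \<beta>_pos[of t] by simp
  then show ?thesis
    using \<alpha>_pos[of t] \<beta>_pos[of t] unfolding r_square \<omega>_def
    by (simp add: real_sqrt_divide real_sqrt_mult field_simps)
qed

lemmas pos = m_pos x0_pos \<alpha>_pos \<beta>_pos \<omega>_pos r_pos L_pos
lemmas nz = pos[THEN less_imp_neq, symmetric]

lemma m_smooth: "smooth_on UNIV m"
  unfolding m_def[abs_def] by (intro smooth_intros open_UNIV L_smooth L_pos)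
lemma e_smooth: "smooth_on UNIV e"
  unfolding e_def[abs_def] by (intro smooth_intros open_UNIV L_smooth) (simp add: nz)
lemma x0_smooth: "smooth_on UNIV x0"
  unfolding x0_def[abs_def] by (intro smooth_intros open_UNIV m_smooth m_pos)
lemma \<alpha>_smooth: "smooth_on UNIV \<alpha>"
  unfolding \<alpha>_def[abs_def] using k by (intro smooth_intros open_UNIV m_smooth) simp
lemma \<beta>_smooth: "smooth_on UNIV \<beta>"
  unfolding \<beta>_def[abs_def] by (intro smooth_intros open_UNIV m_smooth x0_smooth) (simp add: nz)
lemma \<omega>_smooth: "smooth_on UNIV \<omega>"
  unfolding \<omega>_def[abs_def] by (intro smooth_intros open_UNIV \<alpha>_smooth \<beta>_smooth) (simp add: pos)
lemma r_smooth: "smooth_on UNIV r"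
  unfolding r_def[abs_def] by (intro smooth_intros open_UNIV \<alpha>_smooth \<beta>_smooth) (simp_all add: pos nz)
lemma \<rho>_smooth: "smooth_on UNIV \<rho>"
  unfolding \<rho>_def[abs_def]
  by (intro smooth_intros open_UNIV \<alpha>_smooth smooth_on_UNIV_deriv(2) r_smooth) (simp_all add: nz)
lemma z1_smooth: "smooth_on UNIV z1"
  unfolding z1_def[abs_def]
  by (intro smooth_intros open_UNIV \<alpha>_smooth smooth_on_UNIV_deriv(2) x0_smooth) (simp_all add: nz)
lemma x2a_smooth: "smooth_on UNIV x2a"
  unfolding x2a_def[abs_def]
  by (intro smooth_intros open_UNIV e_smooth \<beta>_smooth smooth_on_UNIV_deriv(2) z1_smooth x0_smooth) (simp_all add: nz)
lemma x2b_smooth: "smooth_on UNIV x2b"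
  unfolding x2b_def[abs_def]
  by (intro smooth_intros open_UNIV \<beta>_smooth x0_smooth) (simp_all add: nz)
lemma z3a_smooth: "smooth_on UNIV z3a"
  unfolding z3a_def[abs_def]
  by (intro smooth_intros open_UNIV e_smooth \<alpha>_smooth smooth_on_UNIV_deriv(2) z1_smooth x0_smooth x2a_smooth) (simp_all add: nz)
lemma z3b_smooth: "smooth_on UNIV z3b"
  unfolding z3b_def[abs_def]
  by (intro smooth_intros open_UNIV \<alpha>_smooth smooth_on_UNIV_deriv(2) x2b_smooth) (simp_all add: nz)

lemmas smooths = m_smooth e_smooth x0_smooth \<alpha>_smooth \<beta>_smooth \<omega>_smooth r_smooth \<rho>_smooth z1_smooth
  x2a_smooth x2b_smooth z3a_smooth z3b_smooth L_smooth
lemmas smooth_comps = smooths[THEN smooth_on_compose_UNIV]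
  smooth_on_UNIV_deriv(2)[OF \<rho>_smooth, THEN smooth_on_compose_UNIV]
  smooth_on_UNIV_deriv(2)[OF z3a_smooth, THEN smooth_on_compose_UNIV]
  smooth_on_UNIV_deriv(2)[OF z3b_smooth, THEN smooth_on_compose_UNIV]
lemmas ders = smooths[THEN smooth_on_UNIV_deriv(1)]

lemma L_per: "L (t + P) = L t" using L_periodic by (simp add: periodic_def)
lemma m_per: "m (t + P) = m t" by (simp add: m_def L_per)
lemma e_per: "e (t + P) = e t" by (simp add: e_def L_per)
lemma x0_per: "x0 (t + P) = x0 t" by (simp add: x0_def m_per)
lemma \<alpha>_per: "\<alpha> (t + P) = \<alpha> t" by (simp add: \<alpha>_def m_per)
lemma \<beta>_per: "\<beta> (t + P) = \<beta> t" by (simp add: \<beta>_def m_per x0_per)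
lemma \<omega>_per: "\<omega> (t + P) = \<omega> t" by (simp add: \<omega>_def \<alpha>_per \<beta>_per)
lemma r_per: "r (t + P) = r t" by (simp add: r_def \<alpha>_per \<beta>_per)
lemma deriv_per: "smooth_on UNIV f \<Longrightarrow> (\<And>t. f (t + P) = f t) \<Longrightarrow> deriv f (t + P) = deriv f t"
  for f :: "real \<Rightarrow> real"
  using periodic_deriv[of P f] by (simp add: periodic_def)
lemma \<rho>_per: "\<rho> (t + P) = \<rho> t" by (simp add: \<rho>_def \<alpha>_per deriv_per[OF r_smooth r_per])
lemma z1_per: "z1 (t + P) = z1 t" by (simp add: z1_def \<alpha>_per deriv_per[OF x0_smooth x0_per])
lemma x2a_per: "x2a (t + P) = x2a t"
  by (simp add: x2a_def e_per x0_per \<beta>_per deriv_per[OF z1_smooth z1_per])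
lemma x2b_per: "x2b (t + P) = x2b t" by (simp add: x2b_def x0_per \<beta>_per)
lemma z3a_per: "z3a (t + P) = z3a t"
  by (simp add: z3a_def z1_per e_per x0_per \<alpha>_per deriv_per[OF x2a_smooth x2a_per])
lemma z3b_per: "z3b (t + P) = z3b t"
  by (simp add: z3b_def \<alpha>_per deriv_per[OF x2b_smooth x2b_per])

lemmas pers = L_per m_per e_per x0_per \<alpha>_per \<beta>_per \<omega>_per r_per \<rho>_per z1_per x2a_per x2b_per z3a_per z3b_per
  deriv_per[OF \<rho>_smooth \<rho>_per] deriv_per[OF z3a_smooth z3a_per] deriv_per[OF z3b_smooth z3b_per]

text \<open>Everything is a power of \<open>m\<close>: y0^2 = x0^(-k), and \<alpha> \<beta> = (2 +
  2/k) x0^k because x0^(k+1) = m.\<close>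

lemma \<omega>_eq_q0: "\<omega> t = sqrt (q0 k1 k d2 L t)"
proof -
  have "y0 k1 k d2 L t = m t powr (- (real k / (2 * (real k + 1))))"
  proof -
    have "m t powr (- (real k / (2 * (real k + 1)))) =
        d2 powr (- (real k / (2 * (real k + 1)))) *
        L t powr (2 * real k1 / real k * (- (real k / (2 * (real k + 1)))))"
      using d2 L_pos[of t] unfolding m_def by (simp add: powr_mult powr_powr)
    moreover have "2 * real k1 / real k * (- (real k / (2 * (real k + 1)))) = - (real k1 / (real k + 1))"
      using k by (simp add: field_simps)
    ultimately show ?thesis by (simp add: y0_def algebra_simps)
  qed
  then have "(y0 k1 k d2 L t)\<^sup>2 =
      m t powr (- (real k / (2 * (real k + 1))) + - (real k / (2 * (real k + 1))))"
    by (simp only: power2_eq_square powr_add)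
  also have "- (real k / (2 * (real k + 1))) + - (real k / (2 * (real k + 1))) = - (real k / (real k + 1))"
    by (simp add: divide_simps)
  finally have "(y0 k1 k d2 L t)\<^sup>2 = m t powr (- (real k / (real k + 1)))" .
  moreover have "m t powr (- (real k / (real k + 1))) = 1 / x0 t ^ k"
  proof -
    have "x0 t ^ k = x0 t powr real k" using x0_pos[of t] by (simp add: powr_realpow)
    also have "\<dots> = m t powr (real k / (real k + 1))" by (simp add: x0_def powr_powr)
    finally show ?thesis by (simp add: powr_minus_divide)
  qed
  ultimately have q: "q0 k1 k d2 L t = (2 + 2 / real k) * x0 t ^ k" by (simp add: q0_def)
  have "\<alpha> t * \<beta> t = (2 * (real k + 1) / real k) * (m t * m t / x0 t ^ (k + 2))"
    by (simp add: \<alpha>_def \<beta>_def)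
  also have "m t * m t / x0 t ^ (k + 2) = x0 t ^ k"
    unfolding x0_power[symmetric] using x0_pos[of t] by (simp add: field_simps power_add[symmetric] flip: power_Suc)
  also have "2 * (real k + 1) / real k = 2 + 2 / real k" using k by (simp add: field_simps)
  finally show ?thesis by (simp add: \<omega>_def q)
qed

subsection \<open>Expansion of the right-hand side\<close>

text \<open>The variable \<open>z = (\<mu>, c, t, \<xi>, b)\<close> stands for \<open>\<mu> = \<delta>\<^sup>2\<close>, \<open>x = x\<^sub>0(t) + \<mu> \<xi>\<close> and the
  square \<open>\<mu> b\<close> of the velocity variable.\<close>

definition D :: "(real \<times> real \<times> real \<times> real \<times> real) set" where
  "D = {(\<mu>, c, t, \<xi>, b). \<bar>\<mu>\<bar> * \<bar>\<xi>\<bar> < x0 t / 2 \<and> \<bar>\<mu>\<bar> * ((c\<^sup>2 + 1) * (2 / x0 t) ^ k) < 1 / 2 \<and>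
    \<bar>\<mu>\<bar> * (32 * (2 / x0 t) ^ k) < 1 \<and> \<bar>\<mu>\<bar> * \<bar>b\<bar> < (2 / (3 * x0 t)) ^ k}"

definition X where "X = (\<lambda>(\<mu>, c :: real, t, \<xi>, b :: real). x0 t + \<mu> * \<xi>)"
definition V where "V z = inverse (X z) ^ k"
definition Bq where "Bq = (\<lambda>(\<mu>, c, t, \<xi>, b). 1 - (c\<^sup>2 - 1) * \<mu> * V (\<mu>, c, t, \<xi>, b))"
definition N where "N = (\<lambda>(\<mu>, c, t, \<xi>, b). V (\<mu>, c, t, \<xi>, b) + \<mu> * b)"
definition rt where "rt z = sqrt ((Bq z)\<^sup>2 - 4 * fst z * N z)"
text \<open>The root of \<mu> y^2 - Bq y + N = 0 that stays bounded as \<mu> tends to 0, in the form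
  without \<mu> in the denominator, hence smooth across \<mu> = 0; \<open>rt\<close> is the square
  root of the discriminant.\<close>

definition Y where "Y z = 2 * N z / (Bq z + rt z)"
definition Q where "Q = (\<lambda>(\<mu>, c, t, \<xi>, b). 1 + (c\<^sup>2 - 1) * \<mu> * Y (\<mu>, c, t, \<xi>, b))"
text \<open>Along a solution, \<delta> z' = G1 + \<mu> KK; \<open>G1\<close> is the part that
  vanishes at \<mu> = 0 without the factor \<mu> being visible.\<close>

definition G1 where "G1 = (\<lambda>(\<mu>, c, t, \<xi>, b). 1 - m t * V (\<mu>, c, t, \<xi>, b) / X (\<mu>, c, t, \<xi>, b))"
definition KK where "KK = (\<lambda>(\<mu>, c, t, \<xi>, b). let z = (\<mu>, c, t, \<xi>, b) in
  - (c\<^sup>2 - 1) * m t * Y z * V z / X z + e t * Q z * V z - 2 * Y z - (c\<^sup>2 - 1) * V z)"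
text \<open>The two phase velocities are \<sigma> S1 / \<delta> and \<sigma> c \<delta> S2.\<close>

definition S1 where "S1 z = sqrt (V z) / Y z"
definition S2 where "S2 z = sqrt (V z) / (1 - fst z * Y z)"

lemma open_D: "open D"
proof -
  have c: "continuous_on UNIV (\<lambda>z :: real \<times> real \<times> real \<times> real \<times> real. x0 (fst (snd (snd z))))"
    by (rule continuous_on_compose2[OF smooth_on_continuous[OF x0_smooth]]) (auto intro!: continuous_intros)
  have "D = {z. \<bar>fst z\<bar> * \<bar>fst (snd (snd (snd z)))\<bar> < x0 (fst (snd (snd z))) / 2 \<and>
      \<bar>fst z\<bar> * (((fst (snd z))\<^sup>2 + 1) * (2 / x0 (fst (snd (snd z)))) ^ k) < 1 / 2 \<and>
      \<bar>fst z\<bar> * (32 * (2 / x0 (fst (snd (snd z)))) ^ k) < 1 \<and>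
      \<bar>fst z\<bar> * \<bar>snd (snd (snd (snd z)))\<bar> < (2 / (3 * x0 (fst (snd (snd z))))) ^ k}"
    by (auto simp: D_def)
  also have "open \<dots>"
    by (intro open_Collect_conj open_Collect_less continuous_intros c) (simp_all add: nz)
  finally show ?thesis .
qed

lemma D_0: "(0, q) \<in> D"
  using x0_pos by (cases q) (simp add: D_def)

text \<open>Every bound in \<open>D\<close> limits |\<mu>| times a nonnegative quantity free of
  \<mu>; this shape is what \<open>hadamard\<close> asks for.\<close>

lemma D_star: "(\<mu>, q) \<in> D \<Longrightarrow> 0 \<le> \<theta> \<Longrightarrow> \<theta> \<le> 1 \<Longrightarrow> (\<theta> * \<mu>, q) \<in> D"
proof -
  assume D: "(\<mu>, q) \<in> D" and \<theta>: "0 \<le> \<theta>" "\<theta> \<le> 1"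
  have le: "\<bar>\<theta> * \<mu>\<bar> * a \<le> \<bar>\<mu>\<bar> * a" if "a \<ge> 0" for a
    using \<theta> that by (auto simp: abs_mult mult_left_le_one_le intro!: mult_right_mono)
  obtain c t \<xi> b where q: "q = (c, t, \<xi>, b)" by (metis prod.exhaust)
  have "0 \<le> (c\<^sup>2 + 1) * (2 / x0 t) ^ k" "0 \<le> 32 * (2 / x0 t) ^ k"
    using x0_pos[of t] by (simp_all add: less_imp_le)
  from le[OF this(1)] le[OF this(2)] le[of "\<bar>\<xi>\<bar>"] le[of "\<bar>b\<bar>"] D show "(\<theta> * \<mu>, q) \<in> D"
    unfolding q D_def by auto
qed

text \<open>The four bounds keep X between x0/2 and 3 x0/2, Bq above 1/2, N positive and |\<mu>| N
  below 1/16. The discriminant then exceeds (1/2)^2 - 4/16 = 0, and Y \<le> 4 N gives |\<mu> Y| <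
  1.\<close>

lemma D_facts:
  assumes "(\<mu>, c, t, \<xi>, b) \<in> D"
  defines "z \<equiv> (\<mu>, c, t, \<xi>, b)"
  shows "X z > 0" "V z > 0" "N z > 0" "Bq z > 1/2" "(Bq z)\<^sup>2 - 4 * \<mu> * N z > 0" "rt z > 0" "Y z > 0"
    "\<bar>\<mu> * Y z\<bar> < 1"
proof -
  define A where "A = (2 / x0 t) ^ k"
  have D: "\<bar>\<mu>\<bar> * \<bar>\<xi>\<bar> < x0 t / 2" "\<bar>\<mu>\<bar> * ((c\<^sup>2 + 1) * A) < 1 / 2" "\<bar>\<mu>\<bar> * (32 * A) < 1"
    "\<bar>\<mu>\<bar> * \<bar>b\<bar> < (2 / (3 * x0 t)) ^ k"
    using assms(1) by (auto simp: D_def A_def)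
  have "\<bar>\<mu> * \<xi>\<bar> < x0 t / 2" using D(1) by (simp add: abs_mult)
  then have X: "x0 t / 2 < X z" "X z < 3 * x0 t / 2"
    unfolding X_def z_def by (auto simp: abs_less_iff)
  then show X0: "X z > 0" using x0_pos[of t] by linarith
  have inv: "inverse (X z) < 2 / x0 t" "2 / (3 * x0 t) < inverse (X z)"
    using X X0 x0_pos[of t] by (simp_all add: field_simps)
  have V: "V z < A" "(2 / (3 * x0 t)) ^ k < V z"
    unfolding V_def A_def using inv X0 x0_pos[of t] k by (auto intro!: power_strict_mono less_imp_le)
  show V0: "V z > 0" using X0 by (simp add: V_def)
  have A0: "A > 0" using V V0 by linarith
  have b: "\<bar>\<mu> * b\<bar> < V z" using D(4) V(2) by (simp add: abs_mult)
  then show N0: "N z > 0" by (auto simp: N_def z_def[symmetric] abs_less_iff) (simp add: N_def z_def)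
  have N: "N z < 2 * A" using b V by (simp add: N_def z_def)
  have "\<bar>(c\<^sup>2 - 1) * \<mu> * V z\<bar> = \<bar>\<mu>\<bar> * (\<bar>c\<^sup>2 - 1\<bar> * V z)" using V0 by (simp add: abs_mult)
  also have "\<dots> \<le> \<bar>\<mu>\<bar> * ((c\<^sup>2 + 1) * A)"
    using V V0 by (intro mult_left_mono mult_mono) (auto simp: abs_le_iff)
  finally have "\<bar>(c\<^sup>2 - 1) * \<mu> * V z\<bar> < 1 / 2" using D(2) by linarith
  then show B: "Bq z > 1/2" by (simp add: Bq_def z_def abs_less_iff)
  have \<mu>N: "\<bar>\<mu>\<bar> * N z < 1 / 16"
  proof -
    have "\<bar>\<mu>\<bar> * N z \<le> \<bar>\<mu>\<bar> * (2 * A)" using N by (intro mult_left_mono) auto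
    then show ?thesis using D(3) by linarith
  qed
  have "\<mu> * N z \<le> \<bar>\<mu>\<bar> * N z" using N0 by (intro mult_right_mono) auto
  moreover have "(1/2)\<^sup>2 < (Bq z)\<^sup>2" using B by (intro power_strict_mono) auto
  ultimately show disc: "(Bq z)\<^sup>2 - 4 * \<mu> * N z > 0" using \<mu>N by (simp add: power2_eq_square)
  then show rt: "rt z > 0" by (simp add: rt_def z_def)
  show Y: "Y z > 0" using N0 B rt by (simp add: Y_def)
  have "Y z \<le> 2 * N z / (1/2)"
    unfolding Y_def using N0 B rt by (intro divide_left_mono) auto
  then have "\<bar>\<mu>\<bar> * Y z \<le> \<bar>\<mu>\<bar> * (4 * N z)" by (intro mult_left_mono) auto
  then show "\<bar>\<mu> * Y z\<bar> < 1" using \<mu>N Y by (simp add: abs_mult)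
qed

text \<open>The second identity says that the quadratic has slope - \<open>rt\<close> at
  \<open>Y\<close>, so the root is simple; this is what later determines y'.\<close>

lemma Y_quadratic:
  assumes "(\<mu>, c, t, \<xi>, b) \<in> D"
  defines "z \<equiv> (\<mu>, c, t, \<xi>, b)"
  shows "Q z * V z = Y z - \<mu> * (Y z)\<^sup>2 - \<mu> * b" "1 - 2 * \<mu> * Y z - (c\<^sup>2 - 1) * \<mu> * V z = rt z"
    "\<mu> \<ge> 0 \<Longrightarrow> Q z > 0"
proof -
  note f = D_facts[OF assms(1), folded z_def]
  have s: "(rt z)\<^sup>2 = (Bq z)\<^sup>2 - 4 * \<mu> * N z" using f(5) by (simp add: rt_def z_def)
  have y: "Y z * (Bq z + rt z) = 2 * N z" using f(4,6) by (simp add: Y_def)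
  have nz: "Bq z + rt z \<noteq> 0" using f(4,6) by linarith
  have "(Bq z - 2 * \<mu> * Y z) * (Bq z + rt z) = Bq z * (Bq z + rt z) - 2 * \<mu> * (2 * N z)"
    unfolding y[symmetric] by (simp add: algebra_simps)
  also have "\<dots> = rt z * (Bq z + rt z)" using s by (simp add: algebra_simps power2_eq_square)
  finally have eq: "Bq z - 2 * \<mu> * Y z = rt z" using nz by simp
  then show "1 - 2 * \<mu> * Y z - (c\<^sup>2 - 1) * \<mu> * V z = rt z" by (simp add: Bq_def z_def)
  have "Y z * (2 * Bq z - 2 * \<mu> * Y z) = 2 * N z" using y eq by (simp add: algebra_simps)
  then have "N z = Y z * Bq z - \<mu> * (Y z)\<^sup>2" by (simp add: algebra_simps power2_eq_square)
  then have qd: "V z + \<mu> * b = Y z * (1 - (c\<^sup>2 - 1) * \<mu> * V z) - \<mu> * (Y z)\<^sup>2"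
    by (simp add: N_def Bq_def z_def)
  then show QV: "Q z * V z = Y z - \<mu> * (Y z)\<^sup>2 - \<mu> * b" by (simp add: Q_def z_def algebra_simps)
  have "Q z = 1 - \<mu> * Y z + c\<^sup>2 * (\<mu> * Y z)" by (simp add: Q_def z_def algebra_simps)
  show "Q z > 0" if "\<mu> \<ge> 0"
  proof -
    have "c\<^sup>2 * (\<mu> * Y z) \<ge> 0" using f(7) that by simp
    then show ?thesis using \<open>Q z = _\<close> f(8) by (simp add: abs_less_iff)
  qed
qed

text \<open>The definitions use patterns, the smoothness rules need projections.\<close>

lemma tuple_forms:
  "X z = x0 (fst (snd (snd z))) + fst z * fst (snd (snd (snd z)))"
  "Bq z = 1 - ((fst (snd z))\<^sup>2 - 1) * fst z * V z"
  "N z = V z + fst z * snd (snd (snd (snd z)))"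
  "Q z = 1 + ((fst (snd z))\<^sup>2 - 1) * fst z * Y z"
  "G1 z = 1 - m (fst (snd (snd z))) * V z / X z"
  "KK z = - ((fst (snd z))\<^sup>2 - 1) * m (fst (snd (snd z))) * Y z * V z / X z
    + e (fst (snd (snd z))) * Q z * V z - 2 * Y z - ((fst (snd z))\<^sup>2 - 1) * V z"
  by (cases z; simp add: X_def Bq_def N_def Q_def G1_def KK_def Let_def)+

lemma D_facts':
  assumes "z \<in> D"
  shows "X z > 0" "V z > 0" "N z > 0" "Bq z > 1/2" "(Bq z)\<^sup>2 - 4 * fst z * N z > 0" "rt z > 0" "Y z > 0"
    "\<bar>fst z * Y z\<bar> < 1"
  using assms by (cases z; use D_facts in auto)+

lemma D_nz:
  assumes "z \<in> D"
  shows "X z \<noteq> 0" "V z \<noteq> 0" "Bq z + rt z \<noteq> 0" "Y z \<noteq> 0" "1 - fst z * Y z \<noteq> 0"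
  using D_facts'[OF assms] by (auto simp: abs_less_iff)

lemma X_smooth: "smooth_on D X"
  unfolding tuple_forms(1)[abs_def] by (intro smooth_intros open_D smooth_comps)
lemma V_smooth: "smooth_on D V"
  unfolding V_def[abs_def] by (intro smooth_intros open_D X_smooth) (simp add: D_nz)
lemma Bq_smooth: "smooth_on D Bq"
  unfolding tuple_forms(2)[abs_def] by (intro smooth_intros open_D V_smooth)
lemma N_smooth: "smooth_on D N"
  unfolding tuple_forms(3)[abs_def] by (intro smooth_intros open_D V_smooth)
lemma rt_smooth: "smooth_on D rt"
  unfolding rt_def[abs_def] by (intro smooth_intros open_D Bq_smooth N_smooth) (use D_facts'(5) in simp)
lemma Y_smooth: "smooth_on D Y"
  unfolding Y_def[abs_def] by (intro smooth_intros open_D Bq_smooth N_smooth rt_smooth) (simp add: D_nz)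
lemma Q_smooth: "smooth_on D Q"
  unfolding tuple_forms(4)[abs_def] by (intro smooth_intros open_D Y_smooth)
lemma G1_smooth: "smooth_on D G1"
  unfolding tuple_forms(5)[abs_def] by (intro smooth_intros open_D V_smooth X_smooth smooth_comps) (simp add: D_nz)
lemma KK_smooth: "smooth_on D KK"
  unfolding tuple_forms(6)[abs_def]
  by (intro smooth_intros open_D V_smooth X_smooth Y_smooth Q_smooth smooth_comps) (simp add: D_nz)
lemma S1_smooth: "smooth_on D S1"
  unfolding S1_def[abs_def] by (intro smooth_intros open_D V_smooth Y_smooth) (simp_all add: D_nz D_facts')
lemma S2_smooth: "smooth_on D S2"
  unfolding S2_def[abs_def] by (intro smooth_intros open_D V_smooth Y_smooth) (use D_nz(5) D_facts'(2) in simp_all)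

lemma at_zero:
  "X (0, c, t, \<xi>, b) = x0 t" "V (0, c, t, \<xi>, b) = 1 / x0 t ^ k" "Y (0, c, t, \<xi>, b) = 1 / x0 t ^ k"
  "Q (0, c, t, \<xi>, b) = 1"
proof -
  show X: "X (0, c, t, \<xi>, b) = x0 t" by (simp add: X_def)
  then show V: "V (0, c, t, \<xi>, b) = 1 / x0 t ^ k" by (simp add: V_def field_simps)
  show "Y (0, c, t, \<xi>, b) = 1 / x0 t ^ k" by (simp add: Y_def N_def Bq_def rt_def V)
  show "Q (0, c, t, \<xi>, b) = 1" by (simp add: Q_def)
qed

lemma m_x0: "m t / x0 t ^ k / x0 t = 1"
  using x0_pos[of t] unfolding x0_power[symmetric] by simp

lemma D_per: "(\<mu>, q) \<in> D \<Longrightarrow> (\<mu>, q + (0, P, 0, 0)) \<in> D"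
  by (cases q) (auto simp: D_def pers)

lemma fn_per:
  "G1 (\<mu>, q + (0, P, 0, 0)) = G1 (\<mu>, q)" "KK (\<mu>, q + (0, P, 0, 0)) = KK (\<mu>, q)"
proof -
  obtain c t \<xi> b where q: "q = (c, t, \<xi>, b)" by (metis prod.exhaust)
  have X: "X (\<mu>, c, t + P, \<xi>, b) = X (\<mu>, c, t, \<xi>, b)" by (simp add: X_def pers)
  then have V: "V (\<mu>, c, t + P, \<xi>, b) = V (\<mu>, c, t, \<xi>, b)" by (simp add: V_def)
  then have "N (\<mu>, c, t + P, \<xi>, b) = N (\<mu>, c, t, \<xi>, b)" "Bq (\<mu>, c, t + P, \<xi>, b) = Bq (\<mu>, c, t, \<xi>, b)"
    by (simp_all add: N_def Bq_def)
  then have "Y (\<mu>, c, t + P, \<xi>, b) = Y (\<mu>, c, t, \<xi>, b)" by (simp add: Y_def rt_def)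
  then show "G1 (\<mu>, q + (0, P, 0, 0)) = G1 (\<mu>, q)" "KK (\<mu>, q + (0, P, 0, 0)) = KK (\<mu>, q)"
    using X V by (simp_all add: q G1_def KK_def Q_def pers Let_def)
qed

lemma G1_slope: "frechet_derivative G1 (at (0, c, t, \<xi>, b)) (1, 0) = \<beta> t * \<xi>"
proof -
  let ?q = "(c, t, \<xi>, b)"
  have "(G1 has_derivative frechet_derivative G1 (at (0, ?q))) (at ((0, ?q) + 0 *\<^sub>R (1, 0)))"
    using smooth_on_has_derivative[OF G1_smooth D_0] by simp
  from has_vector_derivative_line[OF this]
  have 1: "((\<lambda>s. G1 (s, ?q)) has_vector_derivative frechet_derivative G1 (at (0, ?q)) (1, 0)) (at 0)"
    by simp
  have "((\<lambda>s. inverse (x0 t + s * \<xi>)) has_real_derivative - (inverse (x0 t) * \<xi> * inverse (x0 t))) (at 0)"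
    by (auto intro!: derivative_eq_intros simp: nz)
  from DERIV_diff[OF DERIV_const DERIV_cmult[OF DERIV_power[OF this, of "k + 1"]], of 1 "m t"]
  have "((\<lambda>s. 1 - m t * inverse (x0 t + s * \<xi>) ^ (k + 1)) has_real_derivative
      (real k + 1) * m t * \<xi> * inverse (x0 t) ^ (k + 2)) (at 0)"
    by (simp add: algebra_simps)
  moreover have "(\<lambda>s. 1 - m t * inverse (x0 t + s * \<xi>) ^ (k + 1)) = (\<lambda>s. G1 (s, ?q))"
    by (auto simp: G1_def V_def X_def divide_inverse)
  moreover have "(real k + 1) * m t * \<xi> * inverse (x0 t) ^ (k + 2) = \<beta> t * \<xi>"
    by (simp add: \<beta>_def divide_inverse power_inverse)
  ultimately show ?thesis
    using vector_derivative_unique_at[OF 1] by (simp add: has_real_derivative_iff_has_vector_derivative)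
qed

text \<open>\<open>hadamard\<close> is applied twice to \<open>G1\<close>, which vanishes at \<mu> =
  0 and has slope \<beta> \<xi> there, and once to \<open>KK\<close>, \<open>S1\<close> and
  \<open>S2\<close>. The remainders are smooth in all variables including \<mu> = 0, and the
  periodicity of \<open>h\<close> comes from the last clause of \<open>hadamard\<close>.\<close>

lemma expansion:
  obtains h s1 s2 where "smooth_on D h" "smooth_on D s1" "smooth_on D s2"
    "\<And>\<mu> c t \<xi> b. (\<mu>, c, t, \<xi>, b) \<in> D \<Longrightarrow> G1 (\<mu>, c, t, \<xi>, b) + \<mu> * KK (\<mu>, c, t, \<xi>, b) =
      \<mu> * (\<beta> t * \<xi> + (e t - 2 * c\<^sup>2) / x0 t ^ k) + \<mu>\<^sup>2 * h (\<mu>, c, t, \<xi>, b)"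
    "\<And>\<mu> c t \<xi> b. (\<mu>, c, t, \<xi>, b) \<in> D \<Longrightarrow> h (\<mu>, c, t + P, \<xi>, b) = h (\<mu>, c, t, \<xi>, b)"
    "\<And>\<mu> c t \<xi> b. (\<mu>, c, t, \<xi>, b) \<in> D \<Longrightarrow> S1 (\<mu>, c, t, \<xi>, b) = sqrt (x0 t ^ k) + \<mu> * s1 (\<mu>, c, t, \<xi>, b)"
    "\<And>\<mu> c t \<xi> b. (\<mu>, c, t, \<xi>, b) \<in> D \<Longrightarrow> S2 (\<mu>, c, t, \<xi>, b) = 1 / sqrt (x0 t ^ k) + \<mu> * s2 (\<mu>, c, t, \<xi>, b)"
proof -
  obtain Ha where Ha: "smooth_on D Ha"
    "\<forall>\<mu> q. (\<mu>, q) \<in> D \<longrightarrow> G1 (\<mu>, q) = G1 (0, q) + \<mu> *\<^sub>R Ha (\<mu>, q)"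
    "\<forall>q. (0, q) \<in> D \<longrightarrow> Ha (0, q) = frechet_derivative G1 (at (0, q)) (1, 0)"
    "\<forall>s. (\<forall>\<mu> q. (\<mu>, q) \<in> D \<longrightarrow> (\<mu>, q + s) \<in> D \<and> G1 (\<mu>, q + s) = G1 (\<mu>, q)) \<longrightarrow>
      (\<forall>\<mu> q. (\<mu>, q) \<in> D \<longrightarrow> Ha (\<mu>, q + s) = Ha (\<mu>, q))"
    using hadamard[OF open_D G1_smooth D_star] by blast
  have Ha_per: "Ha (\<mu>, q + (0, P, 0, 0)) = Ha (\<mu>, q)" if "(\<mu>, q) \<in> D" for \<mu> q
    using Ha(4) D_per fn_per that by blast
  obtain Hb where Hb: "smooth_on D Hb"
    "\<forall>\<mu> q. (\<mu>, q) \<in> D \<longrightarrow> Ha (\<mu>, q) = Ha (0, q) + \<mu> *\<^sub>R Hb (\<mu>, q)"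
    "\<forall>s. (\<forall>\<mu> q. (\<mu>, q) \<in> D \<longrightarrow> (\<mu>, q + s) \<in> D \<and> Ha (\<mu>, q + s) = Ha (\<mu>, q)) \<longrightarrow>
      (\<forall>\<mu> q. (\<mu>, q) \<in> D \<longrightarrow> Hb (\<mu>, q + s) = Hb (\<mu>, q))"
    using hadamard[OF open_D Ha(1) D_star] by blast
  obtain Hc where Hc: "smooth_on D Hc"
    "\<forall>\<mu> q. (\<mu>, q) \<in> D \<longrightarrow> KK (\<mu>, q) = KK (0, q) + \<mu> *\<^sub>R Hc (\<mu>, q)"
    "\<forall>s. (\<forall>\<mu> q. (\<mu>, q) \<in> D \<longrightarrow> (\<mu>, q + s) \<in> D \<and> KK (\<mu>, q + s) = KK (\<mu>, q)) \<longrightarrow>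
      (\<forall>\<mu> q. (\<mu>, q) \<in> D \<longrightarrow> Hc (\<mu>, q + s) = Hc (\<mu>, q))"
    using hadamard[OF open_D KK_smooth D_star] by blast
  obtain s1 where s1: "smooth_on D s1" "\<forall>\<mu> q. (\<mu>, q) \<in> D \<longrightarrow> S1 (\<mu>, q) = S1 (0, q) + \<mu> *\<^sub>R s1 (\<mu>, q)"
    using hadamard[OF open_D S1_smooth D_star] by blast
  obtain s2 where s2: "smooth_on D s2" "\<forall>\<mu> q. (\<mu>, q) \<in> D \<longrightarrow> S2 (\<mu>, q) = S2 (0, q) + \<mu> *\<^sub>R s2 (\<mu>, q)"
    using hadamard[OF open_D S2_smooth D_star] by blast
  show ?thesis
  proof (rule that[of "\<lambda>z. Hb z + Hc z" s1 s2])
    show "smooth_on D (\<lambda>z. Hb z + Hc z)" by (intro smooth_intros open_D Hb Hc)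
    fix \<mu> c t \<xi> b assume D: "(\<mu>, c, t, \<xi>, b) \<in> D"
    have xm: "x0 t ^ k * x0 t = m t" using x0_power[of t] by (simp add: mult.commute)
    have G0: "G1 (0, c, t, \<xi>, b) = 0" using xm x0_pos[of t] m_pos[of t] by (simp add: G1_def at_zero)
    have H0: "Ha (0, c, t, \<xi>, b) = \<beta> t * \<xi>" using Ha(3) D_0 G1_slope by simp
    \<comment> \<open>With m = x0^(k+1) the two terms in c^2 - 1 and the 2 add up to 2 c^2.\<close>
    have K0: "KK (0, c, t, \<xi>, b) = (e t - 2 * c\<^sup>2) / x0 t ^ k"
    proof -
      have "KK (0, c, t, \<xi>, b) = - (c\<^sup>2 - 1) * (m t / x0 t ^ k / x0 t) / x0 t ^ k
          + e t / x0 t ^ k - 2 / x0 t ^ k - (c\<^sup>2 - 1) / x0 t ^ k"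
        using x0_pos[of t] by (simp add: KK_def at_zero xm[symmetric])
      also have "\<dots> = (e t - 2 * c\<^sup>2) / x0 t ^ k"
        unfolding m_x0 by (simp add: diff_divide_distrib add_divide_distrib algebra_simps)
      finally show ?thesis .
    qed
    show "G1 (\<mu>, c, t, \<xi>, b) + \<mu> * KK (\<mu>, c, t, \<xi>, b) =
      \<mu> * (\<beta> t * \<xi> + (e t - 2 * c\<^sup>2) / x0 t ^ k) + \<mu>\<^sup>2 * (Hb (\<mu>, c, t, \<xi>, b) + Hc (\<mu>, c, t, \<xi>, b))"
      using Ha(2)[rule_format, OF D] Hb(2)[rule_format, OF D] Hc(2)[rule_format, OF D] G0 H0 K0
      by (simp add: algebra_simps power2_eq_square)
    show "Hb (\<mu>, c, t + P, \<xi>, b) + Hc (\<mu>, c, t + P, \<xi>, b) = Hb (\<mu>, c, t, \<xi>, b) + Hc (\<mu>, c, t, \<xi>, b)"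
    proof -
      have "Hb (\<mu>, (c, t, \<xi>, b) + (0, P, 0, 0)) = Hb (\<mu>, c, t, \<xi>, b)"
        using Hb(3) D_per Ha_per D by blast
      moreover have "Hc (\<mu>, (c, t, \<xi>, b) + (0, P, 0, 0)) = Hc (\<mu>, c, t, \<xi>, b)"
        using Hc(3) D_per fn_per(2) D by blast
      ultimately show ?thesis by simp
    qed
    have v: "1 / x0 t ^ k > 0" using x0_pos[of t] by simp
    show "S1 (\<mu>, c, t, \<xi>, b) = sqrt (x0 t ^ k) + \<mu> * s1 (\<mu>, c, t, \<xi>, b)"
      using s1(2)[rule_format, OF D] x0_pos[of t] by (simp add: S1_def at_zero real_sqrt_divide real_div_sqrt)
    show "S2 (\<mu>, c, t, \<xi>, b) = 1 / sqrt (x0 t ^ k) + \<mu> * s2 (\<mu>, c, t, \<xi>, b)"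
      using s2(2)[rule_format, OF D] by (simp add: S2_def at_zero real_sqrt_divide)
  qed (fact s1 s2)+
qed

subsection \<open>Coordinates near the slow manifold\<close>

definition xi where "xi z = x2 (snd (fst (fst z))) (snd (fst z)) + r (snd (fst z)) * Re (snd z)"
  for z :: "((real \<times> real) \<times> real) \<times> complex"
text \<open>The term with \<open>\<rho>\<close> cancels r' Re w in the equation for x and, through
  \<rho> \<omega> = r'/r^2, also the derivative of 1/r in the equation for z. Otherwise both would
  remain as terms in w without a factor \<delta>.\<close>

definition zh where "zh z = - fst (fst (fst z)) * \<rho> (snd (fst z)) * Re (snd z) - Im (snd z) / r (snd (fst z))"
  for z :: "((real \<times> real) \<times> real) \<times> complex"
definition zb where "zb z = z1 (snd (fst z)) + (fst (fst (fst z)))\<^sup>2 * z3 (snd (fst (fst z))) (snd (fst z))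
    + fst (fst (fst z)) * zh z" for z :: "((real \<times> real) \<times> real) \<times> complex"
definition pt where "pt z = ((fst (fst (fst z)))\<^sup>2, snd (fst (fst z)), snd (fst z), xi z, (zb z)\<^sup>2)"
  for z :: "((real \<times> real) \<times> real) \<times> complex"

lemma coord_smooth: "open S \<Longrightarrow> smooth_on S xi" "open S \<Longrightarrow> smooth_on S zh"
  "open S \<Longrightarrow> smooth_on S zb" "open S \<Longrightarrow> smooth_on S pt"
proof -
  show xi: "open S \<Longrightarrow> smooth_on S xi" for S
    unfolding xi_def[abs_def] x2_def by (intro smooth_intros smooth_comps)
  show zh: "open S \<Longrightarrow> smooth_on S zh" for S
    unfolding zh_def[abs_def] by (intro smooth_intros smooth_comps) (simp_all add: nz)
  show zb: "open S \<Longrightarrow> smooth_on S zb" for S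
    unfolding zb_def[abs_def] z3_def by (intro smooth_intros smooth_comps zh)
  show "open S \<Longrightarrow> smooth_on S pt"
    unfolding pt_def[abs_def] by (intro smooth_intros xi zb)
qed

lemma pt_per: "pt ((p, t + P), w) = (case pt ((p, t), w) of (\<mu>, c, s, q) \<Rightarrow> (\<mu>, c, t + P, q))"
  by (simp add: pt_def xi_def zb_def zh_def x2_def z3_def pers)

lemma pt_D_of_int: "pt ((p, t), w) \<in> D \<Longrightarrow> pt ((p, t + of_int j * P), w) \<in> D"
proof -
  have "periodic P (\<lambda>t. pt ((p, t), w) \<in> D)"
    unfolding periodic_def
  proof
    fix t
    show "(pt ((p, t + P), w) \<in> D) = (pt ((p, t), w) \<in> D)"
      unfolding pt_per by (auto simp: pt_def D_def pers)
  qed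
  from periodic_of_int[OF this] show "pt ((p, t), w) \<in> D \<Longrightarrow> pt ((p, t + of_int j * P), w) \<in> D" by blast
qed

text \<open>At \<delta> = 0 the first coordinate of \<open>pt\<close> is 0 and the point lies in
  \<open>D\<close> whatever the others are; compactness in c, w and one period of t thickens this to
  a uniform \<delta>1.\<close>

lemma box_exists:
  obtains \<delta>1 where "\<delta>1 > 0"
    "\<And>\<delta> c t w. \<bar>\<delta>\<bar> < \<delta>1 \<Longrightarrow> c0 - 1 \<le> c \<Longrightarrow> c \<le> c0 + 1 \<Longrightarrow> norm w \<le> 2 \<Longrightarrow> pt (((\<delta>, c), t), w) \<in> D"
proof -
  define \<Psi> where "\<Psi> = (\<lambda>y :: real \<times> (real \<times> real \<times> complex). pt (((fst y, fst (snd y)), fst (snd (snd y))), snd (snd (snd y))))"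
  define C where "C = {c0 - 1..c0 + 1} \<times> {0..P} \<times> cball (0 :: complex) 2"
  have "continuous_on UNIV pt" by (rule smooth_on_continuous[OF coord_smooth(4)]) simp
  then have "continuous_on UNIV \<Psi>"
    unfolding \<Psi>_def by (rule continuous_on_compose2) (auto intro!: continuous_intros)
  then have oW: "open (\<Psi> -` D)" using open_D by (simp add: open_vimage)
  have cC: "compact C" unfolding C_def by (intro compact_Times compact_Icc compact_cball)
  have sub: "{0} \<times> C \<subseteq> \<Psi> -` D" by (auto simp: \<Psi>_def pt_def D_0)
  from Elementary_Topology.tube_lemma[OF cC oW sub] obtain X0 where X0: "0 \<in> X0" "open X0" "X0 \<times> C \<subseteq> \<Psi> -` D"
    by blast
  obtain \<delta>1 where \<delta>1: "\<delta>1 > 0" "ball 0 \<delta>1 \<subseteq> X0" using X0(1,2) openE by blast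
  have "pt (((\<delta>, c), t), w) \<in> D" if "\<bar>\<delta>\<bar> < \<delta>1" "c0 - 1 \<le> c" "c \<le> c0 + 1" "norm w \<le> 2" for \<delta> c t w
  proof -
    obtain s j where s: "s \<in> {0..P}" "t = s + of_int j * P" by (rule period_reduce[OF P])
    have "(\<delta>, (c, s, w)) \<in> X0 \<times> C" using that s(1) \<delta>1(2) by (auto simp: C_def)
    then have "\<Psi> (\<delta>, (c, s, w)) \<in> D" using X0(3) by blast
    then have "pt (((\<delta>, c), s), w) \<in> D" by (simp add: \<Psi>_def)
    then show ?thesis unfolding s(2) by (rule pt_D_of_int)
  qed
  then show ?thesis using that \<delta>1(1) by blast
qed

end

lemma (in slow_manifold) tuple_per:
  "X (\<mu>, c, t + P, \<xi>, b) = X (\<mu>, c, t, \<xi>, b)" "Y (\<mu>, c, t + P, \<xi>, b) = Y (\<mu>, c, t, \<xi>, b)"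
proof -
  show X: "X (\<mu>, c, t + P, \<xi>, b) = X (\<mu>, c, t, \<xi>, b)" by (simp add: X_def pers)
  then have V: "V (\<mu>, c, t + P, \<xi>, b) = V (\<mu>, c, t, \<xi>, b)" by (simp add: V_def)
  then have "N (\<mu>, c, t + P, \<xi>, b) = N (\<mu>, c, t, \<xi>, b)" "Bq (\<mu>, c, t + P, \<xi>, b) = Bq (\<mu>, c, t, \<xi>, b)"
    by (simp_all add: N_def Bq_def)
  then show "Y (\<mu>, c, t + P, \<xi>, b) = Y (\<mu>, c, t, \<xi>, b)" by (simp add: Y_def rt_def)
qed

subsection \<open>From a solution of the reduced system to a reconstruction\<close>

text \<open>\<open>A = \<delta>\<^sup>2 y\<close> is the squared magnitude, \<open>v = \<delta>\<^sup>2\<^sup>k / F\<^sup>2\<close> and \<open>x\<close> is proportional to the square of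
  the second warp. In these variables the equations of a reconstruction with first warp \<open>L\<close>
  become the first-order system for \<open>(x, z)\<close> below, with \<open>y\<close> given by a quadratic equation.\<close>

locale reduced_solution = slow_manifold +
  fixes \<delta> c \<sigma> :: real and x y z :: "real \<Rightarrow> real"
  assumes \<delta>: "\<delta> > 0" and \<sigma>: "\<sigma> \<in> {-1, 1}"
    and x_pos: "\<And>t. x t > 0" and y_pos: "\<And>t. y t > 0" and y_lt: "\<And>t. \<delta>\<^sup>2 * y t < 1"
    and quad: "\<And>t. (1 + (c\<^sup>2 - 1) * \<delta>\<^sup>2 * y t) * inverse (x t) ^ k = y t - \<delta>\<^sup>2 * (y t)\<^sup>2 - (z t)\<^sup>2"
    and simple: "\<And>t. 1 - 2 * \<delta>\<^sup>2 * y t - (c\<^sup>2 - 1) * \<delta>\<^sup>2 * inverse (x t) ^ k \<noteq> 0"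
    and Q_pos: "\<And>t. 1 + (c\<^sup>2 - 1) * \<delta>\<^sup>2 * y t > 0"
    and y_smooth: "smooth_on UNIV y"
    and x': "\<And>t. (x has_real_derivative - (2 / (real k * \<delta>)) * z t * (m t - \<delta>\<^sup>2 * e t * x t)) (at t)"
    and z': "\<And>t. (z has_real_derivative (1 - (1 + (c\<^sup>2 - 1) * \<delta>\<^sup>2 * y t) * inverse (x t) ^ k * (m t / x t - \<delta>\<^sup>2 * e t)
        - 2 * \<delta>\<^sup>2 * y t - \<delta>\<^sup>2 * (c\<^sup>2 - 1) * inverse (x t) ^ k) / \<delta>) (at t)"
begin

definition v where "v t = inverse (x t) ^ k"
definition q where "q t = 1 + (c\<^sup>2 - 1) * \<delta>\<^sup>2 * y t"
definition a where "a t = \<delta> * sqrt (y t)"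

lemma v_pos: "v t > 0" using x_pos[of t] by (simp add: v_def)
lemma q_pos: "q t > 0" using Q_pos[of t] by (simp add: q_def)
lemma quad': "q t * v t = y t - \<delta>\<^sup>2 * (y t)\<^sup>2 - (z t)\<^sup>2" using quad[of t] by (simp add: q_def v_def)

lemma v': "(v has_real_derivative 2 * z t * v t * (m t / x t - \<delta>\<^sup>2 * e t) / \<delta>) (at t)"
proof -
  define D where "D = - (2 / (real k * \<delta>)) * z t * (m t - \<delta>\<^sup>2 * e t * x t)"
  have "(v has_real_derivative real k * inverse (x t) ^ (k - 1) * - (inverse (x t) * D * inverse (x t))) (at t)"
    unfolding v_def[abs_def] using x'[of t, folded D_def] x_pos[of t]
    by (auto intro!: derivative_eq_intros)
  also have "real k * inverse (x t) ^ (k - 1) * - (inverse (x t) * D * inverse (x t)) =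
      - real k * (inverse (x t) ^ (k - 1) * inverse (x t)) * D * inverse (x t)" by simp
  also have "inverse (x t) ^ (k - 1) * inverse (x t) = v t"
    unfolding v_def using k by (rule power_minus_mult)
  also have "- real k * v t * D * inverse (x t) = 2 * z t * v t * (m t / x t - \<delta>\<^sup>2 * e t) / \<delta>"
    using k \<delta> x_pos[of t] by (simp add: D_def field_simps)
  finally show ?thesis .
qed

text \<open>Differentiating the quadratic relation gives y' times the factor in
  \<open>simple\<close>; the equations for x and z turn the other side into 2 z / \<delta> times the
  same factor.\<close>

lemma y': "(y has_real_derivative 2 * z t / \<delta>) (at t)"
proof -
  define y' where "y' = deriv y t"
  have dy: "(y has_real_derivative y') (at t)" unfolding y'_def by (rule smooth_on_UNIV_deriv(1)[OF y_smooth])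
  define v' where "v' = 2 * z t * v t * (m t / x t - \<delta>\<^sup>2 * e t) / \<delta>"
  define z' where "z' = (1 - q t * v t * (m t / x t - \<delta>\<^sup>2 * e t) - 2 * \<delta>\<^sup>2 * y t - \<delta>\<^sup>2 * (c\<^sup>2 - 1) * v t) / \<delta>"
  have dz: "(z has_real_derivative z') (at t)" using z'[of t] by (simp add: z'_def q_def v_def)
  have dv: "(v has_real_derivative v') (at t)" unfolding v'_def by (rule v')
  have "((\<lambda>t. q t * v t) has_real_derivative (c\<^sup>2 - 1) * \<delta>\<^sup>2 * y' * v t + q t * v') (at t)"
    unfolding q_def[abs_def] by (auto intro!: derivative_eq_intros dy dv)
  moreover have "((\<lambda>t. q t * v t) has_real_derivative y' - \<delta>\<^sup>2 * (2 * y t * y') - 2 * z t * z') (at t)"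
    unfolding quad' by (auto intro!: derivative_eq_intros dy dz)
  ultimately have "(c\<^sup>2 - 1) * \<delta>\<^sup>2 * y' * v t + q t * v' = y' - \<delta>\<^sup>2 * (2 * y t * y') - 2 * z t * z'"
    by (rule DERIV_unique)
  then have "y' * (1 - 2 * \<delta>\<^sup>2 * y t - (c\<^sup>2 - 1) * \<delta>\<^sup>2 * v t) = q t * v' + 2 * z t * z'"
    by (simp add: algebra_simps)
  also have "\<dots> = 2 * z t / \<delta> * (1 - 2 * \<delta>\<^sup>2 * y t - (c\<^sup>2 - 1) * \<delta>\<^sup>2 * v t)"
    using \<delta> by (simp add: v'_def z'_def field_simps)
  finally have "y' = 2 * z t / \<delta>"
    using simple[of t, folded v_def] mult_right_cancel by blast
  then show ?thesis using dy by simp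
qed

lemma a_pos: "a t > 0" using \<delta> y_pos[of t] by (simp add: a_def)
lemma a_square: "(a t)\<^sup>2 = \<delta>\<^sup>2 * y t" using y_pos[of t] by (simp add: a_def power_mult_distrib)

text \<open>Hence z = a a' / \<delta>, which is where the square of z in the quadratic relation
  comes from.\<close>

lemma a': "(a has_real_derivative z t / sqrt (y t)) (at t)"
proof -
  have "(a has_real_derivative \<delta> * (2 * z t / \<delta> * (inverse (sqrt (y t)) / 2))) (at t)"
    unfolding a_def[abs_def] using y_pos[of t] by (auto intro!: derivative_eq_intros y')
  then show ?thesis using \<delta> by (simp add: field_simps)
qed

lemma deriv_a: "deriv a = (\<lambda>t. z t / sqrt (y t))"
  using DERIV_imp_deriv[OF a'] by auto

lemma deriv_deriv_a:
  "deriv (deriv a) t = ((1 - q t * v t * (m t / x t - \<delta>\<^sup>2 * e t) - 2 * \<delta>\<^sup>2 * y t - \<delta>\<^sup>2 * (c\<^sup>2 - 1) * v t) / \<delta>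
    - (z t)\<^sup>2 / (\<delta> * y t)) / sqrt (y t)"
proof -
  define z' where "z' = (1 - q t * v t * (m t / x t - \<delta>\<^sup>2 * e t) - 2 * \<delta>\<^sup>2 * y t - \<delta>\<^sup>2 * (c\<^sup>2 - 1) * v t) / \<delta>"
  have dz: "(z has_real_derivative z') (at t)" using z'[of t] by (simp add: z'_def q_def v_def)
  have "((\<lambda>t. z t / sqrt (y t)) has_real_derivative
      (z' * sqrt (y t) - z t * (2 * z t / \<delta> * (inverse (sqrt (y t)) / 2))) / (sqrt (y t) * sqrt (y t))) (at t)"
    using y_pos[of t] by (auto intro!: derivative_eq_intros y' dz)
  moreover have "(z' * sqrt (y t) - z t * (2 * z t / \<delta> * (inverse (sqrt (y t)) / 2))) / (sqrt (y t) * sqrt (y t)) =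
      (z' - (z t)\<^sup>2 / (\<delta> * y t)) / sqrt (y t)"
  proof -
    define s where "s = sqrt (y t)"
    have s: "s > 0" "y t = s * s" using y_pos[of t] by (auto simp: s_def)
    show ?thesis unfolding s_def[symmetric] s(2) using s(1) \<delta> by (simp add: field_simps power2_eq_square)
  qed
  ultimately have "((\<lambda>t. z t / sqrt (y t)) has_real_derivative (z' - (z t)\<^sup>2 / (\<delta> * y t)) / sqrt (y t)) (at t)"
    by simp
  then show ?thesis unfolding deriv_a z'_def by (rule DERIV_imp_deriv)
qed

text \<open>The quadratic relation of the locale is the definition of \<open>mag_R\<close> in the
  new variables: y R = Q v.\<close>

lemma R_eq: "mag_R a t = q t * v t / y t"
proof -
  have "mag_R a t = 1 - \<delta>\<^sup>2 * y t - (z t)\<^sup>2 / y t"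
    using y_pos[of t] by (simp add: mag_R_def deriv_a a_square power_divide)
  also have "\<dots> = q t * v t / y t"
    using y_pos[of t] by (simp add: quad' diff_divide_distrib power2_eq_square)
  finally show ?thesis .
qed

lemma Q_eq: "mag_Q c a t = q t"
  by (simp add: mag_Q_def a_square q_def)

text \<open>Here the exponent of \<epsilon> matters: the squared magnitude contributes \<delta>^2 to
  the denominator and leaves \<delta>^(2 k) under the root.\<close>

lemma F_eq: "mag_F c (\<delta> ^ (2 * (k + 1))) a t = \<delta> ^ k / sqrt (v t)"
proof -
  have "\<delta> ^ (2 * (k + 1)) * mag_Q c a t / ((a t)\<^sup>2 * mag_R a t) = (\<delta> ^ k)\<^sup>2 / v t"
  proof -
    have "\<delta> ^ (2 * (k + 1)) = (\<delta> ^ k)\<^sup>2 * \<delta>\<^sup>2"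
      by (simp only: power_even_eq power_add power_one_right power_mult_distrib)
    then show ?thesis
      unfolding Q_eq R_eq a_square using y_pos[of t] v_pos[of t] q_pos[of t] \<delta> by simp
  qed
  then show ?thesis using \<delta> by (simp add: mag_F_def real_sqrt_divide)
qed

text \<open>The equation for z encodes the second derivative of the magnitude; solving it for m/x -
  \<delta>^2 e returns the defining formula of \<open>mag_T\<close>.\<close>

lemma T_eq: "mag_T c a t = (m t / x t - \<delta>\<^sup>2 * e t) / \<delta>\<^sup>2"
proof -
  define \<tau> where "\<tau> = m t / x t - \<delta>\<^sup>2 * e t"
  define s where "s = sqrt (y t)"
  have s: "s > 0" "y t = s\<^sup>2" using y_pos[of t] by (auto simp: s_def)
  have at: "a t = \<delta> * s" by (simp add: a_def s_def)
  have qv: "q t * v t > 0" using q_pos[of t] v_pos[of t] by simp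
  have "a t + deriv (deriv a) t = (\<delta>\<^sup>2 * y t + (1 - q t * v t * \<tau> - 2 * \<delta>\<^sup>2 * y t - \<delta>\<^sup>2 * (c\<^sup>2 - 1) * v t) - (z t)\<^sup>2 / y t) / (\<delta> * s)"
    unfolding deriv_deriv_a \<tau>_def[symmetric] s_def[symmetric] at
    using s(1) \<delta> by (simp add: s(2) field_simps power2_eq_square)
  also have "\<delta>\<^sup>2 * y t + (1 - q t * v t * \<tau> - 2 * \<delta>\<^sup>2 * y t - \<delta>\<^sup>2 * (c\<^sup>2 - 1) * v t) - (z t)\<^sup>2 / y t
      = q t * v t / y t - q t * v t * \<tau> - \<delta>\<^sup>2 * (c\<^sup>2 - 1) * v t"
    using quad'[of t] y_pos[of t] by (simp add: field_simps power2_eq_square)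
  finally have num: "a t + deriv (deriv a) t =
      (q t * v t / y t - q t * v t * \<tau> - \<delta>\<^sup>2 * (c\<^sup>2 - 1) * v t) / (\<delta> * s)" .
  have den: "a t * mag_R a t = \<delta> * q t * v t / s"
    unfolding R_eq at s(2) using s(1) by (simp add: power2_eq_square)
  have "(a t + deriv (deriv a) t) / (a t * mag_R a t) =
      1 / (\<delta>\<^sup>2 * y t) - \<tau> / \<delta>\<^sup>2 - (c\<^sup>2 - 1) / q t"
    unfolding num den s(2) using s(1) q_pos[of t] v_pos[of t] \<delta>
    by (simp add: field_simps power2_eq_square)
  moreover have "1 / ((a t)\<^sup>2 * mag_Q c a t) = 1 / (\<delta>\<^sup>2 * y t) - (c\<^sup>2 - 1) / q t"
  proof -
    have "1 = q t - (c\<^sup>2 - 1) * \<delta>\<^sup>2 * y t" by (simp add: q_def)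
    then have "1 / (\<delta>\<^sup>2 * y t * q t) = (q t - (c\<^sup>2 - 1) * \<delta>\<^sup>2 * y t) / (\<delta>\<^sup>2 * y t * q t)" by simp
    also have "\<dots> = 1 / (\<delta>\<^sup>2 * y t) - (c\<^sup>2 - 1) / q t"
      using q_pos[of t] y_pos[of t] \<delta> by (simp add: field_simps)
    finally show ?thesis by (simp add: a_square Q_eq)
  qed
  ultimately show ?thesis unfolding mag_T_def \<tau>_def[symmetric] by simp
qed

text \<open>The power of \<open>L\<close> cancels \<open>L\<close> from the product of the warps,
  which then depends on x alone.\<close>

definition l2 where "l2 t = \<delta> * sqrt (x t) * L t powr (- (real k1 / real k))"

lemma l2_pos: "l2 t > 0" using \<delta> x_pos[of t] L_pos[of t] by (simp add: l2_def)

lemma source: "source_warps k1 d1 k d2 c (\<delta> ^ (2 * (k + 1))) a L l2"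
  unfolding source_warps_def
proof (intro allI conjI)
  fix t
  show "L t > 0" "l2 t > 0" by (rule L_pos l2_pos)+
  have "(L t powr (- (real k1 / real k))) ^ k = L t powr (- (real k1 / real k) * real k)"
    using L_pos[of t] by (simp add: powr_realpow[symmetric] powr_powr)
  also have "- (real k1 / real k) * real k = - real k1" using k by simp
  finally have Lp: "(L t powr (- (real k1 / real k))) ^ k = 1 / L t ^ k1"
    using L_pos[of t] by (simp add: powr_minus_divide powr_realpow)
  have "1 / sqrt (v t) = sqrt (x t) ^ k"
    using x_pos[of t] by (simp add: v_def power_inverse real_sqrt_inverse real_sqrt_power divide_inverse)
  then have "\<delta> ^ k / sqrt (v t) = \<delta> ^ k * sqrt (x t) ^ k" by (simp add: divide_inverse)
  then show "L t ^ k1 * l2 t ^ k = mag_F c (\<delta> ^ (2 * (k + 1))) a t"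
    unfolding F_eq using L_pos[of t] by (simp add: l2_def power_mult_distrib Lp)
  have "(l2 t)\<^sup>2 = \<delta>\<^sup>2 * x t * (L t powr (- (real k1 / real k)))\<^sup>2"
    using x_pos[of t] by (simp add: l2_def power_mult_distrib)
  also have "(L t powr (- (real k1 / real k)))\<^sup>2 = 1 / (L t powr (2 * real k1 / real k))"
    by (simp add: power2_eq_square powr_add[symmetric] powr_minus_divide[symmetric])
  finally have "d2 / (l2 t)\<^sup>2 = m t / (\<delta>\<^sup>2 * x t)" by (simp add: m_def)
  then show "d2 / (l2 t)\<^sup>2 - d1 / (L t)\<^sup>2 = mag_T c a t"
    unfolding T_eq using \<delta> x_pos[of t] by (simp add: e_def field_simps)
qed

lemma admissible: "admissible_magnitude a"
  unfolding admissible_magnitude_def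
proof (intro conjI allI)
  show "smooth_on UNIV a"
    unfolding a_def[abs_def] by (intro smooth_intros open_UNIV y_smooth y_pos)
  show "0 < a t" for t by (rule a_pos)
  show "a t < 1" for t
    using a_square[of t] y_lt[of t] a_pos[of t] power2_less_imp_less[of "a t" 1] by simp
  show "mag_R a t > 0" for t
    using q_pos[of t] v_pos[of t] y_pos[of t] by (simp add: R_eq)
qed

lemma phase_rates:
  "\<sigma> * sqrt (\<delta> ^ (2 * (k + 1))) / (mag_F c (\<delta> ^ (2 * (k + 1))) a t * (a t)\<^sup>2) = \<sigma> / \<delta> * (sqrt (v t) / y t)"
  "\<sigma> * c * sqrt (\<delta> ^ (2 * (k + 1))) / (mag_F c (\<delta> ^ (2 * (k + 1))) a t * (mag_b a t)\<^sup>2) =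
    \<sigma> * c * \<delta> * (sqrt (v t) / (1 - \<delta>\<^sup>2 * y t))"
proof -
  have s: "sqrt (\<delta> ^ (2 * (k + 1))) = \<delta> ^ (k + 1)"
    unfolding power_even_eq real_sqrt_abs using \<delta> by simp
  have b: "(mag_b a t)\<^sup>2 = 1 - \<delta>\<^sup>2 * y t" using y_lt[of t] by (simp add: mag_b_def a_square)
  show "\<sigma> * sqrt (\<delta> ^ (2 * (k + 1))) / (mag_F c (\<delta> ^ (2 * (k + 1))) a t * (a t)\<^sup>2) = \<sigma> / \<delta> * (sqrt (v t) / y t)"
    unfolding s F_eq a_square using \<delta> v_pos[of t] y_pos[of t] by (simp add: field_simps power2_eq_square)
  show "\<sigma> * c * sqrt (\<delta> ^ (2 * (k + 1))) / (mag_F c (\<delta> ^ (2 * (k + 1))) a t * (mag_b a t)\<^sup>2) =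
    \<sigma> * c * \<delta> * (sqrt (v t) / (1 - \<delta>\<^sup>2 * y t))"
    unfolding s F_eq b using \<delta> v_pos[of t] y_lt[of t] by (simp add: field_simps)
qed

end

subsection \<open>The oscillator of the normal form\<close>

locale slow_expansion = slow_manifold +
  fixes h :: "real \<times> real \<times> real \<times> real \<times> real \<Rightarrow> real" and c0 \<delta>1 :: real
  assumes h_smooth: "smooth_on D h"
    and h_eq: "\<And>\<mu> c t \<xi> b. (\<mu>, c, t, \<xi>, b) \<in> D \<Longrightarrow> G1 (\<mu>, c, t, \<xi>, b) + \<mu> * KK (\<mu>, c, t, \<xi>, b) =
      \<mu> * (\<beta> t * \<xi> + (e t - 2 * c\<^sup>2) / x0 t ^ k) + \<mu>\<^sup>2 * h (\<mu>, c, t, \<xi>, b)"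
    and h_per: "\<And>\<mu> c t \<xi> b. (\<mu>, c, t, \<xi>, b) \<in> D \<Longrightarrow> h (\<mu>, c, t + P, \<xi>, b) = h (\<mu>, c, t, \<xi>, b)"
    and \<delta>1: "\<delta>1 > 0"
    and box: "\<And>\<delta> c t w. \<bar>\<delta>\<bar> < \<delta>1 \<Longrightarrow> c0 - 1 \<le> c \<Longrightarrow> c \<le> c0 + 1 \<Longrightarrow> norm w \<le> 2 \<Longrightarrow>
      pt (((\<delta>, c), t), w) \<in> D"
begin

definition bx where "bx = (({-\<delta>1<..<\<delta>1} \<times> {c0-1<..<c0+1}) \<times> (UNIV :: real set)) \<times> ball (0 :: complex) 2"

text \<open>For nonzero \<delta> this is (2/k) e (zb X - z1 x0) / (\<delta> r), expanded so that no
  division by \<delta> occurs. Likewise \<open>g2\<close> collects what the z equation leaves once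
  its leading terms have cancelled.\<close>

definition g1 where "g1 z = 2 / real k * e (snd (fst z)) * (zh z * X (pt z)
    + fst (fst (fst z)) * z3 (snd (fst (fst z))) (snd (fst z)) * X (pt z)
    + fst (fst (fst z)) * z1 (snd (fst z)) * xi z) / r (snd (fst z))"
definition g2 where "g2 z = r (snd (fst z)) * (- h (pt z)
    + (deriv z3a (snd (fst z)) + (snd (fst (fst z)))\<^sup>2 * deriv z3b (snd (fst z)))
    - deriv \<rho> (snd (fst z)) * Re (snd z) - \<rho> (snd (fst z)) * fst (fst (fst z)) * g1 z)"

text \<open>Cutting off outside the box keeps \<open>g\<close> periodic in \<open>t\<close> everywhere.\<close>

definition g where "g z = (if z \<in> bx then complex_of_real (g1 z) + \<i> * complex_of_real (g2 z) else 0)"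

lemma open_bx: "open bx"
  unfolding bx_def by (intro open_Times open_greaterThanLessThan open_UNIV open_ball)

lemma bx_D: "pt ` bx \<subseteq> D"
  using box by (force simp: bx_def)

lemma comp_bx: "smooth_on D f \<Longrightarrow> smooth_on bx (\<lambda>z. f (pt z))"
  by (rule smooth_on_compose[OF open_bx open_D _ coord_smooth(4)[OF open_bx] bx_D])

lemma g1_smooth: "smooth_on bx g1"
  unfolding g1_def[abs_def] z3_def using k
  by (intro smooth_intros open_bx smooth_comps comp_bx[OF X_smooth] coord_smooth) (simp_all add: nz)

lemma g2_smooth: "smooth_on bx g2"
  unfolding g2_def[abs_def]
  by (intro smooth_intros open_bx smooth_comps comp_bx[OF h_smooth] g1_smooth)

lemma g_smooth: "smooth_on bx g"
  by (rule smooth_on_cong[OF open_bx, of "\<lambda>z. complex_of_real (g1 z) + \<i> * complex_of_real (g2 z)"])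
    (auto simp: g_def intro!: smooth_intros open_bx g1_smooth g2_smooth)

lemma g_per: "g ((p, t + P), w) = g ((p, t), w)"
proof (cases "((p, t), w) \<in> bx")
  case True
  then have T': "((p, t + P), w) \<in> bx" by (auto simp: bx_def)
  have D: "pt ((p, t), w) \<in> D" using True bx_D by blast
  obtain \<mu> c \<xi> b where p0: "pt ((p, t), w) = (\<mu>, c, t, \<xi>, b)" by (simp add: pt_def)
  have pp: "pt ((p, t + P), w) = (\<mu>, c, t + P, \<xi>, b)" unfolding pt_per p0 by simp
  have "X (pt ((p, t + P), w)) = X (pt ((p, t), w))"
    unfolding pp p0 by (rule tuple_per)
  moreover have "h (pt ((p, t + P), w)) = h (pt ((p, t), w))"
    unfolding pp p0 by (rule h_per) (use D p0 in simp)
  moreover have "zh ((p, t + P), w) = zh ((p, t), w)" "xi ((p, t + P), w) = xi ((p, t), w)"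
    by (simp_all add: zh_def xi_def x2_def pers)
  ultimately have "g1 ((p, t + P), w) = g1 ((p, t), w)" "g2 ((p, t + P), w) = g2 ((p, t), w)"
    by (simp_all add: g1_def g2_def z3_def pers)
  then show ?thesis using True T' by (simp add: g_def)
next
  case False
  then have "((p, t + P), w) \<notin> bx" by (auto simp: bx_def)
  then show ?thesis using False by (simp add: g_def)
qed

sublocale osc: oscillator P "integral {0..P} \<omega>" c0 \<delta>1 \<omega> g
proof
  show "periodic P \<omega>" by (simp add: periodic_def pers)
  show "smooth_on ((({-\<delta>1<..<\<delta>1} \<times> {c0-1<..<c0+1}) \<times> UNIV) \<times> ball 0 2) g"
    using g_smooth by (simp add: bx_def)
qed (auto simp: g_per P \<delta>1 \<omega>_smooth)

definition zp where "zp \<delta> c u t = (((\<delta>, c), t), u t)"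
  for \<delta> c :: real and u :: "real \<Rightarrow> complex" and t :: real

text \<open>The coordinates were chosen so that the oscillator equation is exactly the reduced system.\<close>

context
  fixes \<delta> c \<sigma> :: real and u :: "real \<Rightarrow> complex"
  assumes \<delta>: "0 < \<delta>" "\<delta> < \<delta>1" and c: "c0 - 1 < c" "c < c0 + 1" and \<sigma>: "\<sigma> \<in> {-1, 1}"
    and u: "\<And>t. norm (u t) < 1" "\<And>t. (u has_vector_derivative osc.rhs (((\<delta>, c), t), u t)) (at t)"
    and u_smooth: "smooth_on UNIV u"
begin

abbreviation "zz \<equiv> zp \<delta> c u"

lemma zz_bx: "zz t \<in> bx"
  using u(1)[of t] \<delta> c by (auto simp: zp_def bx_def)

lemma zz_D: "pt (zz t) \<in> D"
  using zz_bx bx_D by blast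

lemma zz_D': "(\<delta>\<^sup>2, c, t, xi (zz t), (zb (zz t))\<^sup>2) \<in> D"
  using zz_D[of t] by (simp add: pt_def zp_def)

lemma pt_zz: "pt (zz t) = (\<delta>\<^sup>2, c, t, xi (zz t), (zb (zz t))\<^sup>2)"
  by (simp add: pt_def zp_def)

lemma u_components:
  "((\<lambda>t. Re (u t)) has_real_derivative \<omega> t / \<delta> * Im (u t) + \<delta> * g1 (zz t)) (at t)"
  "((\<lambda>t. Im (u t)) has_real_derivative - (\<omega> t / \<delta>) * Re (u t) + \<delta> * g2 (zz t)) (at t)"
proof -
  have "osc.rhs (zz t) = - (\<omega> t / \<delta>) *\<^sub>R (\<i> * u t) + \<delta> *\<^sub>R (complex_of_real (g1 (zz t)) + \<i> * complex_of_real (g2 (zz t)))"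
    using zz_bx[of t] by (simp add: osc.rhs_def g_def) (simp add: zp_def)
  then have rhs: "Re (osc.rhs (zz t)) = \<omega> t / \<delta> * Im (u t) + \<delta> * g1 (zz t)"
    "Im (osc.rhs (zz t)) = - (\<omega> t / \<delta>) * Re (u t) + \<delta> * g2 (zz t)" by simp_all
  have "(u has_vector_derivative osc.rhs (zz t)) (at t)" using u(2)[of t] by (simp add: zp_def)
  then show "((\<lambda>t. Re (u t)) has_real_derivative \<omega> t / \<delta> * Im (u t) + \<delta> * g1 (zz t)) (at t)"
    "((\<lambda>t. Im (u t)) has_real_derivative - (\<omega> t / \<delta>) * Re (u t) + \<delta> * g2 (zz t)) (at t)"
    unfolding has_vector_derivative_complex_iff rhs by auto
qed

lemma coords_zz:
  "xi (zz t) = x2 c t + r t * Re (u t)" "zh (zz t) = - \<delta> * \<rho> t * Re (u t) - Im (u t) / r t"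
  "zb (zz t) = z1 t + \<delta>\<^sup>2 * z3 c t + \<delta> * zh (zz t)" "X (pt (zz t)) = x0 t + \<delta>\<^sup>2 * xi (zz t)"
  by (simp_all add: xi_def zh_def zb_def X_def pt_def zp_def)

lemma x_ode: "((\<lambda>t. X (pt (zz t))) has_real_derivative
    - (2 / (real k * \<delta>)) * (\<delta> * zb (zz t)) * (m t - \<delta>\<^sup>2 * e t * X (pt (zz t)))) (at t)"
proof -
  define \<eta>f where "\<eta>f = (\<lambda>t. Re (u t))"
  define \<eta> \<zeta> Xt where "\<eta> = Re (u t)" and "\<zeta> = Im (u t)" and "Xt = X (pt (zz t))"
  have d\<eta>: "(\<eta>f has_real_derivative \<omega> t / \<delta> * \<zeta> + \<delta> * g1 (zz t)) (at t)" and \<eta>f: "\<eta>f t = \<eta>"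
    unfolding \<eta>f_def \<zeta>_def \<eta>_def by (rule u_components) simp
  have Xt: "Xt = x0 t + \<delta>\<^sup>2 * (x2 c t + r t * \<eta>)" unfolding Xt_def \<eta>_def coords_zz ..
  have x2': "((\<lambda>t. x2 c t) has_real_derivative deriv x2a t + c\<^sup>2 * deriv x2b t) (at t)"
    unfolding x2_def by (auto intro!: derivative_eq_intros ders)
  have "((\<lambda>t. X (pt (zz t))) has_real_derivative deriv x0 t + \<delta>\<^sup>2 * (deriv x2a t + c\<^sup>2 * deriv x2b t
      + (deriv r t * \<eta> + r t * (\<omega> t / \<delta> * \<zeta> + \<delta> * g1 (zz t))))) (at t)"
  proof -
    have "(\<lambda>t. X (pt (zz t))) = (\<lambda>t. x0 t + \<delta>\<^sup>2 * (x2 c t + r t * \<eta>f t))"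
      by (simp add: coords_zz \<eta>f_def)
    then show ?thesis
      by (auto intro!: derivative_eq_intros ders x2' d\<eta> simp: algebra_simps \<eta>f)
  qed
  moreover have "deriv x0 t + \<delta>\<^sup>2 * (deriv x2a t + c\<^sup>2 * deriv x2b t
      + (deriv r t * \<eta> + r t * (\<omega> t / \<delta> * \<zeta> + \<delta> * g1 (zz t)))) =
    - (2 / (real k * \<delta>)) * (\<delta> * zb (zz t)) * (m t - \<delta>\<^sup>2 * e t * Xt)"
  proof -
    have rg: "r t * g1 (zz t) = 2 / real k * e t * (zh (zz t) * Xt + \<delta> * z3 c t * Xt + \<delta> * z1 t * (x2 c t + r t * \<eta>))"
      using r_pos[of t] by (simp add: g1_def Xt_def \<eta>_def coords_zz(1)) (simp add: zp_def)
    \<comment> \<open>The defining equations of \<open>z1\<close>, of \<open>z3\<close> and, in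
      \<open>ah\<close>, of \<open>\<rho>\<close> and \<open>r\<close>: multiplied by \<alpha>, the
      expansion of \<open>zb\<close> reproduces the derivatives of x0, x2 and r.\<close>
    have a1: "\<alpha> t * z1 t = - deriv x0 t" using \<alpha>_pos[of t] by (simp add: z1_def)
    have a3: "\<alpha> t * z3 c t = 2 / real k * z1 t * e t * x0 t - deriv x2a t - c\<^sup>2 * deriv x2b t"
      using \<alpha>_pos[of t] by (simp add: z3_def z3a_def z3b_def field_simps)
    have ah: "\<alpha> t * zh (zz t) = - \<delta> * deriv r t * \<eta> - r t * \<omega> t * \<zeta>"
    proof -
      have "\<alpha> t * \<rho> t = deriv r t" using \<alpha>_pos[of t] by (simp add: \<rho>_def)
      moreover have "\<alpha> t / r t = r t * \<omega> t" using r_\<alpha>[of t] r_pos[of t] by (simp add: field_simps power2_eq_square)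
      moreover have "\<alpha> t * zh (zz t) = - \<delta> * (\<alpha> t * \<rho> t) * \<eta> - \<alpha> t / r t * \<zeta>"
        unfolding coords_zz \<eta>_def \<zeta>_def by (simp add: algebra_simps)
      ultimately show ?thesis by simp
    qed
    have "\<alpha> t * zb (zz t) = \<alpha> t * z1 t + \<delta>\<^sup>2 * (\<alpha> t * z3 c t) + \<delta> * (\<alpha> t * zh (zz t))"
      unfolding coords_zz(3) by (simp add: algebra_simps)
    then have azb: "\<alpha> t * zb (zz t) = - deriv x0 t
        + \<delta>\<^sup>2 * (2 / real k * z1 t * e t * x0 t - deriv x2a t - c\<^sup>2 * deriv x2b t)
        + \<delta> * (- \<delta> * deriv r t * \<eta> - r t * \<omega> t * \<zeta>)"
      unfolding a1 a3 ah .
    have "- (2 / (real k * \<delta>)) * (\<delta> * zb (zz t)) * (m t - \<delta>\<^sup>2 * e t * Xt) =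
        - (\<alpha> t * zb (zz t)) + \<delta>\<^sup>2 * (2 / real k * e t * (zb (zz t) * Xt))"
      using \<delta> k by (simp add: \<alpha>_def field_simps)
    also have "zb (zz t) * Xt = z1 t * x0 t + \<delta> * (zh (zz t) * Xt + \<delta> * z3 c t * Xt + \<delta> * z1 t * (x2 c t + r t * \<eta>))"
    proof -
      have "zb (zz t) * Xt = z1 t * Xt + \<delta> * (zh (zz t) * Xt + \<delta> * z3 c t * Xt)"
        unfolding coords_zz(3) by (simp add: algebra_simps power2_eq_square)
      also have "z1 t * Xt = z1 t * x0 t + \<delta> * (\<delta> * z1 t * (x2 c t + r t * \<eta>))"
        unfolding Xt by (simp add: algebra_simps power2_eq_square)
      finally show ?thesis by (simp add: algebra_simps)
    qed
    also have "\<delta>\<^sup>2 * (2 / real k * e t * (z1 t * x0 t + \<delta> * (zh (zz t) * Xt + \<delta> * z3 c t * Xt + \<delta> * z1 t * (x2 c t + r t * \<eta>))))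
        = \<delta>\<^sup>2 * (2 / real k * z1 t * e t * x0 t) + \<delta>\<^sup>2 * (\<delta> * (r t * g1 (zz t)))"
      unfolding rg by (simp add: algebra_simps add_divide_distrib)
    finally show ?thesis unfolding azb using \<delta>
      by (simp add: algebra_simps power2_eq_square)
  qed
  ultimately show ?thesis by (simp add: Xt_def)
qed

lemma z_ode: "((\<lambda>t. \<delta> * zb (zz t)) has_real_derivative
    (G1 (pt (zz t)) + \<delta>\<^sup>2 * KK (pt (zz t))) / \<delta>) (at t)"
proof -
  define \<eta> \<zeta> where "\<eta> = Re (u t)" and "\<zeta> = Im (u t)"
  define \<eta>' where "\<eta>' = \<omega> t / \<delta> * \<zeta> + \<delta> * g1 (zz t)"
  define \<zeta>' where "\<zeta>' = - (\<omega> t / \<delta>) * \<eta> + \<delta> * g2 (zz t)"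
  define z3' where "z3' = deriv z3a t + c\<^sup>2 * deriv z3b t"
  define \<eta>f \<zeta>f where "\<eta>f = (\<lambda>t. Re (u t))" and "\<zeta>f = (\<lambda>t. Im (u t))"
  have d: "(\<eta>f has_real_derivative \<eta>') (at t)" "(\<zeta>f has_real_derivative \<zeta>') (at t)"
    and fs: "\<eta>f t = \<eta>" "\<zeta>f t = \<zeta>"
    using u_components[of t] by (simp_all add: \<eta>'_def \<zeta>'_def \<eta>_def \<zeta>_def \<eta>f_def \<zeta>f_def)
  have d3: "((\<lambda>t. z3 c t) has_real_derivative z3') (at t)"
    unfolding z3_def z3'_def by (auto intro!: derivative_eq_intros ders)
  have "((\<lambda>t. zb (zz t)) has_real_derivative deriv z1 t + \<delta>\<^sup>2 * z3'
      + \<delta> * (- \<delta> * (deriv \<rho> t * \<eta> + \<rho> t * \<eta>') - (\<zeta>' * r t - \<zeta> * deriv r t) / (r t * r t))) (at t)"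
  proof -
    have "(\<lambda>t. zb (zz t)) = (\<lambda>t. z1 t + \<delta>\<^sup>2 * z3 c t + \<delta> * (- \<delta> * (\<rho> t * \<eta>f t) - \<zeta>f t / r t))"
      by (simp add: coords_zz \<eta>f_def \<zeta>f_def mult.assoc)
    then show ?thesis using r_pos[of t]
      by (auto intro!: derivative_eq_intros ders d d3 simp: algebra_simps fs)
  qed
  moreover have "deriv z1 t + \<delta>\<^sup>2 * z3'
      + \<delta> * (- \<delta> * (deriv \<rho> t * \<eta> + \<rho> t * \<eta>') - (\<zeta>' * r t - \<zeta> * deriv r t) / (r t * r t)) =
    deriv z1 t + \<beta> t * r t * \<eta> + \<delta>\<^sup>2 * h (pt (zz t))"
  proof -
    \<comment> \<open>This makes the derivative of 1/r cancel against the rotating part of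
      \<delta>^2 \<rho> \<eta>'.\<close>
    have \<rho>\<omega>: "\<rho> t * \<omega> t = deriv r t / (r t * r t)"
      using r_\<alpha>[of t] r_pos[of t] \<alpha>_pos[of t] \<omega>_pos[of t]
      by (simp add: \<rho>_def power2_eq_square r_\<alpha>[of t, symmetric])
    have \<omega>r: "\<omega> t / r t = \<beta> t * r t"
      using r_\<beta>[of t] r_pos[of t] by (simp add: field_simps power2_eq_square)
    have g2r: "g2 (zz t) / r t = - h (pt (zz t)) + z3' - deriv \<rho> t * \<eta> - \<rho> t * \<delta> * g1 (zz t)"
      using r_pos[of t] by (simp add: g2_def z3'_def \<eta>_def) (simp add: zp_def)
    have "\<delta> * (- \<delta> * (deriv \<rho> t * \<eta> + \<rho> t * \<eta>') - (\<zeta>' * r t - \<zeta> * deriv r t) / (r t * r t)) =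
        - \<delta>\<^sup>2 * deriv \<rho> t * \<eta> - \<delta>\<^sup>2 * \<rho> t * \<eta>' - \<delta> * \<zeta>' / r t + \<delta> * \<zeta> * (deriv r t / (r t * r t))"
      using r_pos[of t] by (simp add: algebra_simps diff_divide_distrib power2_eq_square)
    also have "\<delta>\<^sup>2 * \<rho> t * \<eta>' = \<delta> * \<zeta> * (\<rho> t * \<omega> t) + \<delta>\<^sup>2 * (\<rho> t * \<delta> * g1 (zz t))"
      using \<delta> by (simp add: \<eta>'_def algebra_simps power2_eq_square)
    also have "\<delta> * \<zeta>' / r t = - (\<omega> t / r t) * \<eta> + \<delta>\<^sup>2 * (g2 (zz t) / r t)"
      using \<delta> r_pos[of t] by (simp add: \<zeta>'_def algebra_simps power2_eq_square add_divide_distrib diff_divide_distrib)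
    finally show ?thesis unfolding \<rho>\<omega> \<omega>r g2r by (simp add: algebra_simps)
  qed
  moreover have "(G1 (pt (zz t)) + \<delta>\<^sup>2 * KK (pt (zz t))) / \<delta> = \<delta> * (deriv z1 t + \<beta> t * r t * \<eta> + \<delta>\<^sup>2 * h (pt (zz t)))"
  proof -
    \<comment> \<open>The defining equation of \<open>x2\<close>: the terms of order \<delta>^2 in
      \<delta> z' are balanced by the derivative of \<open>z1\<close>, up to the oscillating
      part.\<close>
    have bx2: "\<beta> t * xi (zz t) + (e t - 2 * c\<^sup>2) / x0 t ^ k = deriv z1 t + \<beta> t * r t * \<eta>"
      using \<beta>_pos[of t] x0_pos[of t]
      by (simp add: coords_zz x2_def x2a_def x2b_def \<eta>_def field_simps)
    show ?thesis
      using h_eq[OF zz_D'[of t]] \<delta> unfolding pt_zz bx2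
      by (simp add: field_simps power2_eq_square)
  qed
  ultimately show ?thesis by (metis DERIV_cmult)
qed

lemma reduced: "reduced_solution k1 k d1 d2 P L \<delta> c \<sigma> (\<lambda>t. X (pt (zz t))) (\<lambda>t. Y (pt (zz t))) (\<lambda>t. \<delta> * zb (zz t))"
proof
  fix t
  define p where "p = pt (zz t)"
  have p: "p = (\<delta>\<^sup>2, c, t, xi (zz t), (zb (zz t))\<^sup>2)" unfolding p_def pt_zz ..
  note f = D_facts[OF zz_D'[of t], folded p]
  note q = Y_quadratic[OF zz_D'[of t], folded p]
  have Qp: "Q p = 1 + (c\<^sup>2 - 1) * \<delta>\<^sup>2 * Y p" and Vp: "V p = inverse (X p) ^ k"
    unfolding p by (simp_all add: Q_def V_def)
  show "0 < X (pt (zz t))" "0 < Y (pt (zz t))" "\<delta>\<^sup>2 * Y (pt (zz t)) < 1"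
    using f(1,7,8) by (auto simp: p_def[symmetric] abs_less_iff)
  show "(1 + (c\<^sup>2 - 1) * \<delta>\<^sup>2 * Y (pt (zz t))) * inverse (X (pt (zz t))) ^ k =
      Y (pt (zz t)) - \<delta>\<^sup>2 * (Y (pt (zz t)))\<^sup>2 - (\<delta> * zb (zz t))\<^sup>2"
    using q(1) unfolding p_def[symmetric] Qp Vp by (simp add: power_mult_distrib)
  show "1 - 2 * \<delta>\<^sup>2 * Y (pt (zz t)) - (c\<^sup>2 - 1) * \<delta>\<^sup>2 * inverse (X (pt (zz t))) ^ k \<noteq> 0"
    using q(2) f(6) unfolding p_def[symmetric] Vp by linarith
  show "0 < 1 + (c\<^sup>2 - 1) * \<delta>\<^sup>2 * Y (pt (zz t))"
    using q(3) unfolding p_def[symmetric] Qp by simp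
  show "((\<lambda>t. X (pt (zz t))) has_real_derivative - (2 / (real k * \<delta>)) * (\<delta> * zb (zz t)) * (m t - \<delta>\<^sup>2 * e t * X (pt (zz t)))) (at t)"
    by (rule x_ode)
  have "G1 p + \<delta>\<^sup>2 * KK p = 1 - (1 + (c\<^sup>2 - 1) * \<delta>\<^sup>2 * Y p) * V p * (m t / X p - \<delta>\<^sup>2 * e t)
      - 2 * \<delta>\<^sup>2 * Y p - \<delta>\<^sup>2 * (c\<^sup>2 - 1) * V p"
  proof -
    have G: "G1 p = 1 - m t * V p / X p" and K: "KK p = - (c\<^sup>2 - 1) * m t * Y p * V p / X p + e t * Q p * V p - 2 * Y p - (c\<^sup>2 - 1) * V p"
      unfolding p by (simp_all add: G1_def KK_def Let_def)
    show ?thesis unfolding G K Qp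
      by (simp add: algebra_simps diff_divide_distrib add_divide_distrib)
  qed
  then show "((\<lambda>t. \<delta> * zb (zz t)) has_real_derivative (1 - (1 + (c\<^sup>2 - 1) * \<delta>\<^sup>2 * Y (pt (zz t))) * inverse (X (pt (zz t))) ^ k *
      (m t / X (pt (zz t)) - \<delta>\<^sup>2 * e t) - 2 * \<delta>\<^sup>2 * Y (pt (zz t)) - \<delta>\<^sup>2 * (c\<^sup>2 - 1) * inverse (X (pt (zz t))) ^ k) / \<delta>) (at t)"
    using z_ode[of t] unfolding p_def[symmetric] Vp by simp
next
  have "smooth_on UNIV zz" unfolding zp_def[abs_def] by (intro smooth_intros open_UNIV u_smooth)
  then show "smooth_on UNIV (\<lambda>t. Y (pt (zz t)))"
    using zz_bx by (intro smooth_on_compose[OF open_UNIV open_bx comp_bx[OF Y_smooth]]) auto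
qed (use \<delta> \<sigma> in auto)

end

end

section \<open>Phase increments\<close>

lemma smooth_bounds_on_compact:
  fixes f :: "'a::euclidean_space \<Rightarrow> 'b::real_normed_vector"
  assumes "smooth_on B f" "compact C" "C \<subseteq> B"
  obtains M where "M > 0" "\<And>z. z \<in> C \<Longrightarrow> norm (f z) \<le> M"
    "\<And>z v. z \<in> C \<Longrightarrow> norm (frechet_derivative f (at z) v) \<le> M * norm v"
proof -
  obtain M0 where M0: "M0 > 0" "\<And>z. z \<in> C \<Longrightarrow> norm (f z) \<le> M0"
    by (rule continuous_bounded_on_compact[OF smooth_on_continuous[OF assms(1)] assms(2,3)]) blast
  have "\<exists>M>0. \<forall>z\<in>C. norm (frechet_derivative f (at z) b) \<le> M" for b
    by (rule continuous_bounded_on_compact[OF smooth_on_continuous[OF smooth_on_frechet[OF assms(1), of b]] assms(2,3)])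
      blast
  then obtain m where m: "\<And>b. m b > 0" "\<And>b z. z \<in> C \<Longrightarrow> norm (frechet_derivative f (at z) b) \<le> m b"
    by metis
  define M where "M = M0 + (\<Sum>b\<in>(Basis :: 'a set). m b)"
  have sum0: "(\<Sum>b\<in>(Basis :: 'a set). m b) \<ge> 0" using m(1) by (intro sum_nonneg less_imp_le)
  show ?thesis
  proof (rule that[of M])
    show "M > 0" using M0 sum0 by (simp add: M_def)
    show "norm (f z) \<le> M" if "z \<in> C" for z using M0(2)[OF that] sum0 by (simp add: M_def)
    fix z v assume z: "z \<in> C"
    have lin: "linear (frechet_derivative f (at z))"
      by (rule has_derivative_linear[OF smooth_on_has_derivative[OF assms(1)]]) (use z assms(3) in auto)
    have "frechet_derivative f (at z) v = frechet_derivative f (at z) (\<Sum>b\<in>Basis. (v \<bullet> b) *\<^sub>R b)"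
      by (simp add: euclidean_representation)
    also have "\<dots> = (\<Sum>b\<in>Basis. (v \<bullet> b) *\<^sub>R frechet_derivative f (at z) b)"
      by (simp add: linear_sum[OF lin] linear_cmul[OF lin] del: euclidean_representation)
    also have "norm \<dots> \<le> (\<Sum>b\<in>Basis. norm v * m b)"
    proof (rule sum_norm_le)
      fix b :: 'a assume "b \<in> Basis"
      then show "norm ((v \<bullet> b) *\<^sub>R frechet_derivative f (at z) b) \<le> norm v * m b"
        unfolding norm_scaleR using m(2)[OF z, of b] Basis_le_norm[of b v] by (intro mult_mono) auto
    qed
    also have "\<dots> = norm v * (\<Sum>b\<in>Basis. m b)" by (simp add: sum_distrib_left)
    also have "\<dots> \<le> M * norm v" using M0(1) by (simp add: M_def algebra_simps)
    finally show "norm (frechet_derivative f (at z) v) \<le> M * norm v" .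
  qed
qed

lemma det_surj:
  fixes A11 A12 A21 A22 :: real
  assumes "A11 * A22 - A12 * A21 \<noteq> 0"
  shows "surj (\<lambda>h. (A11 * fst h + A12 * snd h, A21 * fst h + A22 * snd h))"
  unfolding surj_def
proof
  let ?d = "A11 * A22 - A12 * A21"
  fix y :: "real \<times> real"
  show "\<exists>x. y = (A11 * fst x + A12 * snd x, A21 * fst x + A22 * snd x)"
  proof (intro exI)
    have "A11 * ((A22 * fst y - A12 * snd y) / ?d) + A12 * ((A11 * snd y - A21 * fst y) / ?d) = fst y * ?d / ?d"
      by (simp add: add_divide_distrib[symmetric] algebra_simps)
    moreover have "A21 * ((A22 * fst y - A12 * snd y) / ?d) + A22 * ((A11 * snd y - A21 * fst y) / ?d) = snd y * ?d / ?d"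
      by (simp add: add_divide_distrib[symmetric] algebra_simps)
    ultimately show "y = (A11 * fst ((A22 * fst y - A12 * snd y) / ?d, (A11 * snd y - A21 * fst y) / ?d)
          + A12 * snd ((A22 * fst y - A12 * snd y) / ?d, (A11 * snd y - A21 * fst y) / ?d),
        A21 * fst ((A22 * fst y - A12 * snd y) / ?d, (A11 * snd y - A21 * fst y) / ?d)
          + A22 * snd ((A22 * fst y - A12 * snd y) / ?d, (A11 * snd y - A21 * fst y) / ?d))"
      using assms by (simp add: prod_eq_iff)
  qed
qed

lemma integral_pos:
  fixes P :: real
  assumes P: "P > 0" and f: "continuous_on UNIV f" "\<And>t. f t > (0 :: real)"
  shows "integral {0..P} f > 0"
proof -
  have c: "continuous_on {0..P} f" using f(1) continuous_on_subset by blast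
  have "integral {0..P} f \<noteq> 0"
    using integral_eq_0_iff[OF c] f(2) P by (metis atLeastAtMost_iff less_imp_le less_irrefl order_refl)
  moreover have "integral {0..P} f \<ge> 0"
    by (rule integral_nonneg[OF integrable_continuous_real[OF c]]) (simp add: f(2) less_imp_le)
  ultimately show ?thesis by simp
qed

locale slow_family = slow_expansion +
  fixes t1 t2 :: "real \<times> real \<times> real \<times> real \<times> real \<Rightarrow> real" and \<sigma> \<delta>2 M :: real
    and u :: "real \<times> real \<Rightarrow> real \<Rightarrow> complex"
  assumes t_smooth: "smooth_on D t1" "smooth_on D t2"
    and S1_eq: "\<And>\<mu> c t \<xi> b. (\<mu>, c, t, \<xi>, b) \<in> D \<Longrightarrow> S1 (\<mu>, c, t, \<xi>, b) = sqrt (x0 t ^ k) + \<mu> * t1 (\<mu>, c, t, \<xi>, b)"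
    and S2_eq: "\<And>\<mu> c t \<xi> b. (\<mu>, c, t, \<xi>, b) \<in> D \<Longrightarrow> S2 (\<mu>, c, t, \<xi>, b) = 1 / sqrt (x0 t ^ k) + \<mu> * t2 (\<mu>, c, t, \<xi>, b)"
    and \<sigma>: "\<sigma> \<in> {-1, 1}"
    and \<delta>2: "0 < \<delta>2" "\<delta>2 \<le> \<delta>1/2" "\<delta>2 \<le> 1" and M: "M > 0"
    and u_per: "\<And>p. p \<in> osc.dom \<delta>2 \<Longrightarrow> periodic P (u p)"
    and u_lt: "\<And>p t. p \<in> osc.dom \<delta>2 \<Longrightarrow> norm (u p t) < 1"
    and u_ode: "\<And>p t. p \<in> osc.dom \<delta>2 \<Longrightarrow> (u p has_vector_derivative osc.rhs ((p, t), u p t)) (at t)"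
    and u_smooth: "smooth_on (osc.dom \<delta>2 \<times> UNIV) (\<lambda>(p, t). u p t)"
    and u_\<delta>: "\<And>\<delta> c t. (\<delta>, c) \<in> osc.dom \<delta>2 \<Longrightarrow>
      norm (frechet_derivative (\<lambda>(p, t). u p t) (at ((\<delta>, c), t)) ((1, 0), 0)) \<le> M / \<delta>"
    and u_c: "\<And>\<delta> c t. (\<delta>, c) \<in> osc.dom \<delta>2 \<Longrightarrow>
      norm (frechet_derivative (\<lambda>(p, t). u p t) (at ((\<delta>, c), t)) ((0, 1), 0)) \<le> M * \<delta>"
begin

abbreviation "dm \<equiv> osc.dom \<delta>2"

definition zf where "zf x = (x, u (fst x) (snd x))" for x :: "(real \<times> real) \<times> real"

lemma open_dmR: "open (dm \<times> (UNIV :: real set))"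
  by (intro open_Times osc.open_dom open_UNIV)

lemma dm_bounds:
  assumes "(\<delta>, c) \<in> dm"
  shows "0 < \<delta>" "\<delta> < \<delta>1" "\<delta> \<le> 1" "\<delta> \<le> \<delta>1/2" "c0 - 1/2 < c" "c < c0 + 1/2"
  using assms \<delta>2 \<delta>1 by (auto simp: osc.dom_def)

lemma zf_bx: "zf ` (dm \<times> UNIV) \<subseteq> bx"
proof -
  have "zf ((\<delta>, c), t) \<in> bx" if "(\<delta>, c) \<in> dm" for \<delta> c t
    using dm_bounds[OF that] u_lt[OF that, of t] by (auto simp: zf_def bx_def)
  then show ?thesis by auto
qed

lemma zf_D': "x \<in> dm \<times> UNIV \<Longrightarrow> pt (zf x) \<in> D"
  using zf_bx bx_D by blast

lemma zf_smooth: "smooth_on (dm \<times> UNIV) zf"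
proof -
  have "smooth_on (dm \<times> UNIV) (\<lambda>x. u (fst x) (snd x))"
    using u_smooth by (simp add: case_prod_beta')
  then show ?thesis unfolding zf_def[abs_def] by (intro smooth_intros open_dmR)
qed

lemma zf_D: "p \<in> dm \<Longrightarrow> pt (zf (p, t)) \<in> D"
  using zf_bx bx_D by blast

lemma comp_smooth: "smooth_on D f \<Longrightarrow> smooth_on (dm \<times> UNIV) (\<lambda>x. f (pt (zf x)))"
  by (rule smooth_on_compose[OF open_dmR open_bx comp_bx zf_smooth zf_bx])

lemma slice_smooth:
  fixes f :: "(real \<times> real) \<times> real \<Rightarrow> 'b::euclidean_space"
  assumes "smooth_on (dm \<times> UNIV) f" "p \<in> dm"
  shows "smooth_on UNIV (\<lambda>t. f (p, t))"
  by (rule smooth_on_compose[OF open_UNIV open_dmR assms(1)])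
    (use assms(2) in \<open>auto intro!: smooth_intros\<close>)

definition aa where "aa p t = fst p * sqrt (Y (pt (zf (p, t))))"
definition ll where "ll p t = fst p * sqrt (X (pt (zf (p, t)))) * L t powr (- (real k1 / real k))"
definition r1 where "r1 p t = \<sigma> / fst p * S1 (pt (zf (p, t)))"
definition r2 where "r2 p t = \<sigma> * snd p * fst p * S2 (pt (zf (p, t)))"
definition s1 where "s1 p = primitive (r1 p)"
definition s2 where "s2 p = primitive (r2 p)"

lemma fst_nz: "x \<in> dm \<times> UNIV \<Longrightarrow> fst (fst x) \<noteq> 0"
  using dm_bounds by fastforce

lemma aa_smooth: "smooth_on (dm \<times> UNIV) (\<lambda>(p, t). aa p t)"
  unfolding aa_def case_prod_beta' prod.collapse
  by (intro smooth_intros open_dmR comp_smooth[OF Y_smooth]) (erule D_facts'(7)[OF zf_D'])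

lemma ll_smooth: "smooth_on (dm \<times> UNIV) (\<lambda>(p, t). ll p t)"
  unfolding ll_def case_prod_beta' prod.collapse
  by (intro smooth_intros open_dmR comp_smooth[OF X_smooth] smooth_on_compose_UNIV[OF L_smooth])
    (erule D_facts'(1)[OF zf_D'] | rule L_pos)+

lemma r1_smooth: "smooth_on (dm \<times> UNIV) (\<lambda>(p, t). r1 p t)"
  unfolding r1_def case_prod_beta' prod.collapse
  by (intro smooth_intros open_dmR comp_smooth[OF S1_smooth]) (use fst_nz in auto)

lemma r2_smooth: "smooth_on (dm \<times> UNIV) (\<lambda>(p, t). r2 p t)"
  unfolding r2_def case_prod_beta' prod.collapse
  by (intro smooth_intros open_dmR comp_smooth[OF S2_smooth])

lemma s_smooth: "smooth_on (dm \<times> UNIV) (\<lambda>(p, t). s1 p t)" "smooth_on (dm \<times> UNIV) (\<lambda>(p, t). s2 p t)"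
  unfolding s1_def s2_def
  by (intro smooth_on_primitive osc.open_dom r1_smooth r2_smooth)+

lemma r_cont: "p \<in> dm \<Longrightarrow> continuous_on A (r1 p)" "p \<in> dm \<Longrightarrow> continuous_on A (r2 p)"
  using smooth_on_continuous[OF slice_smooth[OF r1_smooth, of p]]
    smooth_on_continuous[OF slice_smooth[OF r2_smooth, of p]]
  by (auto intro: continuous_on_subset)

lemma s_derivative: "p \<in> dm \<Longrightarrow> (s1 p has_real_derivative r1 p t) (at t)"
  "p \<in> dm \<Longrightarrow> (s2 p has_real_derivative r2 p t) (at t)"
  unfolding s1_def s2_def has_real_derivative_iff_has_vector_derivative
  using primitive_derivative[OF r_cont(1)] primitive_derivative[OF r_cont(2)] by blast+

lemma pt_zf_per:
  assumes "p \<in> dm"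
  shows "pt (zf (p, t + P)) = (case pt (zf (p, t)) of (\<mu>, c, s, q) \<Rightarrow> (\<mu>, c, t + P, q))"
  using u_per[OF assms] pt_per[of p t "u p t"] by (simp add: zf_def periodic_def)

lemma XY_per: "p \<in> dm \<Longrightarrow> X (pt (zf (p, t + P))) = X (pt (zf (p, t)))"
  "p \<in> dm \<Longrightarrow> Y (pt (zf (p, t + P))) = Y (pt (zf (p, t)))"
  using tuple_per by (simp_all add: pt_zf_per) (simp_all add: pt_def zf_def)

lemma all_periodic:
  assumes "p \<in> dm"
  shows "periodic P (aa p)" "periodic P (ll p)" "periodic P (r1 p)" "periodic P (r2 p)"
  using XY_per[OF assms] fst_nz
  by (auto simp: periodic_def aa_def ll_def r1_def r2_def S1_def S2_def V_def pers)
    (simp_all add: pt_def zf_def)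

lemma is_reconstruction:
  assumes "(\<delta>, c) \<in> dm"
  shows "periodic_reconstruction P k1 d1 k d2 c (\<delta> ^ (2 * (k + 1))) \<sigma> (aa (\<delta>, c)) L (ll (\<delta>, c)) (s1 (\<delta>, c)) (s2 (\<delta>, c))"
proof -
  note b = dm_bounds[OF assms]
  have us: "smooth_on UNIV (u (\<delta>, c))"
    using slice_smooth[OF u_smooth assms] by simp
  have eq: "zp \<delta> c (u (\<delta>, c)) t = zf ((\<delta>, c), t)" for t
    by (simp add: zp_def zf_def)
  have red: "reduced_solution k1 k d1 d2 P L \<delta> c \<sigma> (\<lambda>t. X (pt (zf ((\<delta>, c), t)))) (\<lambda>t. Y (pt (zf ((\<delta>, c), t))))
      (\<lambda>t. \<delta> * zb (zf ((\<delta>, c), t)))"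
    using reduced[of \<delta> c \<sigma> "u (\<delta>, c)"] b \<sigma> u_lt[OF assms] u_ode[OF assms] us unfolding eq by simp
  interpret rs: reduced_solution k1 k d1 d2 P L \<delta> c \<sigma> "\<lambda>t. X (pt (zf ((\<delta>, c), t)))" "\<lambda>t. Y (pt (zf ((\<delta>, c), t)))"
      "\<lambda>t. \<delta> * zb (zf ((\<delta>, c), t))"
    by (rule red)
  have a: "rs.a = aa (\<delta>, c)" and l: "rs.l2 = ll (\<delta>, c)"
    by (auto simp: rs.a_def aa_def rs.l2_def ll_def)
  have v: "rs.v t = V (pt (zf ((\<delta>, c), t)))" for t by (simp add: rs.v_def V_def)
  have f: "fst (pt (zf ((\<delta>, c), t))) = \<delta>\<^sup>2" for t by (simp add: pt_def zf_def)
  have "phases c (\<delta> ^ (2 * (k + 1))) \<sigma> (aa (\<delta>, c)) (s1 (\<delta>, c)) (s2 (\<delta>, c))"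
    unfolding phases_def a[symmetric] rs.phase_rates
    using s_derivative[OF assms] by (simp add: v r1_def r2_def S1_def S2_def f)
  then show ?thesis
    unfolding periodic_reconstruction_def reconstruction_def
    using rs.source rs.admissible b \<sigma> all_periodic(1)[OF assms] by (simp add: a l)
qed

text \<open>As sqrt (x0^k) = 1/y0, \<open>I1\<close> and \<open>I2\<close> are the integrals of 1/y0
  and of y0 over one period, the leading coefficients of the two increments.\<close>

definition I1 where "I1 = integral {0..P} (\<lambda>t. sqrt (x0 t ^ k))"
definition I2 where "I2 = integral {0..P} (\<lambda>t. 1 / sqrt (x0 t ^ k))"
definition J1 where "J1 p = integral {0..P} (\<lambda>t. t1 (pt (zf (p, t))))"
definition J2 where "J2 p = integral {0..P} (\<lambda>t. t2 (pt (zf (p, t))))"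

lemma x0k_cont: "continuous_on A (\<lambda>t. sqrt (x0 t ^ k))" "continuous_on A (\<lambda>t. 1 / sqrt (x0 t ^ k))"
  using continuous_on_subset[OF smooth_on_continuous[OF x0_smooth], of A] x0_pos
  by (auto intro!: continuous_intros simp: nz)

lemma I_pos: "I1 > 0" "I2 > 0"
  unfolding I1_def I2_def using x0_pos by (auto intro!: integral_pos P x0k_cont)

lemma phase_increments:
  assumes "(\<delta>, c) \<in> dm"
  shows "phase_increment P (s1 (\<delta>, c)) = \<sigma> * (I1 / \<delta> + \<delta> * J1 (\<delta>, c))"
    "phase_increment P (s2 (\<delta>, c)) = \<sigma> * c * (\<delta> * I2 + \<delta> ^ 3 * J2 (\<delta>, c))"
proof -
  note b = dm_bounds[OF assms]
  have d: "deriv (s1 (\<delta>, c)) = r1 (\<delta>, c)" "deriv (s2 (\<delta>, c)) = r2 (\<delta>, c)"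
    using s_derivative[OF assms] DERIV_imp_deriv by blast+
  have e: "pt (zf ((\<delta>, c), t)) = (\<delta>\<^sup>2, c, t, xi (zf ((\<delta>, c), t)), (zb (zf ((\<delta>, c), t)))\<^sup>2)" for t
    by (simp add: pt_def zf_def)
  have S: "S1 (pt (zf ((\<delta>, c), t))) = sqrt (x0 t ^ k) + \<delta>\<^sup>2 * t1 (pt (zf ((\<delta>, c), t)))"
    "S2 (pt (zf ((\<delta>, c), t))) = 1 / sqrt (x0 t ^ k) + \<delta>\<^sup>2 * t2 (pt (zf ((\<delta>, c), t)))" for t
    using S1_eq[of "\<delta>\<^sup>2" c t] S2_eq[of "\<delta>\<^sup>2" c t] zf_D[OF assms, of t] unfolding e by blast+
  have i: "(\<lambda>t. t1 (pt (zf ((\<delta>, c), t)))) integrable_on {0..P}" "(\<lambda>t. t2 (pt (zf ((\<delta>, c), t)))) integrable_on {0..P}"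
    using continuous_on_subset[OF smooth_on_continuous[OF slice_smooth[OF comp_smooth[OF t_smooth(1)] assms]], of "{0..P}"]
      continuous_on_subset[OF smooth_on_continuous[OF slice_smooth[OF comp_smooth[OF t_smooth(2)] assms]], of "{0..P}"]
    by (auto intro: integrable_continuous_real)
  have i0: "(\<lambda>t. sqrt (x0 t ^ k)) integrable_on {0..P}" "(\<lambda>t. 1 / sqrt (x0 t ^ k)) integrable_on {0..P}"
    by (intro integrable_continuous_real x0k_cont)+
  have "phase_increment P (s1 (\<delta>, c)) = \<sigma> / \<delta> * (I1 + \<delta>\<^sup>2 * J1 (\<delta>, c))"
    unfolding phase_increment_def d r1_def S I1_def J1_def
    using i(1) i0(1) by (simp add: integral_add integrable_on_mult_right)
  then show "phase_increment P (s1 (\<delta>, c)) = \<sigma> * (I1 / \<delta> + \<delta> * J1 (\<delta>, c))"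
    using b by (simp add: field_simps power2_eq_square)
  have "phase_increment P (s2 (\<delta>, c)) = \<sigma> * c * \<delta> * (I2 + \<delta>\<^sup>2 * J2 (\<delta>, c))"
    unfolding phase_increment_def d r2_def S I2_def J2_def
    using i(2) i0(2) by (simp add: integral_add integrable_on_mult_right)
  then show "phase_increment P (s2 (\<delta>, c)) = \<sigma> * c * (\<delta> * I2 + \<delta> ^ 3 * J2 (\<delta>, c))"
    by (simp add: algebra_simps power2_eq_square power3_eq_cube)
qed

text \<open>The integrand is a fixed smooth function composed with the solution, so its derivatives
  inherit the orders of \<open>u\<close>: 1/\<delta> in \<delta>, bounded in c. The compact set
  \<open>K\<close> contains all values of the solution over one period, which makes \<open>C\<close>
  independent of the parameters.\<close>

lemma correction_bounds:
  assumes f: "smooth_on D f"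
  defines "J \<equiv> \<lambda>p. integral {0..P} (\<lambda>t. f (pt (zf (p, t))))"
  shows "\<exists>C>0. \<forall>\<delta> c. (\<delta>, c) \<in> dm \<longrightarrow>
    (\<exists>Jd Jc. (J has_derivative (\<lambda>h. Jd * fst h + Jc * snd h)) (at (\<delta>, c)) \<and>
      \<bar>J (\<delta>, c)\<bar> \<le> C \<and> \<delta> * \<bar>Jd\<bar> \<le> C \<and> \<bar>Jc\<bar> \<le> C)"
proof -
  define K where "K = (({-\<delta>1/2..\<delta>1/2} \<times> {c0-1/2..c0+1/2}) \<times> {0..P}) \<times> cball (0 :: complex) 1"
  have K: "compact K" "K \<subseteq> bx" using \<delta>1 by (auto simp: K_def bx_def intro!: compact_Times)
  obtain B where B: "B > 0" "\<And>z. z \<in> K \<Longrightarrow> norm (f (pt z)) \<le> B"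
    "\<And>z v. z \<in> K \<Longrightarrow> norm (frechet_derivative (\<lambda>z. f (pt z)) (at z) v) \<le> B * norm v"
    by (rule smooth_bounds_on_compact[OF comp_bx[OF f] K]) blast
  define C where "C = P * B * (1 + M)"
  have C: "C > 0" using P B M by (simp add: C_def)
  have J_smooth: "smooth_on dm J"
    unfolding J_def by (rule smooth_on_parametric_integral[OF osc.open_dom open_dmR _ comp_smooth[OF f]]) auto
  show ?thesis
  proof (rule exI[of _ C], intro conjI allI impI C)
    fix \<delta> c assume p: "(\<delta>, c) \<in> dm"
    note b = dm_bounds[OF p]
    have zK: "zf ((\<delta>, c), t) \<in> K" if "t \<in> {0..P}" for t
      using b u_lt[OF p, of t] that \<delta>1 by (auto simp: K_def zf_def)
    have zD: "(zf has_derivative frechet_derivative zf (at ((\<delta>, c), t))) (at ((\<delta>, c), t))" for t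
      by (rule smooth_on_has_derivative[OF zf_smooth]) (use p in auto)
    have dz: "frechet_derivative zf (at ((\<delta>, c), t)) (e, 0) =
        ((e, 0), frechet_derivative (\<lambda>(p, t). u p t) (at ((\<delta>, c), t)) (e, 0))" for t e
    proof -
      have "((\<lambda>(p, t). u p t) has_derivative frechet_derivative (\<lambda>(p, t). u p t) (at ((\<delta>, c), t))) (at ((\<delta>, c), t))"
        by (rule smooth_on_has_derivative[OF u_smooth]) (use p in auto)
      then have "((\<lambda>x. u (fst x) (snd x)) has_derivative frechet_derivative (\<lambda>(p, t). u p t) (at ((\<delta>, c), t))) (at ((\<delta>, c), t))"
        by (simp add: case_prod_beta')
      from has_derivative_Pair[OF has_derivative_ident this]
      have "(zf has_derivative (\<lambda>h. (h, frechet_derivative (\<lambda>(p, t). u p t) (at ((\<delta>, c), t)) h))) (at ((\<delta>, c), t))"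
        unfolding zf_def[abs_def] .
      from frechet_derivative_at[OF this] show ?thesis by metis
    qed
    have dv: "frechet_derivative (\<lambda>x. f (pt (zf x))) (at ((\<delta>, c), t)) (e, 0) =
        frechet_derivative (\<lambda>z. f (pt z)) (at (zf ((\<delta>, c), t))) (frechet_derivative zf (at ((\<delta>, c), t)) (e, 0))" for t e
    proof -
      have "((\<lambda>z. f (pt z)) has_derivative frechet_derivative (\<lambda>z. f (pt z)) (at (zf ((\<delta>, c), t)))) (at (zf ((\<delta>, c), t)))"
        by (rule smooth_on_has_derivative[OF comp_bx[OF f]]) (use p zf_bx in auto)
      from frechet_derivative_at[OF has_derivative_compose[OF zD this]] show ?thesis by metis
    qed
    \<comment> \<open>One estimate for both parameter directions; \<open>N\<close> will be M /
      \<delta> in the first and M \<delta> in the second.\<close>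
    have bound: "\<bar>frechet_derivative J (at (\<delta>, c)) e\<bar> \<le> P * (B * (norm e + N))"
      if N: "\<And>t. norm (frechet_derivative (\<lambda>(p, t). u p t) (at ((\<delta>, c), t)) (e, 0)) \<le> N" for e N
    proof -
      have N0: "N \<ge> 0" using N[of 0] norm_ge_zero order_trans by blast
      have "(J has_derivative frechet_derivative J (at (\<delta>, c))) (at ((\<delta>, c) + 0 *\<^sub>R e))"
        using smooth_on_has_derivative[OF J_smooth p] by simp
      from has_vector_derivative_line[OF this]
      have 1: "((\<lambda>s. J ((\<delta>, c) + s *\<^sub>R e)) has_vector_derivative frechet_derivative J (at (\<delta>, c)) e) (at 0)" .
      have 2: "((\<lambda>s. J ((\<delta>, c) + s *\<^sub>R e)) has_vector_derivative
          integral {0..P} (\<lambda>t. frechet_derivative (\<lambda>x. f (pt (zf x))) (at ((\<delta>, c), t)) (e, 0))) (at 0)"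
        unfolding J_def
        by (rule parametric_integral_derivative[OF osc.open_dom _ smooth_onD[OF comp_smooth[OF f]] p]) auto
      have eq: "frechet_derivative J (at (\<delta>, c)) e =
          integral {0..P} (\<lambda>t. frechet_derivative (\<lambda>x. f (pt (zf x))) (at ((\<delta>, c), t)) (e, 0))"
        by (rule vector_derivative_unique_at[OF 1 2])
      have "norm (integral {0..P} (\<lambda>t. frechet_derivative (\<lambda>x. f (pt (zf x))) (at ((\<delta>, c), t)) (e, 0)))
          \<le> B * (norm e + N) * (P - 0)"
      proof (rule integral_bound)
        show "0 \<le> P" using P by simp
        show "continuous_on {0..P} (\<lambda>t. frechet_derivative (\<lambda>x. f (pt (zf x))) (at ((\<delta>, c), t)) (e, 0))"
          by (rule continuous_on_compose2[OF smooth_on_continuous[OF smooth_on_frechet[OF comp_smooth[OF f]]]])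
            (use p in \<open>auto intro!: continuous_intros\<close>)
        fix t assume t: "t \<in> {0..P}"
        have "norm ((e, 0 :: real), frechet_derivative (\<lambda>(p, t). u p t) (at ((\<delta>, c), t)) (e, 0)) \<le> norm e + N"
          using norm_Pair_le[of "(e, 0 :: real)" "frechet_derivative (\<lambda>(p, t). u p t) (at ((\<delta>, c), t)) (e, 0)"]
            norm_Pair_le[of e "0 :: real"] N[of t] by simp
        then have "B * norm ((e, 0 :: real), frechet_derivative (\<lambda>(p, t). u p t) (at ((\<delta>, c), t)) (e, 0)) \<le> B * (norm e + N)"
          using B(1) by simp
        then show "norm (frechet_derivative (\<lambda>x. f (pt (zf x))) (at ((\<delta>, c), t)) (e, 0)) \<le> B * (norm e + N)"
          unfolding dv dz using B(3)[OF zK[OF t], of "((e, 0), frechet_derivative (\<lambda>(p, t). u p t) (at ((\<delta>, c), t)) (e, 0))"]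
          by linarith
      qed
      then show ?thesis unfolding eq by (simp add: mult.commute)
    qed
    let ?Jd = "frechet_derivative J (at (\<delta>, c)) (1, 0)" and ?Jc = "frechet_derivative J (at (\<delta>, c)) (0, 1)"
    have "(J has_derivative (\<lambda>h. ?Jd * fst h + ?Jc * snd h)) (at (\<delta>, c))"
    proof -
      have d: "(J has_derivative frechet_derivative J (at (\<delta>, c))) (at (\<delta>, c))"
        by (rule smooth_on_has_derivative[OF J_smooth p])
      interpret linear "frechet_derivative J (at (\<delta>, c))" using d by (rule has_derivative_linear)
      have eq: "frechet_derivative J (at (\<delta>, c)) = (\<lambda>h. ?Jd * fst h + ?Jc * snd h)"
      proof
        fix h :: "real \<times> real"
        have "h = fst h *\<^sub>R (1, 0) + snd h *\<^sub>R (0, 1)" by (simp add: prod_eq_iff)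
        then have "frechet_derivative J (at (\<delta>, c)) h = frechet_derivative J (at (\<delta>, c)) (fst h *\<^sub>R (1, 0) + snd h *\<^sub>R (0, 1))"
          by (rule arg_cong)
        then show "frechet_derivative J (at (\<delta>, c)) h = ?Jd * fst h + ?Jc * snd h"
          by (simp only: add scale) (simp add: mult.commute)
      qed
      show ?thesis by (rule has_derivative_eq_rhs[OF d eq])
    qed
    moreover have "\<bar>J (\<delta>, c)\<bar> \<le> C"
    proof -
      have "norm (integral {0..P} (\<lambda>t. f (pt (zf ((\<delta>, c), t))))) \<le> B * (P - 0)"
        by (rule integral_bound)
          (use P B(2) zK continuous_on_subset[OF smooth_on_continuous[OF slice_smooth[OF comp_smooth[OF f] p]], of "{0..P}"] in auto)
      moreover have "B * P \<le> C" using P B(1) M by (simp add: C_def algebra_simps)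
      ultimately show ?thesis by (simp add: J_def)
    qed
    moreover have "\<delta> * \<bar>?Jd\<bar> \<le> C"
    proof -
      have "\<delta> * \<bar>?Jd\<bar> \<le> \<delta> * (P * (B * (norm (1 :: real, 0 :: real) + M / \<delta>)))"
        using bound[of "(1, 0)" "M / \<delta>"] u_\<delta>[OF p] b by (intro mult_left_mono) auto
      also have "\<dots> = P * B * (\<delta> + M)" using b by (simp add: norm_Pair field_simps)
      also have "\<dots> \<le> C" unfolding C_def using b P B by (intro mult_left_mono) auto
      finally show ?thesis .
    qed
    moreover have "\<bar>?Jc\<bar> \<le> C"
    proof -
      have "\<bar>?Jc\<bar> \<le> P * (B * (norm (0 :: real, 1 :: real) + M * \<delta>))"
        using bound[of "(0, 1)" "M * \<delta>"] u_c[OF p] by simp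
      also have "\<dots> \<le> C" unfolding C_def using b P B M by (auto simp: norm_Pair mult.assoc intro!: mult_left_mono)
      finally show ?thesis .
    qed
    ultimately show "\<exists>Jd Jc. (J has_derivative (\<lambda>h. Jd * fst h + Jc * snd h)) (at (\<delta>, c)) \<and>
      \<bar>J (\<delta>, c)\<bar> \<le> C \<and> \<delta> * \<bar>Jd\<bar> \<le> C \<and> \<bar>Jc\<bar> \<le> C" by blast
  qed
qed

text \<open>The diagonal product of the Jacobian has order 1/\<delta>, the off-diagonal one order at
  most \<delta>. That \<open>A11\<close> is nonzero is kept separately, since it is the derivative
  along a slice of constant c.\<close>

lemma nondegenerate:
  obtains \<delta>3 where "0 < \<delta>3" "\<delta>3 \<le> \<delta>2"
    "\<And>\<delta> c. (\<delta>, c) \<in> osc.dom \<delta>3 \<Longrightarrow> \<exists>A11 A12 A21 A22. A11 \<noteq> 0 \<and> A11 * A22 - A12 * A21 \<noteq> 0 \<and>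
      ((\<lambda>p. (phase_increment P (s1 p), phase_increment P (s2 p))) has_derivative
        (\<lambda>h. (A11 * fst h + A12 * snd h, A21 * fst h + A22 * snd h))) (at (\<delta>, c))"
proof -
  obtain C1 where C1: "C1 > 0" "\<And>\<delta> c. (\<delta>, c) \<in> dm \<Longrightarrow> \<exists>Jd Jc. (J1 has_derivative (\<lambda>h. Jd * fst h + Jc * snd h)) (at (\<delta>, c)) \<and>
      \<bar>J1 (\<delta>, c)\<bar> \<le> C1 \<and> \<delta> * \<bar>Jd\<bar> \<le> C1 \<and> \<bar>Jc\<bar> \<le> C1"
    using correction_bounds[OF t_smooth(1)] unfolding J1_def[abs_def] by blast
  obtain C2 where C2: "C2 > 0" "\<And>\<delta> c. (\<delta>, c) \<in> dm \<Longrightarrow> \<exists>Jd Jc. (J2 has_derivative (\<lambda>h. Jd * fst h + Jc * snd h)) (at (\<delta>, c)) \<and>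
      \<bar>J2 (\<delta>, c)\<bar> \<le> C2 \<and> \<delta> * \<bar>Jd\<bar> \<le> C2 \<and> \<bar>Jc\<bar> \<le> C2"
    using correction_bounds[OF t_smooth(2)] unfolding J2_def[abs_def] by blast
  define Cc where "Cc = \<bar>c0\<bar> + 1"
  \<comment> \<open>\<open>E1\<close> will bound j + \<delta> Jd, \<open>E2\<close> will bound l + c
    Kc, and \<open>E3\<close> the off-diagonal product divided by \<delta>.\<close>
  define E1 where "E1 = 2 * C1"
  define E2 where "E2 = (1 + Cc) * C2"
  define E3 where "E3 = C1 * (Cc * (I2 + 4 * C2))"
  have Cc: "Cc > 0" by (simp add: Cc_def add_nonneg_pos)
  have E: "E1 > 0" "E2 > 0" "E3 > 0" using C1(1) C2(1) Cc I_pos by (simp_all add: E1_def E2_def E3_def add_pos_pos)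
  \<comment> \<open>Half of \<open>I1\<close> and half of \<open>I2\<close> survive the corrections,
    so the diagonal product is at least I1 I2 / (4 \<delta>); the last bound keeps the off-diagonal
    product below this.\<close>
  define \<delta>3 where "\<delta>3 = min \<delta>2 (min (I1 / (2 * E1)) (min (I2 / (2 * E2)) (I1 * I2 / (4 * E3))))"
  have \<delta>3: "0 < \<delta>3" "\<delta>3 \<le> \<delta>2" "\<delta>3 \<le> I1 / (2 * E1)" "\<delta>3 \<le> I2 / (2 * E2)" "\<delta>3 \<le> I1 * I2 / (4 * E3)"
    using \<delta>2 I_pos E by (auto simp: \<delta>3_def)
  show ?thesis
  proof (rule that[OF \<delta>3(1,2)])
    fix \<delta> c assume p3: "(\<delta>, c) \<in> osc.dom \<delta>3"
    then have p: "(\<delta>, c) \<in> dm" and d3: "\<delta> < \<delta>3" using \<delta>3(2) by (auto simp: osc.dom_def)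
    note b = dm_bounds[OF p]
    have cb: "\<bar>c\<bar> \<le> Cc" using b by (auto simp: Cc_def abs_le_iff)
    have dd: "\<delta>\<^sup>2 \<le> \<delta>" using b by (simp add: power2_eq_square mult_left_le)
    have small: "E1 * \<delta>\<^sup>2 < I1 / 2" "E2 * \<delta>\<^sup>2 < I2 / 2" "E3 * \<delta>\<^sup>2 < I1 * I2 / 4"
    proof -
      have "\<delta> < I1 / (2 * E1)" "\<delta> < I2 / (2 * E2)" "\<delta> < I1 * I2 / (4 * E3)" using d3 \<delta>3 by linarith+
      then have "E1 * \<delta> < I1 / 2" "E2 * \<delta> < I2 / 2" "E3 * \<delta> < I1 * I2 / 4" using E by (simp_all add: field_simps)
      moreover have "E1 * \<delta>\<^sup>2 \<le> E1 * \<delta>" "E2 * \<delta>\<^sup>2 \<le> E2 * \<delta>" "E3 * \<delta>\<^sup>2 \<le> E3 * \<delta>" using E dd by simp_all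
      ultimately show "E1 * \<delta>\<^sup>2 < I1 / 2" "E2 * \<delta>\<^sup>2 < I2 / 2" "E3 * \<delta>\<^sup>2 < I1 * I2 / 4" by linarith+
    qed
    obtain Jd Jc where J: "(J1 has_derivative (\<lambda>h. Jd * fst h + Jc * snd h)) (at (\<delta>, c))"
      "\<bar>J1 (\<delta>, c)\<bar> \<le> C1" "\<delta> * \<bar>Jd\<bar> \<le> C1" "\<bar>Jc\<bar> \<le> C1" using C1(2)[OF p] by blast
    obtain Kd Kc where K: "(J2 has_derivative (\<lambda>h. Kd * fst h + Kc * snd h)) (at (\<delta>, c))"
      "\<bar>J2 (\<delta>, c)\<bar> \<le> C2" "\<delta> * \<bar>Kd\<bar> \<le> C2" "\<bar>Kc\<bar> \<le> C2" using C2(2)[OF p] by blast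
    define j where "j = J1 (\<delta>, c)"
    define l where "l = J2 (\<delta>, c)"
    define A11 where "A11 = \<sigma> * (- I1 / \<delta>\<^sup>2 + j + \<delta> * Jd)"
    define A12 where "A12 = \<sigma> * (\<delta> * Jc)"
    define A21 where "A21 = \<sigma> * c * (I2 + 3 * \<delta>\<^sup>2 * l + \<delta> ^ 3 * Kd)"
    define A22 where "A22 = \<sigma> * (\<delta> * I2 + \<delta> ^ 3 * l) + \<sigma> * c * (\<delta> ^ 3 * Kc)"
    have F: "((\<lambda>p. fst p) has_derivative fst) (at (\<delta>, c))" "((\<lambda>p. snd p) has_derivative snd) (at (\<delta>, c))"
      by (auto intro!: bounded_linear_imp_has_derivative bounded_linear_fst bounded_linear_snd)
    have d1: "((\<lambda>p. \<sigma> * (I1 / fst p + fst p * J1 p)) has_derivative (\<lambda>h. A11 * fst h + A12 * snd h)) (at (\<delta>, c))"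
      unfolding A11_def A12_def j_def using b
      by (auto intro!: derivative_eq_intros F J(1) simp: algebra_simps power2_eq_square)
    have d2: "((\<lambda>p. \<sigma> * snd p * (fst p * I2 + fst p ^ 3 * J2 p)) has_derivative (\<lambda>h. A21 * fst h + A22 * snd h)) (at (\<delta>, c))"
      unfolding A21_def A22_def l_def using b
      by (auto intro!: derivative_eq_intros F K(1) simp: algebra_simps power2_eq_square power3_eq_cube)
    have "((\<lambda>p. (phase_increment P (s1 p), phase_increment P (s2 p))) has_derivative
        (\<lambda>h. (A11 * fst h + A12 * snd h, A21 * fst h + A22 * snd h))) (at (\<delta>, c))"
      by (rule has_derivative_transform_within_open[OF has_derivative_Pair[OF d1 d2] osc.open_dom p])
        (auto simp: phase_increments)
    moreover have s2: "\<sigma> * \<sigma> = 1" "\<bar>\<sigma>\<bar> = 1" using \<sigma> by auto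
    have a11: "\<bar>\<delta>\<^sup>2 * A11\<bar> \<ge> I1 / 2"
    proof -
      have "\<delta>\<^sup>2 * A11 = \<sigma> * (- I1 + \<delta>\<^sup>2 * (j + \<delta> * Jd))" using b by (simp add: A11_def field_simps)
      then have "\<bar>\<delta>\<^sup>2 * A11\<bar> = \<bar>- I1 + \<delta>\<^sup>2 * (j + \<delta> * Jd)\<bar>" by (simp add: abs_mult s2)
      moreover have "\<bar>\<delta>\<^sup>2 * (j + \<delta> * Jd)\<bar> \<le> \<delta>\<^sup>2 * E1"
      proof -
        have "\<bar>j + \<delta> * Jd\<bar> \<le> \<bar>j\<bar> + \<delta> * \<bar>Jd\<bar>" using b by (metis abs_mult abs_of_pos abs_triangle_ineq)
        then have "\<bar>j + \<delta> * Jd\<bar> \<le> E1" using J(2,3) by (simp add: E1_def j_def)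
        then show ?thesis by (simp add: abs_mult mult_left_mono)
      qed
      ultimately show ?thesis using small(1) I_pos(1) by (simp add: mult.commute)
    qed
    have a22: "\<bar>A22\<bar> \<ge> \<delta> * (I2 / 2)"
    proof -
      have "A22 = \<sigma> * (\<delta> * (I2 + \<delta>\<^sup>2 * (l + c * Kc)))"
        by (simp add: A22_def algebra_simps power2_eq_square power3_eq_cube)
      then have eq: "\<bar>A22\<bar> = \<delta> * \<bar>I2 + \<delta>\<^sup>2 * (l + c * Kc)\<bar>" using b by (simp add: abs_mult s2)
      have "\<bar>l + c * Kc\<bar> \<le> \<bar>l\<bar> + \<bar>c\<bar> * \<bar>Kc\<bar>" by (metis abs_mult abs_triangle_ineq)
      also have "\<dots> \<le> C2 + Cc * C2" using K(2,4) cb Cc by (intro add_mono mult_mono) (auto simp: l_def)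
      finally have "\<bar>l + c * Kc\<bar> \<le> E2" by (simp add: E2_def algebra_simps)
      then have "\<bar>\<delta>\<^sup>2 * (l + c * Kc)\<bar> \<le> E2 * \<delta>\<^sup>2" by (simp add: abs_mult mult.commute[of E2] mult_left_mono)
      then have "\<bar>I2 + \<delta>\<^sup>2 * (l + c * Kc)\<bar> \<ge> I2 / 2" using small(2) I_pos(2) by linarith
      then show ?thesis unfolding eq using b by (intro mult_left_mono) auto
    qed
    have off: "\<bar>A12 * A21\<bar> \<le> \<delta> * E3"
    proof -
      have "\<bar>A12\<bar> \<le> \<delta> * C1" using J(4) b by (simp add: A12_def abs_mult s2 mult_left_mono)
      moreover have "\<bar>A21\<bar> \<le> Cc * (I2 + 4 * C2)"
      proof -
        have "\<bar>I2 + 3 * \<delta>\<^sup>2 * l + \<delta> ^ 3 * Kd\<bar> \<le> \<bar>I2\<bar> + 3 * (\<delta>\<^sup>2 * \<bar>l\<bar>) + \<delta>\<^sup>2 * (\<delta> * \<bar>Kd\<bar>)"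
          using b by (intro order_trans[OF abs_triangle_ineq] add_mono order_trans[OF abs_triangle_ineq])
            (auto simp: abs_mult power2_eq_square power3_eq_cube)
        also have "\<dots> \<le> I2 + 3 * (1 * C2) + 1 * C2"
          using K(2,3) I_pos b C2(1) dd
          by (intro add_mono mult_left_mono mult_mono) (auto simp: l_def)
        finally have "\<bar>I2 + 3 * \<delta>\<^sup>2 * l + \<delta> ^ 3 * Kd\<bar> \<le> I2 + 4 * C2" by simp
        then show ?thesis using cb unfolding A21_def abs_mult s2 by (simp add: mult_mono)
      qed
      ultimately have "\<bar>A12 * A21\<bar> \<le> (\<delta> * C1) * (Cc * (I2 + 4 * C2))"
        unfolding abs_mult using b C1(1) by (intro mult_mono) auto
      then show ?thesis by (simp add: E3_def)
    qed
    have "A11 \<noteq> 0" using a11 I_pos(1) by auto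
    moreover have "A11 * A22 - A12 * A21 \<noteq> 0"
    proof
      assume "A11 * A22 - A12 * A21 = 0"
      then have "\<bar>A11 * A22\<bar> \<le> \<delta> * E3" using off by simp
      then have "\<delta>\<^sup>2 * \<bar>A11 * A22\<bar> \<le> \<delta>\<^sup>2 * (\<delta> * E3)" by (intro mult_left_mono) auto
      moreover have "\<delta>\<^sup>2 * \<bar>A11 * A22\<bar> = \<bar>\<delta>\<^sup>2 * A11\<bar> * \<bar>A22\<bar>" by (simp add: abs_mult)
      moreover have "I1 / 2 * (\<delta> * (I2 / 2)) \<le> \<bar>\<delta>\<^sup>2 * A11\<bar> * \<bar>A22\<bar>"
        using a11 a22 I_pos b by (intro mult_mono) auto
      ultimately have "\<delta> * (I1 * I2 / 4) \<le> \<delta> * (E3 * \<delta>\<^sup>2)" by (simp add: algebra_simps)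
      then have "I1 * I2 / 4 \<le> E3 * \<delta>\<^sup>2" using b by simp
      then show False using small(3) by linarith
    qed
    ultimately show "\<exists>A11 A12 A21 A22. A11 \<noteq> 0 \<and> A11 * A22 - A12 * A21 \<noteq> 0 \<and>
      ((\<lambda>p. (phase_increment P (s1 p), phase_increment P (s2 p))) has_derivative
        (\<lambda>h. (A11 * fst h + A12 * snd h, A21 * fst h + A22 * snd h))) (at (\<delta>, c))" by blast
  qed
qed

end

section \<open>The Laplacian of a warped product\<close>

text \<open>\<open>A\<close> is the form read as an endomorphism; positivity makes it injective,
  hence surjective in finite dimension. This turns the definite descriptions of the gradient and of
  the Christoffel vector into characterisations.\<close>

lemma linear_form_represented:
  fixes G :: "'e::euclidean_space \<Rightarrow> 'e \<Rightarrow> real"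
  assumes "bilinear G" "\<And>u. u \<noteq> 0 \<Longrightarrow> G u u > 0" "linear \<phi>"
  shows "\<exists>!w. \<forall>v. G w v = \<phi> v"
proof -
  have lin: "linear (\<lambda>w. G w v)" "linear (G w)" for v w
    using assms(1) by (auto simp: bilinear_def)
  define A where "A w = (\<Sum>b\<in>Basis. G w b *\<^sub>R b)" for w
  have "linear A"
    unfolding A_def by (rule linearI)
      (simp_all add: linear_add[OF lin(1)] linear_cmul[OF lin(1)] scaleR_add_left sum.distrib scaleR_sum_right)
  have Ab: "A w \<bullet> b = G w b" if "b \<in> Basis" for w b
    using that by (simp add: A_def inner_sum_left_Basis)
  have ext: "G w = \<psi>" if "\<And>b. b \<in> Basis \<Longrightarrow> G w b = \<psi> b" "linear \<psi>" for w \<psi>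
    using linear_eq_on_span[OF lin(2) that(2), of Basis] that(1) by (simp add: span_Basis fun_eq_iff)
  have inj: "w = 0" if "A w = 0" for w
  proof -
    have "G w = (\<lambda>_. 0)"
      by (rule ext) (use Ab[of _ w] that in \<open>auto simp: linear_zero\<close>)
    then have "G w w = 0" by metis
    then show ?thesis using assms(2)[of w] by force
  qed
  have "inj A" using inj \<open>linear A\<close> by (simp add: linear_injective_0)
  then have "surj A" using \<open>linear A\<close> linear_injective_imp_surjective by blast
  then obtain w where w: "A w = (\<Sum>b\<in>Basis. \<phi> b *\<^sub>R b)" by (metis surjD)
  have "G w = \<phi>"
  proof (rule ext[OF _ assms(3)])
    fix b :: 'e assume b: "b \<in> Basis"
    then have "A w \<bullet> b = \<phi> b" unfolding w by (simp add: inner_sum_left_Basis)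
    then show "G w b = \<phi> b" using Ab[OF b] by simp
  qed
  moreover have "w' = w" if "\<forall>v. G w' v = \<phi> v" for w'
  proof -
    have "A w' = A w" using that w by (simp add: A_def)
    then show ?thesis using \<open>inj A\<close> by (simp add: inj_eq)
  qed
  ultimately show ?thesis by (intro ex1I[of _ w]) auto
qed

section \<open>Gradient, connection and Laplacian of a metric in one chart\<close>

locale coord_metric =
  fixes U :: "'e::euclidean_space set" and g :: "'e \<Rightarrow> 'e \<Rightarrow> 'e \<Rightarrow> real"
  assumes U: "open U"
    and g_smooth: "\<And>u v. smooth_on U (\<lambda>x. g x u v)"
    and g_bilinear: "\<And>x. x \<in> U \<Longrightarrow> bilinear (g x)"
    and g_sym: "\<And>x u v. x \<in> U \<Longrightarrow> g x u v = g x v u"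
    and g_pos: "\<And>x u. x \<in> U \<Longrightarrow> u \<noteq> 0 \<Longrightarrow> g x u u > 0"
begin

abbreviation dg where "dg x u v \<equiv> frechet_derivative (\<lambda>y. g y u v) (at x)"

lemma g_lin: "x \<in> U \<Longrightarrow> linear (\<lambda>w. g x w v)" "x \<in> U \<Longrightarrow> linear (g x w)"
  using g_bilinear by (auto simp: bilinear_def)

lemmas g_simps = linear_add[OF g_lin(1)] linear_add[OF g_lin(2)] linear_cmul[OF g_lin(1)] linear_cmul[OF g_lin(2)]
  linear_0[OF g_lin(1)] linear_0[OF g_lin(2)]

lemma g_der: "x \<in> U \<Longrightarrow> ((\<lambda>y. g y u v) has_derivative dg x u v) (at x)"
  using smooth_on_has_derivative[OF g_smooth] .

lemma dg_lin: "x \<in> U \<Longrightarrow> linear (dg x u v)"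
  using has_derivative_linear[OF g_der] .

lemma frechet_eqI:
  assumes "x \<in> U" "\<And>y. y \<in> U \<Longrightarrow> f y = h y" "(h has_derivative D) (at x)"
  shows "frechet_derivative f (at x) = D"
  by (rule frechet_derivative_at[OF has_derivative_transform_within_open[OF assms(3) U assms(1)], symmetric])
    (simp add: assms(2))

lemma dg_bilinear:
  assumes "x \<in> U"
  shows "dg x (u + u') v w = dg x u v w + dg x u' v w" "dg x u (v + v') w = dg x u v w + dg x u v' w"
    "dg x (a *\<^sub>R u) v w = a * dg x u v w" "dg x u (a *\<^sub>R v) w = a * dg x u v w"
proof -
  have "dg x (u + u') v = (\<lambda>w. dg x u v w + dg x u' v w)"
    by (rule frechet_eqI[OF assms _ has_derivative_add[OF g_der[OF assms] g_der[OF assms]]]) (simp add: g_simps)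
  then show "dg x (u + u') v w = dg x u v w + dg x u' v w" by simp
  have "dg x u (v + v') = (\<lambda>w. dg x u v w + dg x u v' w)"
    by (rule frechet_eqI[OF assms _ has_derivative_add[OF g_der[OF assms] g_der[OF assms]]]) (simp add: g_simps)
  then show "dg x u (v + v') w = dg x u v w + dg x u v' w" by simp
  have "dg x (a *\<^sub>R u) v = (\<lambda>w. a *\<^sub>R dg x u v w)"
    by (rule frechet_eqI[OF assms _ has_derivative_scaleR_right[OF g_der[OF assms]]]) (simp add: g_simps)
  then show "dg x (a *\<^sub>R u) v w = a * dg x u v w" by simp
  have "dg x u (a *\<^sub>R v) = (\<lambda>w. a *\<^sub>R dg x u v w)"
    by (rule frechet_eqI[OF assms _ has_derivative_scaleR_right[OF g_der[OF assms]]]) (simp add: g_simps)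
  then show "dg x u (a *\<^sub>R v) w = a * dg x u v w" by simp
qed

lemma represented: "x \<in> U \<Longrightarrow> linear \<phi> \<Longrightarrow> \<exists>!w. \<forall>v. g x w v = \<phi> v"
  using linear_form_represented[OF g_bilinear] g_pos by blast

lemma gradient_char:
  assumes "x \<in> U" "h differentiable (at x)"
  shows "g x (gradient g h x) v = frechet_derivative h (at x) v"
  using theI'[OF represented[OF assms(1) linear_frechet_derivative[OF assms(2)]]]
  unfolding gradient_def by blast

lemma gradient_eqI:
  assumes "x \<in> U" "(h has_derivative D) (at x)" "\<And>v. g x w v = D v"
  shows "gradient g h x = w"
  unfolding gradient_def frechet_derivative_at[OF assms(2), symmetric]
  by (rule the1_equality[OF represented[OF assms(1) has_derivative_linear[OF assms(2)]]]) (simp add: assms(3))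

definition koszul where "koszul x u v z = (dg x v z u + dg x u z v - dg x u v z) / 2"

lemma koszul_linear: "x \<in> U \<Longrightarrow> linear (koszul x u v)"
  by (rule linearI)
    (simp_all add: koszul_def dg_bilinear linear_add[OF dg_lin] linear_cmul[OF dg_lin] field_simps)

lemma christoffel_char: "x \<in> U \<Longrightarrow> g x (christoffel g x u v) z = koszul x u v z"
  using theI'[OF represented[OF _ koszul_linear]]
  unfolding christoffel_def koszul_def by blast

lemma christoffel_eqI: "x \<in> U \<Longrightarrow> (\<And>z. g x w z = koszul x u v z) \<Longrightarrow> christoffel g x u v = w"
  unfolding christoffel_def koszul_def[symmetric]
  by (rule the1_equality[OF represented[OF _ koszul_linear]]) auto

lemma christoffel_linear:
  assumes "x \<in> U"
  shows "christoffel g x u (v + v') = christoffel g x u v + christoffel g x u v'"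
    "christoffel g x u (a *\<^sub>R v) = a *\<^sub>R christoffel g x u v"
proof -
  show "christoffel g x u (v + v') = christoffel g x u v + christoffel g x u v'"
    by (rule christoffel_eqI[OF assms])
      (simp add: g_simps assms christoffel_char koszul_def dg_bilinear linear_add[OF dg_lin] field_simps)
  show "christoffel g x u (a *\<^sub>R v) = a *\<^sub>R christoffel g x u v"
    by (rule christoffel_eqI[OF assms])
      (simp add: g_simps assms christoffel_char koszul_def dg_bilinear linear_cmul[OF dg_lin] field_simps)
qed

definition trace_christoffel where
  "trace_christoffel x v = (\<Sum>b\<in>Basis. christoffel g x b v \<bullet> b)"

lemma trace_christoffel_linear:
  assumes "x \<in> U"
  shows "trace_christoffel x (v + v') = trace_christoffel x v + trace_christoffel x v'"
    "trace_christoffel x (a *\<^sub>R v) = a * trace_christoffel x v"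
  by (simp_all add: trace_christoffel_def christoffel_linear[OF assms] inner_add_left sum.distrib sum_distrib_left)

lemma divergence_eq:
  "divergence g X x = (\<Sum>b\<in>Basis. frechet_derivative X (at x) b \<bullet> b) + trace_christoffel x (X x)"
  by (simp add: divergence_def covariant_derivative_def trace_christoffel_def inner_add_left sum.distrib)

text \<open>This bound transfers differentiability from the differential of a function to its gradient
  without inverting the matrix of the metric.\<close>

lemma metric_lower_bound:
  assumes x: "x \<in> U"
  obtains \<kappa> where "\<kappa> > 0" "\<forall>\<^sub>F y in at x. \<forall>u. \<kappa> * (norm u)\<^sup>2 \<le> g y u u"
proof -
  have expand: "g y u u = (\<Sum>i\<in>Basis. \<Sum>j\<in>Basis. (u \<bullet> i) * (u \<bullet> j) * g y i j)" if "y \<in> U" for y u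
  proof -
    have "g y u u = g y (\<Sum>i\<in>Basis. (u \<bullet> i) *\<^sub>R i) (\<Sum>j\<in>Basis. (u \<bullet> j) *\<^sub>R j)"
      by (simp add: euclidean_representation)
    then show ?thesis
      by (simp add: linear_sum[OF g_lin(1)[OF that]] linear_sum[OF g_lin(2)[OF that]] g_simps that
          sum_distrib_left mult.assoc del: euclidean_representation)
        (subst sum.swap, simp add: mult_ac)
  qed
  have cont: "continuous_on (U \<times> sphere 0 1) (\<lambda>z. g (fst z) (snd z) (snd z))"
  proof -
    have "continuous_on (U \<times> sphere 0 1)
        (\<lambda>z. \<Sum>i\<in>Basis. \<Sum>j\<in>Basis. (snd z \<bullet> i) * (snd z \<bullet> j) * g (fst z) i j)"
      by (intro continuous_intros continuous_on_compose2[OF smooth_on_continuous[OF g_smooth]]) auto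
    then show ?thesis by (rule continuous_on_eq) (auto simp: expand)
  qed
  obtain s where s: "\<And>u. norm u = 1 \<Longrightarrow> s \<le> g x u u" "s > 0"
  proof (cases "sphere (0 :: 'e) 1 = {}")
    case True
    then show ?thesis using that[of 1] by auto
  next
    case False
    have "continuous_on (sphere 0 1) (\<lambda>u. (x, u))"
      by (intro continuous_on_Pair continuous_on_const continuous_on_id)
    from continuous_on_compose2[OF cont this] have "continuous_on (sphere 0 1) (\<lambda>u. g x u u)"
      using x by force
    from continuous_attains_inf[OF compact_sphere False this]
    obtain u0 :: 'e where u0: "norm u0 = 1" "\<And>u. norm u = 1 \<Longrightarrow> g x u0 u0 \<le> g x u u" by auto
    then have "g x u0 u0 > 0" using g_pos[OF x, of u0] by force
    then show ?thesis using that[of "g x u0 u0"] u0 by blast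
  qed
  \<comment> \<open>Compactness of the sphere makes the lower bound \<open>s\<close> at x persist,
    up to a factor 1/2, at all nearby points.\<close>
  from continuous_on_prod_compactE[OF cont compact_sphere x, of "s/2"] s(2)
  obtain X where X: "x \<in> X" "open X"
    "\<forall>y\<in>X \<inter> U. \<forall>u\<in>sphere 0 1. dist (g (fst (y, u)) (snd (y, u)) (snd (y, u))) (g (fst (x, u)) (snd (x, u)) (snd (x, u))) \<le> s / 2"
    by auto
  have "\<forall>u. s / 2 * (norm u)\<^sup>2 \<le> g y u u" if y: "y \<in> X \<inter> U" for y
  proof
    fix u :: 'e
    show "s / 2 * (norm u)\<^sup>2 \<le> g y u u"
    proof (cases "u = 0")
      case True
      then show ?thesis using y by (simp add: g_simps)
    next
      case False
      define v where "v = u /\<^sub>R norm u"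
      have v: "norm v = 1" "u = norm u *\<^sub>R v" using False by (auto simp: v_def)
      have "dist (g y v v) (g x v v) \<le> s / 2" using X(3) y v(1) by force
      then have "s / 2 \<le> g y v v" using s(1)[OF v(1)] unfolding dist_real_def by linarith
      then have "(norm u)\<^sup>2 * (s / 2) \<le> (norm u)\<^sup>2 * g y v v" by (intro mult_left_mono) auto
      also have "\<dots> = g y (norm u *\<^sub>R v) (norm u *\<^sub>R v)" using y by (simp add: g_simps power2_eq_square)
      also have "\<dots> = g y u u" using v(2) by simp
      finally show ?thesis by (simp add: mult.commute)
    qed
  qed
  then have "\<forall>\<^sub>F y in at x. \<forall>u. s / 2 * (norm u)\<^sup>2 \<le> g y u u"
    using X U x unfolding eventually_at_topological by (intro exI[of _ "X \<inter> U"]) blast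
  then show ?thesis using that[of "s/2"] s(2) by simp
qed

text \<open>Lowering of an index: the coordinate vector of the linear form that the metric
  associates with w.\<close>

definition musical where "musical y w = (\<Sum>b\<in>Basis. g y w b *\<^sub>R b)"

lemma musical_linear: "y \<in> U \<Longrightarrow> linear (musical y)"
  unfolding musical_def
  by (rule linearI) (simp_all add: g_simps scaleR_add_left sum.distrib scaleR_sum_right)

lemma inner_musical: "y \<in> U \<Longrightarrow> musical y w \<bullet> v = g y w v"
proof -
  assume y: "y \<in> U"
  have "g y w v = g y w (\<Sum>b\<in>Basis. (v \<bullet> b) *\<^sub>R b)" by (simp add: euclidean_representation)
  also have "\<dots> = (\<Sum>b\<in>Basis. (v \<bullet> b) * g y w b)"
    by (simp add: linear_sum[OF g_lin(2)[OF y]] g_simps y del: euclidean_representation)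
  also have "\<dots> = musical y w \<bullet> v"
    by (simp add: musical_def inner_sum_left inner_commute[of v] mult.commute)
  finally show "musical y w \<bullet> v = g y w v" ..
qed

lemma musical_expand: "y \<in> U \<Longrightarrow> musical y w = (\<Sum>b\<in>Basis. (\<Sum>b'\<in>Basis. (w \<bullet> b') * g y b' b) *\<^sub>R b)"
proof -
  assume y: "y \<in> U"
  have "g y w b = (\<Sum>b'\<in>Basis. (w \<bullet> b') * g y b' b)" for b
  proof -
    have "g y w b = g y (\<Sum>b'\<in>Basis. (w \<bullet> b') *\<^sub>R b') b" by (simp add: euclidean_representation)
    then show ?thesis by (simp add: linear_sum[OF g_lin(1)[OF y]] g_simps y del: euclidean_representation)
  qed
  then show ?thesis by (simp add: musical_def)
qed

text \<open>The gradient is defined by an implicit linear equation whose coefficients vary with the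
  point; the derivative is found by solving the differentiated equation at x and then checked
  against the remainder.\<close>

lemma gradient_differentiable:
  assumes x: "x \<in> U" and h: "smooth_on U h"
  shows "gradient g h differentiable (at x)"
proof -
  let ?W = "gradient g h"
  obtain \<kappa> where \<kappa>: "\<kappa> > 0" "\<forall>\<^sub>F y in at x. \<forall>u. \<kappa> * (norm u)\<^sup>2 \<le> g y u u"
    by (rule metric_lower_bound[OF x])
  \<comment> \<open>Near x this is \<open>musical y (?W y - ?W x)\<close>, but in this form it is
    visibly differentiable, since the gradient enters only through its fixed value at x.\<close>
  define \<Theta> where "\<Theta> y = (\<Sum>b\<in>Basis. (frechet_derivative h (at y) b - g y (?W x) b) *\<^sub>R b)" for y
  define \<Theta>' where "\<Theta>' k = (\<Sum>b\<in>Basis. (frechet_derivative (\<lambda>y. frechet_derivative h (at y) b) (at x) k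
      - dg x (?W x) b k) *\<^sub>R b)" for k
  have \<Theta>': "(\<Theta> has_derivative \<Theta>') (at x)"
    unfolding \<Theta>_def \<Theta>'_def
    by (intro has_derivative_sum has_derivative_scaleR_left has_derivative_diff g_der x
        smooth_on_has_derivative[OF smooth_on_frechet[OF h]])
  have W: "g y (?W y) v = frechet_derivative h (at y) v" if "y \<in> U" for y v
    by (rule gradient_char[OF that smooth_on_differentiable[OF h that]])
  have \<Theta>_eq: "\<Theta> y = musical y (?W y - ?W x)" if "y \<in> U" for y
    using that by (simp add: \<Theta>_def musical_def W linear_diff[OF g_lin(1)])
  \<comment> \<open>The candidate derivative, obtained with the metric frozen at x, where
    \<open>musical x\<close> is invertible.\<close>
  have "\<exists>E. linear E \<and> (\<forall>k. musical x (E k) = \<Theta>' k)"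
  proof -
    have "inj (musical x)"
      unfolding linear_injective_0[OF musical_linear[OF x]]
      using inner_musical[OF x] g_pos[OF x] by (metis inner_zero_left less_irrefl)
    then obtain F where F: "linear F" "musical x \<circ> F = id"
      using linear_injective_imp_surjective[OF musical_linear[OF x]]
        linear_surjective_right_inverse[OF musical_linear[OF x]] by blast
    have "linear (F \<circ> \<Theta>')"
      by (rule linear_compose[OF has_derivative_linear[OF \<Theta>'] F(1)])
    moreover have "musical x ((F \<circ> \<Theta>') k) = \<Theta>' k" for k
      using F(2) by (metis comp_apply id_apply)
    ultimately show ?thesis by blast
  qed
  then obtain E where E: "linear E" "\<And>k. musical x (E k) = \<Theta>' k" by blast
  then have E_bl: "bounded_linear E" by (simp add: linear_conv_bounded_linear)
  \<comment> \<open>Near x this is \<open>musical y (?W y - ?W x - E (y - x))\<close>, written out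
    to be differentiable. Its value and derivative at x vanish, and the lower bound on the metric
    passes this on to the vector itself.\<close>
  define \<Lambda> where "\<Lambda> y = \<Theta> y - (\<Sum>b\<in>Basis. (\<Sum>b'\<in>Basis. (E (y - x) \<bullet> b') * g y b' b) *\<^sub>R b)" for y
  have dE: "((\<lambda>y. E (y - x) \<bullet> b') has_derivative (\<lambda>k. E k \<bullet> b')) (at x)" for b'
    by (intro has_derivative_inner_left bounded_linear.has_derivative[OF E_bl])
      (auto intro!: derivative_eq_intros)
  have "(\<Lambda> has_derivative (\<lambda>k. \<Theta>' k - (\<Sum>b\<in>Basis. (\<Sum>b'\<in>Basis.
      (E (x - x) \<bullet> b') * dg x b' b k + (E k \<bullet> b') * g x b' b) *\<^sub>R b))) (at x)"
    unfolding \<Lambda>_def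
    by (intro has_derivative_diff \<Theta>' has_derivative_sum has_derivative_scaleR_left has_derivative_mult dE g_der x)
  moreover have "\<Theta>' k - (\<Sum>b\<in>Basis. (\<Sum>b'\<in>Basis.
      (E (x - x) \<bullet> b') * dg x b' b k + (E k \<bullet> b') * g x b' b) *\<^sub>R b) = 0" for k
    using E(2)[of k] musical_expand[OF x, of "E k"] by (simp add: linear_0[OF E(1)])
  ultimately have \<Lambda>': "(\<Lambda> has_derivative (\<lambda>k. 0)) (at x)" by simp
  have \<Lambda>x: "\<Lambda> x = 0"
    using \<Theta>_eq[OF x] by (simp add: \<Lambda>_def linear_0[OF E(1)] linear_0[OF musical_linear[OF x]])
  have key: "\<kappa> * norm (?W y - ?W x - E (y - x)) \<le> norm (\<Lambda> y)"
    if y: "y \<in> U" and low: "\<forall>u. \<kappa> * (norm u)\<^sup>2 \<le> g y u u" for y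
  proof -
    define w where "w = ?W y - ?W x - E (y - x)"
    have "\<Lambda> y = musical y w"
      using \<Theta>_eq[OF y] musical_expand[OF y, of "E (y - x)"]
      by (simp add: \<Lambda>_def w_def linear_diff[OF musical_linear[OF y]])
    then have "\<kappa> * (norm w)\<^sup>2 \<le> \<Lambda> y \<bullet> w" using low by (simp add: inner_musical[OF y])
    also have "\<dots> \<le> norm (\<Lambda> y) * norm w" by (rule norm_cauchy_schwarz)
    finally have "(\<kappa> * norm w) * norm w \<le> norm (\<Lambda> y) * norm w" by (simp add: power2_eq_square)
    then show ?thesis
      unfolding w_def[symmetric] by (cases "w = 0") (auto simp: mult_le_cancel_right)
  qed
  have "(?W has_derivative E) (at x)"
    unfolding has_derivative_at_alt
  proof (intro conjI allI impI E_bl)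
    fix \<epsilon> :: real assume "\<epsilon> > 0"
    then have "\<epsilon> * \<kappa> > 0" using \<kappa>(1) by simp
    then obtain d1 where d1: "d1 > 0" "\<And>y. norm (y - x) < d1 \<Longrightarrow> norm (\<Lambda> y - \<Lambda> x - 0) \<le> \<epsilon> * \<kappa> * norm (y - x)"
      using \<Lambda>' unfolding has_derivative_at_alt by blast
    have "\<forall>\<^sub>F y in at x. y \<in> U \<and> (\<forall>u. \<kappa> * (norm u)\<^sup>2 \<le> g y u u)"
      using \<kappa>(2) eventually_at_in_open'[OF U x] by eventually_elim auto
    then obtain d2 where d2: "d2 > 0" "\<And>y. y \<noteq> x \<Longrightarrow> dist y x < d2 \<Longrightarrow> y \<in> U \<and> (\<forall>u. \<kappa> * (norm u)\<^sup>2 \<le> g y u u)"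
      unfolding eventually_at by auto
    have "norm (?W y - ?W x - E (y - x)) \<le> \<epsilon> * norm (y - x)" if "norm (y - x) < min d1 d2" for y
    proof (cases "y = x")
      case True
      then show ?thesis by (simp add: linear_0[OF E(1)])
    next
      case False
      have "\<kappa> * norm (?W y - ?W x - E (y - x)) \<le> norm (\<Lambda> y)"
        using d2(2)[OF False] that by (intro key) (auto simp: dist_norm)
      also have "\<dots> \<le> \<kappa> * (\<epsilon> * norm (y - x))" using d1(2)[of y] that \<Lambda>x by (simp add: mult_ac)
      finally show ?thesis using \<kappa>(1) by simp
    qed
    then show "\<exists>d>0. \<forall>y. norm (y - x) < d \<longrightarrow> norm (?W y - ?W x - E (y - x)) \<le> \<epsilon> * norm (y - x)"
      using d1(1) d2(1) by (intro exI[of _ "min d1 d2"]) auto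
  qed
  then show ?thesis by (rule differentiableI)
qed

definition lap where "lap h x = divergence g (gradient g h) x"

lemma gradient_add:
  assumes "x \<in> U" "smooth_on U h1" "smooth_on U h2"
  shows "gradient g (\<lambda>y. h1 y + h2 y) x = gradient g h1 x + gradient g h2 x"
proof (rule gradient_eqI[OF assms(1) has_derivative_add])
  show "(h1 has_derivative frechet_derivative h1 (at x)) (at x)" "(h2 has_derivative frechet_derivative h2 (at x)) (at x)"
    by (rule smooth_on_has_derivative[OF assms(2,1)] smooth_on_has_derivative[OF assms(3,1)])+
  show "g x (gradient g h1 x + gradient g h2 x) v = frechet_derivative h1 (at x) v + frechet_derivative h2 (at x) v" for v
    using assms by (simp add: g_simps gradient_char smooth_on_differentiable)
qed

lemma gradient_cmul:
  assumes "x \<in> U" "smooth_on U h"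
  shows "gradient g (\<lambda>y. a * h y) x = a *\<^sub>R gradient g h x"
proof (rule gradient_eqI[OF assms(1) has_derivative_mult_right])
  show "(h has_derivative frechet_derivative h (at x)) (at x)"
    by (rule smooth_on_has_derivative[OF assms(2,1)])
  show "g x (a *\<^sub>R gradient g h x) v = a * frechet_derivative h (at x) v" for v
    using assms by (simp add: g_simps gradient_char smooth_on_differentiable)
qed

lemma gradient_der:
  "x \<in> U \<Longrightarrow> smooth_on U h \<Longrightarrow> (gradient g h has_derivative frechet_derivative (gradient g h) (at x)) (at x)"
  using gradient_differentiable frechet_derivative_works by blast

lemma lap_add:
  assumes x: "x \<in> U" and h: "smooth_on U h1" "smooth_on U h2"
  shows "lap (\<lambda>y. h1 y + h2 y) x = lap h1 x + lap h2 x"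
proof -
  have "frechet_derivative (gradient g (\<lambda>y. h1 y + h2 y)) (at x) =
      (\<lambda>v. frechet_derivative (gradient g h1) (at x) v + frechet_derivative (gradient g h2) (at x) v)"
    by (rule frechet_eqI[OF x gradient_add[OF _ h] has_derivative_add[OF gradient_der gradient_der]]) (use x h in auto)
  then show ?thesis
    unfolding lap_def divergence_eq gradient_add[OF x h] trace_christoffel_linear[OF x]
    by (simp add: inner_add_left sum.distrib)
qed

lemma lap_cmul:
  assumes x: "x \<in> U" and h: "smooth_on U h"
  shows "lap (\<lambda>y. a * h y) x = a * lap h x"
proof -
  have "frechet_derivative (gradient g (\<lambda>y. a * h y)) (at x) = (\<lambda>v. a *\<^sub>R frechet_derivative (gradient g h) (at x) v)"
    by (rule frechet_eqI[OF x gradient_cmul[OF _ h] has_derivative_scaleR_right[OF gradient_der]]) (use x h in auto)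
  then show ?thesis
    unfolding lap_def divergence_eq gradient_cmul[OF x h] trace_christoffel_linear[OF x]
    by (simp add: sum_distrib_left distrib_left)
qed

lemma lap_sum:
  assumes x: "x \<in> U" and "finite I" and h: "\<And>i. i \<in> I \<Longrightarrow> smooth_on U (h i)"
  shows "lap (\<lambda>y. \<Sum>i\<in>I. c i * h i y) x = (\<Sum>i\<in>I. c i * lap (h i) x)"
  using assms(2,3)
proof (induction I rule: finite_induct)
  case empty
  show ?case using lap_cmul[OF x smooth_on_const, of 0] by simp
next
  case (insert i I)
  have "smooth_on U (\<lambda>y. c i * h i y)" "smooth_on U (\<lambda>y. \<Sum>i\<in>I. c i * h i y)"
    using insert.prems by (auto intro!: smooth_intros U)
  then show ?case
    using insert lap_add[OF x, of "\<lambda>y. c i * h i y" "\<lambda>y. \<Sum>i\<in>I. c i * h i y"] lap_cmul[OF x, of "h i" "c i"] by simp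
qed

text \<open>Multiplication by \<open>\<i>\<close> mixes the components of a map, so they are needed in all directions.\<close>

lemma lap_inner:
  fixes F :: "'e \<Rightarrow> 'v::euclidean_space"
  assumes x: "x \<in> U" and F: "smooth_on U F"
  shows "lap (\<lambda>y. F y \<bullet> w) x = laplacian g F x \<bullet> w"
proof -
  have "lap (\<lambda>y. \<Sum>b\<in>Basis. (w \<bullet> b) * (F y \<bullet> b)) x = (\<Sum>b\<in>Basis. (w \<bullet> b) * lap (\<lambda>y. F y \<bullet> b) x)"
    by (rule lap_sum[OF x finite_Basis]) (intro smooth_intros U F)
  moreover have "(\<lambda>y. \<Sum>b\<in>Basis. (w \<bullet> b) * (F y \<bullet> b)) = (\<lambda>y. F y \<bullet> w)"
    by (auto simp: euclidean_inner[of _ w] mult.commute)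
  moreover have "laplacian g F x \<bullet> w = (\<Sum>b\<in>Basis. (w \<bullet> b) * lap (\<lambda>y. F y \<bullet> b) x)"
    by (simp add: laplacian_def lap_def inner_sum_left inner_commute[of w] mult.commute)
  ultimately show ?thesis by simp
qed

end

section \<open>Doubly warped metrics in product coordinates\<close>

lemma smooth_on_deriv:
  assumes "open T" "smooth_on T (f :: real \<Rightarrow> real)"
  shows "smooth_on T (deriv f)"
proof (rule smooth_on_cong[OF assms(1) _ smooth_on_frechet[OF assms(2), of 1]])
  fix t assume "t \<in> T"
  then have "(f has_real_derivative deriv f t) (at t)"
    using smooth_on_differentiable[OF assms(2)] by (simp add: DERIV_deriv_iff_real_differentiable)
  then show "frechet_derivative f (at t) 1 = deriv f t"
    unfolding has_field_derivative_def by (simp add: frechet_derivative_at[symmetric])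
qed

lemma sum_Basis_prod:
  fixes f :: "'a::euclidean_space \<times> 'b::euclidean_space \<Rightarrow> 'c::comm_monoid_add"
  shows "sum f Basis = (\<Sum>a\<in>Basis. f (a, 0)) + (\<Sum>b\<in>Basis. f (0, b))"
proof -
  have "inj_on (\<lambda>a :: 'a. (a, 0 :: 'b)) Basis" "inj_on (\<lambda>b :: 'b. (0 :: 'a, b)) Basis" by (auto intro: inj_onI)
  then show ?thesis
    unfolding Basis_prod_def by (subst sum.union_disjoint) (auto simp: sum.reindex comp_def)
qed

locale warped_coords = M1: coord_metric U1 g1 + M2: coord_metric U2 g2
  for U1 :: "'e1::euclidean_space set" and g1 and U2 :: "'e2::euclidean_space set" and g2 +
  fixes T :: "real set" and p q :: "real \<Rightarrow> real"
  assumes T: "open T" and p_smooth: "smooth_on T p" and q_smooth: "smooth_on T q"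
    and p_pos: "\<And>t. t \<in> T \<Longrightarrow> p t > 0" and q_pos: "\<And>t. t \<in> T \<Longrightarrow> q t > 0"
begin

definition W :: "(real \<times> 'e1 \<times> 'e2) set" where "W = T \<times> U1 \<times> U2"

definition gw :: "real \<times> 'e1 \<times> 'e2 \<Rightarrow> real \<times> 'e1 \<times> 'e2 \<Rightarrow> real \<times> 'e1 \<times> 'e2 \<Rightarrow> real" where
  "gw = (\<lambda>(t, x, y) (u0, u1, u2) (v0, v1, v2). u0 * v0 + (p t)\<^sup>2 * g1 x u1 v1 + (q t)\<^sup>2 * g2 y u2 v2)"

lemma gw_eq: "gw \<xi> u v = fst u * fst v + (p (fst \<xi>))\<^sup>2 * g1 (fst (snd \<xi>)) (fst (snd u)) (fst (snd v))
    + (q (fst \<xi>))\<^sup>2 * g2 (snd (snd \<xi>)) (snd (snd u)) (snd (snd v))"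
  by (simp add: gw_def split_beta)

lemma open_W: "open W"
  unfolding W_def by (intro open_Times T M1.U M2.U)

lemma W_comp:
  "smooth_on T f \<Longrightarrow> smooth_on W (\<lambda>\<xi>. f (fst \<xi>))"
  "smooth_on U1 f1 \<Longrightarrow> smooth_on W (\<lambda>\<xi>. f1 (fst (snd \<xi>)))"
  "smooth_on U2 f2 \<Longrightarrow> smooth_on W (\<lambda>\<xi>. f2 (snd (snd \<xi>)))"
proof -
  show "smooth_on T f \<Longrightarrow> smooth_on W (\<lambda>\<xi>. f (fst \<xi>))"
    by (rule smooth_on_compose[OF open_W T]) (auto intro!: smooth_intros simp: W_def open_Times T M1.U M2.U)
  show "smooth_on U1 f1 \<Longrightarrow> smooth_on W (\<lambda>\<xi>. f1 (fst (snd \<xi>)))"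
    by (rule smooth_on_compose[OF open_W M1.U]) (auto intro!: smooth_intros simp: W_def open_Times T M1.U M2.U)
  show "smooth_on U2 f2 \<Longrightarrow> smooth_on W (\<lambda>\<xi>. f2 (snd (snd \<xi>)))"
    by (rule smooth_on_compose[OF open_W M2.U]) (auto intro!: smooth_intros simp: W_def open_Times T M1.U M2.U)
qed

sublocale warped: coord_metric W gw
proof
  show "open W" by (rule open_W)
  show "smooth_on W (\<lambda>\<xi>. gw \<xi> u v)" for u v
    unfolding gw_eq
    by (intro smooth_intros open_W W_comp p_smooth q_smooth M1.g_smooth M2.g_smooth)
  fix \<xi> assume "\<xi> \<in> W"
  then have in_U: "fst (snd \<xi>) \<in> U1" "snd (snd \<xi>) \<in> U2" "fst \<xi> \<in> T" by (auto simp: W_def)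
  note s = M1.g_simps[OF in_U(1)] M2.g_simps[OF in_U(2)]
  show "bilinear (gw \<xi>)"
    unfolding bilinear_def by (intro conjI allI; rule linearI) (simp_all add: gw_eq s algebra_simps)
  show "gw \<xi> u v = gw \<xi> v u" for u v
    using M1.g_sym[OF in_U(1)] M2.g_sym[OF in_U(2)] by (simp add: gw_eq mult.commute)
  show "0 < gw \<xi> u u" if u: "u \<noteq> 0" for u
  proof -
    have nn: "g1 (fst (snd \<xi>)) v v \<ge> 0" "g2 (snd (snd \<xi>)) w w \<ge> 0" for v w
      using M1.g_pos[OF in_U(1), of v] M2.g_pos[OF in_U(2), of w] s(5)[of v] s(11)[of w]
      by (cases "v = 0"; cases "w = 0"; force)+
    have pq: "(p (fst \<xi>))\<^sup>2 > 0" "(q (fst \<xi>))\<^sup>2 > 0" using p_pos[OF in_U(3)] q_pos[OF in_U(3)] by auto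
    note nn' = mult_nonneg_nonneg[OF less_imp_le[OF pq(1)] nn(1)] mult_nonneg_nonneg[OF less_imp_le[OF pq(2)] nn(2)]
    consider "fst u \<noteq> 0" | "fst (snd u) \<noteq> 0" | "snd (snd u) \<noteq> 0"
      using u by (auto simp: prod_eq_iff)
    then show ?thesis
    proof cases
      case 1
      then have "fst u * fst u > 0" by (auto simp: zero_less_mult_iff)
      then show ?thesis unfolding gw_eq using nn'(1)[of "fst (snd u)"] nn'(2)[of "snd (snd u)"] by linarith
    next
      case 2
      then show ?thesis
        unfolding gw_eq using mult_pos_pos[OF pq(1) M1.g_pos[OF in_U(1)]] nn'(2)[of "snd (snd u)"] zero_le_square[of "fst u"]
        by (simp add: add_pos_nonneg add_nonneg_pos)
    next
      case 3
      then show ?thesis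
        unfolding gw_eq using mult_pos_pos[OF pq(2) M2.g_pos[OF in_U(2)]] nn'(1)[of "fst (snd u)"] zero_le_square[of "fst u"]
        by (simp add: add_nonneg_pos)
    qed
  qed
qed

lemma in_W:
  assumes "\<xi> \<in> W"
  shows "fst \<xi> \<in> T" "fst (snd \<xi>) \<in> U1" "snd (snd \<xi>) \<in> U2"
  using assms by (auto simp: W_def)

lemma real_der:
  assumes "smooth_on T f" "t \<in> T"
  shows "(f has_real_derivative deriv f t) (at t)"
  using smooth_on_differentiable[OF assms] by (simp add: DERIV_deriv_iff_real_differentiable)

lemma fst_der:
  fixes \<xi> :: "real \<times> 'e1 \<times> 'e2"
  assumes "(f has_real_derivative f') (at (fst \<xi>))"
  shows "((\<lambda>\<xi>. f (fst \<xi>)) has_derivative (\<lambda>v. f' * fst v)) (at \<xi>)"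
  using has_derivative_compose[OF has_derivative_fst[OF has_derivative_ident] assms[unfolded has_field_derivative_def]]
  by (simp add: mult.commute)

lemma comp_der:
  fixes \<xi> :: "real \<times> 'e1 \<times> 'e2"
  shows "(G has_derivative D) (at (fst (snd \<xi>))) \<Longrightarrow> ((\<lambda>\<xi>. G (fst (snd \<xi>))) has_derivative (\<lambda>v. D (fst (snd v)))) (at \<xi>)"
    "(G2 has_derivative D2) (at (snd (snd \<xi>))) \<Longrightarrow> ((\<lambda>\<xi>. G2 (snd (snd \<xi>))) has_derivative (\<lambda>v. D2 (snd (snd v)))) (at \<xi>)"
   by (rule has_derivative_compose[of "\<lambda>\<xi>. fst (snd \<xi>)"]; auto intro!: derivative_eq_intros)
     (rule has_derivative_compose[of "\<lambda>\<xi>. snd (snd \<xi>)"]; auto intro!: derivative_eq_intros)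

lemma dgw:
  assumes "\<xi> \<in> W"
  shows "warped.dg \<xi> u v w =
    (p (fst \<xi>))\<^sup>2 * M1.dg (fst (snd \<xi>)) (fst (snd u)) (fst (snd v)) (fst (snd w))
    + 2 * p (fst \<xi>) * deriv p (fst \<xi>) * fst w * g1 (fst (snd \<xi>)) (fst (snd u)) (fst (snd v))
    + ((q (fst \<xi>))\<^sup>2 * M2.dg (snd (snd \<xi>)) (snd (snd u)) (snd (snd v)) (snd (snd w))
    + 2 * q (fst \<xi>) * deriv q (fst \<xi>) * fst w * g2 (snd (snd \<xi>)) (snd (snd u)) (snd (snd v)))"
proof -
  note i = in_W[OF assms]
  have sq: "((\<lambda>t. (p t)\<^sup>2) has_real_derivative 2 * p (fst \<xi>) * deriv p (fst \<xi>)) (at (fst \<xi>))"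
    "((\<lambda>t. (q t)\<^sup>2) has_real_derivative 2 * q (fst \<xi>) * deriv q (fst \<xi>)) (at (fst \<xi>))"
    by (auto intro!: derivative_eq_intros real_der[OF p_smooth] real_der[OF q_smooth] i)
  have "((\<lambda>\<xi>. fst u * fst v + ((p (fst \<xi>))\<^sup>2 * g1 (fst (snd \<xi>)) (fst (snd u)) (fst (snd v))
      + (q (fst \<xi>))\<^sup>2 * g2 (snd (snd \<xi>)) (snd (snd u)) (snd (snd v)))) has_derivative
     (\<lambda>w. 0 + (((p (fst \<xi>))\<^sup>2 * M1.dg (fst (snd \<xi>)) (fst (snd u)) (fst (snd v)) (fst (snd w))
      + 2 * p (fst \<xi>) * deriv p (fst \<xi>) * fst w * g1 (fst (snd \<xi>)) (fst (snd u)) (fst (snd v)))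
      + ((q (fst \<xi>))\<^sup>2 * M2.dg (snd (snd \<xi>)) (snd (snd u)) (snd (snd v)) (snd (snd w))
      + 2 * q (fst \<xi>) * deriv q (fst \<xi>) * fst w * g2 (snd (snd \<xi>)) (snd (snd u)) (snd (snd v)))))) (at \<xi>)"
    by (intro has_derivative_add has_derivative_const has_derivative_mult fst_der[OF sq(1)] fst_der[OF sq(2)]
        comp_der M1.g_der M2.g_der i)
  from fun_cong[OF frechet_derivative_at[OF this], of w] show ?thesis
    by (simp add: gw_eq add.assoc)
qed

text \<open>Uniqueness in the Koszul identity reduces the formula to a check of its inner product
  with an arbitrary \<open>z\<close>.\<close>

lemma christoffel_warped:
  assumes "\<xi> \<in> W"
  shows "christoffel gw \<xi> u X =
   (- (p (fst \<xi>) * deriv p (fst \<xi>) * g1 (fst (snd \<xi>)) (fst (snd u)) (fst (snd X))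
      + q (fst \<xi>) * deriv q (fst \<xi>) * g2 (snd (snd \<xi>)) (snd (snd u)) (snd (snd X))),
    christoffel g1 (fst (snd \<xi>)) (fst (snd u)) (fst (snd X))
      + (deriv p (fst \<xi>) / p (fst \<xi>)) *\<^sub>R (fst u *\<^sub>R fst (snd X) + fst X *\<^sub>R fst (snd u)),
    christoffel g2 (snd (snd \<xi>)) (snd (snd u)) (snd (snd X))
      + (deriv q (fst \<xi>) / q (fst \<xi>)) *\<^sub>R (fst u *\<^sub>R snd (snd X) + fst X *\<^sub>R snd (snd u)))"
proof (rule warped.christoffel_eqI[OF assms], goal_cases)
  case (1 z)
  note i = in_W[OF assms]
  show ?case
    using p_pos[OF i(1)] q_pos[OF i(1)]
      M1.g_sym[OF i(2), of "fst (snd X)" "fst (snd u)"] M2.g_sym[OF i(3), of "snd (snd X)" "snd (snd u)"]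
    unfolding warped.koszul_def dgw[OF assms]
    by (simp add: gw_eq M1.christoffel_char[OF i(2)] M2.christoffel_char[OF i(3)]
        M1.g_simps[OF i(2)] M2.g_simps[OF i(3)] M1.koszul_def M2.koszul_def field_simps power2_eq_square)
qed

text \<open>The logarithmic derivative of the volume factor p^k1 q^k2, with k1 and k2 the dimensions
  of the factors; for a reconstruction this is F'/F.\<close>

definition mean_rate where
  "mean_rate t = real DIM('e1) * deriv p t / p t + real DIM('e2) * deriv q t / q t"

lemma trace_warped:
  assumes "\<xi> \<in> W"
  shows "warped.trace_christoffel \<xi> X = fst X * mean_rate (fst \<xi>)
    + M1.trace_christoffel (fst (snd \<xi>)) (fst (snd X)) + M2.trace_christoffel (snd (snd \<xi>)) (snd (snd X))"
proof -
  note i = in_W[OF assms]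
  show ?thesis
    by (simp add: warped.trace_christoffel_def M1.trace_christoffel_def M2.trace_christoffel_def christoffel_warped[OF assms]
        sum_Basis_prod inner_add_left sum.distrib M1.g_simps[OF i(2)] M2.g_simps[OF i(3)] mean_rate_def algebra_simps)
qed

text \<open>The map paired with a fixed vector is a sum of functions of this shape, one product for
  each factor. The gradient splits along the three factors, and beyond the Laplacians of the factors
  the Christoffel trace contributes only the first-order term in \<open>mean_rate\<close>.\<close>

lemma lap_warped:
  assumes \<xi>: "\<xi> \<in> W" and \<phi>: "smooth_on T \<phi>1" "smooth_on T \<phi>2" and \<psi>: "smooth_on U1 \<psi>1" "smooth_on U2 \<psi>2"
  shows "warped.lap (\<lambda>\<xi>. \<phi>1 (fst \<xi>) * \<psi>1 (fst (snd \<xi>)) + \<phi>2 (fst \<xi>) * \<psi>2 (snd (snd \<xi>))) \<xi> =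
    (deriv (deriv \<phi>1) (fst \<xi>) + mean_rate (fst \<xi>) * deriv \<phi>1 (fst \<xi>)) * \<psi>1 (fst (snd \<xi>))
    + \<phi>1 (fst \<xi>) / (p (fst \<xi>))\<^sup>2 * M1.lap \<psi>1 (fst (snd \<xi>))
    + ((deriv (deriv \<phi>2) (fst \<xi>) + mean_rate (fst \<xi>) * deriv \<phi>2 (fst \<xi>)) * \<psi>2 (snd (snd \<xi>))
    + \<phi>2 (fst \<xi>) / (q (fst \<xi>))\<^sup>2 * M2.lap \<psi>2 (snd (snd \<xi>)))"
proof -
  let ?h = "\<lambda>\<xi>. \<phi>1 (fst \<xi>) * \<psi>1 (fst (snd \<xi>)) + \<phi>2 (fst \<xi>) * \<psi>2 (snd (snd \<xi>))"
  define X where "X \<xi> = (deriv \<phi>1 (fst \<xi>) * \<psi>1 (fst (snd \<xi>)) + deriv \<phi>2 (fst \<xi>) * \<psi>2 (snd (snd \<xi>)),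
    (\<phi>1 (fst \<xi>) / (p (fst \<xi>))\<^sup>2) *\<^sub>R gradient g1 \<psi>1 (fst (snd \<xi>)),
    (\<phi>2 (fst \<xi>) / (q (fst \<xi>))\<^sup>2) *\<^sub>R gradient g2 \<psi>2 (snd (snd \<xi>)))" for \<xi>
  have grad: "gradient gw ?h \<xi> = X \<xi>" if \<xi>: "\<xi> \<in> W" for \<xi>
  proof -
    note i = in_W[OF \<xi>]
    have "(?h has_derivative (\<lambda>v. (\<phi>1 (fst \<xi>) * frechet_derivative \<psi>1 (at (fst (snd \<xi>))) (fst (snd v))
          + deriv \<phi>1 (fst \<xi>) * fst v * \<psi>1 (fst (snd \<xi>)))
        + (\<phi>2 (fst \<xi>) * frechet_derivative \<psi>2 (at (snd (snd \<xi>))) (snd (snd v))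
          + deriv \<phi>2 (fst \<xi>) * fst v * \<psi>2 (snd (snd \<xi>))))) (at \<xi>)"
      by (intro has_derivative_add has_derivative_mult fst_der comp_der real_der \<phi> i smooth_on_has_derivative[OF \<psi>(1)]
          smooth_on_has_derivative[OF \<psi>(2)])
    from warped.gradient_eqI[OF \<xi> this] show ?thesis
      using p_pos[OF i(1)] q_pos[OF i(1)]
      by (simp add: X_def gw_eq M1.g_simps[OF i(2)] M2.g_simps[OF i(3)]
         M1.gradient_char[OF i(2) smooth_on_differentiable[OF \<psi>(1) i(2)]]
         M2.gradient_char[OF i(3) smooth_on_differentiable[OF \<psi>(2) i(3)]] algebra_simps)
  qed
  note i = in_W[OF \<xi>]
  have pq: "p t \<noteq> 0" "q t \<noteq> 0" if "t \<in> T" for t using p_pos[OF that] q_pos[OF that] by auto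
  have d\<phi>: "smooth_on T (deriv \<phi>1)" "smooth_on T (deriv \<phi>2)"
    by (rule smooth_on_deriv[OF T] \<phi>)+
  have quot: "smooth_on T (\<lambda>t. \<phi>1 t / (p t)\<^sup>2)" "smooth_on T (\<lambda>t. \<phi>2 t / (q t)\<^sup>2)"
    using pq by (auto intro!: smooth_intros T \<phi> p_smooth q_smooth)
  define D where "D v = ((deriv \<phi>1 (fst \<xi>) * frechet_derivative \<psi>1 (at (fst (snd \<xi>))) (fst (snd v))
          + deriv (deriv \<phi>1) (fst \<xi>) * fst v * \<psi>1 (fst (snd \<xi>)))
        + (deriv \<phi>2 (fst \<xi>) * frechet_derivative \<psi>2 (at (snd (snd \<xi>))) (snd (snd v))
          + deriv (deriv \<phi>2) (fst \<xi>) * fst v * \<psi>2 (snd (snd \<xi>))),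
      (\<phi>1 (fst \<xi>) / (p (fst \<xi>))\<^sup>2) *\<^sub>R frechet_derivative (gradient g1 \<psi>1) (at (fst (snd \<xi>))) (fst (snd v))
        + (deriv (\<lambda>t. \<phi>1 t / (p t)\<^sup>2) (fst \<xi>) * fst v) *\<^sub>R gradient g1 \<psi>1 (fst (snd \<xi>)),
      (\<phi>2 (fst \<xi>) / (q (fst \<xi>))\<^sup>2) *\<^sub>R frechet_derivative (gradient g2 \<psi>2) (at (snd (snd \<xi>))) (snd (snd v))
        + (deriv (\<lambda>t. \<phi>2 t / (q t)\<^sup>2) (fst \<xi>) * fst v) *\<^sub>R gradient g2 \<psi>2 (snd (snd \<xi>)))" for v
  have "(X has_derivative D) (at \<xi>)"
    unfolding X_def D_def
    by (intro has_derivative_Pair has_derivative_scaleR has_derivative_add has_derivative_mult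
        fst_der[OF real_der[OF quot(1)]] fst_der[OF real_der[OF quot(2)]]
        fst_der[OF real_der[OF d\<phi>(1)]] fst_der[OF real_der[OF d\<phi>(2)]] comp_der i
        smooth_on_has_derivative[OF \<psi>(1)] smooth_on_has_derivative[OF \<psi>(2)] M1.gradient_der M2.gradient_der \<psi>)
  from warped.frechet_eqI[OF \<xi> grad this]
  have "frechet_derivative (gradient gw ?h) (at \<xi>) = D" .
  then show ?thesis
    unfolding warped.lap_def warped.divergence_eq trace_warped[OF \<xi>] grad[OF \<xi>] M1.lap_def M2.lap_def
      M1.divergence_eq M2.divergence_eq
    by (simp add: D_def X_def sum_Basis_prod inner_add_left sum.distrib M1.trace_christoffel_linear[OF i(2)]
        M2.trace_christoffel_linear[OF i(3)] linear_0[OF has_derivative_linear[OF smooth_on_has_derivative[OF \<psi>(1) i(2)]]]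
        linear_0[OF has_derivative_linear[OF smooth_on_has_derivative[OF \<psi>(2) i(3)]]]
        linear_0[OF has_derivative_linear[OF M1.gradient_der[OF i(2) \<psi>(1)]]]
        linear_0[OF has_derivative_linear[OF M2.gradient_der[OF i(3) \<psi>(2)]]] sum_distrib_left algebra_simps)
qed

end

text \<open>The radial equations of the two factors have the same eigenvalue.\<close>

lemma profile_balance:
  fixes A :: real
  assumes "A > 0" "B > 0" "B\<^sup>2 = 1 - A\<^sup>2" "Q > 0" "Q = 1 + (c\<^sup>2 - 1) * A\<^sup>2"
    and "R > 0" "R = 1 - A\<^sup>2 - A1\<^sup>2" and T: "T = 1 / (A\<^sup>2 * Q) - (A + A2) / (A * R)"
    and B1: "B1 = - A * A1 / B" and B2: "B2 = - (A1\<^sup>2 + A * A2) / B - A\<^sup>2 * A1\<^sup>2 / B ^ 3"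
  shows "A2 / A + (- A * A1 * T) * A1 / A - R / (Q * A\<^sup>2) + T
    = B2 / B + (- A * A1 * T) * B1 / B - c\<^sup>2 * A\<^sup>2 * R / (Q * B ^ 4)"
proof -
  have B4: "B ^ 3 * B = (B\<^sup>2)\<^sup>2" "B ^ 4 = (B\<^sup>2)\<^sup>2" "B * B = B\<^sup>2" by (simp_all add: eval_nat_numeral)
  \<comment> \<open>In terms of C = 1 - A^2 the odd powers of B disappear; the claim is then a
    linear combination of the rational identities that follow.\<close>
  define C where "C = B\<^sup>2"
  have C: "C > 0" "C = 1 - A\<^sup>2" using zero_less_power[OF assms(2), of 2] assms(3) by (simp_all add: C_def)
  have "B1 / B = - A * A1 / C" unfolding B1 C_def by (simp add: power2_eq_square)
  moreover have "B2 / B = - (A1\<^sup>2 / C) - A * A2 / C - A\<^sup>2 * A1\<^sup>2 / C\<^sup>2"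
    unfolding B2 C_def using assms(2) by (simp add: field_simps eval_nat_numeral)
  moreover have "A2 / A + A * A2 / C = A2 / (A * C)"
    using assms(1) C(1) by (simp add: field_simps) (simp add: C(2) power2_eq_square algebra_simps)
  moreover have "A1\<^sup>2 / C + A\<^sup>2 * A1\<^sup>2 / C\<^sup>2 = A1\<^sup>2 / C\<^sup>2"
  proof -
    have "A1\<^sup>2 / C + A\<^sup>2 * A1\<^sup>2 / C\<^sup>2 = A1\<^sup>2 * (C + A\<^sup>2) / C\<^sup>2"
      using C(1) by (simp add: field_simps power2_eq_square)
    then show ?thesis using C(2) by simp
  qed
  moreover have "T - A1\<^sup>2 * T - A\<^sup>2 * A1\<^sup>2 * T / C = T * R / C"
  proof -
    have "T - A1\<^sup>2 * T - A\<^sup>2 * A1\<^sup>2 * T / C = T * (C - A1\<^sup>2 * (C + A\<^sup>2)) / C"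
      using C(1) by (simp add: field_simps)
    then show ?thesis using C(2) assms(7) by simp
  qed
  moreover have "T * R / C = R / (A\<^sup>2 * C * Q) - 1 / C - A2 / (A * C)"
    unfolding T using assms(1,4,6) C(1) by (simp add: field_simps power2_eq_square)
  moreover have "(C - A1\<^sup>2) / C\<^sup>2 = R / (A\<^sup>2 * C * Q) - R / (Q * A\<^sup>2) + c\<^sup>2 * A\<^sup>2 * R / (Q * C\<^sup>2)"
  proof -
    have "R / (A\<^sup>2 * C * Q) - R / (Q * A\<^sup>2) = R * (1 - C) / (A\<^sup>2 * C * Q)"
      using assms(1,4) C(1) by (simp add: field_simps)
    also have "\<dots> = R / (C * Q)" using assms(1) C(2) by simp
    finally have e: "R / (A\<^sup>2 * C * Q) - R / (Q * A\<^sup>2) = R / (C * Q)" .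
    have "R / (A\<^sup>2 * C * Q) - R / (Q * A\<^sup>2) + c\<^sup>2 * A\<^sup>2 * R / (Q * C\<^sup>2) = R * (C + c\<^sup>2 * A\<^sup>2) / (Q * C\<^sup>2)"
      unfolding e using assms(4) C(1) by (simp add: field_simps power2_eq_square)
    moreover have "C + c\<^sup>2 * A\<^sup>2 = Q" using C(2) assms(5) by (simp add: algebra_simps)
    ultimately show ?thesis using assms(4,7) C(2) by simp
  qed
  moreover have "(C - A1\<^sup>2) / C\<^sup>2 = 1 / C - A1\<^sup>2 / C\<^sup>2" using C(1) by (simp add: field_simps power2_eq_square)
  moreover have "(- A * A1 * T) * A1 / A = - A1\<^sup>2 * T" using assms(1) by (simp add: power2_eq_square)
  moreover have "(- A * A1 * T) * B1 / B = A\<^sup>2 * A1\<^sup>2 * T / C"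
    unfolding times_divide_eq_right[symmetric] \<open>B1 / B = - A * A1 / C\<close> by (simp add: power2_eq_square)
  ultimately show ?thesis
    unfolding B4(2) C_def[symmetric] by linarith
qed

lemma spiral_derivatives:
  assumes r: "\<And>t. (r has_real_derivative r1 t) (at t)" "\<And>t. (r1 has_real_derivative r2 t) (at t)"
    and \<theta>: "\<And>t. (\<theta> has_real_derivative v t) (at t)" "\<And>t. (v has_real_derivative v1 t) (at t)"
  shows "deriv (\<lambda>t. r t * cos (\<theta> t)) = (\<lambda>t. r1 t * cos (\<theta> t) - r t * v t * sin (\<theta> t))"
    "deriv (\<lambda>t. r t * sin (\<theta> t)) = (\<lambda>t. r1 t * sin (\<theta> t) + r t * v t * cos (\<theta> t))"
    "deriv (deriv (\<lambda>t. r t * cos (\<theta> t))) =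
      (\<lambda>t. (r2 t - r t * (v t)\<^sup>2) * cos (\<theta> t) - (2 * r1 t * v t + r t * v1 t) * sin (\<theta> t))"
    "deriv (deriv (\<lambda>t. r t * sin (\<theta> t))) =
      (\<lambda>t. (r2 t - r t * (v t)\<^sup>2) * sin (\<theta> t) + (2 * r1 t * v t + r t * v1 t) * cos (\<theta> t))"
proof -
  show c: "deriv (\<lambda>t. r t * cos (\<theta> t)) = (\<lambda>t. r1 t * cos (\<theta> t) - r t * v t * sin (\<theta> t))"
    by (rule ext, rule DERIV_imp_deriv) (auto intro!: derivative_eq_intros r \<theta>)
  show s: "deriv (\<lambda>t. r t * sin (\<theta> t)) = (\<lambda>t. r1 t * sin (\<theta> t) + r t * v t * cos (\<theta> t))"
    by (rule ext, rule DERIV_imp_deriv) (auto intro!: derivative_eq_intros r \<theta>)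
  show "deriv (deriv (\<lambda>t. r t * cos (\<theta> t))) =
      (\<lambda>t. (r2 t - r t * (v t)\<^sup>2) * cos (\<theta> t) - (2 * r1 t * v t + r t * v1 t) * sin (\<theta> t))"
    unfolding c by (rule ext, rule DERIV_imp_deriv)
      (auto intro!: derivative_eq_intros r \<theta> simp: algebra_simps power2_eq_square)
  show "deriv (deriv (\<lambda>t. r t * sin (\<theta> t))) =
      (\<lambda>t. (r2 t - r t * (v t)\<^sup>2) * sin (\<theta> t) + (2 * r1 t * v t + r t * v1 t) * cos (\<theta> t))"
    unfolding s by (rule ext, rule DERIV_imp_deriv)
      (auto intro!: derivative_eq_intros r \<theta> simp: algebra_simps power2_eq_square)
qed

text \<open>Real and imaginary part of the spiral are eigenfunctions of one radial operator with the
  same real eigenvalue \<nu>, a function of t; \<kappa> is the contribution of the eigenmap on the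
  factor.\<close>

definition spiral_eigen where
  "spiral_eigen \<mu> \<kappa> \<nu> r \<theta> \<longleftrightarrow> (\<forall>\<phi>\<in>{\<lambda>t::real. r t * cos (\<theta> t), \<lambda>t. r t * sin (\<theta> t)}. \<forall>t.
     deriv (deriv \<phi>) t + \<mu> t * deriv \<phi> t - \<kappa> t * \<phi> t = (\<nu> t :: real) * \<phi> t)"

text \<open>The conservation law \<open>v r\<^sup>2 F = const\<close> says that the angular part of the equation vanishes.\<close>

lemma spiral_eigenI:
  assumes r: "\<And>t. (r has_real_derivative r1 t) (at t)" "\<And>t. (r1 has_real_derivative r2 t) (at t)"
    and \<theta>: "\<And>t. (\<theta> has_real_derivative K / (F t * (r t)\<^sup>2)) (at t)"
    and F: "\<And>t. (F has_real_derivative F t * \<mu> t) (at t)" "\<And>t. F t > 0" and rp: "\<And>t. r t > 0"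
    and \<nu>: "\<And>t. r2 t / r t + \<mu> t * r1 t / r t - (K / (F t * (r t)\<^sup>2))\<^sup>2 - \<kappa> t = \<nu> t"
  shows "spiral_eigen \<mu> \<kappa> \<nu> r \<theta>"
proof -
  define v where "v t = K / (F t * (r t)\<^sup>2)" for t
  define v1 where "v1 t = - v t * (\<mu> t + 2 * r1 t / r t)" for t
  have nz: "F t \<noteq> 0" "r t \<noteq> 0" for t using F(2)[of t] rp[of t] by auto
  have "(v has_real_derivative v1 t) (at t)" for t
    unfolding v_def[abs_def] v1_def using nz[of t]
    by (auto intro!: derivative_eq_intros F r simp: field_simps power2_eq_square)
  note D = spiral_derivatives[OF r \<theta>[folded v_def] this]
  have "2 * r1 t * v t + r t * v1 t + \<mu> t * (r t * v t) = 0" for t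
    using nz[of t] by (simp add: v1_def field_simps)
  then have ang: "(2 * r1 t * v t + r t * v1 t) = - \<mu> t * (r t * v t)" for t by (simp add: eq_neg_iff_add_eq_0)
  have rad: "r2 t - r t * (v t)\<^sup>2 + \<mu> t * r1 t - \<kappa> t * r t = \<nu> t * r t" for t
    using nz[of t] by (simp add: \<nu>[of t, folded v_def, symmetric] field_simps)
  have "r2 t = \<nu> t * r t + \<kappa> t * r t - \<mu> t * r1 t + r t * (v t)\<^sup>2" for t using rad[of t] by simp
  then show ?thesis
    unfolding spiral_eigen_def
    by (simp only: ball_simps D(3,4), simp only: D(1,2) ang) (simp add: algebra_simps)
qed


lemma smooth_on_UNIV_deriv2:
  assumes "smooth_on UNIV f"
  shows "(deriv f has_real_derivative deriv (deriv f) t) (at t)"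
  using smooth_on_UNIV_deriv[OF smooth_on_UNIV_deriv(2)[OF assms]] by simp

text \<open>The product of the warps is F, so the first-order coefficient is F'/F, and this equals -
  a a' T. \<open>\<nu>\<close> is read off from the first spiral; \<open>profile_balance\<close> and
  the equation T = d2 / l2^2 - d1 / l1^2 show that the second spiral has the same one.\<close>

lemma reconstruction_spirals:
  assumes rec: "reconstruction k1 d1 k2 d2 c \<epsilon> \<sigma> a l1 l2 s1 s2" and l: "smooth_on UNIV l1" "smooth_on UNIV l2"
  obtains \<nu> where
    "spiral_eigen (\<lambda>t. real k1 * deriv l1 t / l1 t + real k2 * deriv l2 t / l2 t) (\<lambda>t. d1 / (l1 t)\<^sup>2) \<nu> a s1"
    "spiral_eigen (\<lambda>t. real k1 * deriv l1 t / l1 t + real k2 * deriv l2 t / l2 t) (\<lambda>t. d2 / (l2 t)\<^sup>2) \<nu> (mag_b a) s2"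
proof -
  let ?\<mu> = "\<lambda>t. real k1 * deriv l1 t / l1 t + real k2 * deriv l2 t / l2 t"
  note r_defs = rec[unfolded reconstruction_def admissible_magnitude_def source_warps_def phases_def]
  have \<epsilon>: "\<epsilon> > 0" and \<sigma>: "\<sigma>\<^sup>2 = 1" and a: "smooth_on UNIV a" "\<And>t. a t > 0" "\<And>t. a t < 1" "\<And>t. mag_R a t > 0"
    and lp: "\<And>t. l1 t > 0" "\<And>t. l2 t > 0" and F_eq: "\<And>t. mag_F c \<epsilon> a t = l1 t ^ k1 * l2 t ^ k2"
    and T_eq: "\<And>t. d2 / (l2 t)\<^sup>2 - d1 / (l1 t)\<^sup>2 = mag_T c a t"
    and s: "\<And>t. (s1 has_real_derivative \<sigma> * sqrt \<epsilon> / (mag_F c \<epsilon> a t * (a t)\<^sup>2)) (at t)"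
      "\<And>t. (s2 has_real_derivative \<sigma> * c * sqrt \<epsilon> / (mag_F c \<epsilon> a t * (mag_b a t)\<^sup>2)) (at t)"
    using r_defs by auto
  define a1 a2 where "a1 = deriv a" and "a2 = deriv a1"
  have da: "(a has_real_derivative a1 t) (at t)" "(a1 has_real_derivative a2 t) (at t)" for t
    using smooth_on_UNIV_deriv(1)[OF a(1)] smooth_on_UNIV_deriv2[OF a(1)] by (auto simp: a1_def a2_def)
  define F Q R T b where "F = mag_F c \<epsilon> a" and "Q = mag_Q c a" and "R = mag_R a" and "T = mag_T c a" and "b = mag_b a"
  have a_sq: "(a t)\<^sup>2 < 1" for t using a(2,3)[of t] by (simp add: power_less_one_iff)
  have b: "b t > 0" "(b t)\<^sup>2 = 1 - (a t)\<^sup>2" for t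
    using a_sq[of t] by (auto simp: b_def mag_b_def)
  have Q_eq: "Q t = 1 + (c\<^sup>2 - 1) * (a t)\<^sup>2" for t by (simp add: Q_def mag_Q_def)
  have Q: "Q t > 0" for t
  proof -
    have "Q t = (1 - (a t)\<^sup>2) + c\<^sup>2 * (a t)\<^sup>2" by (simp add: Q_eq algebra_simps)
    then show ?thesis using a_sq[of t] by (simp add: add_pos_nonneg)
  qed
  have R: "R t = 1 - (a t)\<^sup>2 - (a1 t)\<^sup>2" "R t > 0" for t using a(4) by (simp_all add: R_def mag_R_def a1_def)
  have T: "T t = 1 / ((a t)\<^sup>2 * Q t) - (a t + a2 t) / (a t * R t)" for t
    by (simp add: T_def mag_T_def Q_def R_def a2_def a1_def)
  have F_sq: "(F t)\<^sup>2 = \<epsilon> * Q t / ((a t)\<^sup>2 * R t)" for t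
    using \<epsilon> Q[of t] R(2)[of t] a(2)[of t] by (simp add: F_def mag_F_def Q_def R_def)
  have F_pow: "F t = l1 t ^ k1 * l2 t ^ k2" for t by (simp add: F_def F_eq)
  have F: "F t > 0" for t using lp by (simp add: F_pow)
  have pow: "((\<lambda>t. f t ^ n) has_real_derivative f t ^ n * (real n * deriv f t / f t)) (at t)"
    if "smooth_on UNIV f" "f t > 0" for f :: "real \<Rightarrow> real" and n t
  proof -
    have "real n * (deriv f t * f t ^ (n - Suc 0)) = f t ^ n * (real n * deriv f t / f t)"
      using that(2) by (cases n) simp_all
    then show ?thesis using DERIV_power[OF smooth_on_UNIV_deriv(1)[OF that(1), of t], of n] by simp
  qed
  have dF: "(F has_real_derivative F t * ?\<mu> t) (at t)" for t
    unfolding F_pow[abs_def]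
    by (rule DERIV_cong[OF DERIV_mult[OF pow[OF l(1) lp(1)] pow[OF l(2) lp(2)]]]) (simp add: algebra_simps)
  \<comment> \<open>This is the logarithmic derivative of F^2 a^2 R = \<epsilon> Q.\<close>
  have \<mu>: "?\<mu> t = - a t * a1 t * T t" for t
  proof -
    have dR: "(R has_real_derivative - 2 * a1 t * (a t + a2 t)) (at t)"
      unfolding R(1)[abs_def] by (auto intro!: derivative_eq_intros da simp: algebra_simps)
    have dQ: "(Q has_real_derivative 2 * (c\<^sup>2 - 1) * a t * a1 t) (at t)"
      unfolding Q_eq[abs_def] by (auto intro!: derivative_eq_intros da)
    have lhs: "((\<lambda>t. (F t)\<^sup>2 * ((a t)\<^sup>2 * R t)) has_real_derivative
        2 * F t * (F t * ?\<mu> t) * ((a t)\<^sup>2 * R t) + (F t)\<^sup>2 * (2 * a t * a1 t * R t + (a t)\<^sup>2 * (- 2 * a1 t * (a t + a2 t)))) (at t)"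
      by (auto intro!: derivative_eq_intros da dR dF)
    have aux: "x / r = m + (u - w)" if "2 * x = r * (2 * m + (2 * u - 2 * w))" "r > 0" for x r m u w :: real
    proof -
      have "x = r * (m + (u - w))" using that(1) by (simp add: algebra_simps)
      then show ?thesis using that(2) by simp
    qed
    have gen: "2 * (\<epsilon> * Q t) * m + \<epsilon> * Q t * m' = \<epsilon> * (Q t * (2 * m + m'))" for m m'
      by (simp add: algebra_simps)
    have law: "(F t)\<^sup>2 * ((a t)\<^sup>2 * R t) = \<epsilon> * Q t" for t
      unfolding F_sq using a(2)[of t] R(2)[of t] by simp
    have "((\<lambda>t. \<epsilon> * Q t) has_real_derivative \<epsilon> * (2 * (c\<^sup>2 - 1) * a t * a1 t)) (at t)"
      by (rule DERIV_cmult[OF dQ])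
    note e = DERIV_unique[OF this lhs[unfolded law]]
    have "(F t)\<^sup>2 * (2 * a t * a1 t * R t + (a t)\<^sup>2 * (- 2 * a1 t * (a t + a2 t)))
        = (F t)\<^sup>2 * ((a t)\<^sup>2 * R t) * (2 * a1 t / a t - 2 * a1 t * (a t + a2 t) / R t)"
      using a(2)[of t] R(2)[of t] by (simp add: field_simps power2_eq_square)
    moreover have "2 * F t * (F t * m) * ((a t)\<^sup>2 * R t) = 2 * ((F t)\<^sup>2 * ((a t)\<^sup>2 * R t)) * m" for m
      by (simp add: power2_eq_square)
    ultimately have "\<epsilon> * (2 * (c\<^sup>2 - 1) * a t * a1 t) = 2 * ((F t)\<^sup>2 * ((a t)\<^sup>2 * R t)) * ?\<mu> t
        + (F t)\<^sup>2 * ((a t)\<^sup>2 * R t) * (2 * a1 t / a t - 2 * a1 t * (a t + a2 t) / R t)"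
      by (simp only: e)
    then have "2 * (c\<^sup>2 - 1) * a t * a1 t = Q t * (2 * ?\<mu> t + (2 * a1 t / a t - 2 * a1 t * (a t + a2 t) / R t))"
      unfolding law gen by (rule mult_left_cancel[THEN iffD1, rotated]) (use \<epsilon> in simp)
    then have "(c\<^sup>2 - 1) * a t * a1 t / Q t = ?\<mu> t + (a1 t / a t - a1 t * (a t + a2 t) / R t)"
      by (intro aux Q) (simp only: mult.assoc times_divide_eq_right)
    moreover have "(c\<^sup>2 - 1) * a t * a1 t / Q t - a1 t / a t = - a1 t / (a t * Q t)"
    proof -
      have "(c\<^sup>2 - 1) * a t * a1 t / Q t - a1 t / a t = a1 t * ((c\<^sup>2 - 1) * (a t)\<^sup>2 - Q t) / (a t * Q t)"
        using Q[of t] a(2)[of t] by (simp add: field_simps power2_eq_square)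
      then show ?thesis by (simp add: Q_eq)
    qed
    moreover have "- a t * a1 t * T t = - a1 t / (a t * Q t) + a1 t * (a t + a2 t) / R t"
      unfolding T using Q[of t] a(2)[of t] R(2)[of t] by (simp add: field_simps power2_eq_square)
    ultimately show ?thesis by simp
  qed
  define b1 b2 where "b1 t = - a t * a1 t / b t"
    and "b2 t = - ((a1 t)\<^sup>2 + a t * a2 t) / b t - (a t)\<^sup>2 * (a1 t)\<^sup>2 / b t ^ 3" for t
  have db: "(b has_real_derivative b1 t) (at t)" for t
    using a_sq[of t] unfolding b_def b1_def mag_b_def[abs_def]
    by (auto intro!: derivative_eq_intros da simp: field_simps)
  have db1: "(b1 has_real_derivative b2 t) (at t)" for t
    unfolding b1_def[abs_def]
    by (rule derivative_eq_intros da db | use b(1)[of t] in force)+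
      (use b(1)[of t] in \<open>simp add: b1_def b2_def field_simps power2_eq_square power3_eq_cube\<close>)
  define \<nu> where "\<nu> t = a2 t / a t + ?\<mu> t * a1 t / a t - (\<sigma> * sqrt \<epsilon> / (F t * (a t)\<^sup>2))\<^sup>2 - d1 / (l1 t)\<^sup>2" for t
  have rate1: "(\<sigma> * sqrt \<epsilon> / (F t * (a t)\<^sup>2))\<^sup>2 = R t / (Q t * (a t)\<^sup>2)" for t
    using \<epsilon> \<sigma> Q[of t] R(2)[of t] a(2)[of t]
    by (simp add: power_divide power_mult_distrib F_sq field_simps)
  have rate2: "(\<sigma> * c * sqrt \<epsilon> / (F t * (b t)\<^sup>2))\<^sup>2 = c\<^sup>2 * (a t)\<^sup>2 * R t / (Q t * b t ^ 4)" for t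
    using \<epsilon> \<sigma> Q[of t] R(2)[of t] a(2)[of t] b(1)[of t]
    by (simp add: power_divide power_mult_distrib F_sq field_simps flip: power_mult)
  have \<nu>2: "b2 t / b t + ?\<mu> t * b1 t / b t - (\<sigma> * c * sqrt \<epsilon> / (F t * (b t)\<^sup>2))\<^sup>2 - d2 / (l2 t)\<^sup>2 = \<nu> t" for t
    using profile_balance[OF a(2)[of t] b(1)[of t] b(2)[of t] Q[of t] Q_eq[of t] R(2)[of t] R(1)[of t] T[of t] b1_def[of t] b2_def[of t]]
      T_eq[of t, folded T_def]
    by (simp add: \<nu>_def rate1 rate2 \<mu>)
  show thesis
    by (rule that[of \<nu>];
      rule spiral_eigenI[OF da s(1)[folded F_def] dF F a(2) \<nu>_def[symmetric]]
        spiral_eigenI[OF db[unfolded b_def] db1 s(2)[folded F_def] dF F b(1)[unfolded b_def] \<nu>2[unfolded b_def]])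
qed


text \<open>For the real inner product the adjoint of multiplication by \<i> is multiplication by -
  \<i>, so the imaginary part of the scalar moves to the fixed vector.\<close>

lemma inner_vector_smult:
  fixes x w :: "complex ^ 'n"
  shows "(z *s x) \<bullet> w = Re z * (x \<bullet> w) + Im z * (x \<bullet> ((- \<i>) *s w))"
  by (simp add: inner_vec_def inner_complex_def vector_scalar_mult_def sum_distrib_left sum.distrib[symmetric] algebra_simps)

lemma bounded_bilinear_vector_smult: "bounded_bilinear ((*s) :: complex \<Rightarrow> complex ^ 'n \<Rightarrow> complex ^ 'n)"
  unfolding bilinear_conv_bounded_bilinear[symmetric] bilinear_def
  by (auto intro!: linearI simp: vector_add_ldistrib vector_sadd_rdistrib vec_eq_iff algebra_simps)

lemmas smooth_on_vector_smult [smooth_intros] = smooth_on_bilinear[OF bounded_bilinear_vector_smult]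

lemma norm_vector_smult: "norm (z *s x) = norm z * norm (x :: complex ^ 'n)"
  by (simp add: norm_vec_def norm_mult L2_set_right_distrib)

context warped_coords
begin

text \<open>Testing the Laplacian against a fixed \<open>w\<close> gives real functions to which
  \<open>lap_warped\<close> applies: the cosine parts go with \<open>w\<close>, the sine parts with
  - \<i> w.\<close>

lemma spirals_harmonic:
  fixes F1 :: "'e1 \<Rightarrow> complex ^ 'n1" and F2 :: "'e2 \<Rightarrow> complex ^ 'n2"
  assumes \<xi>: "\<xi> \<in> W" and F: "smooth_on U1 F1" "smooth_on U2 F2"
    and eig: "\<And>x. x \<in> U1 \<Longrightarrow> laplacian g1 F1 x = - d1 *\<^sub>R F1 x" "\<And>y. y \<in> U2 \<Longrightarrow> laplacian g2 F2 y = - d2 *\<^sub>R F2 y"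
    and unit: "\<And>x. x \<in> U1 \<Longrightarrow> norm (F1 x) = 1" "\<And>y. y \<in> U2 \<Longrightarrow> norm (F2 y) = 1"
    and r: "smooth_on T r1" "smooth_on T r2" "\<And>t. t \<in> T \<Longrightarrow> (r1 t)\<^sup>2 + (r2 t)\<^sup>2 = 1"
    and \<theta>: "smooth_on T \<theta>1" "smooth_on T \<theta>2"
    and spiral: "spiral_eigen mean_rate (\<lambda>t. d1 / (p t)\<^sup>2) \<nu> r1 \<theta>1" "spiral_eigen mean_rate (\<lambda>t. d2 / (q t)\<^sup>2) \<nu> r2 \<theta>2"
    and G: "\<And>t x y. G (t, x, y) = ((complex_of_real (r1 t) * exp (\<i> * complex_of_real (\<theta>1 t))) *s F1 x,
      (complex_of_real (r2 t) * exp (\<i> * complex_of_real (\<theta>2 t))) *s F2 y)"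
  shows "smooth_on W G" "norm (G \<xi>) = 1" "tension gw G \<xi> = 0"
proof -
  have ex: "exp (\<i> * complex_of_real s) = complex_of_real (cos s) + \<i> * complex_of_real (sin s)" for s
    by (simp add: cis_conv_exp[symmetric] complex_eq_iff)
  have G_eq: "G = (\<lambda>\<xi>. ((complex_of_real (r1 (fst \<xi>)) * (complex_of_real (cos (\<theta>1 (fst \<xi>))) + \<i> * complex_of_real (sin (\<theta>1 (fst \<xi>))))) *s F1 (fst (snd \<xi>)),
      (complex_of_real (r2 (fst \<xi>)) * (complex_of_real (cos (\<theta>2 (fst \<xi>))) + \<i> * complex_of_real (sin (\<theta>2 (fst \<xi>))))) *s F2 (snd (snd \<xi>))))"
  proof
    fix \<eta>
    show "G \<eta> = ((complex_of_real (r1 (fst \<eta>)) * (complex_of_real (cos (\<theta>1 (fst \<eta>))) + \<i> * complex_of_real (sin (\<theta>1 (fst \<eta>))))) *s F1 (fst (snd \<eta>)),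
      (complex_of_real (r2 (fst \<eta>)) * (complex_of_real (cos (\<theta>2 (fst \<eta>))) + \<i> * complex_of_real (sin (\<theta>2 (fst \<eta>))))) *s F2 (snd (snd \<eta>)))"
      using G[of "fst \<eta>" "fst (snd \<eta>)" "snd (snd \<eta>)"] by (simp only: ex prod.collapse)
  qed
  show G_smooth: "smooth_on W G"
    unfolding G_eq by (intro smooth_intros open_W W_comp F r \<theta>)
  show unitG: "norm (G \<xi>) = 1"
  proof -
    obtain t x y where txy: "\<xi> = (t, x, y)" by (cases \<xi>)
    show ?thesis
      using in_W[OF assms(1)] unit r(3)[of t]
      by (simp add: txy G norm_Pair norm_vector_smult norm_mult cis_conv_exp[symmetric])
  qed
  have "laplacian gw G \<xi> \<bullet> w = (\<nu> (fst \<xi>) *\<^sub>R G \<xi>) \<bullet> w" for w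
  proof -
    note i = in_W[OF \<xi>]
    define A where "A j \<phi>1 \<phi>2 = (\<lambda>\<xi> :: real \<times> 'e1 \<times> 'e2. \<phi>1 (fst \<xi>) * (F1 (fst (snd \<xi>)) \<bullet> (j *s fst w)) + \<phi>2 (fst \<xi>) * (F2 (snd (snd \<xi>)) \<bullet> (j *s snd w)))" for j and \<phi>1 \<phi>2 :: "real \<Rightarrow> real"
    have A: "warped.lap (A j \<phi>1 \<phi>2) \<xi> = \<nu> (fst \<xi>) * A j \<phi>1 \<phi>2 \<xi>"
      if "smooth_on T \<phi>1" "smooth_on T \<phi>2"
        "deriv (deriv \<phi>1) (fst \<xi>) + mean_rate (fst \<xi>) * deriv \<phi>1 (fst \<xi>) - d1 / (p (fst \<xi>))\<^sup>2 * \<phi>1 (fst \<xi>) = \<nu> (fst \<xi>) * \<phi>1 (fst \<xi>)"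
        "deriv (deriv \<phi>2) (fst \<xi>) + mean_rate (fst \<xi>) * deriv \<phi>2 (fst \<xi>) - d2 / (q (fst \<xi>))\<^sup>2 * \<phi>2 (fst \<xi>) = \<nu> (fst \<xi>) * \<phi>2 (fst \<xi>)"
      for j \<phi>1 \<phi>2
    proof -
      have sm: "smooth_on U1 (\<lambda>x. F1 x \<bullet> (j *s fst w))" "smooth_on U2 (\<lambda>x. F2 x \<bullet> (j *s snd w))"
        by (intro smooth_intros M1.U M2.U F)+
      have "deriv (deriv \<phi>1) (fst \<xi>) + mean_rate (fst \<xi>) * deriv \<phi>1 (fst \<xi>) = \<nu> (fst \<xi>) * \<phi>1 (fst \<xi>) + d1 / (p (fst \<xi>))\<^sup>2 * \<phi>1 (fst \<xi>)"
        "deriv (deriv \<phi>2) (fst \<xi>) + mean_rate (fst \<xi>) * deriv \<phi>2 (fst \<xi>) = \<nu> (fst \<xi>) * \<phi>2 (fst \<xi>) + d2 / (q (fst \<xi>))\<^sup>2 * \<phi>2 (fst \<xi>)"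
        using that(3,4) by simp_all
      then show ?thesis
        unfolding A_def lap_warped[OF \<xi> that(1,2) sm] M1.lap_inner[OF i(2) F(1)] M2.lap_inner[OF i(3) F(2)]
          eig(1)[OF i(2)] eig(2)[OF i(3)]
        by (simp add: distrib_right distrib_left)
    qed
    have sm: "smooth_on T (\<lambda>t. r1 t * cos (\<theta>1 t))" "smooth_on T (\<lambda>t. r2 t * cos (\<theta>2 t))"
      "smooth_on T (\<lambda>t. r1 t * sin (\<theta>1 t))" "smooth_on T (\<lambda>t. r2 t * sin (\<theta>2 t))"
      by (intro smooth_intros T r \<theta>)+
    let ?A = "A 1 (\<lambda>t. r1 t * cos (\<theta>1 t)) (\<lambda>t. r2 t * cos (\<theta>2 t))"
    let ?B = "A (- \<i>) (\<lambda>t. r1 t * sin (\<theta>1 t)) (\<lambda>t. r2 t * sin (\<theta>2 t))"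
    have AB_smooth: "smooth_on W ?A" "smooth_on W ?B"
      unfolding A_def by (intro smooth_intros open_W W_comp T M1.U M2.U F r \<theta>)+
    have comp: "(\<lambda>\<xi>. G \<xi> \<bullet> w) = (\<lambda>\<xi>. ?A \<xi> + ?B \<xi>)"
      by (rule ext) (simp add: G_eq A_def inner_prod_def inner_vector_smult algebra_simps)
    have "laplacian gw G \<xi> \<bullet> w = warped.lap ?A \<xi> + warped.lap ?B \<xi>"
      unfolding warped.lap_inner[OF \<xi> G_smooth, symmetric] comp by (rule warped.lap_add[OF \<xi> AB_smooth])
    also have "warped.lap ?A \<xi> = \<nu> (fst \<xi>) * ?A \<xi>"
      by (rule A[OF sm(1,2)]) (use spiral in \<open>auto simp: spiral_eigen_def\<close>)
    also have "warped.lap ?B \<xi> = \<nu> (fst \<xi>) * ?B \<xi>"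
      by (rule A[OF sm(3,4)]) (use spiral in \<open>auto simp: spiral_eigen_def\<close>)
    also have "\<nu> (fst \<xi>) * ?A \<xi> + \<nu> (fst \<xi>) * ?B \<xi> = \<nu> (fst \<xi>) * (G \<xi> \<bullet> w)"
      using fun_cong[OF comp, of \<xi>] by (simp add: algebra_simps)
    finally show ?thesis by simp
  qed
  then have "laplacian gw G \<xi> = \<nu> (fst \<xi>) *\<^sub>R G \<xi>" by (subst vector_eq_rdot[symmetric]) simp
  then show "tension gw G \<xi> = 0"
    using unitG by (simp add: tension_def dot_square_norm)
qed

end

section \<open>Warped products over the line and the circle\<close>

lemma second_countable_prod_topology:
  assumes "second_countable X" "second_countable Y"
  shows "second_countable (prod_topology X Y)"
proof -
  from assms obtain A B where A: "countable A" "\<And>V. V \<in> A \<Longrightarrow> openin X V"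
      "\<And>U x. openin X U \<Longrightarrow> x \<in> U \<Longrightarrow> \<exists>V\<in>A. x \<in> V \<and> V \<subseteq> U"
    and B: "countable B" "\<And>V. V \<in> B \<Longrightarrow> openin Y V"
      "\<And>U x. openin Y U \<Longrightarrow> x \<in> U \<Longrightarrow> \<exists>V\<in>B. x \<in> V \<and> V \<subseteq> U"
    unfolding second_countable_def by metis
  show ?thesis
    unfolding second_countable_def
  proof (intro exI[of _ "(\<lambda>(V, V'). V \<times> V') ` (A \<times> B)"] conjI ballI allI impI)
    show "countable ((\<lambda>(V, V'). V \<times> V') ` (A \<times> B))" using A(1) B(1) by auto
    show "openin (prod_topology X Y) V" if "V \<in> (\<lambda>(V, V'). V \<times> V') ` (A \<times> B)" for V
      using that A(2) B(2) by (auto simp: openin_prod_Times_iff)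
    fix U z assume "openin (prod_topology X Y) U \<and> z \<in> U"
    then obtain U1 U2 where U: "openin X U1" "openin Y U2" "fst z \<in> U1" "snd z \<in> U2" "U1 \<times> U2 \<subseteq> U"
      unfolding openin_prod_topology_alt by (metis prod.collapse)
    then obtain V1 V2 where "V1 \<in> A" "fst z \<in> V1" "V1 \<subseteq> U1" "V2 \<in> B" "snd z \<in> V2" "V2 \<subseteq> U2"
      using A(3) B(3) by metis
    then show "\<exists>V\<in>(\<lambda>(V, V'). V \<times> V') ` (A \<times> B). z \<in> V \<and> V \<subseteq> U"
      using U(5) by (intro bexI[of _ "V1 \<times> V2"]) (auto simp: mem_Times_iff)
  qed
qed

lemma homeomorphic_map_map_prod:
  assumes "homeomorphic_map X X' f" "homeomorphic_map Y Y' g"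
  shows "homeomorphic_map (prod_topology X Y) (prod_topology X' Y') (map_prod f g)"
proof -
  obtain f' g' where "homeomorphic_maps X X' f f'" "homeomorphic_maps Y Y' g g'"
    using assms by (auto simp: homeomorphic_map_maps)
  then have "homeomorphic_maps (prod_topology X Y) (prod_topology X' Y') (\<lambda>(x, y). (f x, g y)) (\<lambda>(x, y). (f' x, g' y))"
    by (simp add: homeomorphic_maps_prod)
  then show ?thesis by (auto simp: homeomorphic_map_maps map_prod_def)
qed

lemma the_inv_into_map_prod:
  assumes "inj_on f A" "inj_on g B" "p \<in> f ` A" "q \<in> g ` B"
  shows "the_inv_into (A \<times> B) (map_prod f g) (p, q) = (the_inv_into A f p, the_inv_into B g q)"
  using assms by (intro the_inv_into_f_eq map_prod_inj_on) (auto simp: the_inv_into_f_f)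

lemma smooth_on_map_prod:
  assumes "open A" "open B" "smooth_on A f" "smooth_on B g"
  shows "smooth_on (A \<times> B) (map_prod f g)"
    "x \<in> A \<Longrightarrow> y \<in> B \<Longrightarrow> frechet_derivative (map_prod f g) (at (x, y)) =
      map_prod (frechet_derivative f (at x)) (frechet_derivative g (at y))"
proof -
  have "smooth_on (A \<times> B) (\<lambda>z. (f (fst z), g (snd z)))"
    by (rule smooth_on_Pair smooth_on_compose[OF _ assms(1,3)] smooth_on_compose[OF _ assms(2,4)]
        smooth_on_fst smooth_on_snd smooth_on_id open_Times assms | force)+
  moreover have eq: "map_prod f g = (\<lambda>z. (f (fst z), g (snd z)))" by (auto simp: fun_eq_iff)
  ultimately show "smooth_on (A \<times> B) (map_prod f g)" by simp
  assume x: "x \<in> A" and y: "y \<in> B"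
  have "(f has_derivative frechet_derivative f (at x)) (at (fst (x, y)))"
    "(g has_derivative frechet_derivative g (at y)) (at (snd (x, y)))"
    using smooth_on_has_derivative[OF assms(3) x] smooth_on_has_derivative[OF assms(4) y] by simp_all
  from has_derivative_Pair[OF has_derivative_compose[OF has_derivative_fst[OF has_derivative_ident] this(1)]
      has_derivative_compose[OF has_derivative_snd[OF has_derivative_ident] this(2)]]
  show "frechet_derivative (map_prod f g) (at (x, y)) =
      map_prod (frechet_derivative f (at x)) (frechet_derivative g (at y))"
    unfolding eq by (subst frechet_derivative_at[symmetric], assumption) (auto simp: fun_eq_iff)
qed

lemma smooth_manifoldD:
  assumes "smooth_manifold N" "i \<in> charts N"
  shows "open (chart_dom N i)" "openin (manifold_top N) (chart_range N i)"
    "homeomorphic_map (top_of_set (chart_dom N i)) (subtopology (manifold_top N) (chart_range N i)) (chart_par N i)"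
    "inj_on (chart_par N i) (chart_dom N i)"
proof -
  show *: "open (chart_dom N i)" "openin (manifold_top N) (chart_range N i)"
    "homeomorphic_map (top_of_set (chart_dom N i)) (subtopology (manifold_top N) (chart_range N i)) (chart_par N i)"
    using assms by (auto simp: smooth_manifold_def)
  show "inj_on (chart_par N i) (chart_dom N i)"
    using homeomorphic_imp_injective_map[OF *(3)] by simp
qed

lemma open_overlap:
  assumes N: "smooth_manifold N" and ij: "i \<in> charts N" "j \<in> charts N"
  shows "open (overlap N i j)"
proof -
  have "continuous_map (top_of_set (chart_dom N i)) (manifold_top N) (chart_par N i)"
    using homeomorphic_imp_continuous_map[OF smooth_manifoldD(3)[OF N ij(1)]]
    by (simp add: continuous_map_in_subtopology)
  from openin_continuous_map_preimage[OF this smooth_manifoldD(2)[OF N ij(2)]]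
  have "openin (top_of_set (chart_dom N i)) (overlap N i j)"
    by (simp add: overlap_def)
  then show ?thesis using smooth_manifoldD(1)[OF N ij(1)] openin_open_eq by blast
qed

lemma overlap_transition:
  assumes N: "smooth_manifold N" and ij: "i \<in> charts N" "j \<in> charts N" and x: "x \<in> overlap N i j"
  shows "transition N i j x \<in> chart_dom N j" "chart_par N j (transition N i j x) = chart_par N i x"
proof -
  have "chart_par N i x \<in> chart_par N j ` chart_dom N j" using x by (auto simp: overlap_def chart_range_def)
  then show "transition N i j x \<in> chart_dom N j" "chart_par N j (transition N i j x) = chart_par N i x"
    unfolding transition_def using smooth_manifoldD(4)[OF N ij(2)]
    by (auto intro: the_inv_into_into f_the_inv_into_f)
qed

lemma coord_metric_chart:
  "riemannian_manifold N \<Longrightarrow> i \<in> charts N \<Longrightarrow> coord_metric (chart_dom N i) (chart_metric N i)"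
  by unfold_locales (auto simp: riemannian_manifold_def riemannian_metric_def smooth_manifold_def)

locale warped_factors =
  fixes B :: "('b, 'i0, real) riemannian" and l1 l2 :: "'b \<Rightarrow> real"
    and N1 :: "('m1, 'i1, 'e1::euclidean_space) riemannian" and N2 :: "('m2, 'i2, 'e2::euclidean_space) riemannian"
  assumes B: "smooth_manifold B" and N1: "smooth_manifold N1" and N2: "smooth_manifold N2"
begin

abbreviation WP where "WP \<equiv> warped_product B l1 N1 l2 N2"

lemma WP_simps:
  "manifold_top WP = prod_topology (manifold_top B) (prod_topology (manifold_top N1) (manifold_top N2))"
  "charts WP = charts B \<times> charts N1 \<times> charts N2"
  "chart_dom WP (i, j, k) = chart_dom B i \<times> chart_dom N1 j \<times> chart_dom N2 k"
  "chart_par WP (i, j, k) = map_prod (chart_par B i) (map_prod (chart_par N1 j) (chart_par N2 k))"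
  by (auto simp: warped_product_def fun_eq_iff)

lemma WP_range: "chart_range WP (i, j, k) = chart_range B i \<times> chart_range N1 j \<times> chart_range N2 k"
  by (simp add: chart_range_def WP_simps map_prod_surj_on[OF refl map_prod_surj_on[OF refl refl]])

lemma WP_overlap: "overlap WP (i, j, k) (i', j', k') = overlap B i i' \<times> overlap N1 j j' \<times> overlap N2 k k'"
  unfolding overlap_def WP_range WP_simps by auto

lemma WP_transition:
  assumes "i' \<in> charts B" "j' \<in> charts N1" "k' \<in> charts N2"
    and "t \<in> overlap B i i'" "x \<in> overlap N1 j j'" "y \<in> overlap N2 k k'"
  shows "transition WP (i, j, k) (i', j', k') (t, x, y) =
    map_prod (transition B i i') (map_prod (transition N1 j j') (transition N2 k k')) (t, x, y)"
proof -
  have "chart_par B i t \<in> chart_par B i' ` chart_dom B i'" "chart_par N1 j x \<in> chart_par N1 j' ` chart_dom N1 j'"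
    "chart_par N2 k y \<in> chart_par N2 k' ` chart_dom N2 k'"
    using assms(4-6) by (auto simp: overlap_def chart_range_def)
  then show ?thesis
    unfolding transition_def WP_simps map_prod_simp
    using smooth_manifoldD(4)[OF B assms(1)] smooth_manifoldD(4)[OF N1 assms(2)] smooth_manifoldD(4)[OF N2 assms(3)]
    by (subst the_inv_into_map_prod) (simp_all add: the_inv_into_map_prod map_prod_inj_on map_prod_surj_on[OF refl refl])
qed

lemma WP_transition_smooth:
  assumes c: "i \<in> charts B" "j \<in> charts N1" "k \<in> charts N2" "i' \<in> charts B" "j' \<in> charts N1" "k' \<in> charts N2"
  shows "smooth_on (overlap WP (i, j, k) (i', j', k')) (transition WP (i, j, k) (i', j', k'))"
    "\<lbrakk>t \<in> overlap B i i'; x \<in> overlap N1 j j'; y \<in> overlap N2 k k'\<rbrakk> \<Longrightarrow>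
      frechet_derivative (transition WP (i, j, k) (i', j', k')) (at (t, x, y)) =
      map_prod (frechet_derivative (transition B i i') (at t))
       (map_prod (frechet_derivative (transition N1 j j') (at x)) (frechet_derivative (transition N2 k k') (at y)))"
proof -
  let ?F = "map_prod (transition B i i') (map_prod (transition N1 j j') (transition N2 k k'))"
  let ?O = "overlap WP (i, j, k) (i', j', k')"
  note op = open_overlap[OF B c(1,4)] open_overlap[OF N1 c(2,5)] open_overlap[OF N2 c(3,6)]
  have sm: "smooth_on (overlap B i i') (transition B i i')" "smooth_on (overlap N1 j j') (transition N1 j j')"
    "smooth_on (overlap N2 k k') (transition N2 k k')"
    using B N1 N2 c by (auto simp: smooth_manifold_def)
  have open_O: "open ?O" unfolding WP_overlap by (intro open_Times op)
  have eq: "?F \<xi> = transition WP (i, j, k) (i', j', k') \<xi>" if "\<xi> \<in> ?O" for \<xi>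
    using that WP_transition[OF c(4-6)] unfolding WP_overlap by force
  have F: "smooth_on ?O ?F"
    unfolding WP_overlap by (intro smooth_on_map_prod open_Times op sm)
  show "smooth_on ?O (transition WP (i, j, k) (i', j', k'))"
    by (rule smooth_on_cong[OF open_O eq F])
  assume p: "t \<in> overlap B i i'" "x \<in> overlap N1 j j'" "y \<in> overlap N2 k k'"
  then have in_O: "(t, x, y) \<in> ?O" by (simp add: WP_overlap)
  have "frechet_derivative (transition WP (i, j, k) (i', j', k')) (at (t, x, y)) = frechet_derivative ?F (at (t, x, y))"
    by (rule frechet_derivative_at[OF has_derivative_transform_within_open[OF
        smooth_on_has_derivative[OF F in_O] open_O in_O], symmetric]) (rule eq)
  also have "\<dots> = map_prod (frechet_derivative (transition B i i') (at t))
       (map_prod (frechet_derivative (transition N1 j j') (at x)) (frechet_derivative (transition N2 k k') (at y)))"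
    using p by (subst smooth_on_map_prod(2)[OF op(1) open_Times[OF op(2,3)] sm(1) smooth_on_map_prod(1)[OF op(2,3) sm(2,3)]])
      (auto simp: smooth_on_map_prod(2)[OF op(2,3) sm(2,3)])
  finally show "frechet_derivative (transition WP (i, j, k) (i', j', k')) (at (t, x, y)) =
      map_prod (frechet_derivative (transition B i i') (at t))
       (map_prod (frechet_derivative (transition N1 j j') (at x)) (frechet_derivative (transition N2 k k') (at y)))" .
qed

lemma WP_smooth_manifold: "smooth_manifold WP"
  unfolding smooth_manifold_def
proof (intro conjI ballI)
  show "Hausdorff_space (manifold_top WP)" "second_countable (manifold_top WP)"
    using B N1 N2 by (auto simp: WP_simps smooth_manifold_def Hausdorff_space_prod_topology second_countable_prod_topology)
  have "(\<Union>i\<in>charts WP. chart_range WP i) =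
      (\<Union>i\<in>charts B. chart_range B i) \<times> (\<Union>i\<in>charts N1. chart_range N1 i) \<times> (\<Union>i\<in>charts N2. chart_range N2 i)"
    by (simp add: WP_simps) (auto simp: WP_range)
  then show "(\<Union>i\<in>charts WP. chart_range WP i) = topspace (manifold_top WP)"
    using B N1 N2 by (simp add: WP_simps smooth_manifold_def)
next
  fix \<alpha> assume \<alpha>: "\<alpha> \<in> charts WP"
  then obtain i j k where i: "\<alpha> = (i, j, k)" "i \<in> charts B" "j \<in> charts N1" "k \<in> charts N2"
    by (auto simp: WP_simps)
  note D = smooth_manifoldD[OF B i(2)] smooth_manifoldD[OF N1 i(3)] smooth_manifoldD[OF N2 i(4)]
  show "open (chart_dom WP \<alpha>)" unfolding i WP_simps by (intro open_Times D)
  show "openin (manifold_top WP) (chart_range WP \<alpha>)"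
    unfolding i WP_simps WP_range using D by (auto simp: openin_prod_Times_iff)
  have "homeomorphic_map (prod_topology (top_of_set (chart_dom B i)) (prod_topology (top_of_set (chart_dom N1 j)) (top_of_set (chart_dom N2 k))))
      (prod_topology (subtopology (manifold_top B) (chart_range B i)) (prod_topology
        (subtopology (manifold_top N1) (chart_range N1 j)) (subtopology (manifold_top N2) (chart_range N2 k))))
      (map_prod (chart_par B i) (map_prod (chart_par N1 j) (chart_par N2 k)))"
    by (intro homeomorphic_map_map_prod D)
  then show "homeomorphic_map (top_of_set (chart_dom WP \<alpha>)) (subtopology (manifold_top WP) (chart_range WP \<alpha>)) (chart_par WP \<alpha>)"
    unfolding i WP_simps WP_range by (simp add: subtopology_Times)
  fix \<beta> assume "\<beta> \<in> charts WP"
  then obtain i' j' k' where i': "\<beta> = (i', j', k')" "i' \<in> charts B" "j' \<in> charts N1" "k' \<in> charts N2"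
    by (auto simp: WP_simps)
  show "smooth_on (overlap WP \<alpha> \<beta>) (transition WP \<alpha> \<beta>)"
    unfolding i(1) i'(1) by (rule WP_transition_smooth) (use i i' in auto)
qed

lemma WP_closed:
  "compact_space (manifold_top B) \<Longrightarrow> compact_space (manifold_top N1) \<Longrightarrow> compact_space (manifold_top N2)
    \<Longrightarrow> closed_manifold WP"
  by (simp add: closed_manifold_def WP_smooth_manifold WP_simps compact_space_prod_topology)

end


text \<open>Treats the line and the circle at once: every chart of the base is a restriction of one
  map \<pi>, and the base metric is dt^2. For the line \<pi> is the identity, for the circle the
  projection; \<open>p\<close> and \<open>q\<close> are the warps lifted along \<pi>.\<close>

locale flat_base = warped_factors B l1 l2 N1 N2
  for B :: "('b, 'i0, real) riemannian" and l1 l2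
    and N1 :: "('m1, 'i1, 'e1::euclidean_space) riemannian" and N2 :: "('m2, 'i2, 'e2::euclidean_space) riemannian" +
  fixes \<pi> :: "real \<Rightarrow> 'b" and p q :: "real \<Rightarrow> real"
  assumes riem_B: "riemannian_manifold B" and riem_N1: "riemannian_manifold N1" and riem_N2: "riemannian_manifold N2"
    and B_par: "chart_par B = (\<lambda>_. \<pi>)" and B_metric: "chart_metric B = (\<lambda>_ _ u v. u * v)"
    and lift: "\<And>t. l1 (\<pi> t) = p t" "\<And>t. l2 (\<pi> t) = q t"
    and warps: "smooth_on UNIV p" "smooth_on UNIV q" "\<And>t. p t > 0" "\<And>t. q t > 0"
begin

lemma chart_coords:
  assumes "i \<in> charts B" "j \<in> charts N1" "k \<in> charts N2"
  shows "warped_coords (chart_dom N1 j) (chart_metric N1 j) (chart_dom N2 k) (chart_metric N2 k) (chart_dom B i) p q"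
  using assms coord_metric_chart[OF riem_N1] coord_metric_chart[OF riem_N2] smooth_manifoldD(1)[OF B] warps
  by (auto simp: warped_coords_def warped_coords_axioms_def intro: smooth_on_subset)

lemma chart_metric_eq:
  assumes "i \<in> charts B" "j \<in> charts N1" "k \<in> charts N2"
  shows "chart_metric WP (i, j, k) = warped_coords.gw (chart_metric N1 j) (chart_metric N2 k) p q"
    "chart_dom WP (i, j, k) = warped_coords.W (chart_dom N1 j) (chart_dom N2 k) (chart_dom B i)"
  by (auto simp: fun_eq_iff warped_product_def warped_coords.gw_def[OF chart_coords[OF assms]]
      warped_coords.W_def[OF chart_coords[OF assms]] B_metric B_par lift)

text \<open>Compatibility on overlaps: the warps are functions on the base, hence agree in both
  charts, and the derivative of a transition splits into those of the three factors.\<close>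

lemma WP_riemannian: "riemannian_manifold WP"
  unfolding riemannian_manifold_def riemannian_metric_def
proof (intro conjI ballI allI impI WP_smooth_manifold)
  fix \<alpha> assume \<alpha>: "\<alpha> \<in> charts WP"
  then obtain i j k where i: "\<alpha> = (i, j, k)" "i \<in> charts B" "j \<in> charts N1" "k \<in> charts N2"
    by (auto simp: WP_simps)
  interpret warped_coords "chart_dom N1 j" "chart_metric N1 j" "chart_dom N2 k" "chart_metric N2 k" "chart_dom B i" p q
    by (rule chart_coords[OF i(2-4)])
  note eq = chart_metric_eq[OF i(2-4)]
  show "smooth_on (chart_dom WP \<alpha>) (\<lambda>x. chart_metric WP \<alpha> x u v)" for u v
    unfolding i(1) eq by (rule warped.g_smooth)
  fix \<xi>
  show "bilinear (chart_metric WP \<alpha> \<xi>)" "\<And>u v. chart_metric WP \<alpha> \<xi> u v = chart_metric WP \<alpha> \<xi> v u"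
    "\<And>u. u \<noteq> 0 \<Longrightarrow> chart_metric WP \<alpha> \<xi> u u > 0" if "\<xi> \<in> chart_dom WP \<alpha>"
    using that unfolding i(1) eq by (auto intro: warped.g_bilinear warped.g_sym warped.g_pos)
  fix \<beta> and u v :: "real \<times> 'e1 \<times> 'e2" assume "\<beta> \<in> charts WP" and \<xi>: "\<xi> \<in> overlap WP \<alpha> \<beta>"
  then obtain i' j' k' where i': "\<beta> = (i', j', k')" "i' \<in> charts B" "j' \<in> charts N1" "k' \<in> charts N2"
    by (auto simp: WP_simps)
  obtain t x y where txy: "\<xi> = (t, x, y)" by (cases \<xi>)
  then have o: "t \<in> overlap B i i'" "x \<in> overlap N1 j j'" "y \<in> overlap N2 k k'"
    using \<xi> by (auto simp: i i' WP_overlap)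
  obtain u0 u1 u2 v0 v1 v2 where uv: "u = (u0, u1, u2)" "v = (v0, v1, v2)" by (cases u, cases v) auto
  have "l1 (chart_par B i' (transition B i i' t)) = l1 (chart_par B i t)"
    "l2 (chart_par B i' (transition B i i' t)) = l2 (chart_par B i t)"
    by (simp_all add: overlap_transition(2)[OF B i(2) i'(2) o(1)])
  moreover have "chart_metric B i t u0 v0 = chart_metric B i' (transition B i i' t)
      (frechet_derivative (transition B i i') (at t) u0) (frechet_derivative (transition B i i') (at t) v0)"
    "chart_metric N1 j x u1 v1 = chart_metric N1 j' (transition N1 j j' x)
      (frechet_derivative (transition N1 j j') (at x) u1) (frechet_derivative (transition N1 j j') (at x) v1)"
    "chart_metric N2 k y u2 v2 = chart_metric N2 k' (transition N2 k k' y)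
      (frechet_derivative (transition N2 k k') (at y) u2) (frechet_derivative (transition N2 k k') (at y) v2)"
    using riem_B riem_N1 riem_N2 i i' o by (auto simp: riemannian_manifold_def riemannian_metric_def)
  ultimately show "chart_metric WP \<alpha> \<xi> u v = chart_metric WP \<beta> (transition WP \<alpha> \<beta> \<xi>)
      (frechet_derivative (transition WP \<alpha> \<beta>) (at \<xi>) u) (frechet_derivative (transition WP \<alpha> \<beta>) (at \<xi>) v)"
    unfolding i(1) i'(1) txy WP_transition[OF i'(2-4) o] WP_transition_smooth(2)[OF i(2-4) i'(2-4) o] uv
    by (simp add: warped_product_def)
qed

text \<open>Tension is computed in charts, where the base coordinate is t and the warps are their
  lifts. Only the warps and the whole map have to descend along \<pi>, not the phases.\<close>

lemma reconstruction_harmonic: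
  fixes f1 :: "'m1 \<Rightarrow> complex ^ 'n1" and f2 :: "'m2 \<Rightarrow> complex ^ 'n2"
  assumes eig: "eigenmap N1 f1 d1" "eigenmap N2 f2 d2"
    and rec: "reconstruction DIM('e1) d1 DIM('e2) d2 c \<epsilon> \<sigma> a p q s1 s2"
    and s: "smooth_on UNIV s1" "smooth_on UNIV s2"
    and G: "\<And>t x y. G (\<pi> t, x, y) = reconstructed_map a s1 s2 f1 f2 (t, x, y)"
  shows "harmonic_sphere_map WP G"
proof -
  have a: "smooth_on UNIV a" "\<And>t. 0 < a t" "\<And>t. a t < 1"
    using rec by (auto simp: reconstruction_def admissible_magnitude_def)
  have a_sq: "(a t)\<^sup>2 < 1" for t using a(2,3)[of t] by (simp add: power_less_one_iff)
  have b: "smooth_on UNIV (mag_b a)" "\<And>t. (a t)\<^sup>2 + (mag_b a t)\<^sup>2 = 1"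
    using a_sq by (auto simp: mag_b_def[abs_def] less_imp_le intro!: smooth_intros a)
  obtain \<nu> where \<nu>: "spiral_eigen (\<lambda>t. real DIM('e1) * deriv p t / p t + real DIM('e2) * deriv q t / q t) (\<lambda>t. d1 / (p t)\<^sup>2) \<nu> a s1"
    "spiral_eigen (\<lambda>t. real DIM('e1) * deriv p t / p t + real DIM('e2) * deriv q t / q t) (\<lambda>t. d2 / (q t)\<^sup>2) \<nu> (mag_b a) s2"
    using reconstruction_spirals[OF rec warps(1,2)] by blast
  have chart: "smooth_on (chart_dom WP \<alpha>) (G \<circ> chart_par WP \<alpha>)
      \<and> (\<forall>\<xi>\<in>chart_dom WP \<alpha>. norm (G (chart_par WP \<alpha> \<xi>)) = 1 \<and> tension (chart_metric WP \<alpha>) (G \<circ> chart_par WP \<alpha>) \<xi> = 0)"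
    if \<alpha>: "\<alpha> \<in> charts WP" for \<alpha>
  proof -
    obtain i j k where i: "\<alpha> = (i, j, k)" "i \<in> charts B" "j \<in> charts N1" "k \<in> charts N2"
      using \<alpha> by (auto simp: WP_simps)
    interpret warped_coords "chart_dom N1 j" "chart_metric N1 j" "chart_dom N2 k" "chart_metric N2 k" "chart_dom B i" p q
      by (rule chart_coords[OF i(2-4)])
    let ?F1 = "f1 \<circ> chart_par N1 j" and ?F2 = "f2 \<circ> chart_par N2 k"
    have top: "chart_par N1 j x \<in> topspace (manifold_top N1)" if "x \<in> chart_dom N1 j" for x
      using openin_subset[OF smooth_manifoldD(2)[OF N1 i(3)]] that by (auto simp: chart_range_def)
    have top2: "chart_par N2 k x \<in> topspace (manifold_top N2)" if "x \<in> chart_dom N2 k" for x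
      using openin_subset[OF smooth_manifoldD(2)[OF N2 i(4)]] that by (auto simp: chart_range_def)
    have F: "smooth_on (chart_dom N1 j) ?F1" "smooth_on (chart_dom N2 k) ?F2"
      "\<And>x. x \<in> chart_dom N1 j \<Longrightarrow> laplacian (chart_metric N1 j) ?F1 x = - d1 *\<^sub>R ?F1 x"
      "\<And>x. x \<in> chart_dom N2 k \<Longrightarrow> laplacian (chart_metric N2 k) ?F2 x = - d2 *\<^sub>R ?F2 x"
      "\<And>x. x \<in> chart_dom N1 j \<Longrightarrow> norm (?F1 x) = 1" "\<And>x. x \<in> chart_dom N2 k \<Longrightarrow> norm (?F2 x) = 1"
      using eig i(3,4) top top2 by (auto simp: eigenmap_def smooth_sphere_map_def smooth_map_def)
    have G_eq: "(G \<circ> chart_par WP \<alpha>) (t, x, y) = ((complex_of_real (a t) * exp (\<i> * complex_of_real (s1 t))) *s ?F1 x,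
      (complex_of_real (mag_b a t) * exp (\<i> * complex_of_real (s2 t))) *s ?F2 y)" for t x y
      by (simp add: i(1) WP_simps B_par G reconstructed_map_def)
    note sub = smooth_on_subset[OF _ subset_UNIV]
    note H = spirals_harmonic[OF _ F sub[OF a(1)] sub[OF b(1)] b(2) sub[OF s(1)] sub[OF s(2)]
        \<nu>[folded mean_rate_def[abs_def]] G_eq]
    have dom: "chart_dom WP \<alpha> = W" "chart_metric WP \<alpha> = gw"
      using chart_metric_eq[OF i(2-4)] by (simp_all add: i(1))
    show ?thesis
    \<comment> \<open>\<open>H\<close> starts from a point of \<open>W\<close> even for smoothness,
      so an empty chart domain is treated apart.\<close>
    proof (cases "W = {}")
      case True
      then show ?thesis using smooth_on_local[of "{}"] by (simp add: dom)
    next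
      case False
      then show ?thesis using H unfolding dom by (auto simp: comp_def)
    qed
  qed
  have "norm (G z) = 1" if z: "z \<in> topspace (manifold_top WP)" for z
  proof -
    have "z \<in> (\<Union>i\<in>charts WP. chart_range WP i)"
      using z WP_smooth_manifold by (simp add: smooth_manifold_def)
    then show ?thesis using chart by (auto simp: chart_range_def)
  qed
  then show ?thesis
    using chart WP_riemannian
    by (simp add: harmonic_sphere_map_def smooth_sphere_map_def smooth_map_def)
qed

end

section \<open>The line and the circles as bases\<close>

lemma second_countable_euclidean: "second_countable (euclidean :: 'a::second_countable_topology topology)"
proof -
  obtain D :: "'a set set" where "countable D" "topological_basis D" using ex_countable_basis by auto
  then show ?thesis
    unfolding second_countable_def open_openin[symmetric]
    by (intro exI[of _ D]) (metis topological_basis_open topological_basisE)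
qed

lemma line_riemannian: "riemannian_manifold line"
proof -
  have id: "transition line i j = (\<lambda>x. x)" for i j
    by (auto simp: transition_def[abs_def] line_def fun_eq_iff intro!: the_inv_into_f_eq)
  have "Hausdorff_space (euclidean :: real topology)" by simp
  moreover have "homeomorphic_map euclidean euclidean (\<lambda>t::real. t)"
    using homeomorphic_map_id[of euclidean euclidean] by (simp add: id_def)
  ultimately show ?thesis
    unfolding riemannian_manifold_def smooth_manifold_def riemannian_metric_def id
    by (auto simp: line_def chart_range_def overlap_def bilinear_def second_countable_euclidean algebra_simps
        zero_less_mult_iff frechet_derivative_at[OF has_derivative_ident, symmetric]
        intro!: smooth_intros linearI)
qed

locale circle_length =
  fixes \<tau> :: real
  assumes \<tau>: "\<tau> > 0"
begin

lemma coset_eq: "coset \<tau> s = coset \<tau> t \<longleftrightarrow> (\<exists>j::int. s = t + of_int j * \<tau>)"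
proof
  assume "coset \<tau> s = coset \<tau> t"
  moreover have "s \<in> coset \<tau> s" unfolding coset_def by (rule range_eqI[of _ _ 0]) simp
  ultimately show "\<exists>j::int. s = t + of_int j * \<tau>" by (auto simp: coset_def)
next
  assume "\<exists>j::int. s = t + of_int j * \<tau>"
  then obtain j :: int where j: "s = t + of_int j * \<tau>" by blast
  have sh: "s + of_int k * \<tau> = t + of_int (j + k) * \<tau>" "t + of_int k * \<tau> = s + of_int (k - j) * \<tau>" for k
    by (simp_all add: j algebra_simps)
  show "coset \<tau> s = coset \<tau> t"
    unfolding coset_def set_eq_iff image_iff by (metis sh UNIV_I)
qed

lemma coset_mem: "t \<in> coset \<tau> t"
  unfolding coset_def by (rule range_eqI[of _ _ 0]) simp

lemma topspace_circle: "topspace (circle_top \<tau>) = range (coset \<tau>)"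
proof
  show "topspace (circle_top \<tau>) \<subseteq> range (coset \<tau>)"
    using openin_topspace[of "circle_top \<tau>"] unfolding openin_circle_top by blast
  have "coset \<tau> -` range (coset \<tau>) = UNIV" by auto
  then have "openin (circle_top \<tau>) (range (coset \<tau>))" unfolding openin_circle_top by simp
  then show "range (coset \<tau>) \<subseteq> topspace (circle_top \<tau>)" by (rule openin_subset)
qed

lemma coset_continuous: "continuous_map euclidean (circle_top \<tau>) (coset \<tau>)"
  unfolding continuous_map by (auto simp: topspace_circle openin_circle_top vimage_def)

lemma coset_open: "open_map euclidean (circle_top \<tau>) (coset \<tau>)"
  unfolding open_map_def openin_circle_top
proof (intro allI impI conjI)
  fix V :: "real set" assume "openin euclidean V"
  then have V: "open V" by simp
  have "coset \<tau> -` coset \<tau> ` V = (\<Union>j::int. (\<lambda>t. t + of_int j * \<tau>) ` V)"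
    by (rule set_eqI) (unfold vimage_eq image_iff coset_eq UN_iff, blast)
  moreover have "open ((\<lambda>t. t + of_int j * \<tau>) ` V)" for j :: int
    using open_translation[OF V, of "of_int j * \<tau>"] by (simp add: add.commute)
  ultimately show "open (coset \<tau> -` coset \<tau> ` V)" by auto
qed auto

lemma coset_inj: "inj_on (coset \<tau>) {r<..<r + \<tau>}"
proof (rule inj_onI)
  fix s t assume st: "s \<in> {r<..<r + \<tau>}" "t \<in> {r<..<r + \<tau>}" "coset \<tau> s = coset \<tau> t"
  then obtain j :: int where j: "s = t + of_int j * \<tau>" by (auto simp: coset_eq)
  then have "\<bar>of_int j * \<tau>\<bar> < \<tau>" using st(1,2) by auto
  then have "\<bar>of_int j :: real\<bar> < 1" using \<tau> by (simp add: abs_mult)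
  then have "j = 0" by linarith
  then show "s = t" using j by simp
qed

text \<open>The exponential of 2 pi i t / \<tau> descends to an injective continuous map into the
  complex plane, whose separation property pulls back. Any representative of a coset gives the same
  value, so an arbitrary one is used.\<close>

lemma Hausdorff_circle: "Hausdorff_space (circle_top \<tau>)"
proof -
  define \<phi> where "\<phi> A = cis (2 * pi * (SOME t. t \<in> A) / \<tau>)" for A
  have \<phi>: "\<phi> (coset \<tau> t) = cis (2 * pi * t / \<tau>)" for t
  proof -
    have "(SOME s. s \<in> coset \<tau> t) \<in> coset \<tau> t" using coset_mem by (rule someI)
    then obtain j :: int where "(SOME s. s \<in> coset \<tau> t) = t + of_int j * \<tau>" by (auto simp: coset_def)
    then have "2 * pi * (SOME s. s \<in> coset \<tau> t) / \<tau> = 2 * pi * t / \<tau> + 2 * pi * of_int j"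
      using \<tau> by (simp add: field_simps)
    then show ?thesis by (simp add: \<phi>_def cis_mult[symmetric] cis_multiple_2pi)
  qed
  have "continuous_map (circle_top \<tau>) euclidean \<phi>"
    unfolding continuous_map
  proof (intro conjI allI impI)
    fix U :: "complex set" assume "openin euclidean U"
    then have "open ((\<lambda>t. cis (2 * pi * t / \<tau>)) -` U)"
      by (intro open_vimage continuous_intros) (use \<tau> in auto)
    moreover have "coset \<tau> -` {x \<in> topspace (circle_top \<tau>). \<phi> x \<in> U} = (\<lambda>t. cis (2 * pi * t / \<tau>)) -` U"
      by (auto simp: topspace_circle \<phi>)
    ultimately show "openin (circle_top \<tau>) {x \<in> topspace (circle_top \<tau>). \<phi> x \<in> U}"
      unfolding openin_circle_top topspace_circle by auto
  qed auto
  moreover have "inj_on \<phi> (topspace (circle_top \<tau>))"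
  proof (rule inj_onI)
    fix A B assume "A \<in> topspace (circle_top \<tau>)" "B \<in> topspace (circle_top \<tau>)" and eq: "\<phi> A = \<phi> B"
    then obtain s t where st: "A = coset \<tau> s" "B = coset \<tau> t" by (auto simp: topspace_circle)
    then have "exp (\<i> * of_real (2 * pi * s / \<tau>)) = exp (\<i> * of_real (2 * pi * t / \<tau>))"
      using eq by (simp add: \<phi> cis_conv_exp)
    then obtain n :: int where "\<i> * of_real (2 * pi * s / \<tau>) = \<i> * of_real (2 * pi * t / \<tau>) + of_int (2 * n) * (of_real pi * \<i>)"
      unfolding exp_eq by (auto simp: mult.assoc)
    then have "2 * pi * s / \<tau> = 2 * pi * t / \<tau> + of_int (2 * n) * pi"
      by (simp add: complex_eq_iff)
    then have "2 * pi * s = 2 * pi * (t + of_int n * \<tau>)" using \<tau> by (simp add: field_simps)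
    then have "s = t + of_int n * \<tau>" by simp
    then show "A = B" unfolding st coset_eq by blast
  qed
  ultimately show ?thesis
    by (rule Hausdorff_space_injective_preimage[OF Hausdorff_space_euclidean])
qed

lemma second_countable_circle: "second_countable (circle_top \<tau>)"
  by (rule second_countable_open_map_image[OF coset_continuous coset_open _ second_countable_euclidean])
    (simp add: topspace_circle)

lemma compact_circle: "compact_space (circle_top \<tau>)"
proof -
  have "coset \<tau> ` {0..\<tau>} = range (coset \<tau>)"
  proof (intro equalityI subsetI)
    fix A assume "A \<in> range (coset \<tau>)"
    then obtain t where t: "A = coset \<tau> t" by auto
    define j where "j = \<lfloor>t / \<tau>\<rfloor>"
    have "of_int j \<le> t / \<tau>" "t / \<tau> < of_int j + 1" unfolding j_def by linarith+
    then have "t - of_int j * \<tau> \<in> {0..\<tau>}" using \<tau> by (simp add: field_simps)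
    moreover have "A = coset \<tau> (t - of_int j * \<tau>)"
      unfolding t coset_eq by (rule exI[of _ j]) simp
    ultimately show "A \<in> coset \<tau> ` {0..\<tau>}" by blast
  qed auto
  moreover have "compactin (circle_top \<tau>) (coset \<tau> ` {0..\<tau>})"
    by (rule image_compactin[OF _ coset_continuous]) simp
  ultimately show ?thesis by (simp add: compact_space_def topspace_circle)
qed

lemma circle_simps:
  "manifold_top (circle \<tau>) = circle_top \<tau>" "charts (circle \<tau>) = UNIV"
  "chart_dom (circle \<tau>) r = {r<..<r + \<tau>}" "chart_par (circle \<tau>) = (\<lambda>_. coset \<tau>)"
  "chart_metric (circle \<tau>) = (\<lambda>_ _ u v. u * v)"
  by (simp_all add: circle_def)

text \<open>A translation only locally: the overlap of two charts can have two components with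
  different shifts.\<close>

lemma circle_transition:
  assumes "x \<in> overlap (circle \<tau>) r s"
  obtains V b where "open V" "x \<in> V" "\<And>y. y \<in> V \<Longrightarrow> transition (circle \<tau>) r s y = y + b"
proof -
  obtain z where z: "z \<in> {s<..<s + \<tau>}" "coset \<tau> x = coset \<tau> z"
    using assms by (auto simp: overlap_def chart_range_def circle_simps)
  then obtain j :: int where "z = x + of_int j * \<tau>" using coset_eq[of z x] by auto
  moreover have "transition (circle \<tau>) r s y = y + of_int j * \<tau>" if "y + of_int j * \<tau> \<in> {s<..<s + \<tau>}" for y
    unfolding transition_def circle_simps
    by (rule the_inv_into_f_eq[OF coset_inj _ that]) (auto simp: coset_eq)
  ultimately show ?thesis
    using z(1) by (intro that[of "(\<lambda>y. y + of_int j * \<tau>) -` {s<..<s + \<tau>}"] open_vimage continuous_intros) auto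
qed

lemma circle_riemannian: "riemannian_manifold (circle \<tau>)"
proof -
  have smooth: "smooth_on (overlap (circle \<tau>) r s) (transition (circle \<tau>) r s)" for r s
  proof (rule smooth_on_local)
    fix x assume "x \<in> overlap (circle \<tau>) r s"
    then obtain V b where V: "open V" "x \<in> V" "\<And>y. y \<in> V \<Longrightarrow> transition (circle \<tau>) r s y = y + b"
      by (rule circle_transition) blast
    then show "\<exists>V. open V \<and> x \<in> V \<and> smooth_on V (transition (circle \<tau>) r s)"
      by (intro exI[of _ V] conjI smooth_on_cong[OF V(1) _ smooth_on_add[OF V(1) smooth_on_id[OF V(1)] smooth_on_const[of V b]]]) auto
  qed
  have deriv: "frechet_derivative (transition (circle \<tau>) r s) (at x) = (\<lambda>v. v)" if x: "x \<in> overlap (circle \<tau>) r s" for r s x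
  proof -
    obtain V b where V: "open V" "x \<in> V" "\<And>y. y \<in> V \<Longrightarrow> transition (circle \<tau>) r s y = y + b"
      by (rule circle_transition[OF x]) blast
    have "((\<lambda>y. y + b) has_derivative (\<lambda>v. v)) (at x)" by (auto intro!: derivative_eq_intros)
    from has_derivative_transform_within_open[OF this V(1,2)] V(3) show ?thesis
      by (intro frechet_derivative_at[symmetric]) simp
  qed
  have range_open: "openin (circle_top \<tau>) (coset \<tau> ` {r<..<r + \<tau>})" for r
    using coset_open by (simp add: open_map_def)
  have hom: "homeomorphic_map (top_of_set {r<..<r + \<tau>}) (subtopology (circle_top \<tau>) (coset \<tau> ` {r<..<r + \<tau>})) (coset \<tau>)" for r
  proof (rule bijective_open_imp_homeomorphic_map)
    show "continuous_map (top_of_set {r<..<r + \<tau>}) (subtopology (circle_top \<tau>) (coset \<tau> ` {r<..<r + \<tau>})) (coset \<tau>)"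
      using continuous_map_from_subtopology[OF coset_continuous] by (auto simp: continuous_map_in_subtopology)
    show "open_map (top_of_set {r<..<r + \<tau>}) (subtopology (circle_top \<tau>) (coset \<tau> ` {r<..<r + \<tau>})) (coset \<tau>)"
      unfolding open_map_def
    proof (intro allI impI)
      fix V assume "openin (top_of_set {r<..<r + \<tau>}) V"
      then have "open V" "V \<subseteq> {r<..<r + \<tau>}" by (auto simp: openin_open_eq)
      then show "openin (subtopology (circle_top \<tau>) (coset \<tau> ` {r<..<r + \<tau>})) (coset \<tau> ` V)"
        using coset_open by (auto simp: openin_open_subtopology[OF range_open] open_map_def)
    qed
    show "coset \<tau> ` topspace (top_of_set {r<..<r + \<tau>}) = topspace (subtopology (circle_top \<tau>) (coset \<tau> ` {r<..<r + \<tau>}))"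
      using openin_subset[OF range_open] by auto
  qed (simp add: coset_inj)
  have cover: "(\<Union>r. coset \<tau> ` {r<..<r + \<tau>}) = range (coset \<tau>)"
  proof (intro equalityI subsetI)
    fix A assume "A \<in> range (coset \<tau>)"
    then obtain t where "A = coset \<tau> t" by auto
    moreover have "t \<in> {t - \<tau> / 2<..<t - \<tau> / 2 + \<tau>}" using \<tau> by auto
    ultimately show "A \<in> (\<Union>r. coset \<tau> ` {r<..<r + \<tau>})" by blast
  qed auto
  have "smooth_manifold (circle \<tau>)"
    unfolding smooth_manifold_def
    using smooth Hausdorff_circle second_countable_circle cover range_open hom
    by (simp add: circle_simps chart_range_def topspace_circle)
  moreover have "riemannian_metric (circle \<tau>)"
    unfolding riemannian_metric_def
    by (auto simp: circle_simps deriv bilinear_def algebra_simps zero_less_mult_iff intro!: smooth_on_const linearI)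
  ultimately show ?thesis by (simp add: riemannian_manifold_def)
qed

end

section \<open>Rational returns\<close>

lemma dense_preimage:
  fixes f :: "'a::euclidean_space \<Rightarrow> 'b::euclidean_space"
  assumes U: "open U" and R: "closure R = UNIV"
    and f: "\<And>p. p \<in> U \<Longrightarrow> \<exists>D. (f has_derivative D) (at p) \<and> surj D"
  shows "U \<subseteq> closure {p \<in> U. f p \<in> R}"
proof
  fix p assume p: "p \<in> U"
  obtain D where D: "(f has_derivative D) (at p)" "surj D" using f[OF p] by blast
  obtain D' where D': "linear D'" "D \<circ> D' = id"
    using linear_surjective_right_inverse[OF has_derivative_linear[OF D(1)] D(2)] by blast
  have cont: "continuous_on U f"
  proof (rule continuous_at_imp_continuous_on, rule ballI)
    fix p assume "p \<in> U"
    then obtain D where "(f has_derivative D) (at p)" using f by blast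
    then show "isCont f p" by (rule has_derivative_continuous)
  qed
  show "p \<in> closure {p \<in> U. f p \<in> R}"
    unfolding closure_approachable
  proof (intro allI impI)
    fix e :: real assume e: "e > 0"
    have "p \<in> interior (U \<inter> ball p e)" using U p e by (simp add: interior_open open_Int)
    then have "f p \<in> interior (f ` (U \<inter> ball p e))"
      using sussmann_open_mapping[OF U cont p D(1) _ D'(2)] D'(1) by (simp add: linear_conv_bounded_linear)
    moreover have "f p \<in> closure R" using R by simp
    ultimately have "R \<inter> interior (f ` (U \<inter> ball p e)) \<noteq> {}"
      using open_Int_closure_eq_empty[OF open_interior] by blast
    then show "\<exists>y\<in>{p \<in> U. f p \<in> R}. dist y p < e"
      using interior_subset[of "f ` (U \<inter> ball p e)"] by (auto simp: dist_commute)
  qed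
qed

lemma closure_rational_angles: "closure ((\<lambda>r. 2 * pi * r) ` \<rat>) = UNIV"
proof -
  have "closure ((\<lambda>r. 2 * pi * r) ` \<rat>) = (\<lambda>r. 2 * pi * r) ` closure \<rat>"
    by (rule closure_injective_linear_image[symmetric]) (auto simp: inj_on_def linear_iff algebra_simps)
  also have "\<dots> = UNIV"
    unfolding Rats_closure_real surj_def by (metis mult.assoc mult_2 nonzero_mult_div_cancel_left pi_neq_zero times_divide_eq_right zero_neq_numeral mult_eq_0_iff)
  finally show ?thesis .
qed

lemma phase_advance:
  fixes s :: "real \<Rightarrow> real"
  assumes P: "P > 0" and s: "smooth_on UNIV s" and per: "periodic P (deriv s)"
  shows "s (t + real m * P) = s t + real m * phase_increment P s"
proof -
  note ds = smooth_on_UNIV_deriv(1)[OF s]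
  have step: "s (t + P) = s t + phase_increment P s" for t
  proof -
    have "((\<lambda>t. s (t + P) - s t) has_real_derivative deriv s (t + P) - deriv s t) (at t)" for t
      using DERIV_diff[OF DERIV_shift[THEN iffD1, OF ds[of "t + P"]] ds[of t]] by simp
    then have "((\<lambda>t. s (t + P) - s t) has_real_derivative 0) (at t)" for t
      using per by (simp add: periodic_def)
    then have "s (t + P) - s t = s (0 + P) - s 0"
      by (rule DERIV_isconst_all[of "\<lambda>t. s (t + P) - s t", rule_format])
    moreover have "(deriv s has_integral s P - s 0) {0..P}"
      using P ds by (intro fundamental_theorem_of_calculus)
        (auto simp: has_real_derivative_iff_has_vector_derivative intro: has_vector_derivative_at_within)
    ultimately show ?thesis by (simp add: phase_increment_def integral_unique)
  qed
  show ?thesis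
  proof (induction m)
    case (Suc m)
    have "s (t + real (Suc m) * P) = s ((t + real m * P) + P)" by (simp add: algebra_simps)
    also have "\<dots> = s (t + real m * P) + phase_increment P s" by (rule step)
    finally show ?case using Suc by (simp add: algebra_simps)
  qed simp
qed

text \<open>The product of the two denominators clears both fractions.\<close>

lemma rational_return_multiple:
  assumes "rational_return P s1 s2"
  obtains m :: nat and n1 n2 :: int where "m \<ge> 1"
    "real m * phase_increment P s1 = 2 * pi * of_int n1" "real m * phase_increment P s2 = 2 * pi * of_int n2"
proof -
  obtain r1 r2 where r: "phase_increment P s1 = 2 * pi * r1" "r1 \<in> \<rat>" "phase_increment P s2 = 2 * pi * r2" "r2 \<in> \<rat>"
    using assms by (auto simp: rational_return_def)
  obtain a1 b1 a2 b2 :: int where ab: "r1 = of_int a1 / of_int b1" "b1 > 0" "r2 = of_int a2 / of_int b2" "b2 > 0"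
    using r(2,4) by (metis Rats_cases')
  have "real (nat (b1 * b2)) = of_int b1 * of_int b2" using ab(2,4) by (simp add: of_nat_nat)
  moreover have "1 \<le> nat (b1 * b2)" using mult_pos_pos[OF ab(2,4)] by linarith
  ultimately show ?thesis
    using ab by (intro that[of "nat (b1 * b2)" "a1 * b2" "a2 * b1"]) (auto simp: r field_simps)
qed

lemma exp_phase_shift: "exp (\<i> * complex_of_real (s + 2 * pi * of_int n)) = exp (\<i> * complex_of_real s)"
  unfolding cis_conv_exp[symmetric] cis_mult[symmetric] by (simp add: cis_multiple_2pi)

text \<open>Over m periods the phases advance by multiples of 2 pi, so their exponentials, and with
  them the map, have period m P and descend to the circle, although the phases themselves need
  not.\<close>

lemma returning_member_closes:
  fixes N1 :: "('m1, 'i1, 'e1::euclidean_space) riemannian" and N2 :: "('m2, 'i2, 'e2::euclidean_space) riemannian"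
    and f1 :: "'m1 \<Rightarrow> complex ^ 'n1" and f2 :: "'m2 \<Rightarrow> complex ^ 'n2"
  assumes N: "riemannian_manifold N1" "riemannian_manifold N2" "closed_manifold N1" "closed_manifold N2"
    and eig: "eigenmap N1 f1 d1" "eigenmap N2 f2 d2"
    and rec: "periodic_reconstruction P DIM('e1) d1 DIM('e2) d2 c \<epsilon> \<sigma> a p q s1 s2"
    and P: "P > 0" and smooth: "smooth_on UNIV p" "smooth_on UNIV q" "smooth_on UNIV s1" "smooth_on UNIV s2"
    and per: "periodic P p" "periodic P q" "periodic P (deriv s1)" "periodic P (deriv s2)"
    and ret: "rational_return P s1 s2"
  shows "\<exists>(m::nat) (p' :: real set \<Rightarrow> real) (q' :: real set \<Rightarrow> real)
     (G :: real set \<times> 'm1 \<times> 'm2 \<Rightarrow> (complex ^ 'n1) \<times> (complex ^ 'n2)).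
     m \<ge> 1 \<and> (\<forall>t. p' (coset (real m * P) t) = p t) \<and> (\<forall>t. q' (coset (real m * P) t) = q t) \<and>
     (\<forall>t. \<forall>x\<in>topspace (manifold_top N1). \<forall>y\<in>topspace (manifold_top N2).
       G (coset (real m * P) t, x, y) = reconstructed_map a s1 s2 f1 f2 (t, x, y)) \<and>
     closed_manifold (warped_product (circle (real m * P)) p' N1 q' N2) \<and>
     harmonic_sphere_map (warped_product (circle (real m * P)) p' N1 q' N2) G"
proof -
  obtain m :: nat and n1 n2 :: int where m: "m \<ge> 1"
    and n: "real m * phase_increment P s1 = 2 * pi * of_int n1" "real m * phase_increment P s2 = 2 * pi * of_int n2"
    by (rule rational_return_multiple[OF ret]) blast
  define \<tau> where "\<tau> = real m * P"
  interpret circle_length \<tau> using P m by unfold_locales (simp add: \<tau>_def)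
  \<comment> \<open>An arbitrary representative of a coset; \<open>descend\<close> shows that
    periodic functions do not see the choice.\<close>
  define rep where "rep A = (SOME t. t \<in> A)" for A :: "real set"
  have descend: "f (rep (coset \<tau> t)) = f t" if "periodic \<tau> f" for f :: "real \<Rightarrow> 'z" and t
  proof -
    have "rep (coset \<tau> t) \<in> coset \<tau> t" unfolding rep_def using coset_mem by (rule someI)
    then show ?thesis using periodic_of_int[OF that] by (auto simp: coset_def)
  qed
  have mult: "periodic \<tau> f" if "periodic P f" for f :: "real \<Rightarrow> 'z"
    using periodic_of_int[OF that, of _ "int m"] by (simp add: periodic_def \<tau>_def)
  have "periodic P a" using rec by (simp add: periodic_reconstruction_def)
  then have a: "periodic \<tau> a" "periodic \<tau> (mag_b a)" using mult[of a] by (auto simp: periodic_def mag_b_def)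
  have e: "exp (\<i> * complex_of_real (s1 (t + \<tau>))) = exp (\<i> * complex_of_real (s1 t))"
    "exp (\<i> * complex_of_real (s2 (t + \<tau>))) = exp (\<i> * complex_of_real (s2 t))" for t
    unfolding \<tau>_def phase_advance[OF P smooth(3) per(3)] phase_advance[OF P smooth(4) per(4)] n
    by (rule exp_phase_shift)+
  have map_per: "periodic \<tau> (\<lambda>t. reconstructed_map a s1 s2 f1 f2 (t, x, y))" for x y
    using a by (simp add: periodic_def reconstructed_map_def e)
  define p' q' where "p' A = p (rep A)" and "q' A = q (rep A)" for A
  define G where "G = (\<lambda>(A, x, y). reconstructed_map a s1 s2 f1 f2 (rep A, x, y))"
  have lift: "p' (coset \<tau> t) = p t" "q' (coset \<tau> t) = q t" for t
    unfolding p'_def q'_def by (rule descend mult per)+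
  have G: "G (coset \<tau> t, x, y) = reconstructed_map a s1 s2 f1 f2 (t, x, y)" for t x y
    using descend[OF map_per] by (simp add: G_def)
  have rc: "reconstruction DIM('e1) d1 DIM('e2) d2 c \<epsilon> \<sigma> a p q s1 s2"
    using rec by (simp add: periodic_reconstruction_def)
  interpret flat_base "circle \<tau>" p' q' N1 N2 "coset \<tau>" p q
    using circle_riemannian N(1,2) smooth(1,2) rc lift
    by unfold_locales (auto simp: riemannian_manifold_def circle_simps reconstruction_def source_warps_def)
  have "closed_manifold WP"
    using N(3,4) compact_circle by (intro WP_closed) (simp_all add: circle_simps closed_manifold_def)
  moreover have "harmonic_sphere_map WP G"
    by (rule reconstruction_harmonic[OF eig rc smooth(3,4) G])
  ultimately show ?thesis
    using m lift G unfolding \<tau>_def by blast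
qed

lemma reconstruction_harmonic_line:
  fixes N1 :: "('m1, 'i1, 'e1::euclidean_space) riemannian" and N2 :: "('m2, 'i2, 'e2::euclidean_space) riemannian"
    and f1 :: "'m1 \<Rightarrow> complex ^ 'n1" and f2 :: "'m2 \<Rightarrow> complex ^ 'n2"
  assumes "riemannian_manifold N1" "riemannian_manifold N2" "eigenmap N1 f1 d1" "eigenmap N2 f2 d2"
    and rec: "reconstruction DIM('e1) d1 DIM('e2) d2 c \<epsilon> \<sigma> a p q s1 s2"
    and "smooth_on UNIV p" "smooth_on UNIV q" "smooth_on UNIV s1" "smooth_on UNIV s2"
  shows "harmonic_sphere_map (warped_product line p N1 q N2) (reconstructed_map a s1 s2 f1 f2)"
proof -
  interpret flat_base line p q N1 N2 "\<lambda>t. t" p q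
    using assms line_riemannian
    by unfold_locales (auto simp: riemannian_manifold_def line_def reconstruction_def source_warps_def)
  show ?thesis by (rule reconstruction_harmonic) (use assms in auto)
qed

text \<open>\<open>U\<close> is given explicitly so that membership of a point of the sequence
  becomes a condition on \<open>cis (S / \<delta>)\<close> and the size of \<delta>. One such set
  contains all windows between resonances below \<delta>3.\<close>

lemma reconstruction_family:
  fixes k1 k :: nat and d1 d2 P \<sigma> c0 :: real and L :: "real \<Rightarrow> real"
  assumes "slow_manifold k d2 P L" and \<sigma>: "\<sigma> \<in> {-1, 1}"
  defines "S \<equiv> integral {0..P} (\<lambda>t. sqrt (q0 k1 k d2 L t))"
  obtains \<delta>3 and U :: "(real \<times> real) set" and a l2 s1 s2 :: "real \<times> real \<Rightarrow> real \<Rightarrow> real"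
  where "\<delta>3 > 0" "open U"
    "U = {(\<delta>, c). 0 < \<delta> \<and> \<delta> < \<delta>3 \<and> c0 - 1/2 < c \<and> c < c0 + 1/2 \<and> norm (cis (S / \<delta>) - 1) > 1}"
    "smooth_on (U \<times> UNIV) (\<lambda>(p, t). a p t)" "smooth_on (U \<times> UNIV) (\<lambda>(p, t). l2 p t)"
    "smooth_on (U \<times> UNIV) (\<lambda>(p, t). s1 p t)" "smooth_on (U \<times> UNIV) (\<lambda>(p, t). s2 p t)"
    "\<And>\<delta> c. (\<delta>, c) \<in> U \<Longrightarrow> periodic_reconstruction P k1 d1 k d2 c (\<delta> ^ (2 * (k + 1))) \<sigma>
      (a (\<delta>, c)) L (l2 (\<delta>, c)) (s1 (\<delta>, c)) (s2 (\<delta>, c))"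
    "\<And>p. p \<in> U \<Longrightarrow> periodic P (l2 p)" "\<And>p. p \<in> U \<Longrightarrow> periodic P (deriv (s1 p))"
    "\<And>p. p \<in> U \<Longrightarrow> periodic P (deriv (s2 p))"
    "\<And>\<delta>. (\<delta>, 0) \<in> U \<Longrightarrow> phase_increment P (s2 (\<delta>, 0)) = 0"
    "\<And>p. p \<in> U \<Longrightarrow> \<exists>A11 A12 A21 A22. A11 \<noteq> 0 \<and> A11 * A22 - A12 * A21 \<noteq> 0 \<and>
      ((\<lambda>p. (phase_increment P (s1 p), phase_increment P (s2 p))) has_derivative
        (\<lambda>h. (A11 * fst h + A12 * snd h, A21 * fst h + A22 * snd h))) (at p)"
proof -
  interpret slow_manifold k1 k d1 d2 P L by fact
  obtain h t1 t2 where ex: "smooth_on D h" "smooth_on D t1" "smooth_on D t2"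
    "\<And>\<mu> c t \<xi> b. (\<mu>, c, t, \<xi>, b) \<in> D \<Longrightarrow> G1 (\<mu>, c, t, \<xi>, b) + \<mu> * KK (\<mu>, c, t, \<xi>, b) =
      \<mu> * (\<beta> t * \<xi> + (e t - 2 * c\<^sup>2) / x0 t ^ k) + \<mu>\<^sup>2 * h (\<mu>, c, t, \<xi>, b)"
    "\<And>\<mu> c t \<xi> b. (\<mu>, c, t, \<xi>, b) \<in> D \<Longrightarrow> h (\<mu>, c, t + P, \<xi>, b) = h (\<mu>, c, t, \<xi>, b)"
    "\<And>\<mu> c t \<xi> b. (\<mu>, c, t, \<xi>, b) \<in> D \<Longrightarrow> S1 (\<mu>, c, t, \<xi>, b) = sqrt (x0 t ^ k) + \<mu> * t1 (\<mu>, c, t, \<xi>, b)"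
    "\<And>\<mu> c t \<xi> b. (\<mu>, c, t, \<xi>, b) \<in> D \<Longrightarrow> S2 (\<mu>, c, t, \<xi>, b) = 1 / sqrt (x0 t ^ k) + \<mu> * t2 (\<mu>, c, t, \<xi>, b)"
    by (rule expansion) blast
  obtain \<delta>1 where box: "\<delta>1 > 0"
    "\<And>\<delta> c t w. \<bar>\<delta>\<bar> < \<delta>1 \<Longrightarrow> c0 - 1 \<le> c \<Longrightarrow> c \<le> c0 + 1 \<Longrightarrow> norm w \<le> 2 \<Longrightarrow> pt (((\<delta>, c), t), w) \<in> D"
    by (rule box_exists) blast
  interpret slow_expansion k1 k d1 d2 P L h c0 \<delta>1
    by (unfold_locales; (fact ex box)?)
  obtain \<delta>2 M u where u: "0 < \<delta>2" "\<delta>2 \<le> \<delta>1/2" "\<delta>2 \<le> 1" "M > 0"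
    "\<And>p. p \<in> osc.dom \<delta>2 \<Longrightarrow> periodic P (u p)"
    "\<And>\<delta> c t. (\<delta>, c) \<in> osc.dom \<delta>2 \<Longrightarrow> norm (u (\<delta>, c) t) \<le> M * \<delta>"
    "\<And>p t. p \<in> osc.dom \<delta>2 \<Longrightarrow> norm (u p t) < 1"
    "\<And>p t. p \<in> osc.dom \<delta>2 \<Longrightarrow> (u p has_vector_derivative osc.rhs ((p, t), u p t)) (at t)"
    "smooth_on (osc.dom \<delta>2 \<times> UNIV) (\<lambda>(p, t). u p t)"
    "\<And>\<delta> c t. (\<delta>, c) \<in> osc.dom \<delta>2 \<Longrightarrow>
      norm (frechet_derivative (\<lambda>(p, t). u p t) (at ((\<delta>, c), t)) ((1, 0), 0)) \<le> M / \<delta>"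
    "\<And>\<delta> c t. (\<delta>, c) \<in> osc.dom \<delta>2 \<Longrightarrow>
      norm (frechet_derivative (\<lambda>(p, t). u p t) (at ((\<delta>, c), t)) ((0, 1), 0)) \<le> M * \<delta>"
    by (rule osc.oscillator_family) blast
  interpret slow_family k1 k d1 d2 P L h c0 \<delta>1 t1 t2 \<sigma> \<delta>2 M u
    by unfold_locales (fact ex u \<sigma>)+
  obtain \<delta>3 where \<delta>3: "0 < \<delta>3" "\<delta>3 \<le> \<delta>2"
    "\<And>\<delta> c. (\<delta>, c) \<in> osc.dom \<delta>3 \<Longrightarrow> \<exists>A11 A12 A21 A22. A11 \<noteq> 0 \<and> A11 * A22 - A12 * A21 \<noteq> 0 \<and>
      ((\<lambda>p. (phase_increment P (s1 p), phase_increment P (s2 p))) has_derivative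
        (\<lambda>h. (A11 * fst h + A12 * snd h, A21 * fst h + A22 * snd h))) (at (\<delta>, c))"
    by (rule nondegenerate) blast
  have sub: "osc.dom \<delta>3 \<subseteq> dm" using \<delta>3(2) by (auto simp: osc.dom_def)
  then have subR: "osc.dom \<delta>3 \<times> (UNIV :: real set) \<subseteq> dm \<times> UNIV" by auto
  have S: "S = integral {0..P} \<omega>" unfolding S_def \<omega>_eq_q0[symmetric] ..
  have ders: "deriv (s1 p) = r1 p" "deriv (s2 p) = r2 p" if "p \<in> dm" for p
    using s_derivative[OF that] DERIV_imp_deriv by blast+
  show thesis
  proof (rule that[OF \<delta>3(1) osc.open_dom[of \<delta>3], of aa ll s1 s2])
    show "osc.dom \<delta>3 = {(\<delta>, c). 0 < \<delta> \<and> \<delta> < \<delta>3 \<and> c0 - 1/2 < c \<and> c < c0 + 1/2 \<and> norm (cis (S / \<delta>) - 1) > 1}"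
      by (simp add: osc.dom_def S)
    show "smooth_on (osc.dom \<delta>3 \<times> UNIV) (\<lambda>(p, t). aa p t)" "smooth_on (osc.dom \<delta>3 \<times> UNIV) (\<lambda>(p, t). ll p t)"
      "smooth_on (osc.dom \<delta>3 \<times> UNIV) (\<lambda>(p, t). s1 p t)" "smooth_on (osc.dom \<delta>3 \<times> UNIV) (\<lambda>(p, t). s2 p t)"
      by (rule smooth_on_subset[OF _ subR], rule aa_smooth ll_smooth s_smooth)+
    show "periodic_reconstruction P k1 d1 k d2 c (\<delta> ^ (2 * (k + 1))) \<sigma>
      (aa (\<delta>, c)) L (ll (\<delta>, c)) (s1 (\<delta>, c)) (s2 (\<delta>, c))" if "(\<delta>, c) \<in> osc.dom \<delta>3" for \<delta> c
      using is_reconstruction that sub by blast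
    fix p assume p: "p \<in> osc.dom \<delta>3"
    then have pd: "p \<in> dm" using sub by blast
    show "periodic P (ll p)" "periodic P (deriv (s1 p))" "periodic P (deriv (s2 p))"
      unfolding ders[OF pd] by (rule all_periodic[OF pd])+
    show "\<exists>A11 A12 A21 A22. A11 \<noteq> 0 \<and> A11 * A22 - A12 * A21 \<noteq> 0 \<and>
      ((\<lambda>p. (phase_increment P (s1 p), phase_increment P (s2 p))) has_derivative
        (\<lambda>h. (A11 * fst h + A12 * snd h, A21 * fst h + A22 * snd h))) (at p)"
      using \<delta>3(3)[of "fst p" "snd p"] p by simp
  next
    fix \<delta> assume "(\<delta>, 0) \<in> osc.dom \<delta>3"
    then show "phase_increment P (s2 (\<delta>, 0)) = 0"
      using phase_increments(2)[of \<delta> 0] sub by auto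
  qed
qed

lemma delta_seq_properties:
  assumes "slow_manifold k d2 P L"
  shows "decseq (delta_seq P k1 k d2 L)" "delta_seq P k1 k d2 L n > 0" "delta_seq P k1 k d2 L \<longlonglongrightarrow> 0"
    "integral {0..P} (\<lambda>t. sqrt (q0 k1 k d2 L t)) / delta_seq P k1 k d2 L n = 2 * pi * of_int (int n) + pi"
proof -
  \<comment> \<open>\<open>0\<close> is a placeholder for \<open>d1\<close>: the frequency is
    determined by the dimensions, \<open>d2\<close> and \<open>L\<close>.\<close>
  interpret slow_manifold k1 k 0 d2 P L by fact
  define S where "S = integral {0..P} (\<lambda>t. sqrt (q0 k1 k d2 L t))"
  have S: "S > 0"
    unfolding S_def \<omega>_eq_q0[symmetric]
    by (rule integral_pos[OF P smooth_on_continuous[OF \<omega>_smooth] \<omega>_pos])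
  have eq: "delta_seq P k1 k d2 L = (\<lambda>n. S / (2 * pi * (real n + 1 / 2)))"
    by (rule ext) (simp add: delta_seq_def S_def)
  show "decseq (delta_seq P k1 k d2 L)"
    unfolding eq decseq_def using S by (auto intro!: divide_left_mono mult_left_mono mult_pos_pos)
  show "delta_seq P k1 k d2 L n > 0" unfolding eq using S by (auto intro!: divide_pos_pos mult_pos_pos)
  show "delta_seq P k1 k d2 L \<longlonglongrightarrow> 0"
    unfolding eq
  proof (rule tendsto_divide_0[OF tendsto_const filterlim_at_top_imp_at_infinity])
    show "LIM n sequentially. 2 * pi * (real n + 1 / 2) :> at_top"
      by (intro filterlim_tendsto_pos_mult_at_top[OF tendsto_const] filterlim_at_top_mono[OF filterlim_real_sequentially])
        auto
  qed
  show "integral {0..P} (\<lambda>t. sqrt (q0 k1 k d2 L t)) / delta_seq P k1 k d2 L n = 2 * pi * of_int (int n) + pi"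
    unfolding eq S_def[symmetric] using S by (simp add: field_simps)
qed

theorem theorem5p2:
  fixes N1 :: "('m1, 'i1, 'e1::euclidean_space) riemannian"
    and N2 :: "('m2, 'i2, 'e2::euclidean_space) riemannian"
    and f1 :: "'m1 \<Rightarrow> complex ^ 'n1"
    and f2 :: "'m2 \<Rightarrow> complex ^ 'n2"
    and d1 d2 P \<sigma> :: real
    and L :: "real \<Rightarrow> real"
  assumes "riemannian_manifold N1" and "riemannian_manifold N2"
    and "eigenmap N1 f1 d1" and "eigenmap N2 f2 d2"
    and "\<sigma> \<in> {-1, 1}"
    and "P > 0" and "smooth_on UNIV L" and "\<forall>t. L t > 0" and "periodic P L"
  shows "decseq (delta_seq P DIM('e1) DIM('e2) d2 L) \<and>
    (\<forall>n. delta_seq P DIM('e1) DIM('e2) d2 L n > 0) \<and>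
    delta_seq P DIM('e1) DIM('e2) d2 L \<longlonglongrightarrow> 0 \<and>
    (\<forall>c0::real. \<forall>\<^sub>F n in sequentially.
      \<exists>(U :: (real \<times> real) set) (a :: real \<times> real \<Rightarrow> real \<Rightarrow> real)
         (l2 :: real \<times> real \<Rightarrow> real \<Rightarrow> real)
         (s1 :: real \<times> real \<Rightarrow> real \<Rightarrow> real) (s2 :: real \<times> real \<Rightarrow> real \<Rightarrow> real).
        open U \<and> (delta_seq P DIM('e1) DIM('e2) d2 L n, c0) \<in> U \<and>
        smooth_on (U \<times> UNIV) (\<lambda>(p, t). a p t) \<and>
        smooth_on (U \<times> UNIV) (\<lambda>(p, t). l2 p t) \<and>
        smooth_on (U \<times> UNIV) (\<lambda>(p, t). s1 p t) \<and>
        smooth_on (U \<times> UNIV) (\<lambda>(p, t). s2 p t) \<and>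
        (\<forall>(\<delta>, c)\<in>U.
          periodic_reconstruction P DIM('e1) d1 DIM('e2) d2 c (\<delta> ^ (2 * (DIM('e2) + 1))) \<sigma>
            (a (\<delta>, c)) L (l2 (\<delta>, c)) (s1 (\<delta>, c)) (s2 (\<delta>, c))) \<and>
        (\<forall>p\<in>U. harmonic_sphere_map (warped_product line L N1 (l2 p) N2)
          (reconstructed_map (a p) (s1 p) (s2 p) f1 f2)) \<and>
        (\<forall>p\<in>U. rank_two_at (\<lambda>p. (phase_increment P (s1 p), phase_increment P (s2 p))) p) \<and>
        U \<subseteq> closure {p \<in> U. rational_return P (s1 p) (s2 p)} \<and>
        (\<forall>\<delta>. (\<delta>, 0) \<in> U \<longrightarrow>
          (\<exists>D. D \<noteq> 0 \<and>
            ((\<lambda>\<delta>. phase_increment P (s1 (\<delta>, 0))) has_real_derivative D) (at \<delta>))) \<and>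
        {\<delta>. (\<delta>, 0) \<in> U} \<subseteq>
          closure {\<delta>. (\<delta>, 0) \<in> U \<and> rational_return P (s1 (\<delta>, 0)) (s2 (\<delta>, 0))} \<and>
        (closed_manifold N1 \<and> closed_manifold N2 \<longrightarrow>
          (\<forall>p\<in>U. rational_return P (s1 p) (s2 p) \<longrightarrow>
            (\<exists>(m::nat) (L' :: real set \<Rightarrow> real) (l2' :: real set \<Rightarrow> real)
               (G' :: real set \<times> 'm1 \<times> 'm2 \<Rightarrow> (complex ^ 'n1) \<times> (complex ^ 'n2)).
              m \<ge> 1 \<and>
              (\<forall>t. L' (coset (real m * P) t) = L t) \<and>
              (\<forall>t. l2' (coset (real m * P) t) = l2 p t) \<and>
              (\<forall>t. \<forall>x\<in>topspace (manifold_top N1). \<forall>y\<in>topspace (manifold_top N2).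
                G' (coset (real m * P) t, x, y) =
                reconstructed_map (a p) (s1 p) (s2 p) f1 f2 (t, x, y)) \<and>
              closed_manifold (warped_product (circle (real m * P)) L' N1 l2' N2) \<and>
              harmonic_sphere_map (warped_product (circle (real m * P)) L' N1 l2' N2) G'))))"
proof -
  note N = assms(1,2) and eig = assms(3,4)
  have slow: "slow_manifold DIM('e2) d2 P L"
    using assms by unfold_locales (auto simp: eigenmap_def)
  note seq = delta_seq_properties[OF slow, of "DIM('e1)"]
  let ?\<delta> = "delta_seq P DIM('e1) DIM('e2) d2 L"
  define S where "S = integral {0..P} (\<lambda>t. sqrt (q0 DIM('e1) DIM('e2) d2 L t))"
  show ?thesis
  proof (intro conjI allI)
    show "decseq ?\<delta>" "?\<delta> n > 0" "?\<delta> \<longlonglongrightarrow> 0" for n by (rule seq)+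
    fix c0 :: real
    \<comment> \<open>Chosen for \<open>c0\<close> before any n is fixed: the same family serves all
      large n.\<close>
    obtain \<delta>3 and U :: "(real \<times> real) set" and a l2 s1 s2 :: "real \<times> real \<Rightarrow> real \<Rightarrow> real"
      where \<delta>3: "\<delta>3 > 0" and U: "open U"
      "U = {(\<delta>, c). 0 < \<delta> \<and> \<delta> < \<delta>3 \<and> c0 - 1/2 < c \<and> c < c0 + 1/2 \<and> norm (cis (S / \<delta>) - 1) > 1}"
      and smooth: "smooth_on (U \<times> UNIV) (\<lambda>(p, t). a p t)" "smooth_on (U \<times> UNIV) (\<lambda>(p, t). l2 p t)"
      "smooth_on (U \<times> UNIV) (\<lambda>(p, t). s1 p t)" "smooth_on (U \<times> UNIV) (\<lambda>(p, t). s2 p t)"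
      and rec: "\<And>\<delta> c. (\<delta>, c) \<in> U \<Longrightarrow> periodic_reconstruction P DIM('e1) d1 DIM('e2) d2 c (\<delta> ^ (2 * (DIM('e2) + 1))) \<sigma>
        (a (\<delta>, c)) L (l2 (\<delta>, c)) (s1 (\<delta>, c)) (s2 (\<delta>, c))"
      and per: "\<And>p. p \<in> U \<Longrightarrow> periodic P (l2 p)" "\<And>p. p \<in> U \<Longrightarrow> periodic P (deriv (s1 p))"
      "\<And>p. p \<in> U \<Longrightarrow> periodic P (deriv (s2 p))"
      and slice: "\<And>\<delta>. (\<delta>, 0) \<in> U \<Longrightarrow> phase_increment P (s2 (\<delta>, 0)) = 0"
      and der: "\<And>p. p \<in> U \<Longrightarrow> \<exists>A11 A12 A21 A22. A11 \<noteq> 0 \<and> A11 * A22 - A12 * A21 \<noteq> 0 \<and>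
        ((\<lambda>p. (phase_increment P (s1 p), phase_increment P (s2 p))) has_derivative
          (\<lambda>h. (A11 * fst h + A12 * snd h, A21 * fst h + A22 * snd h))) (at p)"
      using reconstruction_family[OF slow assms(5), of c0 "DIM('e1)" d1] unfolding S_def[symmetric] by blast
    let ?\<Phi> = "\<lambda>p. (phase_increment P (s1 p), phase_increment P (s2 p))"
    let ?A = "(\<lambda>r. 2 * pi * r) ` \<rat>"
    have fibre: "smooth_on UNIV (\<lambda>t. f p t)" if "smooth_on (U \<times> UNIV) (\<lambda>(p, t). f p t)" "p \<in> U"
      for f :: "real \<times> real \<Rightarrow> real \<Rightarrow> real" and p
      using smooth_on_compose[OF open_UNIV open_Times[OF U(1) open_UNIV] that(1)
          smooth_on_Pair[OF open_UNIV smooth_on_const smooth_on_id[OF open_UNIV]], of p] that(2) by auto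
    have rank: "\<exists>D. (?\<Phi> has_derivative D) (at p) \<and> dim (range D) = 2 \<and> surj D" if p: "p \<in> U" for p
    proof -
      obtain A11 A12 A21 A22 where A: "A11 * A22 - A12 * A21 \<noteq> 0"
        "(?\<Phi> has_derivative (\<lambda>h. (A11 * fst h + A12 * snd h, A21 * fst h + A22 * snd h))) (at p)"
        using der[OF p] by blast
      then show ?thesis using det_surj[OF A(1)] by (intro exI conjI) (assumption | simp)+
    qed
    have slice_der: "\<exists>D. D \<noteq> 0 \<and> ((\<lambda>\<delta>. phase_increment P (s1 (\<delta>, 0))) has_real_derivative D) (at \<delta>)"
      if p: "(\<delta>, 0) \<in> U" for \<delta>
    proof -
      obtain A11 A12 A21 A22 where A: "A11 \<noteq> 0"
        "(?\<Phi> has_derivative (\<lambda>h. (A11 * fst h + A12 * snd h, A21 * fst h + A22 * snd h))) (at (\<delta>, 0))"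
        using der[OF p] by blast
      have "((\<lambda>\<delta>. (\<delta>, 0 :: real)) has_derivative (\<lambda>h. (h, 0))) (at \<delta>)"
        by (intro has_derivative_Pair has_derivative_ident has_derivative_const)
      from has_derivative_fst[OF has_derivative_compose[OF this A(2)]]
      have "((\<lambda>\<delta>. phase_increment P (s1 (\<delta>, 0))) has_derivative (*) A11) (at \<delta>)" by simp
      then show ?thesis using A(1) by (auto simp: has_field_derivative_def)
    qed
    have ev: "\<forall>\<^sub>F n in sequentially. ?\<delta> n < \<delta>3" using seq(3) \<delta>3 by (rule order_tendstoD)
    have in_U: "(?\<delta> n, c0) \<in> U" if "?\<delta> n < \<delta>3" for n
    proof -
      \<comment> \<open>The half in the denominator of the sequence is what produces - 1; its
        distance 2 from 1 exceeds the bound in \<open>U\<close>.\<close>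
      have "cis (S / ?\<delta> n) = - 1"
        unfolding S_def seq(4) cis_mult[symmetric] by (simp add: cis_multiple_2pi)
      then show ?thesis using that seq(2)[of n] by (simp add: U(2))
    qed
    have fibres: "smooth_on UNIV (l2 p)" "smooth_on UNIV (s1 p)" "smooth_on UNIV (s2 p)" if "p \<in> U" for p
      using fibre[OF smooth(2) that] fibre[OF smooth(3) that] fibre[OF smooth(4) that] by simp_all
    have recp: "\<exists>c \<epsilon>. periodic_reconstruction P DIM('e1) d1 DIM('e2) d2 c \<epsilon> \<sigma> (a p) L (l2 p) (s1 p) (s2 p)"
      if "p \<in> U" for p
      using rec[of "fst p" "snd p"] that by auto
    have harm: "harmonic_sphere_map (warped_product line L N1 (l2 p) N2) (reconstructed_map (a p) (s1 p) (s2 p) f1 f2)"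
      if "p \<in> U" for p
      using recp[OF that] reconstruction_harmonic_line[OF N eig _ assms(7) fibres[OF that]]
      by (auto simp: periodic_reconstruction_def)
    have dense: "U \<subseteq> closure {p \<in> U. rational_return P (s1 p) (s2 p)}"
    proof -
      have "closure (?A \<times> ?A) = UNIV" by (simp add: closure_Times closure_rational_angles)
      from dense_preimage[OF U(1) this, of ?\<Phi>] rank show ?thesis
        by (simp add: rational_return_def mem_Times_iff) blast
    qed
    have slice_open: "open {\<delta>. (\<delta>, 0) \<in> U}"
      using open_vimage[OF U(1), of "\<lambda>\<delta>. (\<delta>, 0)"] by (simp add: vimage_def continuous_intros)
    have slice_dense: "{\<delta>. (\<delta>, 0) \<in> U} \<subseteq> closure {\<delta>. (\<delta>, 0) \<in> U \<and> rational_return P (s1 (\<delta>, 0)) (s2 (\<delta>, 0))}"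
    proof -
      have surj: "\<exists>D. ((\<lambda>\<delta>. phase_increment P (s1 (\<delta>, 0))) has_derivative D) (at \<delta>) \<and> surj D"
        if p: "\<delta> \<in> {\<delta>. (\<delta>, 0) \<in> U}" for \<delta>
      proof -
        obtain D where D: "D \<noteq> 0" "((\<lambda>\<delta>. phase_increment P (s1 (\<delta>, 0))) has_real_derivative D) (at \<delta>)"
          using slice_der p by blast
        have "surj ((*) D)" by (rule surjI[of _ "\<lambda>y. y / D"]) (use D(1) in simp)
        then show ?thesis using D(2) unfolding has_field_derivative_def by blast
      qed
      \<comment> \<open>On the slice the second increment is 0, a rational angle, so a return is
        decided by the first one alone.\<close>
      have "0 \<in> ?A" by (rule image_eqI[of _ _ 0]) auto
      then have "{\<delta> \<in> {\<delta>. (\<delta>, 0) \<in> U}. phase_increment P (s1 (\<delta>, 0)) \<in> ?A}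
          = {\<delta>. (\<delta>, 0) \<in> U \<and> rational_return P (s1 (\<delta>, 0)) (s2 (\<delta>, 0))}"
        by (auto simp: rational_return_def slice)
      then show ?thesis using dense_preimage[OF slice_open closure_rational_angles surj] by simp
    qed
    have closes: "closed_manifold N1 \<and> closed_manifold N2 \<longrightarrow>
      (\<forall>p\<in>U. rational_return P (s1 p) (s2 p) \<longrightarrow>
        (\<exists>(m::nat) (L' :: real set \<Rightarrow> real) (l2' :: real set \<Rightarrow> real)
           (G' :: real set \<times> 'm1 \<times> 'm2 \<Rightarrow> (complex ^ 'n1) \<times> (complex ^ 'n2)).
          m \<ge> 1 \<and>
          (\<forall>t. L' (coset (real m * P) t) = L t) \<and>
          (\<forall>t. l2' (coset (real m * P) t) = l2 p t) \<and>
          (\<forall>t. \<forall>x\<in>topspace (manifold_top N1). \<forall>y\<in>topspace (manifold_top N2).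
            G' (coset (real m * P) t, x, y) = reconstructed_map (a p) (s1 p) (s2 p) f1 f2 (t, x, y)) \<and>
          closed_manifold (warped_product (circle (real m * P)) L' N1 l2' N2) \<and>
          harmonic_sphere_map (warped_product (circle (real m * P)) L' N1 l2' N2) G'))"
    proof (intro impI ballI)
      fix p assume cl: "closed_manifold N1 \<and> closed_manifold N2" and p: "p \<in> U"
        and ret: "rational_return P (s1 p) (s2 p)"
      obtain c \<epsilon> where r: "periodic_reconstruction P DIM('e1) d1 DIM('e2) d2 c \<epsilon> \<sigma> (a p) L (l2 p) (s1 p) (s2 p)"
        using recp[OF p] by blast
      show "\<exists>(m::nat) (L' :: real set \<Rightarrow> real) (l2' :: real set \<Rightarrow> real)
           (G' :: real set \<times> 'm1 \<times> 'm2 \<Rightarrow> (complex ^ 'n1) \<times> (complex ^ 'n2)).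
          m \<ge> 1 \<and>
          (\<forall>t. L' (coset (real m * P) t) = L t) \<and>
          (\<forall>t. l2' (coset (real m * P) t) = l2 p t) \<and>
          (\<forall>t. \<forall>x\<in>topspace (manifold_top N1). \<forall>y\<in>topspace (manifold_top N2).
            G' (coset (real m * P) t, x, y) = reconstructed_map (a p) (s1 p) (s2 p) f1 f2 (t, x, y)) \<and>
          closed_manifold (warped_product (circle (real m * P)) L' N1 l2' N2) \<and>
          harmonic_sphere_map (warped_product (circle (real m * P)) L' N1 l2' N2) G'"
        by (rule returning_member_closes[OF N conjunct1[OF cl] conjunct2[OF cl] eig r assms(6,7) fibres[OF p] assms(9) per[OF p] ret])
    qed
    show "\<forall>\<^sub>F n in sequentially.
      \<exists>(U :: (real \<times> real) set) (a :: real \<times> real \<Rightarrow> real \<Rightarrow> real)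
         (l2 :: real \<times> real \<Rightarrow> real \<Rightarrow> real)
         (s1 :: real \<times> real \<Rightarrow> real \<Rightarrow> real) (s2 :: real \<times> real \<Rightarrow> real \<Rightarrow> real).
        open U \<and> (delta_seq P DIM('e1) DIM('e2) d2 L n, c0) \<in> U \<and>
        smooth_on (U \<times> UNIV) (\<lambda>(p, t). a p t) \<and>
        smooth_on (U \<times> UNIV) (\<lambda>(p, t). l2 p t) \<and>
        smooth_on (U \<times> UNIV) (\<lambda>(p, t). s1 p t) \<and>
        smooth_on (U \<times> UNIV) (\<lambda>(p, t). s2 p t) \<and>
        (\<forall>(\<delta>, c)\<in>U.
          periodic_reconstruction P DIM('e1) d1 DIM('e2) d2 c (\<delta> ^ (2 * (DIM('e2) + 1))) \<sigma>
            (a (\<delta>, c)) L (l2 (\<delta>, c)) (s1 (\<delta>, c)) (s2 (\<delta>, c))) \<and>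
        (\<forall>p\<in>U. harmonic_sphere_map (warped_product line L N1 (l2 p) N2)
          (reconstructed_map (a p) (s1 p) (s2 p) f1 f2)) \<and>
        (\<forall>p\<in>U. rank_two_at (\<lambda>p. (phase_increment P (s1 p), phase_increment P (s2 p))) p) \<and>
        U \<subseteq> closure {p \<in> U. rational_return P (s1 p) (s2 p)} \<and>
        (\<forall>\<delta>. (\<delta>, 0) \<in> U \<longrightarrow>
          (\<exists>D. D \<noteq> 0 \<and>
            ((\<lambda>\<delta>. phase_increment P (s1 (\<delta>, 0))) has_real_derivative D) (at \<delta>))) \<and>
        {\<delta>. (\<delta>, 0) \<in> U} \<subseteq>
          closure {\<delta>. (\<delta>, 0) \<in> U \<and> rational_return P (s1 (\<delta>, 0)) (s2 (\<delta>, 0))} \<and>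
        (closed_manifold N1 \<and> closed_manifold N2 \<longrightarrow>
          (\<forall>p\<in>U. rational_return P (s1 p) (s2 p) \<longrightarrow>
            (\<exists>(m::nat) (L' :: real set \<Rightarrow> real) (l2' :: real set \<Rightarrow> real)
               (G' :: real set \<times> 'm1 \<times> 'm2 \<Rightarrow> (complex ^ 'n1) \<times> (complex ^ 'n2)).
              m \<ge> 1 \<and>
              (\<forall>t. L' (coset (real m * P) t) = L t) \<and>
              (\<forall>t. l2' (coset (real m * P) t) = l2 p t) \<and>
              (\<forall>t. \<forall>x\<in>topspace (manifold_top N1). \<forall>y\<in>topspace (manifold_top N2).
                G' (coset (real m * P) t, x, y) =
                reconstructed_map (a p) (s1 p) (s2 p) f1 f2 (t, x, y)) \<and>
              closed_manifold (warped_product (circle (real m * P)) L' N1 l2' N2) \<and>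
              harmonic_sphere_map (warped_product (circle (real m * P)) L' N1 l2' N2) G')))"
    proof (rule eventually_mono[OF ev], rule exI[of _ U], rule exI[of _ a], rule exI[of _ l2], rule exI[of _ s1],
        rule exI[of _ s2], intro conjI)
      fix n assume "?\<delta> n < \<delta>3"
      then show "(?\<delta> n, c0) \<in> U" by (rule in_U)
      show "\<forall>(\<delta>, c)\<in>U. periodic_reconstruction P DIM('e1) d1 DIM('e2) d2 c (\<delta> ^ (2 * (DIM('e2) + 1))) \<sigma>
            (a (\<delta>, c)) L (l2 (\<delta>, c)) (s1 (\<delta>, c)) (s2 (\<delta>, c))"
        using rec by blast
      show "\<forall>p\<in>U. rank_two_at ?\<Phi> p" using rank unfolding rank_two_at_def by blast
    qed (use U(1) smooth harm dense slice_der slice_dense closes in blast)+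
  qed
qed

end
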